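(* Assume that (H1), (H2), (H3) and (H4), as stated in the context, hold, and let $K$ be a compact subset of $E$ with $K\supset K_0$ (arbitrary, as fixed in the context). (i) Suppose there are constants $M,C>0$, $0<\alpha<1$ and $0\le\beta<2$ such that $$\left|\Gamma(\rho,\rho)+\frac{(\rho+1)N(\rho)}{C(2-\beta)(\log(\rho+1))^{1-\beta}}\right|\le M(\rho+1)^2(\log(\rho+1))^\beta$$ $\mu$-a.e. outside $K$, and $$\widehat A_n(\phi)\le n\exp\bigl(\alpha C(\log(n+1))^{2-\beta}\bigr)$$ for all sufficiently large $n$, where $\phi(r)=C(\log(r+1))^{2-\beta}$. Then $(T_t)_{t>0}$ is conservative. (ii) Suppose there are constants $M,C>0$ and $0<\alpha<1$ such that $$\left|\Gamma(\rho,\rho)+\frac1C(\rho+1)(\log(\rho+1))N(\rho)\right|\le M(\rho+1)^2(\log(\rho+1))^2$$ $\mu$-a.e. outside $K$, and $$\widehat A_n(\phi)\le n\,(\log(n+1))^{C\alpha}$$ for all sufficiently large $n$, where $\phi(r)=C\log(\log(r+1)+1)$. Then $(T_t)_{t>0}$ is conservative. (iii) Suppose there are constants $M,C>0$ and $0<\alpha<2$ such that $$\left|\Gamma(\rho,\rho)+\frac{N(\rho)}{C\rho}\right|\le M$$ $\mu$-a.e. outside $K$, and $$\widehat A_n(\phi)\le n\exp(\alpha Cn^2)$$ for all sufficiently large $n$, where $\phi(r)=\frac{Cr^2}{2}$. Then $(T_t)_{t>0}$ is conservative.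
   Context: Basic setting. $(E,d)$ is a locally compact separable metric space, $\mu$ a positive Borel measure on $E$, finite on compacts, with full support; $(\cdot,\cdot)$ is the inner product of $L^2(E,\mu)$. For a set $W$ of functions on $E$: $W_0$ = elements with compact support, $W_b$ = $\mu$-a.e. bounded elements, $W_{0,b}=W_0\cap W_b$, $W_{loc}$ = measurable $u$ such that for every relatively compact open $V$ there is $v\in W$ with $u=v$ $\mu$-a.e. on $V$, $W_{loc,b}$ = bounded measurable elements of $W_{loc}$. Functions on $V_n$ are regarded as functions on $E$ by extending them by $0$. Generalized Dirichlet form. $(\mathcal A,\mathcal V)$ is a (not necessarily symmetric) Dirichlet form on $L^2(E,\mu)$ with $\mathcal V$ normed by $\|u\|_{\mathcal V}^2=\mathcal A(u,u)+(u,u)$; $(\Lambda,D(\Lambda,L^2(E,\mu)))$ generates a sub-Markovian $C_0$-semigroup of contractions on $L^2(E,\mu)$ that restricts to a $C_0$-semigroup on $\mathcal V$; $(\Lambda,\mathcal F)$ is the closure of $\Lambda:D(\Lambda,L^2(E,\mu))\cap\mathcal V\to\mathcal V'$; $\mathcal E(u,v)=\mathcal A(u,v)-{}_{\mathcal V'}\langle\Lambda u,v\rangle_{\mathcal V}$, $u\in\mathcal F,v\in\mathcal V$. $(T_t)_{t>0}$ is the sub-Markovian $C_0$-semigroup of contractions on $L^2(E,\mu)$ whose resolvent satisfies $G_\alpha(L^2(E,\mu))\subset\mathcal F$, $\mathcal E(G_\alpha f,g)+\alpha(G_\alpha f,g)=(f,g)$ for $f\in L^2(E,\mu)$, $g\in\mathcal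 V$. $(\widehat T_t)_{t>0}$ is the adjoint semigroup, also viewed as a $C_0$-semigroup of contractions on $L^1(E,\mu)$; it is sub-Markovian. $T_t$ extends to $L^\infty(E,\mu)$ by monotone approximation from $L^2\cap L^\infty$; $(T_t)_{t>0}$ is conservative if $T_t1=1$ $\mu$-a.e. for some (and hence any) $t>0$. Fix $t>0$. (H1) Let $(V_n)_{n\ge1}$ be an arbitrary increasing sequence of relatively compact open sets in $E$ with $\overline V_n\subset V_{n+1}$, $\bigcup_nV_n=E$. Then for $p=1$ or $p=2$ there exist sub-Markovian $C_0$-semigroups of contractions $(\widehat T^n_t)_{t>0}$ on $L^p(V_n,\mu)$ with generators $(\widehat L^n,D(\widehat L^n))$, $n\ge1$, such that for any non-negative $f\in L^1(E,\mu)\cap L^\infty(E,\mu)$, $\widehat T^n_tf:=\widehat T^n_t(f\cdot1_{V_n})\nearrow\widehat T_tf$ $\mu$-a.e. as $n\to\infty$. (H2) There are a symmetric strongly local regular Dirichlet form $(\mathcal E^0,D(\mathcal E^0))$ on $L^2(E,\mu)$ with $\mathcal E^0(u,v)=\int_E\Gamma(u,v)\,d\mu$, where $\Gamma$ is a positive semidefinite symmetric bilinear form on $D(\mathcal E^0)$ with values in $L^1(E,\mu)$ (carré du champ; extended to $D(\mathcal E^0)_{loc}$ by locality), and a linear operator $N:D(N)\to L^1(E,\mu)_{loc}$ on $L^2(E,\mu)$ with $D(\mathcal E^0)_b\subset D(N)$ and $u\cdot1_{V_n}\in D(N)$ for all $u\in D(\mathcal E^0)_{loc,b}$, such that for each $n\ge1$: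 $D(\widehat L^n)_b\subset D(\mathcal E^0)_b$ and $$-\int_{V_n}\widehat L^nv\;u\,d\mu=\int_E\Gamma(u,v)\,d\mu+\int_{V_n}u\,Nv\,d\mu\quad\text{for any }v\in D(\widehat L^n)_b,\ u\in D(\mathcal E^0).$$ Moreover: if $v\in D(\mathcal E^0)_b$ is $\mu$-a.e. constant on a Borel set $B$ then $Nv=0$ $\mu$-a.e. on $B$; $\int_ENv\,d\mu=0$ for any $v\in D(\mathcal E^0)_{0,b}$; $N\phi(v)=\phi'(v)Nv$ and $N(uv)=vNu+uNv$ for any $u,v\in D(N)_b$, $\phi\in C^1_b(\mathbb R)$. (H3) There is a non-negative continuous $\rho\in D(\mathcal E^0)_{loc}$ such that $E_r:=\{x\in E:\rho(x)<r\}$ is relatively compact and open for every $r>0$, $\bigcup_{r>0}E_r=E$, and there is a compact $K_0\subset E$ with $\Gamma(\rho,\rho),N(\rho)\in L^\infty_{loc}(K_0^c,\mu)$, where $N(\rho)$ is understood on $E_{4n}$ as $N(\rho1_{E_{4n}})$. Choice of $V_n$ and $D_0$. From now on $V_n:=E_{4n}$. Fix an arbitrary compact $K\supset K_0$, and for compactly supported $f$ let $k_f:=\min\{m\in\mathbb N:\operatorname{supp}(f)\subset E_m,\ K\subset E_m\}$. Put $$D_0:=\{f\in L^\infty(E,\mu)\cap L^2(E,\mu)_0:\ \widehat T^n_sf\in D(\widehat L^n)\text{ for any }n\ge k_f,\ s\in[0,t]\}$$ ($\widehat T^n_0$ = identity). (H4) $D_0$ is dense in $L^1(E,\mu)$.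 Quantities. $a_n:=\operatorname{ess\,sup}_{E_{4n}\setminus E_{2n}}\Gamma(\rho,\rho)$, $b_n:=\operatorname{ess\,sup}_{E_{4n}\setminus E_{2n}}\phi'(\rho)\Gamma(\rho,\rho)$, and $$\widehat A_n(\phi):=(\sqrt{a_n}+b_n)\,\mu(E_{4n}\setminus E_{2n})^{1/2}+\|N(\rho)\|_{L^2(E_{4n}\setminus E_{2n},\mu)} .$$ *)

theory Defs
  imports "HOL-Analysis.Analysis" "HOL-Probability.Essential_Supremum"
begin

text \<open>
  Elements of Lebesgue spaces are represented by real functions. Domains of forms and operators
  are sets of functions closed under almost everywhere equality, and linearity of function valued
  maps is required almost everywhere only.
\<close>

section \<open>Function spaces\<close>

definition Lspace :: "nat \<Rightarrow> 'a measure \<Rightarrow> ('a \<Rightarrow> real) set" where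
  "Lspace p M = {f \<in> borel_measurable M. integrable M (\<lambda>x. \<bar>f x\<bar> ^ p)}"

definition Lnorm :: "nat \<Rightarrow> 'a measure \<Rightarrow> ('a \<Rightarrow> real) \<Rightarrow> real" where
  "Lnorm p M f = root p (LINT x|M. \<bar>f x\<bar> ^ p)"

definition inner2 :: "'a measure \<Rightarrow> ('a \<Rightarrow> real) \<Rightarrow> ('a \<Rightarrow> real) \<Rightarrow> real" where
  "inner2 M f g = (LINT x|M. f x * g x)"

definition ae_bounded :: "'a measure \<Rightarrow> ('a \<Rightarrow> real) \<Rightarrow> bool" where
  "ae_bounded M f \<longleftrightarrow> (\<exists>c. AE x in M. \<bar>f x\<bar> \<le> c)"

definition Linf :: "'a measure \<Rightarrow> ('a \<Rightarrow> real) set" where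
  "Linf M = {f \<in> borel_measurable M. ae_bounded M f}"

definition relatively_compact :: "'a::topological_space set \<Rightarrow> bool" where
  "relatively_compact V \<longleftrightarrow> compact (closure V)"

text \<open>The support of the measure \<open>\<bar>f\<bar> \<mu>\<close>.\<close>

definition ess_supp :: "'a::topological_space measure \<Rightarrow> ('a \<Rightarrow> real) \<Rightarrow> 'a set" where
  "ess_supp M f = \<Inter> {F. closed F \<and> (AE x in M. x \<notin> F \<longrightarrow> f x = 0)}"

definition sub_cpt :: "'a::topological_space measure \<Rightarrow> ('a \<Rightarrow> real) set \<Rightarrow> ('a \<Rightarrow> real) set" where
  "sub_cpt M W = {u \<in> W. compact (ess_supp M u)}"

definition sub_bdd :: "'a measure \<Rightarrow> ('a \<Rightarrow> real) set \<Rightarrow> ('a \<Rightarrow> real) set" where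
  "sub_bdd M W = {u \<in> W. ae_bounded M u}"

definition sub_loc :: "'a::topological_space measure \<Rightarrow> ('a \<Rightarrow> real) set \<Rightarrow> ('a \<Rightarrow> real) set" where
  "sub_loc M W = {u \<in> borel_measurable M.
     \<forall>V. open V \<and> relatively_compact V \<longrightarrow> (\<exists>v\<in>W. AE x\<in>V in M. u x = v x)}"

definition sub_loc_bdd :: "'a::topological_space measure \<Rightarrow> ('a \<Rightarrow> real) set \<Rightarrow> ('a \<Rightarrow> real) set" where
  "sub_loc_bdd M W = {u \<in> sub_loc M W. \<exists>c. \<forall>x. \<bar>u x\<bar> \<le> c}"

text \<open>Restriction to \<open>V\<close>, equivalently extension by \<open>0\<close> of a function on \<open>V\<close>.\<close>

definition cut :: "'a set \<Rightarrow> ('a \<Rightarrow> real) \<Rightarrow> 'a \<Rightarrow> real" where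
  "cut V f = (\<lambda>x. indicator V x * f x)"

definition Cc :: "('a::topological_space \<Rightarrow> real) set" where
  "Cc = {f. continuous_on UNIV f \<and> compact (closure {x. f x \<noteq> 0})}"

text \<open>Bounded continuously differentiable functions with bounded derivative.\<close>

definition C1b :: "(real \<Rightarrow> real) set" where
  "C1b = {\<phi>. (\<forall>r. \<phi> differentiable (at r)) \<and> continuous_on UNIV (deriv \<phi>)
        \<and> bounded (range \<phi>) \<and> bounded (range (deriv \<phi>))}"

section \<open>Linear maps, semigroups and generators\<close>

definition ae_subspace :: "'a measure \<Rightarrow> ('a \<Rightarrow> real) set \<Rightarrow> bool" where
  "ae_subspace M D \<longleftrightarrow> D \<subseteq> borel_measurable M \<and> (\<lambda>_. 0) \<in> D
     \<and> (\<forall>u\<in>D. \<forall>v\<in>D. \<forall>a b. (\<lambda>x. a * u x + b * v x) \<in> D)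
     \<and> (\<forall>u\<in>D. \<forall>v\<in>borel_measurable M. (AE x in M. u x = v x) \<longrightarrow> v \<in> D)"

definition ae_linear_on :: "'a measure \<Rightarrow> ('a \<Rightarrow> real) set \<Rightarrow> (('a \<Rightarrow> real) \<Rightarrow> 'a \<Rightarrow> real) \<Rightarrow> bool" where
  "ae_linear_on M D T \<longleftrightarrow>
     (\<forall>u\<in>D. \<forall>v\<in>D. \<forall>a b. AE x in M. T (\<lambda>y. a * u y + b * v y) x = a * T u x + b * T v x)
     \<and> (\<forall>u\<in>D. \<forall>v\<in>D. (AE x in M. u x = v x) \<longrightarrow> (AE x in M. T u x = T v x))"

definition sub_Markovian :: "nat \<Rightarrow> 'a measure \<Rightarrow> (real \<Rightarrow> ('a \<Rightarrow> real) \<Rightarrow> 'a \<Rightarrow> real) \<Rightarrow> bool" where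
  "sub_Markovian p M T \<longleftrightarrow> (\<forall>t>0. \<forall>f\<in>Lspace p M.
     (AE x in M. 0 \<le> f x \<and> f x \<le> 1) \<longrightarrow> (AE x in M. 0 \<le> T t f x \<and> T t f x \<le> 1))"

definition C0_contraction_semigroup ::
    "nat \<Rightarrow> 'a measure \<Rightarrow> (real \<Rightarrow> ('a \<Rightarrow> real) \<Rightarrow> 'a \<Rightarrow> real) \<Rightarrow> bool" where
  "C0_contraction_semigroup p M T \<longleftrightarrow>
     (\<forall>t>0. ae_linear_on M (Lspace p M) (T t)
        \<and> (\<forall>f\<in>Lspace p M. T t f \<in> Lspace p M \<and> Lnorm p M (T t f) \<le> Lnorm p M f))
     \<and> (\<forall>s>0. \<forall>t>0. \<forall>f\<in>Lspace p M. AE x in M. T (s + t) f x = T s (T t f) x)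
     \<and> (\<forall>f\<in>Lspace p M. ((\<lambda>t. Lnorm p M (\<lambda>x. T t f x - f x)) \<longlongrightarrow> 0) (at_right 0))"

definition gen_graph :: "nat \<Rightarrow> 'a measure \<Rightarrow> (real \<Rightarrow> ('a \<Rightarrow> real) \<Rightarrow> 'a \<Rightarrow> real)
    \<Rightarrow> ('a \<Rightarrow> real) \<Rightarrow> ('a \<Rightarrow> real) \<Rightarrow> bool" where
  "gen_graph p M T f g \<longleftrightarrow> f \<in> Lspace p M \<and> g \<in> Lspace p M
     \<and> ((\<lambda>t. Lnorm p M (\<lambda>x. (T t f x - f x) / t - g x)) \<longlongrightarrow> 0) (at_right 0)"

definition gen_dom :: "nat \<Rightarrow> 'a measure \<Rightarrow> (real \<Rightarrow> ('a \<Rightarrow> real) \<Rightarrow> 'a \<Rightarrow> real) \<Rightarrow> ('a \<Rightarrow> real) set" where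
  "gen_dom p M T = {f. \<exists>g. gen_graph p M T f g}"

definition generator :: "nat \<Rightarrow> 'a measure \<Rightarrow> (real \<Rightarrow> ('a \<Rightarrow> real) \<Rightarrow> 'a \<Rightarrow> real)
    \<Rightarrow> ('a \<Rightarrow> real) \<Rightarrow> 'a \<Rightarrow> real" where
  "generator p M T f = (SOME g. gen_graph p M T f g)"

text \<open>\<open>G\<^sub>\<alpha> = (\<alpha> - L)\<^sup>-\<^sup>1\<close> for the generator \<open>L\<close> of \<open>T\<close>.\<close>

definition resolvent :: "nat \<Rightarrow> 'a measure \<Rightarrow> (real \<Rightarrow> ('a \<Rightarrow> real) \<Rightarrow> 'a \<Rightarrow> real)
    \<Rightarrow> real \<Rightarrow> ('a \<Rightarrow> real) \<Rightarrow> 'a \<Rightarrow> real" where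
  "resolvent p M T \<alpha> f = (SOME g. gen_graph p M T g (\<lambda>x. \<alpha> * g x - f x))"

text \<open>Value at a non-negative function \<open>f\<close> in \<open>L\<^sup>\<infinity>\<close> of the extension of a positive operator
  on \<open>L\<^sup>2\<close> by monotone approximation.\<close>

definition mono_ext :: "'a measure \<Rightarrow> (('a \<Rightarrow> real) \<Rightarrow> 'a \<Rightarrow> real) \<Rightarrow> ('a \<Rightarrow> real) \<Rightarrow> 'a \<Rightarrow> real" where
  "mono_ext M T f = (SOME h. h \<in> borel_measurable M \<and>
     (\<forall>g. (\<forall>k. g k \<in> Lspace 2 M \<inter> Linf M)
        \<and> (AE x in M. (\<forall>k. 0 \<le> g k x) \<and> incseq (\<lambda>k. g k x) \<and> (\<lambda>k. g k x) \<longlonglongrightarrow> f x)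
        \<longrightarrow> (AE x in M. (\<lambda>k. T (g k) x) \<longlonglongrightarrow> h x)))"

definition conservative :: "'a measure \<Rightarrow> (real \<Rightarrow> ('a \<Rightarrow> real) \<Rightarrow> 'a \<Rightarrow> real) \<Rightarrow> bool" where
  "conservative M T \<longleftrightarrow> (\<forall>t>0. AE x in M. mono_ext M (T t) (\<lambda>_. 1) x = 1)"

section \<open>Dirichlet forms\<close>

definition ae_bilinear_form ::
    "'a measure \<Rightarrow> ('a \<Rightarrow> real) set \<Rightarrow> (('a \<Rightarrow> real) \<Rightarrow> ('a \<Rightarrow> real) \<Rightarrow> real) \<Rightarrow> bool" where
  "ae_bilinear_form M D A \<longleftrightarrow>
     (\<forall>u\<in>D. \<forall>v\<in>D. \<forall>w\<in>D. \<forall>a b.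
        A (\<lambda>x. a * u x + b * v x) w = a * A u w + b * A v w
      \<and> A w (\<lambda>x. a * u x + b * v x) = a * A w u + b * A w v)
     \<and> (\<forall>u\<in>D. \<forall>v\<in>D. \<forall>w\<in>D. (AE x in M. u x = v x) \<longrightarrow> A u w = A v w \<and> A w u = A w v)"

definition form1 :: "'a measure \<Rightarrow> (('a \<Rightarrow> real) \<Rightarrow> ('a \<Rightarrow> real) \<Rightarrow> real)
    \<Rightarrow> ('a \<Rightarrow> real) \<Rightarrow> ('a \<Rightarrow> real) \<Rightarrow> real" where
  "form1 M A u v = A u v + inner2 M u v"

definition form_norm :: "'a measure \<Rightarrow> (('a \<Rightarrow> real) \<Rightarrow> ('a \<Rightarrow> real) \<Rightarrow> real) \<Rightarrow> ('a \<Rightarrow> real) \<Rightarrow> real" where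
  "form_norm M A u = sqrt (form1 M A u u)"

definition coercive_closed_form ::
    "'a measure \<Rightarrow> ('a \<Rightarrow> real) set \<Rightarrow> (('a \<Rightarrow> real) \<Rightarrow> ('a \<Rightarrow> real) \<Rightarrow> real) \<Rightarrow> bool" where
  "coercive_closed_form M D A \<longleftrightarrow>
     D \<subseteq> Lspace 2 M \<and> ae_subspace M D
     \<and> (\<forall>f\<in>Lspace 2 M. \<forall>e>0. \<exists>u\<in>D. Lnorm 2 M (\<lambda>x. f x - u x) < e)
     \<and> ae_bilinear_form M D A
     \<and> (\<forall>u\<in>D. 0 \<le> A u u)
     \<and> (\<exists>c>0. \<forall>u\<in>D. \<forall>v\<in>D. \<bar>form1 M A u v\<bar> \<le> c * form_norm M A u * form_norm M A v)
     \<and> (\<forall>u. (\<forall>n. u n \<in> D)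
          \<and> (\<forall>e>0. \<exists>n0. \<forall>m\<ge>n0. \<forall>n\<ge>n0. form_norm M A (\<lambda>x. u m x - u n x) < e)
          \<longrightarrow> (\<exists>v\<in>D. (\<lambda>n. form_norm M A (\<lambda>x. u n x - v x)) \<longlonglongrightarrow> 0))"

definition unit_contraction :: "('a \<Rightarrow> real) \<Rightarrow> 'a \<Rightarrow> real" where
  "unit_contraction u = (\<lambda>x. min (max (u x) 0) 1)"

definition Dirichlet_form ::
    "'a measure \<Rightarrow> ('a \<Rightarrow> real) set \<Rightarrow> (('a \<Rightarrow> real) \<Rightarrow> ('a \<Rightarrow> real) \<Rightarrow> real) \<Rightarrow> bool" where
  "Dirichlet_form M D A \<longleftrightarrow> coercive_closed_form M D A
     \<and> (\<forall>u\<in>D. unit_contraction u \<in> D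
        \<and> 0 \<le> A (\<lambda>x. u x + unit_contraction u x) (\<lambda>x. u x - unit_contraction u x)
        \<and> 0 \<le> A (\<lambda>x. u x - unit_contraction u x) (\<lambda>x. u x + unit_contraction u x))"

definition symmetric_form ::
    "('a \<Rightarrow> real) set \<Rightarrow> (('a \<Rightarrow> real) \<Rightarrow> ('a \<Rightarrow> real) \<Rightarrow> real) \<Rightarrow> bool" where
  "symmetric_form D A \<longleftrightarrow> (\<forall>u\<in>D. \<forall>v\<in>D. A u v = A v u)"

definition regular_form ::
    "'a::topological_space measure \<Rightarrow> ('a \<Rightarrow> real) set \<Rightarrow> (('a \<Rightarrow> real) \<Rightarrow> ('a \<Rightarrow> real) \<Rightarrow> real) \<Rightarrow> bool" where
  "regular_form M D A \<longleftrightarrow>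
     (\<forall>u\<in>D. \<forall>e>0. \<exists>v\<in>D \<inter> Cc. form_norm M A (\<lambda>x. u x - v x) < e)
     \<and> (\<forall>f\<in>Cc. \<forall>e>0. \<exists>v\<in>D \<inter> Cc. \<forall>x. \<bar>f x - v x\<bar> < e)"

definition strongly_local ::
    "'a::topological_space measure \<Rightarrow> ('a \<Rightarrow> real) set \<Rightarrow> (('a \<Rightarrow> real) \<Rightarrow> ('a \<Rightarrow> real) \<Rightarrow> real) \<Rightarrow> bool" where
  "strongly_local M D A \<longleftrightarrow> (\<forall>u\<in>sub_cpt M D. \<forall>v\<in>sub_cpt M D.
     (\<exists>U c. open U \<and> ess_supp M u \<subseteq> U \<and> (AE x\<in>U in M. v x = c)) \<longrightarrow> A u v = 0)"

text \<open>
  The last clause is the defining property of the carre du champ (in the normalization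
  \<open>A u v = \<integral> \<Gamma> u v d\<mu>\<close>, so that \<open>\<Gamma> u u d\<mu>\<close> is the energy measure of \<open>u\<close>);
  the other clauses alone would not determine \<open>\<Gamma>\<close>.
\<close>

definition carre_du_champ ::
    "'a measure \<Rightarrow> ('a \<Rightarrow> real) set \<Rightarrow> (('a \<Rightarrow> real) \<Rightarrow> ('a \<Rightarrow> real) \<Rightarrow> real)
     \<Rightarrow> (('a \<Rightarrow> real) \<Rightarrow> ('a \<Rightarrow> real) \<Rightarrow> 'a \<Rightarrow> real) \<Rightarrow> bool" where
  "carre_du_champ M D A \<Gamma> \<longleftrightarrow>
     (\<forall>u\<in>D. \<forall>v\<in>D. integrable M (\<Gamma> u v) \<and> (AE x in M. \<Gamma> u v x = \<Gamma> v u x)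
        \<and> A u v = (LINT x|M. \<Gamma> u v x))
     \<and> (\<forall>u\<in>D. AE x in M. 0 \<le> \<Gamma> u u x)
     \<and> (\<forall>v\<in>D. ae_linear_on M D (\<lambda>u. \<Gamma> u v))
     \<and> (\<forall>u\<in>sub_bdd M D. \<forall>v\<in>sub_bdd M D. \<forall>h\<in>sub_bdd M D.
          2 * (LINT x|M. h x * \<Gamma> u v x)
            = A (\<lambda>x. u x * h x) v + A (\<lambda>x. v x * h x) u - A (\<lambda>x. u x * v x) h)"

text \<open>Extension of \<open>\<Gamma>\<close> to functions locally in the domain; well-defined a.e. by locality.\<close>

definition carre_loc ::
    "'a::topological_space measure \<Rightarrow> ('a \<Rightarrow> real) set \<Rightarrow> (('a \<Rightarrow> real) \<Rightarrow> ('a \<Rightarrow> real) \<Rightarrow> 'a \<Rightarrow> real)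
     \<Rightarrow> ('a \<Rightarrow> real) \<Rightarrow> ('a \<Rightarrow> real) \<Rightarrow> 'a \<Rightarrow> real" where
  "carre_loc M D \<Gamma> u v = (SOME g. g \<in> borel_measurable M \<and>
     (\<forall>V. \<forall>u'\<in>D. \<forall>v'\<in>D. open V \<and> relatively_compact V
        \<and> (AE x\<in>V in M. u x = u' x) \<and> (AE x\<in>V in M. v x = v' x)
        \<longrightarrow> (AE x\<in>V in M. g x = \<Gamma> u' v' x)))"

section \<open>Generalized Dirichlet forms\<close>

definition form_dual ::
    "'a measure \<Rightarrow> ('a \<Rightarrow> real) set \<Rightarrow> (('a \<Rightarrow> real) \<Rightarrow> ('a \<Rightarrow> real) \<Rightarrow> real)
     \<Rightarrow> (('a \<Rightarrow> real) \<Rightarrow> real) set" where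
  "form_dual M D A = {l.
     (\<forall>u\<in>D. \<forall>v\<in>D. \<forall>a b. l (\<lambda>x. a * u x + b * v x) = a * l u + b * l v)
     \<and> (\<exists>c. \<forall>v\<in>D. \<bar>l v\<bar> \<le> c * form_norm M A v)}"

definition dual_norm ::
    "'a measure \<Rightarrow> ('a \<Rightarrow> real) set \<Rightarrow> (('a \<Rightarrow> real) \<Rightarrow> ('a \<Rightarrow> real) \<Rightarrow> real)
     \<Rightarrow> (('a \<Rightarrow> real) \<Rightarrow> real) \<Rightarrow> real" where
  "dual_norm M D A l = (SUP v\<in>{v\<in>D. form_norm M A v \<le> 1}. \<bar>l v\<bar>)"

definition restricts_to_C0_semigroup ::
    "'a measure \<Rightarrow> ('a \<Rightarrow> real) set \<Rightarrow> (('a \<Rightarrow> real) \<Rightarrow> ('a \<Rightarrow> real) \<Rightarrow> real)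
     \<Rightarrow> (real \<Rightarrow> ('a \<Rightarrow> real) \<Rightarrow> 'a \<Rightarrow> real) \<Rightarrow> bool" where
  "restricts_to_C0_semigroup M D A U \<longleftrightarrow>
     (\<forall>t>0. (\<forall>u\<in>D. U t u \<in> D) \<and> (\<exists>c. \<forall>u\<in>D. form_norm M A (U t u) \<le> c * form_norm M A u))
     \<and> (\<forall>u\<in>D. ((\<lambda>t. form_norm M A (\<lambda>x. U t u x - u x)) \<longlongrightarrow> 0) (at_right 0))"

text \<open>
  Graph of the closure, as an operator from \<open>D\<close> (with the form norm) to its dual, of the generator
  \<open>\<Lambda>\<close> of \<open>U\<close> restricted to \<open>D\<close>; here \<open>w \<in> L\<^sup>2\<close> is identified with the functional \<open>(w, \<cdot>)\<close>.
\<close>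

definition Lambda_graph ::
    "'a measure \<Rightarrow> ('a \<Rightarrow> real) set \<Rightarrow> (('a \<Rightarrow> real) \<Rightarrow> ('a \<Rightarrow> real) \<Rightarrow> real)
     \<Rightarrow> (real \<Rightarrow> ('a \<Rightarrow> real) \<Rightarrow> 'a \<Rightarrow> real) \<Rightarrow> ('a \<Rightarrow> real) \<Rightarrow> (('a \<Rightarrow> real) \<Rightarrow> real) \<Rightarrow> bool" where
  "Lambda_graph M D A U u l \<longleftrightarrow> u \<in> D \<and> l \<in> form_dual M D A
     \<and> (\<exists>w. (\<forall>k. w k \<in> gen_dom 2 M U \<inter> D)
          \<and> (\<forall>k. (\<lambda>v. inner2 M (generator 2 M U (w k)) v) \<in> form_dual M D A)
          \<and> (\<lambda>k. form_norm M A (\<lambda>x. w k x - u x)) \<longlonglongrightarrow> 0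
          \<and> (\<lambda>k. dual_norm M D A (\<lambda>v. inner2 M (generator 2 M U (w k)) v - l v)) \<longlonglongrightarrow> 0)"

definition Lambda_dom ::
    "'a measure \<Rightarrow> ('a \<Rightarrow> real) set \<Rightarrow> (('a \<Rightarrow> real) \<Rightarrow> ('a \<Rightarrow> real) \<Rightarrow> real)
     \<Rightarrow> (real \<Rightarrow> ('a \<Rightarrow> real) \<Rightarrow> 'a \<Rightarrow> real) \<Rightarrow> ('a \<Rightarrow> real) set" where
  "Lambda_dom M D A U = {u. \<exists>l. Lambda_graph M D A U u l}"

definition gen_form ::
    "'a measure \<Rightarrow> ('a \<Rightarrow> real) set \<Rightarrow> (('a \<Rightarrow> real) \<Rightarrow> ('a \<Rightarrow> real) \<Rightarrow> real)
     \<Rightarrow> (real \<Rightarrow> ('a \<Rightarrow> real) \<Rightarrow> 'a \<Rightarrow> real) \<Rightarrow> ('a \<Rightarrow> real) \<Rightarrow> ('a \<Rightarrow> real) \<Rightarrow> real" where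
  "gen_form M D A U u v = A u v - (SOME l. Lambda_graph M D A U u l) v"

definition state_space :: "'a::{metric_space, second_countable_topology} measure \<Rightarrow> bool" where
  "state_space M \<longleftrightarrow> locally compact (UNIV :: 'a set) \<and> sets M = sets borel
     \<and> (\<forall>K. compact K \<longrightarrow> emeasure M K < \<infinity>)
     \<and> (\<forall>G. open G \<and> G \<noteq> {} \<longrightarrow> 0 < emeasure M G)"

text \<open>
  \<open>(A, V)\<close> is the Dirichlet form, \<open>U\<close> the semigroup generated by \<open>\<Lambda>\<close>, \<open>T\<close> the semigroup
  of the resulting generalized Dirichlet form and \<open>T'\<close> its adjoint.
\<close>

definition gen_Dirichlet_setting ::
    "'a measure \<Rightarrow> ('a \<Rightarrow> real) set \<Rightarrow> (('a \<Rightarrow> real) \<Rightarrow> ('a \<Rightarrow> real) \<Rightarrow> real)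
     \<Rightarrow> (real \<Rightarrow> ('a \<Rightarrow> real) \<Rightarrow> 'a \<Rightarrow> real) \<Rightarrow> (real \<Rightarrow> ('a \<Rightarrow> real) \<Rightarrow> 'a \<Rightarrow> real)
     \<Rightarrow> (real \<Rightarrow> ('a \<Rightarrow> real) \<Rightarrow> 'a \<Rightarrow> real) \<Rightarrow> bool" where
  "gen_Dirichlet_setting M V A U T T' \<longleftrightarrow>
     Dirichlet_form M V A
     \<and> C0_contraction_semigroup 2 M U \<and> sub_Markovian 2 M U
     \<and> restricts_to_C0_semigroup M V A U
     \<and> C0_contraction_semigroup 2 M T \<and> sub_Markovian 2 M T
     \<and> (\<forall>\<alpha>>0. \<forall>f\<in>Lspace 2 M. resolvent 2 M T \<alpha> f \<in> Lambda_dom M V A U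
          \<and> (\<forall>g\<in>V. gen_form M V A U (resolvent 2 M T \<alpha> f) g
                     + \<alpha> * inner2 M (resolvent 2 M T \<alpha> f) g = inner2 M f g))
     \<and> C0_contraction_semigroup 2 M T' \<and> sub_Markovian 2 M T'
     \<and> (\<forall>t>0. \<forall>f\<in>Lspace 2 M. \<forall>g\<in>Lspace 2 M. inner2 M (T t f) g = inner2 M f (T' t g))"

section \<open>The standing hypotheses\<close>

text \<open>
  Sequences of sets and of semigroups are indexed by \<open>n \<ge> 1\<close>. The operator \<open>S n s\<close> acts on
  functions on \<open>V n\<close>; \<open>approx_op\<close> is the induced operator on functions on the whole space,
  with time \<open>0\<close> interpreted as the identity.
\<close>

definition approx_op :: "(nat \<Rightarrow> 'a set) \<Rightarrow> (nat \<Rightarrow> real \<Rightarrow> ('a \<Rightarrow> real) \<Rightarrow> 'a \<Rightarrow> real)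
    \<Rightarrow> nat \<Rightarrow> real \<Rightarrow> ('a \<Rightarrow> real) \<Rightarrow> 'a \<Rightarrow> real" where
  "approx_op V S n s f = cut (V n) (if s = 0 then cut (V n) f else S n s (cut (V n) f))"

definition cond_H1 ::
    "'a::topological_space measure \<Rightarrow> (real \<Rightarrow> ('a \<Rightarrow> real) \<Rightarrow> 'a \<Rightarrow> real) \<Rightarrow> real \<Rightarrow> (nat \<Rightarrow> 'a set)
     \<Rightarrow> nat \<Rightarrow> (nat \<Rightarrow> real \<Rightarrow> ('a \<Rightarrow> real) \<Rightarrow> 'a \<Rightarrow> real) \<Rightarrow> bool" where
  "cond_H1 M T' t V p S \<longleftrightarrow>
     (\<forall>n\<ge>1. open (V n) \<and> relatively_compact (V n) \<and> closure (V n) \<subseteq> V (Suc n))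
     \<and> (\<Union>n\<in>{1..}. V n) = UNIV
     \<and> (p = 1 \<or> p = 2)
     \<and> (\<forall>n\<ge>1. C0_contraction_semigroup p (restrict_space M (V n)) (S n)
             \<and> sub_Markovian p (restrict_space M (V n)) (S n))
     \<and> (\<forall>f\<in>Lspace 1 M \<inter> Linf M. (AE x in M. 0 \<le> f x) \<longrightarrow>
          (AE x in M. (\<forall>n\<ge>1. approx_op V S n t f x \<le> approx_op V S (Suc n) t f x)
             \<and> (\<lambda>n. approx_op V S n t f x) \<longlonglongrightarrow> T' t f x))"

definition cond_H2 ::
    "'a::topological_space measure \<Rightarrow> (nat \<Rightarrow> 'a set)
     \<Rightarrow> nat \<Rightarrow> (nat \<Rightarrow> real \<Rightarrow> ('a \<Rightarrow> real) \<Rightarrow> 'a \<Rightarrow> real)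
     \<Rightarrow> ('a \<Rightarrow> real) set \<Rightarrow> (('a \<Rightarrow> real) \<Rightarrow> ('a \<Rightarrow> real) \<Rightarrow> real)
     \<Rightarrow> (('a \<Rightarrow> real) \<Rightarrow> ('a \<Rightarrow> real) \<Rightarrow> 'a \<Rightarrow> real)
     \<Rightarrow> ('a \<Rightarrow> real) set \<Rightarrow> (('a \<Rightarrow> real) \<Rightarrow> 'a \<Rightarrow> real) \<Rightarrow> bool" where
  "cond_H2 M V p S DE E0 \<Gamma> DN N \<longleftrightarrow>
     Dirichlet_form M DE E0 \<and> symmetric_form DE E0 \<and> regular_form M DE E0 \<and> strongly_local M DE E0
     \<and> carre_du_champ M DE E0 \<Gamma>
     \<and> DN \<subseteq> Lspace 2 M \<and> ae_subspace M DN \<and> ae_linear_on M DN N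
     \<and> (\<forall>v\<in>DN. N v \<in> sub_loc M (Lspace 1 M))
     \<and> sub_bdd M DE \<subseteq> DN
     \<and> (\<forall>n\<ge>1. \<forall>u\<in>sub_loc_bdd M DE. cut (V n) u \<in> DN)
     \<and> (\<forall>n\<ge>1. \<forall>v\<in>sub_bdd (restrict_space M (V n)) (gen_dom p (restrict_space M (V n)) (S n)).
          cut (V n) v \<in> sub_bdd M DE
          \<and> (\<forall>u\<in>DE.
               set_integrable M (V n) (\<lambda>x. generator p (restrict_space M (V n)) (S n) v x * u x)
             \<and> set_integrable M (V n) (\<lambda>x. u x * N (cut (V n) v) x)
             \<and> - (LINT x:V n|M. generator p (restrict_space M (V n)) (S n) v x * u x)
                 = (LINT x|M. \<Gamma> u (cut (V n) v) x) + (LINT x:V n|M. u x * N (cut (V n) v) x)))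
     \<and> (\<forall>v\<in>sub_bdd M DE. \<forall>B\<in>sets borel. (\<exists>c. AE x\<in>B in M. v x = c) \<longrightarrow> (AE x\<in>B in M. N v x = 0))
     \<and> (\<forall>v\<in>sub_cpt M (sub_bdd M DE). (LINT x|M. N v x) = 0)
     \<and> (\<forall>v\<in>sub_bdd M DN. \<forall>\<phi>\<in>C1b. (\<lambda>x. \<phi> (v x)) \<in> Lspace 2 M \<longrightarrow>
          (\<lambda>x. \<phi> (v x)) \<in> DN \<and> (AE x in M. N (\<lambda>y. \<phi> (v y)) x = deriv \<phi> (v x) * N v x))
     \<and> (\<forall>u\<in>sub_bdd M DN. \<forall>v\<in>sub_bdd M DN. (\<lambda>x. u x * v x) \<in> DN
          \<and> (AE x in M. N (\<lambda>y. u y * v y) x = v x * N u x + u x * N v x))"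

definition sublevel :: "('a \<Rightarrow> real) \<Rightarrow> real \<Rightarrow> 'a set" where
  "sublevel \<rho> r = {x. \<rho> x < r}"

definition exhaustion :: "('a \<Rightarrow> real) \<Rightarrow> nat \<Rightarrow> 'a set" where
  "exhaustion \<rho> n = sublevel \<rho> (4 * real n)"

text \<open>
  On \<open>exhaustion \<rho> n\<close> the function \<open>N(\<rho>)\<close> is understood as \<open>N_rho N \<rho> n\<close>; every statement
  about \<open>N(\<rho>)\<close> is therefore made on each \<open>exhaustion \<rho> n\<close> separately.
\<close>

definition N_rho :: "(('a \<Rightarrow> real) \<Rightarrow> 'a \<Rightarrow> real) \<Rightarrow> ('a \<Rightarrow> real) \<Rightarrow> nat \<Rightarrow> 'a \<Rightarrow> real" where
  "N_rho N \<rho> n = N (cut (exhaustion \<rho> n) \<rho>)"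

definition cond_H3 ::
    "'a::topological_space measure \<Rightarrow> ('a \<Rightarrow> real) set
     \<Rightarrow> (('a \<Rightarrow> real) \<Rightarrow> ('a \<Rightarrow> real) \<Rightarrow> 'a \<Rightarrow> real) \<Rightarrow> (('a \<Rightarrow> real) \<Rightarrow> 'a \<Rightarrow> real)
     \<Rightarrow> ('a \<Rightarrow> real) \<Rightarrow> 'a set \<Rightarrow> bool" where
  "cond_H3 M DE \<Gamma> N \<rho> K0 \<longleftrightarrow>
     (\<forall>x. 0 \<le> \<rho> x) \<and> continuous_on UNIV \<rho> \<and> \<rho> \<in> sub_loc M DE
     \<and> (\<forall>r>0. open (sublevel \<rho> r) \<and> relatively_compact (sublevel \<rho> r))
     \<and> (\<Union>r\<in>{0<..}. sublevel \<rho> r) = UNIV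
     \<and> compact K0
     \<and> (\<forall>C. compact C \<and> C \<inter> K0 = {} \<longrightarrow>
          (\<exists>c. AE x\<in>C in M. \<bar>carre_loc M DE \<Gamma> \<rho> \<rho> x\<bar> \<le> c)
          \<and> (\<forall>n\<ge>1. \<exists>c. AE x\<in>C \<inter> exhaustion \<rho> n in M. \<bar>N_rho N \<rho> n x\<bar> \<le> c))"

definition k_supp :: "'a::topological_space measure \<Rightarrow> ('a \<Rightarrow> real) \<Rightarrow> 'a set \<Rightarrow> ('a \<Rightarrow> real) \<Rightarrow> nat" where
  "k_supp M \<rho> K f = (LEAST m. 1 \<le> m \<and> ess_supp M f \<subseteq> sublevel \<rho> (real m) \<and> K \<subseteq> sublevel \<rho> (real m))"

definition test_class ::
    "'a::topological_space measure \<Rightarrow> real \<Rightarrow> ('a \<Rightarrow> real) \<Rightarrow> 'a set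
     \<Rightarrow> nat \<Rightarrow> (nat \<Rightarrow> real \<Rightarrow> ('a \<Rightarrow> real) \<Rightarrow> 'a \<Rightarrow> real) \<Rightarrow> ('a \<Rightarrow> real) set" where
  "test_class M t \<rho> K p S = {f \<in> Linf M \<inter> sub_cpt M (Lspace 2 M).
     \<forall>n\<ge>k_supp M \<rho> K f. \<forall>s\<in>{0..t}.
       approx_op (exhaustion \<rho>) S n s f \<in> gen_dom p (restrict_space M (exhaustion \<rho> n)) (S n)}"

definition cond_H4 ::
    "'a::topological_space measure \<Rightarrow> real \<Rightarrow> ('a \<Rightarrow> real) \<Rightarrow> 'a set
     \<Rightarrow> nat \<Rightarrow> (nat \<Rightarrow> real \<Rightarrow> ('a \<Rightarrow> real) \<Rightarrow> 'a \<Rightarrow> real) \<Rightarrow> bool" where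
  "cond_H4 M t \<rho> K p S \<longleftrightarrow>
     (\<forall>f\<in>Lspace 1 M. \<forall>e>0. \<exists>g\<in>test_class M t \<rho> K p S. Lnorm 1 M (\<lambda>x. f x - g x) < e)"

section \<open>Growth quantities\<close>

definition annulus :: "('a \<Rightarrow> real) \<Rightarrow> nat \<Rightarrow> 'a set" where
  "annulus \<rho> n = sublevel \<rho> (4 * real n) - sublevel \<rho> (2 * real n)"

text \<open>
  Real valued essential supremum of a non-negative function: it is \<open>0\<close> on null sets, and the
  conversion from \<open>ereal\<close> is harmless below because the functions involved are essentially
  bounded on all but finitely many annuli.
\<close>

definition ess_sup_on :: "'a measure \<Rightarrow> 'a set \<Rightarrow> ('a \<Rightarrow> real) \<Rightarrow> real" where
  "ess_sup_on M S f = real_of_ereal (esssup (restrict_space M S) (\<lambda>x. ereal (f x)))"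

definition growth :: "'a measure \<Rightarrow> ('a \<Rightarrow> real) \<Rightarrow> ('a \<Rightarrow> real) \<Rightarrow> (nat \<Rightarrow> 'a \<Rightarrow> real)
    \<Rightarrow> (real \<Rightarrow> real) \<Rightarrow> nat \<Rightarrow> real" where
  "growth M \<rho> \<Gamma>\<rho> N\<rho> \<phi> n =
     (sqrt (ess_sup_on M (annulus \<rho> n) \<Gamma>\<rho>)
        + ess_sup_on M (annulus \<rho> n) (\<lambda>x. deriv \<phi> (\<rho> x) * \<Gamma>\<rho> x)) * sqrt (measure M (annulus \<rho> n))
     + Lnorm 2 (restrict_space M (annulus \<rho> n)) (N\<rho> n)"

text \<open>Real power with \<open>0\<^sup>0 = 1\<close>, whereas \<open>0 powr 0 = 0\<close>.\<close>

definition rpow :: "real \<Rightarrow> real \<Rightarrow> real" where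
  "rpow x a = (if a = 0 then 1 else x powr a)"

end

theory Submission
 imports Defs
begin

text \<open>
 Let \<open>v\<^sub>s\<close> be the approximating semigroup on \<open>{\<rho> < 4n}\<close> applied to a bounded function supported in
 \<open>{\<rho> < k}\<close>. The mass of \<open>v\<^sub>s\<close> seen through a cut-off of \<open>\<rho>\<close>, which is 1 for \<open>\<rho> \<le> 2 R\<close> and 0 for
 \<open>\<rho> \<ge> 4 R\<close>, changes only by the flux through the annulus in between. By Cauchy-Schwarz the flux is at most
 the growth quantity times the energy of \<open>u = exp (\<Phi> \<rho>) v\<^sub>s\<close> divided by the minimum of \<open>exp (\<Phi> \<rho>)\<close> on the
 annulus, where \<open>\<Phi>\<close> is \<open>\<phi> - \<phi> k\<close>, smoothed, and frozen beyond \<open>4 R\<close>. Testing the equation with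
 \<open>exp (2 \<Phi> \<rho>) v\<^sub>s\<close> controls this energy as soon as \<open>\<phi>'(\<rho>)\<^sup>2 \<Gamma>(\<rho>,\<rho>) + \<phi>'(\<rho>) N(\<rho>) \<le> c (\<phi>(\<rho>) + 1)\<close>, up to a
 factor \<open>exp (const * s * \<phi> (4 R))\<close>. For short times the factor is absorbed by \<open>exp (- \<phi> (2 R))\<close>, and no mass
 is lost as \<open>R\<close> tends to infinity. Iterating short steps, with a larger \<open>R\<close> in each step, reaches time \<open>t\<close>,
 and duality turns conservation of mass by the adjoint semigroup into \<open>T\<^sub>t 1 = 1\<close>.
\<close>

section \<open>Square integrable functions\<close>

text \<open>The main obstacle is calculus. Chain and product rules are given for \<open>N\<close>;
  for \<Gamma> there are only its defining identity and strong locality of the form. Leibniz rule,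
  chain rule and locality of \<Gamma> are therefore extracted from truncations: the parts of a
  function between successive levels are orthogonal for the form, so functions of it are limits of
  Riemann sums in the level. The chain rule for \<open>N\<close> admits C1 functions with bounded
  value and derivative. This is why \<Phi> is smoothed and frozen, why the cut-off is a quadratic
  spline, and why \<open>exp (\<Phi> \<rho>) - 1\<close>, which vanishes at 0, is used in place of
  the exponential. As \<rho> lies in the form domain only locally, bounded stand-ins replace it on
  each sublevel set. Testing with \<open>exp (2 \<Phi> \<rho>) v\<close> turns the first order terms
  into \<open>N\<close> of a square, whose integral is 0, plus a term that only involves
  \<open>N(\<rho>)\<close>. The energy grows at a rate governed by \<open>\<phi> (4 R)\<close> while
  the gain is \<open>\<phi> (2 R)\<close>. Their comparability, encoded in \<kappa>, makes the
  length of a short step independent of \<open>R\<close> and of the initial function, hence finitely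
  many steps suffice.\<close>

lemma quadratic_discriminant_le:
 fixes a b c :: real
 assumes "\<And>s. 0 \<le> a + 2 * s * b + s\<^sup>2 * c"
 shows "b\<^sup>2 \<le> a * c"
proof (cases "c = 0")
 case True
 have "b = 0"
 proof (rule ccontr)
  assume "b \<noteq> 0"
  then show False
   using assms[of "- (a + 1) / (2 * b)"] True by (simp add: field_simps)
 qed
 then show ?thesis using True by simp
next
 case False
 have "c \<ge> 0"
 proof (rule ccontr)
  assume c: "\<not> c \<ge> 0"
  \<comment> \<open>The summands make \<open>2 * b + s * c\<close> at most
    \<open>- (1 + \<bar>a\<bar>)\<close> and \<open>s\<close> at least 1, so the polynomial is
    negative at \<open>s\<close>.\<close>
  define s where "s = (1 + \<bar>a\<bar>) / (- c) + 1 + 2 * \<bar>b\<bar> / (- c)"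
  have "0 \<le> (1 + \<bar>a\<bar>) / (- c)" "0 \<le> 2 * \<bar>b\<bar> / (- c)"
   using c by (intro divide_nonneg_nonneg; simp)+
  then have s1: "s \<ge> 1" unfolding s_def by linarith
  have sc: "s * c = - (1 + \<bar>a\<bar>) + c - 2 * \<bar>b\<bar>" using c by (simp add: s_def field_simps)
  have "a + 2 * s * b + s\<^sup>2 * c = a + s * (2 * b + s * c)" by (simp add: power2_eq_square algebra_simps)
  also have "\<dots> \<le> a + s * (- (1 + \<bar>a\<bar>))"
   using s1 c by (intro add_left_mono mult_left_mono) (auto simp: sc)
  also have "\<dots> \<le> a + 1 * (- (1 + \<bar>a\<bar>))"
   using s1 by (intro add_left_mono mult_right_mono_neg) auto
  also have "\<dots> < 0" by simp
  finally show False using assms[of s] by simp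
 qed
 then have c: "c > 0" using False by simp
 show ?thesis using assms[of "- b / c"] c by (simp add: field_simps power2_eq_square)
qed

lemma Lspace2_iff: "f \<in> Lspace 2 M \<longleftrightarrow> f \<in> borel_measurable M \<and> integrable M (\<lambda>x. (f x)\<^sup>2)"
 by (simp add: Lspace_def)

lemma Lnorm2_eq: "Lnorm 2 M f = sqrt (LINT x|M. (f x)\<^sup>2)"
 by (simp add: Lnorm_def sqrt_def)

lemma Lspace2_mult_integrable:
 assumes "f \<in> Lspace 2 M" "g \<in> Lspace 2 M"
 shows "integrable M (\<lambda>x. f x * g x)"
proof (rule Bochner_Integration.integrable_bound)
 show "integrable M (\<lambda>x. (f x)\<^sup>2 + (g x)\<^sup>2)"
  using assms by (auto simp: Lspace2_iff)
 show "(\<lambda>x. f x * g x) \<in> borel_measurable M"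
  using assms by (auto simp: Lspace2_iff)
 show "AE x in M. norm (f x * g x) \<le> norm ((f x)\<^sup>2 + (g x)\<^sup>2)"
 proof (rule AE_I2)
  fix x
  have "0 \<le> (\<bar>f x\<bar> - \<bar>g x\<bar>)\<^sup>2" by simp
  then have "2 * (\<bar>f x\<bar> * \<bar>g x\<bar>) \<le> (f x)\<^sup>2 + (g x)\<^sup>2"
   by (simp add: power2_diff algebra_simps)
  moreover have "0 \<le> \<bar>f x\<bar> * \<bar>g x\<bar>" by simp
  ultimately have "\<bar>f x\<bar> * \<bar>g x\<bar> \<le> (f x)\<^sup>2 + (g x)\<^sup>2" by linarith
  then show "norm (f x * g x) \<le> norm ((f x)\<^sup>2 + (g x)\<^sup>2)"
   by (simp add: abs_mult)
 qed
qed

lemma Lspace2_lin: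
 assumes "f \<in> Lspace 2 M" "g \<in> Lspace 2 M"
 shows "(\<lambda>x. a * f x + b * g x) \<in> Lspace 2 M"
proof -
 have "integrable M (\<lambda>x. a\<^sup>2 * (f x)\<^sup>2 + (2 * a * b) * (f x * g x) + b\<^sup>2 * (g x)\<^sup>2)"
  using assms Lspace2_mult_integrable[OF assms] by (auto simp: Lspace2_iff)
 then show ?thesis using assms
  by (auto simp: Lspace2_iff power2_eq_square algebra_simps)
qed

lemma Lspace2_diff: "f \<in> Lspace 2 M \<Longrightarrow> g \<in> Lspace 2 M \<Longrightarrow> (\<lambda>x. f x - g x) \<in> Lspace 2 M"
 using Lspace2_lin[of f M g 1 "-1"] by simp

lemma Lspace2_Cauchy_Schwarz:
 assumes "f \<in> Lspace 2 M" "g \<in> Lspace 2 M"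
 shows "(LINT x|M. f x * g x)\<^sup>2 \<le> (LINT x|M. (f x)\<^sup>2) * (LINT x|M. (g x)\<^sup>2)"
proof (rule quadratic_discriminant_le)
 fix s :: real
 have "0 \<le> (LINT x|M. (f x + s * g x)\<^sup>2)" by (rule integral_nonneg_AE) auto
 also have "\<dots> = (LINT x|M. ((f x)\<^sup>2 + (2 * s) * (f x * g x)) + s\<^sup>2 * (g x)\<^sup>2)"
  by (intro Bochner_Integration.integral_cong) (auto simp: power2_eq_square algebra_simps)
 also have "\<dots> = (LINT x|M. (f x)\<^sup>2) + 2 * s * (LINT x|M. f x * g x) + s\<^sup>2 * (LINT x|M. (g x)\<^sup>2)"
  using assms Lspace2_mult_integrable[OF assms] by (simp add: Lspace2_iff)
 finally show "0 \<le> (LINT x|M. (f x)\<^sup>2) + 2 * s * (LINT x|M. f x * g x) + s\<^sup>2 * (LINT x|M. (g x)\<^sup>2)" .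
qed

lemma Lspace2_Cauchy_Schwarz_abs:
 assumes "f \<in> Lspace 2 M" "g \<in> Lspace 2 M"
 shows "\<bar>LINT x|M. f x * g x\<bar> \<le> sqrt (LINT x|M. (f x)\<^sup>2) * sqrt (LINT x|M. (g x)\<^sup>2)"
 using real_sqrt_le_mono[OF Lspace2_Cauchy_Schwarz[OF assms]] by (simp add: real_sqrt_mult)

lemma sq_diff_le: "(a - b)\<^sup>2 \<le> 2 * (a - c)\<^sup>2 + 2 * (b - c)\<^sup>2" for a b c :: real
proof -
 have "0 \<le> (a - c + (b - c))\<^sup>2" by simp
 then show ?thesis by (simp add: power2_eq_square algebra_simps)
qed

lemma L2_limit_unique:
 assumes "\<And>n. u n \<in> Lspace 2 M" "v \<in> Lspace 2 M" "w \<in> Lspace 2 M"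
  and "(\<lambda>n. LINT x|M. (u n x - v x)\<^sup>2) \<longlonglongrightarrow> 0" "(\<lambda>n. LINT x|M. (u n x - w x)\<^sup>2) \<longlonglongrightarrow> 0"
 shows "AE x in M. v x = w x"
proof -
 have int: "integrable M (\<lambda>x. (f x - g x)\<^sup>2)" if "f \<in> Lspace 2 M" "g \<in> Lspace 2 M" for f g
  using Lspace2_diff[OF that] by (simp add: Lspace2_iff)
 have le: "(LINT x|M. (v x - w x)\<^sup>2) \<le> 2 * (LINT x|M. (u n x - v x)\<^sup>2) + 2 * (LINT x|M. (u n x - w x)\<^sup>2)" for n
 proof -
  have "(LINT x|M. (v x - w x)\<^sup>2) \<le> (LINT x|M. 2 * (u n x - v x)\<^sup>2 + 2 * (u n x - w x)\<^sup>2)"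
   using assms int sq_diff_le[of "v _" "w _" "u n _"]
   by (intro integral_mono) (auto simp: power2_commute)
  also have "\<dots> = 2 * (LINT x|M. (u n x - v x)\<^sup>2) + 2 * (LINT x|M. (u n x - w x)\<^sup>2)"
   using assms int by simp
  finally show ?thesis .
 qed
 have "(\<lambda>n. 2 * (LINT x|M. (u n x - v x)\<^sup>2) + 2 * (LINT x|M. (u n x - w x)\<^sup>2)) \<longlonglongrightarrow> 2 * 0 + 2 * 0"
  by (intro tendsto_intros assms)
 then have "(LINT x|M. (v x - w x)\<^sup>2) \<le> 0"
  by (intro LIMSEQ_le_const) (use le in auto)
 moreover have "0 \<le> (LINT x|M. (v x - w x)\<^sup>2)" by (rule integral_nonneg_AE) auto
 ultimately have "(LINT x|M. (v x - w x)\<^sup>2) = 0" by simp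
 then have "AE x in M. (v x - w x)\<^sup>2 = 0"
  by (subst (asm) integral_nonneg_eq_0_iff_AE) (use int assms in auto)
 then show ?thesis by simp
qed

lemma L1_limit_unique:
 fixes f :: "nat \<Rightarrow> 'a \<Rightarrow> real"
 assumes "\<And>n. integrable M (f n)" "integrable M g" "integrable M h"
  and "(\<lambda>n. LINT x|M. \<bar>f n x - g x\<bar>) \<longlonglongrightarrow> 0" "(\<lambda>n. LINT x|M. \<bar>f n x - h x\<bar>) \<longlonglongrightarrow> 0"
 shows "AE x in M. g x = h x"
proof -
 have le: "(LINT x|M. \<bar>g x - h x\<bar>) \<le> (LINT x|M. \<bar>f n x - g x\<bar>) + (LINT x|M. \<bar>f n x - h x\<bar>)" for n
 proof -
  have "(LINT x|M. \<bar>g x - h x\<bar>) \<le> (LINT x|M. \<bar>f n x - g x\<bar> + \<bar>f n x - h x\<bar>)"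
   using assms by (intro integral_mono) auto
  also have "\<dots> = (LINT x|M. \<bar>f n x - g x\<bar>) + (LINT x|M. \<bar>f n x - h x\<bar>)"
   using assms by simp
  finally show ?thesis .
 qed
 have "(\<lambda>n. (LINT x|M. \<bar>f n x - g x\<bar>) + (LINT x|M. \<bar>f n x - h x\<bar>)) \<longlonglongrightarrow> 0 + 0"
  by (intro tendsto_intros assms)
 then have "(LINT x|M. \<bar>g x - h x\<bar>) \<le> 0"
  by (intro LIMSEQ_le_const) (use le in auto)
 moreover have "0 \<le> (LINT x|M. \<bar>g x - h x\<bar>)" by (rule integral_nonneg_AE) auto
 ultimately have "(LINT x|M. \<bar>g x - h x\<bar>) = 0" by simp
 then have "AE x in M. \<bar>g x - h x\<bar> = 0"
  by (subst (asm) integral_nonneg_eq_0_iff_AE) (use assms in auto)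
 then show ?thesis by simp
qed

lemma L2_tendsto_AE_subseq:
 assumes "\<And>n. u n \<in> Lspace 2 M" "v \<in> Lspace 2 M" "(\<lambda>n. LINT x|M. (u n x - v x)\<^sup>2) \<longlonglongrightarrow> 0"
 obtains r where "strict_mono r" "AE x in M. (\<lambda>n. u (r n) x) \<longlonglongrightarrow> v x"
proof -
 have "\<exists>r. strict_mono r \<and> (AE x in M. (\<lambda>n. (u (r n) x - v x)\<^sup>2) \<longlonglongrightarrow> 0)"
  by (rule tendsto_L1_AE_subseq)
    (use assms Lspace2_diff[OF assms(1,2)] in \<open>auto simp: Lspace2_iff\<close>)
 then obtain r where r: "strict_mono r" "AE x in M. (\<lambda>n. (u (r n) x - v x)\<^sup>2) \<longlonglongrightarrow> 0" by blast
 have "AE x in M. (\<lambda>n. u (r n) x) \<longlonglongrightarrow> v x"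
  using r(2)
 proof eventually_elim
  case (elim x)
  then have "(\<lambda>n. sqrt ((u (r n) x - v x)\<^sup>2)) \<longlonglongrightarrow> sqrt 0" by (rule tendsto_real_sqrt)
  then have "(\<lambda>n. u (r n) x - v x) \<longlonglongrightarrow> 0" by (simp add: tendsto_rabs_zero_iff)
  then show ?case by (simp add: LIM_zero_iff)
 qed
 then show thesis using r that by blast
qed

section \<open>Strongly local Dirichlet forms\<close>

lemma ess_supp_closed: "closed (ess_supp M f)"
 unfolding ess_supp_def by (intro closed_Inter) auto

lemma ess_supp_subset: "closed F \<Longrightarrow> (\<And>x. x \<notin> F \<Longrightarrow> f x = 0) \<Longrightarrow> ess_supp M f \<subseteq> F"
 unfolding ess_supp_def by (intro Inter_lower) auto

lemma ess_supp_compact: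
 assumes "compact F" "\<And>x. x \<notin> F \<Longrightarrow> f x = 0"
 shows "compact (ess_supp M (f :: 'a::t2_space \<Rightarrow> real))"
proof -
 have "ess_supp M f \<subseteq> F" using assms by (intro ess_supp_subset compact_imp_closed)
 then show ?thesis using assms(1) ess_supp_closed[of M f]
  by (metis closed_Int_compact inf.absorb1 inf.commute)
qed

section \<open>Truncations and their energy\<close>

definition clip :: "real \<Rightarrow> ('a \<Rightarrow> real) \<Rightarrow> 'a \<Rightarrow> real" where
 "clip c u = (\<lambda>x. min (max (u x) 0) c)"

lemma clip_clip: "0 \<le> a \<Longrightarrow> a \<le> b \<Longrightarrow> clip a (clip b u) = clip a u"
 by (auto simp: clip_def fun_eq_iff)

lemma clip_bounds: "0 \<le> c \<Longrightarrow> 0 \<le> clip c u x \<and> clip c u x \<le> c"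
 by (auto simp: clip_def)

text \<open>In this locale \<rho> acts as a proper exhaustion function: its relatively compact
  sublevel sets provide compact supports in \<open>zero_if_orthogonal_to_Dc\<close>.\<close>

locale local_form =
 fixes M :: "'a::{metric_space, second_countable_topology} measure"
  and D :: "('a \<Rightarrow> real) set" and A \<Gamma> and \<rho> :: "'a \<Rightarrow> real"
 assumes sets_M: "sets M = sets borel"
  and finite_compact: "\<And>K. compact K \<Longrightarrow> emeasure M K < \<infinity>"
  and dirichlet: "Dirichlet_form M D A"
  and symmetric: "symmetric_form D A"
  and regular: "regular_form M D A"
  and strong_locality: "strongly_local M D A"
  and carre: "carre_du_champ M D A \<Gamma>"
  and rho_cont: "continuous_on UNIV \<rho>"
  and rho_compact: "\<And>r. compact (closure {x. \<rho> x < r})"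
begin

abbreviation "E u \<equiv> A u u"

lemma space_M: "space M = UNIV"
 using sets_eq_imp_space_eq[OF sets_M] by simp

lemma closed_form: "coercive_closed_form M D A"
 using dirichlet by (simp add: Dirichlet_form_def)

lemma D_L2: "u \<in> D \<Longrightarrow> u \<in> Lspace 2 M"
 using closed_form unfolding coercive_closed_form_def by blast

lemma D_meas[measurable]: "u \<in> D \<Longrightarrow> u \<in> borel_measurable M"
 using D_L2 by (simp add: Lspace2_iff)

lemma D_lin: "u \<in> D \<Longrightarrow> v \<in> D \<Longrightarrow> (\<lambda>x. a * u x + b * v x) \<in> D"
 using closed_form unfolding coercive_closed_form_def ae_subspace_def by blast

lemma D_zero: "(\<lambda>_. 0) \<in> D"
 using closed_form unfolding coercive_closed_form_def ae_subspace_def by blast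

lemma D_cong: "u \<in> D \<Longrightarrow> v \<in> borel_measurable M \<Longrightarrow> (AE x in M. u x = v x) \<Longrightarrow> v \<in> D"
 using closed_form unfolding coercive_closed_form_def ae_subspace_def by blast

lemma D_add: "u \<in> D \<Longrightarrow> v \<in> D \<Longrightarrow> (\<lambda>x. u x + v x) \<in> D"
 using D_lin[of u v 1 1] by simp

lemma D_diff: "u \<in> D \<Longrightarrow> v \<in> D \<Longrightarrow> (\<lambda>x. u x - v x) \<in> D"
 using D_lin[of u v 1 "-1"] by simp

lemma D_scale: "u \<in> D \<Longrightarrow> (\<lambda>x. a * u x) \<in> D"
 using D_lin[of u u a 0] by simp

lemma D_sum: "finite I \<Longrightarrow> (\<And>i. i \<in> I \<Longrightarrow> f i \<in> D) \<Longrightarrow> (\<lambda>x. \<Sum>i\<in>I. a i * f i x) \<in> D"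
 by (induction I rule: finite_induct) (auto simp: D_zero intro!: D_add D_scale)

lemma A_lin1: "u \<in> D \<Longrightarrow> v \<in> D \<Longrightarrow> w \<in> D \<Longrightarrow> A (\<lambda>x. a * u x + b * v x) w = a * A u w + b * A v w"
 using closed_form unfolding coercive_closed_form_def ae_bilinear_form_def by blast

lemma A_cong: "u \<in> D \<Longrightarrow> v \<in> D \<Longrightarrow> w \<in> D \<Longrightarrow> (AE x in M. u x = v x) \<Longrightarrow> A u w = A v w"
 using closed_form unfolding coercive_closed_form_def ae_bilinear_form_def by blast

lemma A_sym: "u \<in> D \<Longrightarrow> v \<in> D \<Longrightarrow> A u v = A v u"
 using symmetric by (auto simp: symmetric_form_def)

lemma A_lin2: "u \<in> D \<Longrightarrow> v \<in> D \<Longrightarrow> w \<in> D \<Longrightarrow> A w (\<lambda>x. a * u x + b * v x) = a * A w u + b * A w v"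
 using A_lin1[of u v w a b] by (simp add: A_sym D_lin)

lemma A_add1: "u \<in> D \<Longrightarrow> v \<in> D \<Longrightarrow> w \<in> D \<Longrightarrow> A (\<lambda>x. u x + v x) w = A u w + A v w"
 using A_lin1[of u v w 1 1] by simp
lemma A_add2: "u \<in> D \<Longrightarrow> v \<in> D \<Longrightarrow> w \<in> D \<Longrightarrow> A w (\<lambda>x. u x + v x) = A w u + A w v"
 using A_lin2[of u v w 1 1] by simp
lemma A_diff1: "u \<in> D \<Longrightarrow> v \<in> D \<Longrightarrow> w \<in> D \<Longrightarrow> A (\<lambda>x. u x - v x) w = A u w - A v w"
 using A_lin1[of u v w 1 "-1"] by simp
lemma A_diff2: "u \<in> D \<Longrightarrow> v \<in> D \<Longrightarrow> w \<in> D \<Longrightarrow> A w (\<lambda>x. u x - v x) = A w u - A w v"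
 using A_lin2[of u v w 1 "-1"] by simp
lemma A_scale1: "u \<in> D \<Longrightarrow> w \<in> D \<Longrightarrow> A (\<lambda>x. a * u x) w = a * A u w"
 using A_lin1[of u u w a 0] by simp
lemma A_scale2: "u \<in> D \<Longrightarrow> w \<in> D \<Longrightarrow> A w (\<lambda>x. a * u x) = a * A w u"
 using A_lin2[of u u w a 0] by simp
lemma A_zero1: "w \<in> D \<Longrightarrow> A (\<lambda>x. 0) w = 0"
 using A_scale1[OF D_zero, of w 0] by simp

lemmas A_simps = A_add1 A_add2 A_diff1 A_diff2 A_scale1 A_scale2 D_add D_diff D_scale

lemma A_sum1:
 "finite I \<Longrightarrow> (\<And>i. i \<in> I \<Longrightarrow> f i \<in> D) \<Longrightarrow> w \<in> D \<Longrightarrow>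
  A (\<lambda>x. \<Sum>i\<in>I. a i * f i x) w = (\<Sum>i\<in>I. a i * A (f i) w)"
 by (induction I rule: finite_induct) (auto simp: A_zero1 A_add1 A_scale1 D_sum D_scale)

lemma A_sum2:
 "finite I \<Longrightarrow> (\<And>i. i \<in> I \<Longrightarrow> f i \<in> D) \<Longrightarrow> w \<in> D \<Longrightarrow>
  A w (\<lambda>x. \<Sum>i\<in>I. a i * f i x) = (\<Sum>i\<in>I. a i * A w (f i))"
 using A_sum1[of I f w a] by (simp add: A_sym D_sum)

lemma E_nonneg: "u \<in> D \<Longrightarrow> 0 \<le> E u"
 using closed_form unfolding coercive_closed_form_def by blast

lemma A_Cauchy_Schwarz:
 assumes "u \<in> D" "v \<in> D"
 shows "\<bar>A u v\<bar> \<le> sqrt (E u) * sqrt (E v)"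
proof -
 have "(A u v)\<^sup>2 \<le> E u * E v"
 proof (rule quadratic_discriminant_le)
  fix s :: real
  have "0 \<le> E (\<lambda>x. u x + s * v x)" using assms by (intro E_nonneg D_add D_scale)
  also have "\<dots> = E u + 2 * s * A u v + s\<^sup>2 * E v"
   using assms A_sym[OF assms] by (simp add: A_simps power2_eq_square algebra_simps)
  finally show "0 \<le> E u + 2 * s * A u v + s\<^sup>2 * E v" .
 qed
 from real_sqrt_le_mono[OF this] show ?thesis by (simp add: real_sqrt_mult)
qed

lemma A_tendsto:
 assumes "\<And>n. u n \<in> D" "\<And>n. v n \<in> D" "u' \<in> D" "v' \<in> D"
  and u: "(\<lambda>n. E (\<lambda>x. u n x - u' x)) \<longlonglongrightarrow> 0" and v: "(\<lambda>n. E (\<lambda>x. v n x - v' x)) \<longlonglongrightarrow> 0"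
 shows "(\<lambda>n. A (u n) (v n)) \<longlonglongrightarrow> A u' v'"
proof -
 let ?a = "\<lambda>n. sqrt (E (\<lambda>x. u n x - u' x))" and ?b = "\<lambda>n. sqrt (E (\<lambda>x. v n x - v' x))"
 have "(\<lambda>n. ?a n * ?b n + ?a n * sqrt (E v') + sqrt (E u') * ?b n) \<longlonglongrightarrow>
   sqrt 0 * sqrt 0 + sqrt 0 * sqrt (E v') + sqrt (E u') * sqrt 0"
  by (intro tendsto_intros u v)
 then have lim: "(\<lambda>n. ?a n * ?b n + ?a n * sqrt (E v') + sqrt (E u') * ?b n) \<longlonglongrightarrow> 0" by simp
 have "norm (A (u n) (v n) - A u' v') \<le> ?a n * ?b n + ?a n * sqrt (E v') + sqrt (E u') * ?b n" for n
 proof -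
  have eq: "A (u n) (v n) - A u' v' = A (\<lambda>x. u n x - u' x) (\<lambda>x. v n x - v' x)
    + A (\<lambda>x. u n x - u' x) v' + A u' (\<lambda>x. v n x - v' x)"
   using assms by (simp add: A_simps)
  have "\<bar>A (\<lambda>x. u n x - u' x) (\<lambda>x. v n x - v' x)\<bar> \<le> ?a n * ?b n"
   "\<bar>A (\<lambda>x. u n x - u' x) v'\<bar> \<le> ?a n * sqrt (E v')"
   "\<bar>A u' (\<lambda>x. v n x - v' x)\<bar> \<le> sqrt (E u') * ?b n"
   using assms by (intro A_Cauchy_Schwarz D_diff; simp)+
  then show ?thesis unfolding eq by simp
 qed
 then have "(\<lambda>n. A (u n) (v n) - A u' v') \<longlonglongrightarrow> 0"
  by (intro Lim_null_comparison[OF _ lim] always_eventually allI)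
 then show ?thesis by (rule LIM_zero_cancel)
qed

lemma complete_form:
 assumes "\<And>n. u n \<in> D"
  and "\<forall>e>0. \<exists>n0. \<forall>m\<ge>n0. \<forall>n\<ge>n0. form_norm M A (\<lambda>x. u m x - u n x) < e"
 shows "\<exists>v\<in>D. (\<lambda>n. form_norm M A (\<lambda>x. u n x - v x)) \<longlonglongrightarrow> 0"
proof -
 have "\<forall>u. (\<forall>n. u n \<in> D)
     \<and> (\<forall>e>0. \<exists>n0. \<forall>m\<ge>n0. \<forall>n\<ge>n0. form_norm M A (\<lambda>x. u m x - u n x) < e)
     \<longrightarrow> (\<exists>v\<in>D. (\<lambda>n. form_norm M A (\<lambda>x. u n x - v x)) \<longlonglongrightarrow> 0)"
  using closed_form unfolding coercive_closed_form_def by (elim conjE)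
 then show ?thesis using assms by (elim allE[where x = u]) auto
qed

text \<open>Closedness in the shape used below: functions of \<open>u\<close> enter \<open>D\<close>
  as L2 limits with controlled energy differences. The two bounds give a Cauchy sequence for the
  form norm, and its limit is \<open>v\<close> because L2 limits are unique.\<close>

lemma closed_limit:
 assumes u: "\<And>n. u n \<in> D" and v: "v \<in> Lspace 2 M"
  and c: "c \<longlonglongrightarrow> 0" and le: "\<And>m n. E (\<lambda>x. u m x - u n x) \<le> c m + c n"
  and L2: "(\<lambda>n. LINT x|M. (u n x - v x)\<^sup>2) \<longlonglongrightarrow> 0"
 shows "v \<in> D" "(\<lambda>n. E (\<lambda>x. u n x - v x)) \<longlonglongrightarrow> 0"
proof -
 let ?d = "\<lambda>n. LINT x|M. (u n x - v x)\<^sup>2"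
 have int: "integrable M (\<lambda>x. (f x - g x)\<^sup>2)" if "f \<in> Lspace 2 M" "g \<in> Lspace 2 M" for f g
  using Lspace2_diff[OF that] by (simp add: Lspace2_iff)
 have fn: "form_norm M A f = sqrt (E f + (LINT x|M. (f x)\<^sup>2))" for f
  by (simp add: form_norm_def form1_def inner2_def power2_eq_square)
 have "\<exists>n0. \<forall>m\<ge>n0. \<forall>n\<ge>n0. form_norm M A (\<lambda>x. u m x - u n x) < e" if e: "e > 0" for e
 proof -
  have "(\<lambda>n. c n + 2 * ?d n) \<longlonglongrightarrow> 0 + 2 * 0" by (intro tendsto_intros c L2)
  then have "eventually (\<lambda>n. c n + 2 * ?d n < e\<^sup>2 / 2) sequentially"
   using e by (intro order_tendstoD) auto
  then obtain n0 where n0: "\<And>n. n \<ge> n0 \<Longrightarrow> c n + 2 * ?d n < e\<^sup>2 / 2"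
   by (auto simp: eventually_sequentially)
  have "form_norm M A (\<lambda>x. u m x - u n x) < e" if "m \<ge> n0" "n \<ge> n0" for m n
  proof -
   have "(LINT x|M. (u m x - u n x)\<^sup>2) \<le> (LINT x|M. 2 * (u m x - v x)\<^sup>2 + 2 * (u n x - v x)\<^sup>2)"
    using u v D_L2 int by (intro integral_mono sq_diff_le) auto
   also have "\<dots> = 2 * ?d m + 2 * ?d n"
    using u v by (simp add: int D_L2)
   finally have "E (\<lambda>x. u m x - u n x) + (LINT x|M. (u m x - u n x)\<^sup>2) < e\<^sup>2"
    using le[of m n] n0[of m] n0[of n] that by simp
   then have "sqrt (E (\<lambda>x. u m x - u n x) + (LINT x|M. (u m x - u n x)\<^sup>2)) < sqrt (e\<^sup>2)"
    by (rule real_sqrt_less_mono)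
   then show ?thesis using e by (simp add: fn)
  qed
  then show ?thesis by blast
 qed
 then obtain w where w: "w \<in> D" and lim: "(\<lambda>n. form_norm M A (\<lambda>x. u n x - w x)) \<longlonglongrightarrow> 0"
  using complete_form[of u] u by blast
 have nn: "0 \<le> E (\<lambda>x. u n x - w x)" "0 \<le> (LINT x|M. (u n x - w x)\<^sup>2)" for n
  using u w by (auto intro!: E_nonneg D_diff integral_nonneg_AE)
 have "(\<lambda>n. (form_norm M A (\<lambda>x. u n x - w x))\<^sup>2) \<longlonglongrightarrow> 0\<^sup>2" by (intro tendsto_intros lim)
 then have lim2: "(\<lambda>n. E (\<lambda>x. u n x - w x) + (LINT x|M. (u n x - w x)\<^sup>2)) \<longlonglongrightarrow> 0"
  using nn by (simp add: fn)
 have limE: "(\<lambda>n. E (\<lambda>x. u n x - w x)) \<longlonglongrightarrow> 0"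
  by (rule Lim_null_comparison[OF _ lim2]) (use nn in auto)
 have limL: "(\<lambda>n. (LINT x|M. (u n x - w x)\<^sup>2)) \<longlonglongrightarrow> 0"
  by (rule Lim_null_comparison[OF _ lim2]) (use nn in auto)
 have vw: "AE x in M. w x = v x"
  by (rule L2_limit_unique[of u]) (use u v w limL L2 in \<open>auto intro: D_L2\<close>)
 show vD: "v \<in> D" using w vw v by (intro D_cong[of w v]) (auto simp: Lspace2_iff)
 have "E (\<lambda>x. u n x - w x) = E (\<lambda>x. u n x - v x)" for n
 proof -
  have ae: "AE x in M. u n x - w x = u n x - v x" using vw by auto
  \<comment> \<open>\<open>A_cong\<close> replaces the first argument only, so the second one is
    changed after a swap.\<close>
  have "E (\<lambda>x. u n x - w x) = A (\<lambda>x. u n x - v x) (\<lambda>x. u n x - w x)"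
   using u w vD ae by (intro A_cong D_diff)
  also have "\<dots> = A (\<lambda>x. u n x - w x) (\<lambda>x. u n x - v x)" using u w vD by (intro A_sym D_diff)
  also have "\<dots> = E (\<lambda>x. u n x - v x)"
   using u w vD ae by (intro A_cong D_diff)
  finally show ?thesis .
 qed
 then show "(\<lambda>n. E (\<lambda>x. u n x - v x)) \<longlonglongrightarrow> 0" using limE by simp
qed

text \<open>The unit contraction property pairs sum and difference of \<open>w\<close> and its
  contraction; by symmetry this is an inequality of energies, and scaling moves the level from 1 to
  \<open>c\<close>. Level 0 cannot be reached by scaling and is treated apart.\<close>

lemma clip_D:
 assumes "u \<in> D" "0 \<le> c"
 shows "clip c u \<in> D" "E (clip c u) \<le> E u"
proof -
 have "clip c u \<in> D \<and> E (clip c u) \<le> E u"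
 proof (cases "c = 0")
  case True
  then have "clip c u = (\<lambda>_. 0)" by (auto simp: clip_def)
  then show ?thesis using D_zero A_zero1[OF D_zero] E_nonneg[OF assms(1)] by simp
 next
  case False
  then have c: "c > 0" using assms by simp
  define w where "w = (\<lambda>x. (1 / c) * u x)"
  have w: "w \<in> D" unfolding w_def by (intro D_scale assms)
  have uc: "unit_contraction w \<in> D"
   and ineq: "0 \<le> A (\<lambda>x. w x + unit_contraction w x) (\<lambda>x. w x - unit_contraction w x)"
   using dirichlet w by (auto simp: Dirichlet_form_def)
  have le: "E (unit_contraction w) \<le> E w"
   using ineq w uc A_sym[OF w uc] by (simp add: A_simps)
  have eq: "clip c u = (\<lambda>x. c * unit_contraction w x)"
   using c by (simp add: clip_def unit_contraction_def w_def min_mult_distrib_left max_mult_distrib_left)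
  have u: "u = (\<lambda>x. c * w x)" using c by (auto simp: w_def)
  have "E u = c\<^sup>2 * E w" by (subst (1 2) u) (simp add: A_simps w power2_eq_square)
  moreover have "E (clip c u) = c\<^sup>2 * E (unit_contraction w)"
   unfolding eq by (simp add: A_simps uc power2_eq_square)
  moreover have "c\<^sup>2 * E (unit_contraction w) \<le> c\<^sup>2 * E w"
   using le by (rule mult_left_mono) simp
  moreover have "clip c u \<in> D" unfolding eq by (rule D_scale[OF uc])
  ultimately show ?thesis by linarith
 qed
 then show "clip c u \<in> D" "E (clip c u) \<le> E u" by auto
qed

text \<open>Adding a multiple \<open>s \<ge> 0\<close> of the part above level \<open>a\<close> does
  not change the truncation at \<open>a\<close>. So \<open>clip a u\<close> minimises the energy
  along this ray, and the derivative at \<open>s = 0\<close> shows that \<open>clip a u\<close> has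
  nonnegative inner product with that part. Expanding \<open>E (clip b u)\<close> gives the
  claim.\<close>

lemma clip_energy_increment:
 assumes u: "u \<in> D" and "0 \<le> a" "a \<le> b"
 shows "E (\<lambda>x. clip b u x - clip a u x) \<le> E (clip b u) - E (clip a u)"
proof -
 let ?g = "\<lambda>x. clip b u x - clip a u x"
 have D: "clip a u \<in> D" "clip b u \<in> D" using assms by (auto intro: clip_D)
 have g: "?g \<in> D" using D by (rule D_diff[rotated])
 have ineq: "0 \<le> 2 * A (clip a u) ?g + s * E ?g" if s: "s > 0" for s
 proof -
  have ceq: "clip a (\<lambda>x. clip a u x + s * ?g x) = clip a u"
  proof
   fix x show "clip a (\<lambda>x. clip a u x + s * ?g x) x = clip a u x"
   proof (cases "u x \<le> a")
    case True
    then show ?thesis using assms by (auto simp: clip_def min_def max_def)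
   next
    case False
    then have "clip a u x = a" "0 \<le> s * ?g x"
     using assms s by (auto simp: clip_def)
    moreover have "min (max (a + y) 0) a = a" if "0 \<le> y" for y :: real
     using that assms by auto
    ultimately show ?thesis by (subst clip_def) metis
   qed
  qed
  have "E (clip a u) \<le> E (\<lambda>x. clip a u x + s * ?g x)"
   using clip_D(2)[OF D_add[OF D(1) D_scale[OF g, of s]] assms(2)] unfolding ceq .
  also have "\<dots> = E (clip a u) + s * (2 * A (clip a u) ?g + s * E ?g)"
   using D g A_sym[OF D(1) g] by (simp only: A_add1 A_add2 A_scale1 A_scale2 D_add D_scale)
    (simp add: algebra_simps)
  finally have "0 \<le> s * (2 * A (clip a u) ?g + s * E ?g)" by simp
  then show ?thesis using s by (simp add: zero_le_mult_iff)
 qed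
 have "((\<lambda>s. 2 * A (clip a u) ?g + s * E ?g) \<longlongrightarrow> 2 * A (clip a u) ?g + 0 * E ?g) (at_right 0)"
  by (intro tendsto_intros)
 then have "0 \<le> 2 * A (clip a u) ?g + 0 * E ?g"
  by (rule tendsto_lowerbound[OF _ eventually_mono[OF eventually_at_right_less ineq]]) auto
 then have nn: "0 \<le> A (clip a u) ?g" by simp
 have "E (clip b u) = E (\<lambda>x. clip a u x + ?g x)" by simp
 also have "\<dots> = E (clip a u) + 2 * A (clip a u) ?g + E ?g"
  using D g A_sym[OF D(1) g] by (simp only: A_add1 A_add2 D_add)
 finally show ?thesis using nn by simp
qed

text \<open>Right continuity in the level, needed because strong locality only sees levels separated
  by a gap. The energies decrease along the sequence, hence converge, and
  \<open>clip_energy_increment\<close> bounds the energy of a difference by the difference of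
  energies. In L2 the error is at most \<open>1 / Suc n\<close> on the set \<open>F\<close> of
  finite measure.\<close>

lemma clip_tendsto_right:
 assumes u: "u \<in> D" and "0 \<le> a" and F: "emeasure M F < \<infinity>" "F \<in> sets M" "\<And>x. x \<notin> F \<Longrightarrow> u x \<le> 0"
 shows "(\<lambda>n. E (\<lambda>x. clip (a + 1 / Suc n) u x - clip a u x)) \<longlonglongrightarrow> 0"
proof -
 let ?b = "\<lambda>n. a + 1 / Suc n"
 let ?m = "\<lambda>n. E (clip (?b n) u)"
 have D: "clip c u \<in> D" if "0 \<le> c" for c using u that by (rule clip_D)
 have b0: "0 \<le> ?b n" for n using assms by simp
 have mono: "E (clip c u) \<le> E (clip d u)" if "0 \<le> c" "c \<le> d" for c d
  using clip_D(2)[OF D, of d c] that by (simp add: clip_clip)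
 have dec: "decseq ?m"
 proof (rule decseq_SucI)
  fix n
  have "1 / (2 + real n) \<le> 1 / (1 + real n)" by (simp add: field_simps)
  then show "?m (Suc n) \<le> ?m n" using b0[of "Suc n"] by (intro mono) (auto simp: add.commute)
 qed
 obtain l where l: "?m \<longlonglongrightarrow> l"
  using decseq_convergent[OF dec, of 0] E_nonneg[OF D[OF b0]] by blast
 have le: "E (\<lambda>x. clip (?b m) u x - clip (?b n) u x) \<le> \<bar>?m m - l\<bar> + \<bar>?m n - l\<bar>" for m n
 proof -
  have *: "E (\<lambda>x. clip (?b i) u x - clip (?b j) u x) \<le> ?m i - ?m j" if "j \<ge> i" for i j
   using that by (intro clip_energy_increment u b0) (auto simp: frac_le)
  have sw: "E (\<lambda>x. clip (?b m) u x - clip (?b n) u x) = E (\<lambda>x. clip (?b n) u x - clip (?b m) u x)"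
   using D[OF b0[of m]] D[OF b0[of n]] by (simp add: A_simps)
  show ?thesis
  proof (cases "m \<le> n")
   case True then show ?thesis using *[of m n] by linarith
  next
   case False then show ?thesis using *[of n m] sw by linarith
  qed
 qed
 have c0: "(\<lambda>n. \<bar>?m n - l\<bar>) \<longlonglongrightarrow> 0"
  using tendsto_rabs[OF LIM_zero[OF l]] by simp
 have "(\<lambda>n. (1 / real (Suc n))\<^sup>2 * measure M F) \<longlonglongrightarrow> 0\<^sup>2 * measure M F"
  by (intro tendsto_intros LIMSEQ_Suc[OF lim_1_over_n])
 then have lim0: "(\<lambda>n. (1 / real (Suc n))\<^sup>2 * measure M F) \<longlonglongrightarrow> 0" by simp
 have L2: "(\<lambda>n. LINT x|M. (clip (?b n) u x - clip a u x)\<^sup>2) \<longlonglongrightarrow> 0"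
 proof (rule Lim_null_comparison[OF always_eventually[OF allI] lim0])
  fix n
  have "(LINT x|M. (clip (?b n) u x - clip a u x)\<^sup>2) \<le> (LINT x|M. (1 / real (Suc n))\<^sup>2 * indicator F x)"
  proof (rule integral_mono)
   show "integrable M (\<lambda>x. (clip (?b n) u x - clip a u x)\<^sup>2)"
    using Lspace2_diff[OF D_L2[OF D[OF b0[of n]]] D_L2[OF D[OF assms(2)]]] by (simp add: Lspace2_iff)
   show "integrable M (\<lambda>x. (1 / real (Suc n))\<^sup>2 * indicator F x)"
    using F by (intro integrable_mult_right integrable_real_indicator) auto
   fix x
   have "\<bar>clip (?b n) u x - clip a u x\<bar> \<le> (1 / real (Suc n)) * indicator F x"
   proof (cases "x \<in> F")
    case True
    have "\<bar>clip (a + d) u x - clip a u x\<bar> \<le> d" if "d \<ge> 0" for d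
     using that by (simp add: clip_def abs_le_iff)
    then show ?thesis using True by simp
   next
    case False then show ?thesis using assms(2) F(3)[of x] by (simp add: clip_def)
   qed
   from power_mono[OF this abs_ge_zero, of 2]
   show "(clip (?b n) u x - clip a u x)\<^sup>2 \<le> (1 / real (Suc n))\<^sup>2 * indicator F x"
    by (cases "x \<in> F") (auto simp: power_divide)
  qed
  also have "\<dots> = (1 / real (Suc n))\<^sup>2 * measure M F" using F by simp
  finally show "norm (LINT x|M. (clip (?b n) u x - clip a u x)\<^sup>2) \<le> (1 / real (Suc n))\<^sup>2 * measure M F"
   by (simp add: integral_nonneg_AE)
 qed
 show ?thesis
  using D[OF b0] D_L2[OF D[OF assms(2)]] c0 le L2 by (rule closed_limit(2))
qed

end

section \<open>Continuous functions of compact support\<close>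

lemma CcI: "continuous_on UNIV f \<Longrightarrow> compact F \<Longrightarrow> (\<And>x. x \<notin> F \<Longrightarrow> f x = 0) \<Longrightarrow> f \<in> Cc"
 for f :: "'a::t2_space \<Rightarrow> real"
proof -
 assume f: "continuous_on UNIV f" "compact F" "\<And>x. x \<notin> F \<Longrightarrow> f x = 0"
 have "closure {x. f x \<noteq> 0} \<subseteq> F"
  using f by (intro closure_minimal compact_imp_closed) auto
 then have "compact (closure {x. f x \<noteq> 0})"
  using f(2) by (metis closed_closure closed_Int_compact inf.absorb1)
 then show "f \<in> Cc" using f by (simp add: Cc_def)
qed

lemma Cc_cont: "f \<in> Cc \<Longrightarrow> continuous_on UNIV f"
 by (simp add: Cc_def)

lemma Cc_supportE:
 fixes f :: "'a::t2_space \<Rightarrow> real"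
 assumes "f \<in> Cc"
 obtains F where "compact F" "\<And>x. x \<notin> F \<Longrightarrow> f x = 0"
proof
 show "compact (closure {x. f x \<noteq> 0})" using assms by (simp add: Cc_def)
 show "f x = 0" if "x \<notin> closure {x. f x \<noteq> 0}" for x
  using that closure_subset[of "{x. f x \<noteq> 0}"] by blast
qed

lemma Cc_compose:
 fixes f :: "'a::t2_space \<Rightarrow> real"
 assumes "f \<in> Cc" "continuous_on UNIV F" "F 0 = (0::real)"
 shows "(\<lambda>x. F (f x)) \<in> Cc"
proof -
 obtain K where "compact K" "\<And>x. x \<notin> K \<Longrightarrow> f x = 0" by (rule Cc_supportE[OF assms(1)]) blast
 moreover have "continuous_on UNIV (\<lambda>x. F (f x))"
  by (rule continuous_on_compose2[OF assms(2) Cc_cont[OF assms(1)]]) auto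
 ultimately show ?thesis using assms(3) by (intro CcI[of _ K]) auto
qed

lemma Cc_lin:
 fixes f g :: "'a::t2_space \<Rightarrow> real"
 assumes "f \<in> Cc" "g \<in> Cc"
 shows "(\<lambda>x. a * f x + b * g x) \<in> Cc"
proof -
 obtain K where "compact K" "\<And>x. x \<notin> K \<Longrightarrow> f x = 0" by (rule Cc_supportE[OF assms(1)]) blast
 moreover obtain L where "compact L" "\<And>x. x \<notin> L \<Longrightarrow> g x = 0" by (rule Cc_supportE[OF assms(2)]) blast
 moreover have "continuous_on UNIV (\<lambda>x. a * f x + b * g x)"
  by (intro continuous_intros Cc_cont assms)
 ultimately show ?thesis by (intro CcI[of _ "K \<union> L"]) auto
qed

lemma Cc_bounded:
 fixes f :: "'a::t2_space \<Rightarrow> real"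
 assumes "f \<in> Cc"
 obtains B where "B > 0" "\<And>x. \<bar>f x\<bar> \<le> B"
proof -
 obtain K where K: "compact K" "\<And>x. x \<notin> K \<Longrightarrow> f x = 0" by (rule Cc_supportE[OF assms(1)]) blast
 have "compact (f ` K)"
  by (rule compact_continuous_image[OF continuous_on_subset[OF Cc_cont[OF assms]] K(1)]) simp
 then have "bounded (f ` K)" by (rule compact_imp_bounded)
 then obtain B where B: "B > 0" "\<And>x. x \<in> K \<Longrightarrow> \<bar>f x\<bar> \<le> B"
  unfolding bounded_pos by auto
 have "\<bar>f x\<bar> \<le> B" for x
  using B K(2)[of x] by (cases "x \<in> K") auto
 then show thesis using B(1) that by blast
qed

context local_form
begin

abbreviation "Dc \<equiv> D \<inter> Cc"

lemma Dc_lin: "u \<in> Dc \<Longrightarrow> v \<in> Dc \<Longrightarrow> (\<lambda>x. a * u x + b * v x) \<in> Dc"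
 by (auto intro: D_lin Cc_lin)

lemma Dc_add: "u \<in> Dc \<Longrightarrow> v \<in> Dc \<Longrightarrow> (\<lambda>x. u x + v x) \<in> Dc"
 using Dc_lin[of u v 1 1] by simp

lemma Dc_scale: "u \<in> Dc \<Longrightarrow> (\<lambda>x. a * u x) \<in> Dc"
 using Dc_lin[of u u a 0] by simp

lemma clip_Dc: 
 assumes "u \<in> Dc" "0 \<le> c"
 shows "clip c u \<in> Dc"
proof -
 have "continuous_on UNIV (\<lambda>r::real. min (max r 0) c)" by (intro continuous_intros)
 then have "clip c u \<in> Cc"
  using Cc_compose[of u "\<lambda>r. min (max r 0) c"] assms by (simp add: clip_def)
 then show ?thesis using clip_D(1)[of u c] assms by simp
qed

text \<open>The gap between \<open>a\<close> and \<open>b\<close> leaves room for an open set: the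
  upper part is supported in \<open>{b \<le> u}\<close>, which lies in the open set
  \<open>{a < u}\<close> where \<open>clip a u\<close> is constant.\<close>

lemma clip_strongly_local:
 assumes u: "u \<in> Dc" and ab: "0 \<le> a" "a < b" "b \<le> c"
 shows "A (clip a u) (\<lambda>x. clip c u x - clip b u x) = 0"
proof -
 have D: "clip d u \<in> D" if "0 \<le> d" for d using clip_Dc[OF u that] by simp
 let ?g = "\<lambda>x. clip c u x - clip b u x"
 have g: "?g \<in> D" using ab by (intro D_diff D) auto
 obtain K where K: "compact K" "\<And>x. x \<notin> K \<Longrightarrow> u x = 0" by (rule Cc_supportE[of u]) (use u in blast)+
 have cpt: "compact (ess_supp M ?g)" "compact (ess_supp M (clip a u))"
  using K ab by (auto simp: clip_def intro!: ess_supp_compact[of K])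
 have cl: "closed {x. b \<le> u x}"
  using u by (intro closed_Collect_le continuous_on_const Cc_cont) auto
 have "ess_supp M ?g \<subseteq> {x. b \<le> u x}"
  using ab by (intro ess_supp_subset cl) (auto simp: clip_def)
 moreover have "open {x. a < u x}"
  using u by (intro open_Collect_less continuous_on_const Cc_cont) auto
 ultimately have "\<exists>U c. open U \<and> ess_supp M ?g \<subseteq> U \<and> (AE x\<in>U in M. clip a u x = c)"
  using ab by (intro exI[of _ "{x. a < u x}"] exI[of _ a]) (auto simp: clip_def)
 then have "A ?g (clip a u) = 0"
  using strong_locality g D[OF ab(1)] cpt unfolding strongly_local_def sub_cpt_def by blast
 then show ?thesis using A_sym[OF g D[OF ab(1)]] by simp
qed

text \<open>Strong locality kills the part of \<open>clip b u\<close> above any level strictly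
  greater than \<open>a\<close>; letting that level fall to \<open>a\<close> removes the gap by
  right continuity.\<close>

lemma clip_inner:
 assumes u: "u \<in> Dc" and ab: "0 \<le> a" "a \<le> b"
 shows "A (clip a u) (clip b u) = E (clip a u)"
proof (cases "a = b")
 case False
 then have lt: "a < b" using ab by simp
 have D: "clip d u \<in> D" if "0 \<le> d" for d using clip_Dc[OF u that] by simp
 let ?c = "\<lambda>n. clip (a + 1 / Suc n) u"
 have c0: "0 \<le> a + 1 / Suc n" for n using ab by simp
 obtain K where K: "compact K" "\<And>x. x \<notin> K \<Longrightarrow> u x = 0" by (rule Cc_supportE[of u]) (use u in blast)+
 have F: "emeasure M K < \<infinity>" "K \<in> sets M" "\<And>x. x \<notin> K \<Longrightarrow> u x \<le> 0"
  using K finite_compact by (auto simp: sets_M compact_imp_closed)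
 have lim: "(\<lambda>n. E (\<lambda>x. ?c n x - clip a u x)) \<longlonglongrightarrow> 0"
  using u by (intro clip_tendsto_right[OF _ ab(1) F]) auto
 have "(\<lambda>n. sqrt (E (clip a u)) * sqrt (E (\<lambda>x. ?c n x - clip a u x))) \<longlonglongrightarrow> sqrt (E (clip a u)) * sqrt 0"
  by (intro tendsto_intros lim)
 then have lim': "(\<lambda>n. sqrt (E (clip a u)) * sqrt (E (\<lambda>x. ?c n x - clip a u x))) \<longlonglongrightarrow> 0" by simp
 have "(\<lambda>n. A (clip a u) (\<lambda>x. ?c n x - clip a u x)) \<longlonglongrightarrow> 0"
  using ab by (intro Lim_null_comparison[OF always_eventually[OF allI] lim'])
   (auto intro!: A_Cauchy_Schwarz D D_diff)
 moreover have "eventually (\<lambda>n. A (clip a u) (\<lambda>x. ?c n x - clip a u x) = A (clip a u) (clip b u) - E (clip a u)) sequentially"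
 proof -
  have "eventually (\<lambda>n. 1 / real (Suc n) < b - a) sequentially"
   using lt by (intro order_tendstoD[OF LIMSEQ_Suc[OF lim_1_over_n]]) auto
  then show ?thesis
  proof eventually_elim
   case (elim n)
   have "A (clip a u) (\<lambda>x. clip b u x - ?c n x) = 0"
    using elim ab by (intro clip_strongly_local u) (auto simp: add_strict_left_mono)
   then show ?case using D[OF ab(1)] D[of b] D[OF c0[of n]] ab by (simp add: A_simps)
  qed
 qed
 ultimately have "(\<lambda>n. A (clip a u) (clip b u) - E (clip a u)) \<longlonglongrightarrow> 0"
  by (rule Lim_transform_eventually)
 then show ?thesis by (simp add: LIMSEQ_const_iff)
qed simp

section \<open>Orthogonal slices and functions of \<open>u\<close> built from them\<close>

definition slice :: "real \<Rightarrow> ('a \<Rightarrow> real) \<Rightarrow> nat \<Rightarrow> 'a \<Rightarrow> real" where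
 "slice h u i = (\<lambda>x. clip (real (Suc i) * h) u x - clip (real i * h) u x)"

lemma slice_D: "u \<in> Dc \<Longrightarrow> 0 \<le> h \<Longrightarrow> slice h u i \<in> D"
 unfolding slice_def using clip_Dc[of u] by (intro D_diff) auto

text \<open>By \<open>clip_inner\<close> the inner product of two truncations is the energy of the
  lower one. Among the four terms for \<open>i < j\<close> those with the same lower level
  cancel.\<close>

lemma slice_orthogonal:
 assumes u: "u \<in> Dc" and h: "0 \<le> h" and "i \<noteq> j"
 shows "A (slice h u i) (slice h u j) = 0"
proof -
 have *: "A (slice h u i) (slice h u j) = 0" if "i < j" for i j
 proof -
  have D: "clip (real k * h) u \<in> D" for k using clip_Dc[OF u, of "real k * h"] h by simp
  have in': "A (clip (real k * h) u) (clip (real l * h) u) = E (clip (real k * h) u)" if "k \<le> l" for k l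
   using that h by (intro clip_inner u mult_right_mono) auto
  show ?thesis unfolding slice_def
   using D in'[of "Suc i" "Suc j"] in'[of "Suc i" j] in'[of i "Suc j"] in'[of i j] that
   by (simp only: A_diff1 A_diff2 D_diff)
 qed
 show ?thesis
 proof (cases "i < j")
  case False
  then have "j < i" using assms by simp
  then show ?thesis using *[of j i] A_sym[OF slice_D[OF u h] slice_D[OF u h], of i j] by simp
 qed (rule *)
qed

lemma slice_sum_inner:
 assumes u: "u \<in> Dc" and h: "0 \<le> h"
 shows "A (\<lambda>x. \<Sum>i<N. a i * slice h u i x) (\<lambda>x. \<Sum>i<N. b i * slice h u i x)
   = (\<Sum>i<N. a i * b i * E (slice h u i))"
proof -
 have "A (\<lambda>x. \<Sum>i<N. a i * slice h u i x) (\<lambda>x. \<Sum>i<N. b i * slice h u i x)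
  = (\<Sum>i<N. a i * (\<Sum>j<N. b j * A (slice h u i) (slice h u j)))"
  using slice_D[OF u h] by (simp add: A_sum1 A_sum2 D_sum)
 also have "\<dots> = (\<Sum>i<N. a i * (\<Sum>j<N. if j = i then b j * E (slice h u i) else 0))"
  using slice_orthogonal[OF u h] by (intro sum.cong refl arg_cong2[where f = "(*)"]) auto
 also have "\<dots> = (\<Sum>i<N. a i * b i * E (slice h u i))"
  by (intro sum.cong refl) (simp add: sum.delta)
 finally show ?thesis .
qed

lemma slice_sum:
 assumes "\<And>x. 0 \<le> u x" "\<And>x. u x \<le> real N * h"
 shows "(\<Sum>i<N. slice h u i x) = u x"
proof -
 have "(\<Sum>i<N. slice h u i x) = clip (real N * h) u x - clip (real 0 * h) u x"
  unfolding slice_def by (rule sum_lessThan_telescope)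
 also have "\<dots> = u x" using assms[of x] by (simp add: clip_def)
 finally show ?thesis .
qed

lemma slice_refine: "slice (real q * h) u i x = (\<Sum>l = i * q..<i * q + q. slice h u l x)"
proof -
 have "(\<Sum>l = i * q..<i * q + q. slice h u l x) = clip (real (i * q + q) * h) u x - clip (real (i * q) * h) u x"
  unfolding slice_def by (rule sum_Suc_diff') simp
 then show ?thesis by (simp add: slice_def algebra_simps)
qed

text \<open>A Riemann sum in the level: on the \<open>i\<close>-th layer the function has slope
  \<open>s (i h)\<close>. If \<open>s\<close> is the derivative of \<open>F\<close> and
  \<open>F 0 = 0\<close>, a fine mesh makes it close to \<open>F u\<close>.\<close>

definition step :: "(real \<Rightarrow> real) \<Rightarrow> real \<Rightarrow> ('a \<Rightarrow> real) \<Rightarrow> nat \<Rightarrow> 'a \<Rightarrow> real" where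
 "step s h u N = (\<lambda>x. \<Sum>i<N. s (real i * h) * slice h u i x)"

lemma step_D: "u \<in> Dc \<Longrightarrow> 0 \<le> h \<Longrightarrow> step s h u N \<in> D"
 unfolding step_def by (intro D_sum slice_D) auto

text \<open>Puts two meshes on a common footing: a coarse slice is a sum of \<open>q\<close> fine
  ones, and \<open>l div q\<close> is the coarse layer that contains the fine layer
  \<open>l\<close>.\<close>

lemma step_refine:
 assumes q: "q > 0"
 shows "step s (real q * h) u N x = (\<Sum>l<N * q. s (real (l div q) * (real q * h)) * slice h u l x)"
proof -
 have "step s (real q * h) u N x = (\<Sum>i<N. \<Sum>l = i * q..<i * q + q. s (real i * (real q * h)) * slice h u l x)"
  unfolding step_def by (simp add: slice_refine sum_distrib_left)
 also have "\<dots> = (\<Sum>i<N. \<Sum>l = i * q..<i * q + q. s (real (l div q) * (real q * h)) * slice h u l x)"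
 proof (intro sum.cong refl)
  fix i l assume "l \<in> {i * q..<i * q + q}"
  then have "l div q = i" using q by (intro div_nat_eqI) (auto simp: algebra_simps)
  then show "s (real i * (real q * h)) * slice h u l x = s (real (l div q) * (real q * h)) * slice h u l x" by simp
 qed
 also have "\<dots> = (\<Sum>l<N * q. s (real (l div q) * (real q * h)) * slice h u l x)"
  by (rule sum.nat_group)
 finally show ?thesis .
qed

text \<open>On the fine mesh both functions are combinations of the same orthogonal slices. Their
  coefficients differ by at most \<open>L\<close> times the coarse mesh width, and by orthogonality
  this number comes out squared in front of the energy of \<open>u\<close>.\<close>

lemma step_energy_diff:
 assumes u: "u \<in> Dc" "\<And>x. 0 \<le> u x" "\<And>x. u x \<le> B" and B: "B > 0" and N: "N > 0" "q > 0"
  and lip: "\<And>a b. 0 \<le> a \<Longrightarrow> a \<le> b \<Longrightarrow> b \<le> B \<Longrightarrow> \<bar>s b - s a\<bar> \<le> L * (b - a)" and L: "0 \<le> L"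
 shows "E (\<lambda>x. step s (B / real (N * q)) u (N * q) x - step s (B / real N) u N x) \<le> (L * (B / real N))\<^sup>2 * E u"
proof -
 define h where "h = B / real (N * q)"
 have h: "0 < h" "B / real N = real q * h" "real (N * q) * h = B"
  using B N by (auto simp: h_def)
 define c where "c = (\<lambda>l. s (real l * h) - s (real (l div q) * (real q * h)))"
 have eq: "(\<lambda>x. step s h u (N * q) x - step s (B / real N) u N x) = (\<lambda>x. \<Sum>l<N * q. c l * slice h u l x)"
  unfolding h(2) step_refine[OF N(2)] by (simp add: step_def c_def left_diff_distrib sum_subtractf)
 have c: "(c l)\<^sup>2 \<le> (L * (B / real N))\<^sup>2" if "l < N * q" for l
 proof -
  have le: "l div q * q \<le> l" by simp
  have lt: "l < l div q * q + q" using N(2) by (metis div_mult_mod_eq mod_less_divisor add_strict_left_mono)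
  have a: "real (l div q) * (real q * h) = real (l div q * q) * h" by simp
  have "\<bar>c l\<bar> \<le> L * (real l * h - real (l div q * q) * h)"
   unfolding c_def a
  proof (rule lip)
   show "0 \<le> real (l div q * q) * h" using h by simp
   show "real (l div q * q) * h \<le> real l * h" using h le by (intro mult_right_mono) (auto simp only: of_nat_le_iff)
   have "real l * h \<le> real (N * q) * h" using h that by (intro mult_right_mono) (auto simp only: of_nat_le_iff)
   then show "real l * h \<le> B" by (simp only: h(3))
  qed
  also have "\<dots> \<le> L * (real q * h)"
  proof (intro mult_left_mono L)
   have "real l \<le> real (l div q * q) + real q" using lt by linarith
   then have "real l * h \<le> (real (l div q * q) + real q) * h" using h by (intro mult_right_mono) auto
   then show "real l * h - real (l div q * q) * h \<le> real q * h" by (simp add: algebra_simps)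
  qed
  finally have "\<bar>c l\<bar> \<le> L * (B / real N)" using h by simp
  from power_mono[OF this abs_ge_zero, of 2] show ?thesis by simp
 qed
 have nn: "0 \<le> E (slice h u l)" for l using slice_D[OF u(1)] h by (intro E_nonneg) auto
 have one: "(\<lambda>x. \<Sum>l<N * q. 1 * slice h u l x) = u"
  using slice_sum[of u "N * q" h] u h by auto
 have "E (\<lambda>x. step s h u (N * q) x - step s (B / real N) u N x) = (\<Sum>l<N * q. c l * c l * E (slice h u l))"
  unfolding eq using u h by (intro slice_sum_inner) auto
 also have "\<dots> \<le> (\<Sum>l<N * q. (L * (B / real N))\<^sup>2 * E (slice h u l))"
  using c nn by (intro sum_mono mult_right_mono) (auto simp: power2_eq_square)
 also have "\<dots> = (L * (B / real N))\<^sup>2 * (\<Sum>l<N * q. 1 * 1 * E (slice h u l))"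
  by (simp add: sum_distrib_left)
 also have "(\<Sum>l<N * q. 1 * 1 * E (slice h u l)) = E (\<lambda>x. \<Sum>l<N * q. 1 * slice h u l x)"
  using u h slice_sum_inner[of u h "\<lambda>_. 1" "N * q" "\<lambda>_. 1"] by simp
 also have "\<dots> = E u" unfolding one ..
 finally show ?thesis unfolding h_def .
qed

text \<open>Both functions telescope over the layers; on each layer the error is at most
  \<open>L h\<close> times the height of \<open>u x\<close> inside it, and these heights add up to
  \<open>u x\<close>. An error proportional to \<open>u x\<close>, not merely small, is square
  integrable even if the measure is infinite.\<close>

lemma step_uniform:
 assumes u: "0 \<le> u x" "u x \<le> B" and B: "B > 0" and N: "N > 0" and F0: "F 0 = 0" and L: "0 \<le> L"
  and F: "\<And>a b. 0 \<le> a \<Longrightarrow> a \<le> b \<Longrightarrow> b \<le> B \<Longrightarrow> \<bar>F b - F a - s a * (b - a)\<bar> \<le> L * (b - a)\<^sup>2"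
 shows "\<bar>step s (B / real N) u N x - F (u x)\<bar> \<le> L * (B / real N) * u x"
proof -
 define h where "h = B / real N"
 have h: "0 < h" "real N * h = B" using B N by (auto simp: h_def)
 let ?c = "\<lambda>i. clip (real i * h) u x"
 have ends: "?c N = u x" "?c 0 = 0" using u h by (auto simp: clip_def)
 have tel: "(\<Sum>i<N. ?c (Suc i) - ?c i) = u x"
  using sum_lessThan_telescope[of ?c N] ends by linarith
 have "(\<Sum>i<N. F (?c (Suc i)) - F (?c i)) = F (u x)"
  using sum_lessThan_telescope[of "\<lambda>i. F (?c i)" N] ends F0 by simp
 then have "\<bar>step s h u N x - F (u x)\<bar> = \<bar>\<Sum>i<N. s (real i * h) * (?c (Suc i) - ?c i) - (F (?c (Suc i)) - F (?c i))\<bar>"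
  by (simp only: sum_subtractf step_def slice_def)
 also have "\<dots> \<le> (\<Sum>i<N. L * h * (?c (Suc i) - ?c i))"
 proof (rule order_trans[OF sum_abs sum_mono])
  fix i assume i: "i \<in> {..<N}"
  have iB: "real (Suc i) * h \<le> B"
   using i h mult_right_mono[of "real (Suc i)" "real N" h] by auto
  have mono: "?c i \<le> ?c (Suc i)" using h u by (simp add: clip_def algebra_simps)
  have width: "?c (Suc i) - ?c i \<le> h" using h u by (simp add: clip_def algebra_simps)
  show "\<bar>s (real i * h) * (?c (Suc i) - ?c i) - (F (?c (Suc i)) - F (?c i))\<bar> \<le> L * h * (?c (Suc i) - ?c i)"
  proof (cases "u x \<le> real i * h")
   case True
   then have "?c i = u x" "?c (Suc i) = u x" using u h by (auto simp: clip_def algebra_simps)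
   then show ?thesis by simp
  next
   case False
   then have ci: "?c i = real i * h" using u h by (simp add: clip_def)
   have "\<bar>F (?c (Suc i)) - F (?c i) - s (?c i) * (?c (Suc i) - ?c i)\<bar> \<le> L * (?c (Suc i) - ?c i)\<^sup>2"
    using mono iB h u by (intro F) (auto simp: clip_def)
   also have "\<dots> \<le> L * (h * (?c (Suc i) - ?c i))"
    unfolding power2_eq_square using mono width L by (intro mult_left_mono mult_right_mono) auto
   finally show ?thesis unfolding ci by (subst abs_minus_commute) (simp only: mult.assoc)
  qed
 qed
 also have "\<dots> = L * h * u x" by (subst sum_distrib_left[symmetric]) (simp only: tel)
 finally show ?thesis unfolding h_def .
qed

text \<open>
 The form is only known to decrease under truncations, so \<open>F u\<close> is approximated by linear combinations of
 the slices of \<open>u\<close>; \<open>s\<close> stands for the derivative of \<open>F\<close>.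
\<close>

lemma step_limit:
 assumes u: "u \<in> Dc" "\<And>x. 0 \<le> u x" "\<And>x. u x \<le> B" and B: "B > 0"
  and lip: "\<And>a b. 0 \<le> a \<Longrightarrow> a \<le> b \<Longrightarrow> b \<le> B \<Longrightarrow> \<bar>s b - s a\<bar> \<le> L * (b - a)" and L: "0 \<le> L"
  and F: "\<And>a b. 0 \<le> a \<Longrightarrow> a \<le> b \<Longrightarrow> b \<le> B \<Longrightarrow> \<bar>F b - F a - s a * (b - a)\<bar> \<le> L * (b - a)\<^sup>2"
  and F0: "F 0 = 0" and Fc: "continuous_on UNIV F"
 shows "(\<lambda>x. F (u x)) \<in> Dc"
  "(\<lambda>j. E (\<lambda>x. step s (B / 2 ^ j) u (2 ^ j) x - F (u x))) \<longlonglongrightarrow> 0"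
proof -
 \<comment> \<open>Dyadic meshes are nested, as \<open>step_energy_diff\<close> requires of two
   meshes.\<close>
 let ?S = "\<lambda>j. step s (B / 2 ^ j) u (2 ^ j)"
 let ?d = "\<lambda>j. L * (B / 2 ^ j)"
 have "(\<lambda>j::nat. B / 2 ^ j) \<longlonglongrightarrow> 0"
  using tendsto_mult_right_zero[OF LIMSEQ_realpow_zero[of "1/2"], of B] by (simp add: power_divide)
 then have "(\<lambda>j. (?d j)\<^sup>2 * c) \<longlonglongrightarrow> (L * 0)\<^sup>2 * c" for c
  by (intro tendsto_intros)
 then have d0: "(\<lambda>j. (?d j)\<^sup>2 * c) \<longlonglongrightarrow> 0" for c by simp
 have S: "?S j \<in> D" for j using u B by (intro step_D) auto
 have le1: "E (\<lambda>x. ?S k x - ?S j x) \<le> (?d j)\<^sup>2 * E u" if "j \<le> k" for j k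
 proof -
  show ?thesis
   using step_energy_diff[OF u B _ _ lip L, of "2 ^ j" "2 ^ (k - j)"] that by (simp flip: power_add)
 qed
 have nn: "0 \<le> (?d j)\<^sup>2 * E u" for j using u by (intro mult_nonneg_nonneg E_nonneg) auto
 have le: "E (\<lambda>x. ?S k x - ?S j x) \<le> (?d k)\<^sup>2 * E u + (?d j)\<^sup>2 * E u" for j k
 proof (cases "j \<le> k")
  case True then show ?thesis using le1[OF True] nn[of k] by linarith
 next
  case False
  have "E (\<lambda>x. ?S k x - ?S j x) = E (\<lambda>x. ?S j x - ?S k x)" using S by (simp add: A_simps)
  then show ?thesis using le1[of k j] nn[of j] False by linarith
 qed
 have Cc: "(\<lambda>x. F (u x)) \<in> Cc" using Cc_compose[of u F] u F0 Fc by simp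
 have uni: "\<bar>?S j x - F (u x)\<bar> \<le> ?d j * u x" for j x
  using step_uniform[of u x B "2 ^ j" F L s] u B F0 L F by simp
 have FB: "\<bar>F (u x)\<bar> \<le> (\<bar>s 0\<bar> + L * B) * u x" for x
 proof -
  have "\<bar>F (u x) - s 0 * u x\<bar> \<le> L * (u x)\<^sup>2" using F[of 0 "u x"] u F0 by simp
  moreover have "L * (u x)\<^sup>2 \<le> L * B * u x"
   using u L by (simp add: power2_eq_square mult.assoc) (intro mult_left_mono mult_right_mono; simp)
  moreover have "\<bar>s 0 * u x\<bar> = \<bar>s 0\<bar> * u x" using u by (simp add: abs_mult)
  ultimately have "\<bar>F (u x)\<bar> \<le> \<bar>s 0\<bar> * u x + L * B * u x" by linarith
  then show ?thesis by (simp add: algebra_simps)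
 qed
 have u2: "integrable M (\<lambda>x. (u x)\<^sup>2)" using D_L2[of u] u by (simp add: Lspace2_iff)
 have FL2: "(\<lambda>x. F (u x)) \<in> Lspace 2 M"
 proof -
  have m: "(\<lambda>x. F (u x)) \<in> borel_measurable M"
   using Cc_cont[OF Cc] borel_measurable_continuous_onI[of "\<lambda>x. F (u x)"] measurable_cong_sets[OF sets_M refl] by blast
  moreover have "integrable M (\<lambda>x. (F (u x))\<^sup>2)"
  proof (rule Bochner_Integration.integrable_bound)
   show "integrable M (\<lambda>x. (\<bar>s 0\<bar> + L * B)\<^sup>2 * (u x)\<^sup>2)" using u2 by simp
   show "AE x in M. norm ((F (u x))\<^sup>2) \<le> norm ((\<bar>s 0\<bar> + L * B)\<^sup>2 * (u x)\<^sup>2)"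
    using power_mono[OF FB abs_ge_zero, of _ 2] by (simp add: power_mult_distrib)
  qed (use m in measurable)
  ultimately show ?thesis by (simp add: Lspace2_iff)
 qed
 have L2: "(\<lambda>j. LINT x|M. (?S j x - F (u x))\<^sup>2) \<longlonglongrightarrow> 0"
 proof (rule Lim_null_comparison[OF always_eventually[OF allI] d0])
  fix j
  have "(LINT x|M. (?S j x - F (u x))\<^sup>2) \<le> (LINT x|M. (?d j)\<^sup>2 * (u x)\<^sup>2)"
  proof (rule integral_mono)
   show "integrable M (\<lambda>x. (?S j x - F (u x))\<^sup>2)"
    using Lspace2_diff[OF D_L2[OF S] FL2] by (simp add: Lspace2_iff)
   show "(?S j x - F (u x))\<^sup>2 \<le> (?d j)\<^sup>2 * (u x)\<^sup>2" for x
    using power_mono[OF uni abs_ge_zero, of j x 2] by (simp add: power_mult_distrib power_divide)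
  qed (use u2 in simp)
  then show "norm (LINT x|M. (?S j x - F (u x))\<^sup>2) \<le> (?d j)\<^sup>2 * (LINT x|M. (u x)\<^sup>2)"
   by (simp add: integral_nonneg_AE)
 qed
 note lim = closed_limit[where u = ?S and v = "\<lambda>x. F (u x)" and c = "\<lambda>j. (?d j)\<^sup>2 * E u",
   OF S FL2 d0[of "E u"] le L2]
 show "(\<lambda>x. F (u x)) \<in> Dc" using lim(1) Cc by simp
 have "(\<lambda>j. E (\<lambda>x. ?S j x - F (u x))) \<longlonglongrightarrow> 0" by (rule lim(2))
 then show "(\<lambda>j. E (\<lambda>x. step s (B / 2 ^ j) u (2 ^ j) x - F (u x))) \<longlonglongrightarrow> 0" .
qed

end

text \<open>Only \<open>s \<ge> 0\<close> is available, since the energy identities below are proved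
  for nonnegative functions such as \<open>u + s h\<close>. Five nodes determine a quartic.\<close>

lemma quartic_coefficient_zero:
 fixes a b c d e :: real
 assumes "\<And>s. 0 \<le> s \<Longrightarrow> a + s * b + s\<^sup>2 * c + s ^ 3 * d + s ^ 4 * e = 0"
 shows "b = 0"
 using assms[of 0] assms[of 1] assms[of 2] assms[of 3] assms[of 4] by simp

lemma integrable_mult_bounded:
 fixes X f :: "'a \<Rightarrow> real"
 assumes "integrable M X" "f \<in> borel_measurable M" "AE x in M. \<bar>f x\<bar> \<le> c"
 shows "integrable M (\<lambda>x. f x * X x)"
proof (rule Bochner_Integration.integrable_bound)
 show "integrable M (\<lambda>x. c * X x)" using assms(1) by simp
 show "(\<lambda>x. f x * X x) \<in> borel_measurable M" using assms by simp
 show "AE x in M. norm (f x * X x) \<le> norm (c * X x)"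
  using assms(3) by eventually_elim (auto simp: abs_mult intro!: mult_right_mono)
qed

section \<open>Products in the form domain and polarised energy identities\<close>

context local_form
begin

text \<open>Truncating at a bound of \<open>\<bar>u\<bar>\<close> changes nothing, so positive and
  negative part are themselves truncations and stay in \<open>Dc\<close>.\<close>

lemma Dc_decomp:
 assumes u: "u \<in> Dc"
 obtains p m where "p \<in> Dc" "m \<in> Dc" "\<And>x. 0 \<le> p x" "\<And>x. 0 \<le> m x" "u = (\<lambda>x. p x - m x)"
proof -
 obtain B where B: "B > 0" "\<And>x. \<bar>u x\<bar> \<le> B" by (rule Cc_bounded[of u]) (use u in blast)+
 define v where "v = (\<lambda>x. (-1) * u x)"
 have v: "v \<in> Dc" unfolding v_def by (rule Dc_scale[OF u])
 have "u = (\<lambda>x. clip B u x - clip B v x)"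
 proof
  fix x show "u x = clip B u x - clip B v x"
   using B(2)[of x] B(1) by (auto simp: clip_def v_def min_def max_def abs_le_iff)
 qed
 moreover have "clip B u \<in> Dc" "clip B v \<in> Dc"
  using B by (intro clip_Dc u v; simp)+
 moreover have "0 \<le> clip B w x" for w :: "'a \<Rightarrow> real" and x using clip_bounds[of B w x] B by simp
 ultimately show thesis by (intro that) blast+
qed

text \<open>An integrated chain rule, obtained before any product rule is available: formally both
  sides of the last claim are 12 times the integral of \<open>u\<^sup>2 \<Gamma>(u, u)\<close>. On
  slices it reads \<open>3 * (2 r)\<^sup>2 = 4 * (3 r\<^sup>2)\<close> at each level
  \<open>r\<close>, and \<open>step_limit\<close> carries it to the limit.\<close>

lemma square_cube_energy:
 assumes u: "u \<in> Dc" "\<And>x. 0 \<le> u x"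
 shows "(\<lambda>x. u x * u x) \<in> Dc" "(\<lambda>x. u x * u x * u x) \<in> Dc"
  "3 * E (\<lambda>x. u x * u x) = 4 * A (\<lambda>x. u x * u x * u x) u"
proof -
 obtain B where B: "B > 0" "\<And>x. \<bar>u x\<bar> \<le> B" by (rule Cc_bounded[of u]) (use u in blast)+
 have uB: "u x \<le> B" for x using B(2)[of x] by simp
 \<comment> \<open>One constant for both powers: it bounds the Lipschitz constants of
   \<open>2 r\<close> and \<open>3 r\<^sup>2\<close> on \<open>[0, B]\<close> and the quadratic
   remainders.\<close>
 define L where "L = 2 + 6 * B"
 have L: "0 \<le> L" "2 \<le> L" "6 * B \<le> L" using B by (auto simp: L_def)
 let ?S2 = "\<lambda>j. step (\<lambda>r. 2 * r) (B / 2 ^ j) u (2 ^ j)"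
 let ?S3 = "\<lambda>j. step (\<lambda>r. 3 * (r * r)) (B / 2 ^ j) u (2 ^ j)"
 have lip2: "\<bar>2 * b - 2 * a\<bar> \<le> L * (b - a)" if "0 \<le> a" "a \<le> b" "b \<le> B" for a b :: real
  using that L mult_right_mono[of 2 L "b - a"] by simp
 have F2: "\<bar>b * b - a * a - 2 * a * (b - a)\<bar> \<le> L * (b - a)\<^sup>2" if "0 \<le> a" "a \<le> b" "b \<le> B" for a b :: real
 proof -
  have "b * b - a * a - 2 * a * (b - a) = (b - a)\<^sup>2" by (simp add: power2_eq_square algebra_simps)
  then show ?thesis using L mult_right_mono[of 1 L "(b - a)\<^sup>2"] by simp
 qed
 have lip3: "\<bar>3 * (b * b) - 3 * (a * a)\<bar> \<le> L * (b - a)" if "0 \<le> a" "a \<le> b" "b \<le> B" for a b :: real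
 proof -
  have "3 * (b * b) - 3 * (a * a) = (3 * (a + b)) * (b - a)" by (simp add: algebra_simps)
  moreover have "\<dots> \<le> L * (b - a)" using that L by (intro mult_right_mono) auto
  moreover have "0 \<le> (3 * (a + b)) * (b - a)" using that by simp
  ultimately show ?thesis by simp
 qed
 have F3: "\<bar>b * b * b - a * a * a - 3 * (a * a) * (b - a)\<bar> \<le> L * (b - a)\<^sup>2" if "0 \<le> a" "a \<le> b" "b \<le> B" for a b :: real
 proof -
  have "b * b * b - a * a * a - 3 * (a * a) * (b - a) = (2 * a + b) * (b - a)\<^sup>2"
   by (simp add: power2_eq_square algebra_simps)
  moreover have "\<dots> \<le> L * (b - a)\<^sup>2" using that L by (intro mult_right_mono) auto
  moreover have "0 \<le> (2 * a + b) * (b - a)\<^sup>2" using that by simp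
  ultimately show ?thesis by simp
 qed
 note s2 = step_limit[where s = "\<lambda>r. 2 * r" and F = "\<lambda>r. r * r", OF u uB B(1) lip2 L(1) F2]
 note s3 = step_limit[where s = "\<lambda>r. 3 * (r * r)" and F = "\<lambda>r. r * r * r", OF u uB B(1) lip3 L(1) F3]
 show D2: "(\<lambda>x. u x * u x) \<in> Dc" by (rule s2(1)) (auto intro!: continuous_intros)
 show D3: "(\<lambda>x. u x * u x * u x) \<in> Dc" by (rule s3(1)) (auto intro!: continuous_intros)
 have l2: "(\<lambda>j. E (\<lambda>x. ?S2 j x - u x * u x)) \<longlonglongrightarrow> 0" by (rule s2(2)) (auto intro!: continuous_intros)
 have l3: "(\<lambda>j. E (\<lambda>x. ?S3 j x - u x * u x * u x)) \<longlonglongrightarrow> 0" by (rule s3(2)) (auto intro!: continuous_intros)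
 have S: "step s (B / 2 ^ j) u (2 ^ j) \<in> D" for s and j :: nat using u B by (intro step_D) auto
 have uD: "u \<in> D" "(\<lambda>x. u x * u x) \<in> D" "(\<lambda>x. u x * u x * u x) \<in> D" using u D2 D3 by auto
 have z: "E (\<lambda>x. u x - u x) = 0" using A_zero1[OF D_zero] by simp
 have lim2: "(\<lambda>j. E (?S2 j)) \<longlonglongrightarrow> E (\<lambda>x. u x * u x)"
  by (rule A_tendsto[OF S S uD(2) uD(2) l2 l2])
 have lim3: "(\<lambda>j. A (?S3 j) u) \<longlonglongrightarrow> A (\<lambda>x. u x * u x * u x) u"
  by (rule A_tendsto[OF S uD(1) uD(3) uD(1) l3]) (simp only: z tendsto_const)
 have eq: "3 * E (?S2 j) = 4 * A (?S3 j) u" for j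
 proof -
  let ?h = "B / 2 ^ j"
  have h: "0 \<le> ?h" using B by simp
  have one: "(\<lambda>x. \<Sum>i<2 ^ j. 1 * slice ?h u i x) = u"
   using slice_sum[of u "2 ^ j" ?h] u uB by simp
  have "A (?S3 j) u = A (?S3 j) (\<lambda>x. \<Sum>i<2 ^ j. 1 * slice ?h u i x)" unfolding one ..
  also have "\<dots> = (\<Sum>i<2 ^ j. 3 * (real i * ?h * (real i * ?h)) * 1 * E (slice ?h u i))"
   unfolding step_def by (rule slice_sum_inner[OF u(1) h])
  finally have a: "A (?S3 j) u = (\<Sum>i<2 ^ j. 3 * (real i * ?h * (real i * ?h)) * 1 * E (slice ?h u i))" .
  have b: "E (?S2 j) = (\<Sum>i<2 ^ j. 2 * (real i * ?h) * (2 * (real i * ?h)) * E (slice ?h u i))"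
   unfolding step_def by (rule slice_sum_inner[OF u(1) h])
  show ?thesis unfolding a b sum_distrib_left by (intro sum.cong refl) simp
 qed
 show "3 * E (\<lambda>x. u x * u x) = 4 * A (\<lambda>x. u x * u x * u x) u"
  by (rule LIMSEQ_unique[OF tendsto_mult[OF tendsto_const lim2, of 3]])
    (simp only: eq tendsto_mult[OF tendsto_const lim3])
qed

lemma Dc_mult_nonneg:
 assumes u: "u \<in> Dc" "\<And>x. 0 \<le> u x" and v: "v \<in> Dc" "\<And>x. 0 \<le> v x"
 shows "(\<lambda>x. u x * v x) \<in> Dc"
proof -
 have s: "(\<lambda>x. (u x + v x) * (u x + v x)) \<in> Dc"
  using square_cube_energy(1)[OF Dc_add[OF u(1) v(1)]] u v by simp
 have "(\<lambda>x. (1/2) * ((u x + v x) * (u x + v x)) + (-1/2) * (1 * (u x * u x) + 1 * (v x * v x))) \<in> Dc"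
  by (intro Dc_lin s square_cube_energy(1) u v)
 moreover have "(\<lambda>x. (1/2) * ((u x + v x) * (u x + v x)) + (-1/2) * (1 * (u x * u x) + 1 * (v x * v x))) = (\<lambda>x. u x * v x)"
  by (simp add: fun_eq_iff field_simps)
 ultimately show ?thesis by simp
qed

lemma Dc_mult:
 assumes u: "u \<in> Dc" and v: "v \<in> Dc"
 shows "(\<lambda>x. u x * v x) \<in> Dc"
proof -
 obtain p m where pm: "p \<in> Dc" "m \<in> Dc" "\<And>x. 0 \<le> p x" "\<And>x. 0 \<le> m x" "u = (\<lambda>x. p x - m x)"
  by (rule Dc_decomp[OF u]) blast
 obtain q n where qn: "q \<in> Dc" "n \<in> Dc" "\<And>x. 0 \<le> q x" "\<And>x. 0 \<le> n x" "v = (\<lambda>x. q x - n x)"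
  by (rule Dc_decomp[OF v]) blast
 have "(\<lambda>x. 1 * (1 * (p x * q x) + (-1) * (p x * n x)) + (-1) * (1 * (m x * q x) + (-1) * (m x * n x))) \<in> Dc"
  by (intro Dc_lin Dc_mult_nonneg pm qn)
 moreover have "(\<lambda>x. 1 * (1 * (p x * q x) + (-1) * (p x * n x)) + (-1) * (1 * (m x * q x) + (-1) * (m x * n x))) = (\<lambda>x. u x * v x)"
  unfolding pm(5) qn(5) by (simp add: fun_eq_iff algebra_simps)
 ultimately show ?thesis by simp
qed

text \<open>The linear coefficient in \<open>s\<close> of the identity between square and cube of
  \<open>u + s h\<close>, divided by 4.\<close>

lemma energy_polarization:
 assumes u: "u \<in> Dc" "\<And>x. 0 \<le> u x" and h: "h \<in> Dc" "\<And>x. 0 \<le> h x"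
 shows "3 * A (\<lambda>x. u x * u x) (\<lambda>x. u x * h x)
  = A (\<lambda>x. u x * u x * u x) h + 3 * A (\<lambda>x. u x * u x * h x) u"
proof -
 define P Q R where "P = (\<lambda>x. u x * u x)" "Q = (\<lambda>x. u x * h x)" "R = (\<lambda>x. h x * h x)"
 define W X Y Z where "W = (\<lambda>x. u x * u x * u x)" "X = (\<lambda>x. u x * u x * h x)"
  "Y = (\<lambda>x. u x * h x * h x)" "Z = (\<lambda>x. h x * h x * h x)"
 have D: "P \<in> D" "Q \<in> D" "R \<in> D" "W \<in> D" "X \<in> D" "Y \<in> D" "Z \<in> D" "u \<in> D" "h \<in> D"
  using Dc_mult[OF u(1) u(1)] Dc_mult[OF u(1) h(1)] Dc_mult[OF h(1) h(1)] u h
   Dc_mult[OF Dc_mult[OF u(1) u(1)] u(1)] Dc_mult[OF Dc_mult[OF u(1) u(1)] h(1)]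
   Dc_mult[OF Dc_mult[OF u(1) h(1)] h(1)] Dc_mult[OF Dc_mult[OF h(1) h(1)] h(1)]
  by (auto simp: P_Q_R_def W_X_Y_Z_def)
 have main: "3 * (2 * A P Q + 2 * A Q P) - 4 * (A W h + 3 * A X u) = 0"
 proof (rule quartic_coefficient_zero)
  fix s :: real assume s: "0 \<le> s"
  have sq: "(\<lambda>x. (u x + s * h x) * (u x + s * h x)) = (\<lambda>x. P x + ((2 * s) * Q x + s\<^sup>2 * R x))"
   by (simp add: fun_eq_iff P_Q_R_def power2_eq_square algebra_simps)
  have cu: "(\<lambda>x. (u x + s * h x) * (u x + s * h x) * (u x + s * h x))
    = (\<lambda>x. W x + ((3 * s) * X x + ((3 * s\<^sup>2) * Y x + s ^ 3 * Z x)))"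
   by (simp add: fun_eq_iff W_X_Y_Z_def power2_eq_square power3_eq_cube algebra_simps)
  have "3 * E (\<lambda>x. (u x + s * h x) * (u x + s * h x))
    = 4 * A (\<lambda>x. (u x + s * h x) * (u x + s * h x) * (u x + s * h x)) (\<lambda>x. u x + s * h x)"
   using u h s by (intro square_cube_energy(3) Dc_add Dc_scale) auto
  then have "3 * E (\<lambda>x. P x + ((2 * s) * Q x + s\<^sup>2 * R x))
    - 4 * A (\<lambda>x. W x + ((3 * s) * X x + ((3 * s\<^sup>2) * Y x + s ^ 3 * Z x))) (\<lambda>x. u x + s * h x) = 0"
   unfolding sq cu by simp
  then show "3 * A P P - 4 * A W u + s * (3 * (2 * A P Q + 2 * A Q P) - 4 * (A W h + 3 * A X u))
   + s\<^sup>2 * (3 * (A P R + A R P + 4 * A Q Q) - 4 * (3 * A X h + 3 * A Y u))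
   + s ^ 3 * (3 * (2 * A Q R + 2 * A R Q) - 4 * (3 * A Y h + A Z u)) + s ^ 4 * (3 * A R R - 4 * A Z h) = 0"
   using D by (simp only: A_simps) (simp add: power2_eq_square power3_eq_cube power4_eq_xxxx algebra_simps)
 qed
 have "3 * A P Q = A W h + 3 * A X u" using main A_sym[OF D(1,2)] by simp
 then show ?thesis by (simp add: P_Q_R_def W_X_Y_Z_def)
qed

text \<open>A second polarisation, with \<open>u + s v\<close> for \<open>u\<close> in
  \<open>energy_polarization\<close>. The combination is the one that the defining identity of
  \<Gamma> produces when \<open>\<Gamma>(u\<^sup>2, v)\<close> and \<open>2 u \<Gamma>(u, v)\<close>
  are tested with \<open>h\<close>.\<close>

lemma energy_polarization2:
 assumes u: "u \<in> Dc" "\<And>x. 0 \<le> u x" and v: "v \<in> Dc" "\<And>x. 0 \<le> v x" and h: "h \<in> Dc" "\<And>x. 0 \<le> h x"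
 shows "A (\<lambda>x. u x * u x) (\<lambda>x. v x * h x) + 2 * A (\<lambda>x. u x * v x) (\<lambda>x. u x * h x)
  = A (\<lambda>x. u x * u x * v x) h + A (\<lambda>x. u x * u x * h x) v + 2 * A (\<lambda>x. u x * v x * h x) u"
proof -
 define P Q R where "P = (\<lambda>x. u x * u x)" "Q = (\<lambda>x. u x * v x)" "R = (\<lambda>x. v x * v x)"
 define W X Y Z where "W = (\<lambda>x. u x * u x * u x)" "X = (\<lambda>x. u x * u x * v x)"
  "Y = (\<lambda>x. u x * v x * v x)" "Z = (\<lambda>x. v x * v x * v x)"
 define F G H I J where "F = (\<lambda>x. u x * h x)" "G = (\<lambda>x. v x * h x)" "H = (\<lambda>x. u x * u x * h x)"
  "I = (\<lambda>x. u x * v x * h x)" "J = (\<lambda>x. v x * v x * h x)"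
 have D: "P \<in> D" "Q \<in> D" "R \<in> D" "W \<in> D" "X \<in> D" "Y \<in> D" "Z \<in> D" "u \<in> D" "v \<in> D" "h \<in> D"
  "F \<in> D" "G \<in> D" "H \<in> D" "I \<in> D" "J \<in> D"
  using Dc_mult[OF u(1) u(1)] Dc_mult[OF u(1) v(1)] Dc_mult[OF v(1) v(1)] u v h
   Dc_mult[OF Dc_mult[OF u(1) u(1)] u(1)] Dc_mult[OF Dc_mult[OF u(1) u(1)] v(1)]
   Dc_mult[OF Dc_mult[OF u(1) v(1)] v(1)] Dc_mult[OF Dc_mult[OF v(1) v(1)] v(1)]
   Dc_mult[OF u(1) h(1)] Dc_mult[OF v(1) h(1)] Dc_mult[OF Dc_mult[OF u(1) u(1)] h(1)]
   Dc_mult[OF Dc_mult[OF u(1) v(1)] h(1)] Dc_mult[OF Dc_mult[OF v(1) v(1)] h(1)]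
  by (auto simp: P_Q_R_def W_X_Y_Z_def F_G_H_I_J_def)
 have main: "3 * (A P G + 2 * A Q F) - (3 * A X h + 3 * (A H v + 2 * A I u)) = 0"
 proof (rule quartic_coefficient_zero[where e = 0])
  fix s :: real assume s: "0 \<le> s"
  have sq: "(\<lambda>x. (u x + s * v x) * (u x + s * v x)) = (\<lambda>x. P x + ((2 * s) * Q x + s\<^sup>2 * R x))"
   by (simp add: fun_eq_iff P_Q_R_def power2_eq_square algebra_simps)
  have cu: "(\<lambda>x. (u x + s * v x) * (u x + s * v x) * (u x + s * v x))
    = (\<lambda>x. W x + ((3 * s) * X x + ((3 * s\<^sup>2) * Y x + s ^ 3 * Z x)))"
   by (simp add: fun_eq_iff W_X_Y_Z_def power2_eq_square power3_eq_cube algebra_simps)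
  have sh: "(\<lambda>x. (u x + s * v x) * (u x + s * v x) * h x) = (\<lambda>x. H x + ((2 * s) * I x + s\<^sup>2 * J x))"
   by (simp add: fun_eq_iff F_G_H_I_J_def power2_eq_square algebra_simps)
  have lh: "(\<lambda>x. (u x + s * v x) * h x) = (\<lambda>x. F x + s * G x)"
   by (simp add: fun_eq_iff F_G_H_I_J_def algebra_simps)
  have "3 * A (\<lambda>x. (u x + s * v x) * (u x + s * v x)) (\<lambda>x. (u x + s * v x) * h x)
    = A (\<lambda>x. (u x + s * v x) * (u x + s * v x) * (u x + s * v x)) h
     + 3 * A (\<lambda>x. (u x + s * v x) * (u x + s * v x) * h x) (\<lambda>x. u x + s * v x)"
   using u v h s by (intro energy_polarization Dc_add Dc_scale) auto
  then have "3 * A (\<lambda>x. P x + ((2 * s) * Q x + s\<^sup>2 * R x)) (\<lambda>x. F x + s * G x)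
    - (A (\<lambda>x. W x + ((3 * s) * X x + ((3 * s\<^sup>2) * Y x + s ^ 3 * Z x))) h
     + 3 * A (\<lambda>x. H x + ((2 * s) * I x + s\<^sup>2 * J x)) (\<lambda>x. u x + s * v x)) = 0"
   unfolding sq cu sh lh by simp
  then show "3 * A P F - A W h - 3 * A H u + s * (3 * (A P G + 2 * A Q F) - (3 * A X h + 3 * (A H v + 2 * A I u)))
   + s\<^sup>2 * (3 * (2 * A Q G + A R F) - (3 * A Y h + 3 * (2 * A I v + A J u)))
   + s ^ 3 * (3 * A R G - (A Z h + 3 * A J v)) + s ^ 4 * 0 = 0"
   using D by (simp only: A_simps) (simp add: power2_eq_square power3_eq_cube algebra_simps)
 qed
 then have "A P G + 2 * A Q F = A X h + A H v + 2 * A I u" by simp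
 then show ?thesis by (simp add: P_Q_R_def W_X_Y_Z_def F_G_H_I_J_def)
qed

end

text \<open>Closed sets generate the Borel sets and are stable under intersection. The sets over
  which the integral vanishes are stable under complements, since the whole space is closed, and
  under countable disjoint unions. Hence the sets where \<open>X \<ge> 0\<close> and where
  \<open>X \<le> 0\<close> are among them.\<close>

lemma AE_zero_if_borel_integrals_zero:
 fixes X :: "'a::topological_space \<Rightarrow> real"
 assumes M: "sets M = sets borel" and X: "integrable M X"
  and closed: "\<And>C. closed C \<Longrightarrow> (LINT x:C|M. X x) = 0"
 shows "AE x in M. X x = 0"
proof -
 have sp: "space M = UNIV" using sets_eq_imp_space_eq[OF M] by simp
 have set_int: "set_integrable M B X" if "B \<in> sets M" for B
  using that X sp by (intro set_integrable_subset[where A = UNIV and B = B]) (auto simp: set_integrable_def)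
 have borel: "sets M = sigma_sets UNIV (Collect closed)"
  unfolding M borel_eq_closed by (simp add: sets_measure_of_conv)
 have all: "(LINT x:B|M. X x) = 0" if B: "B \<in> sets M" for B
 proof -
  have "Int_stable (Collect closed :: 'a set set)" "Collect closed \<subseteq> Pow (UNIV :: 'a set)"
   "B \<in> sigma_sets UNIV (Collect closed)" using B borel by (auto simp: Int_stable_def)
  then show ?thesis
  proof (induct rule: sigma_sets_induct_disjoint)
   case (basic A) then show ?case using closed by simp
  next
   case empty then show ?case by (simp add: set_lebesgue_integral_def)
  next
   case (compl A)
   then have A: "A \<in> sets M" using borel by simp
   then have A': "UNIV - A \<in> sets M" using sets.compl_sets[of A M] sp by simp
   have "(LINT x:A \<union> (UNIV - A)|M. X x) = (LINT x:A|M. X x) + (LINT x:UNIV - A|M. X x)"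
    by (rule set_integral_Un) (use A A' set_int in auto)
   then show ?case using compl(2) closed[of UNIV] by (simp add: Un_Diff_cancel)
  next
   case (union A)
   then have A: "A i \<in> sets M" for i using borel by auto
   then have "(\<Union>i. A i) \<in> sets M" by auto
   then have "(LINT x:(\<Union>i. A i)|M. X x) = (\<Sum>i. LINT x:A i|M. X x)"
    using union(1) A by (intro lebesgue_integral_countable_add set_int) (auto simp: disjoint_family_on_def)
   then show ?case using union(3) by simp
  qed
 qed
 have "AE x in M. indicator B x * X x = 0" if B: "B \<in> sets M" and s: "\<And>x. x \<in> B \<Longrightarrow> 0 \<le> c * X x" and c: "c \<noteq> 0" for B c
 proof -
  have i: "integrable M (\<lambda>x. c * (indicator B x * X x))"
   using set_int[OF B] by (simp add: set_integrable_def)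
  have "(LINT x|M. c * (indicator B x * X x)) = 0"
   using all[OF B] by (simp add: set_lebesgue_integral_def)
  then have "AE x in M. c * (indicator B x * X x) = 0"
   using i s by (subst (asm) integral_nonneg_eq_0_iff_AE) (auto simp: indicator_def)
  then show ?thesis using c by simp
 qed
 from this[of "{x\<in>space M. X x \<ge> 0}" 1] this[of "{x\<in>space M. X x \<le> 0}" "-1"]
 have "AE x in M. indicator {x\<in>space M. X x \<ge> 0} x * X x = 0" "AE x in M. indicator {x\<in>space M. X x \<le> 0} x * X x = 0"
  using X by auto
 then show ?thesis
 proof eventually_elim
  case (elim x) then show ?case using sp by (cases "X x \<ge> 0") (auto simp: indicator_def)
 qed
qed

context local_form
begin

lemma Cc_meas: "f \<in> Cc \<Longrightarrow> f \<in> borel_measurable M"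
 using Cc_cont[of f] borel_measurable_continuous_onI[of f] measurable_cong_sets[OF sets_M refl] by blast

lemma rho_meas: "\<rho> \<in> borel_measurable M"
 using rho_cont borel_measurable_continuous_onI[of \<rho>] measurable_cong_sets[OF sets_M refl] by blast

text \<open>Two approximations combine: regularity reaches nonnegative continuous functions of
  compact support uniformly, and these reach indicators of closed sets pointwise and
  boundedly.\<close>

lemma zero_if_orthogonal_to_Dc:
 assumes X: "integrable M X" and orth: "\<And>h. h \<in> Dc \<Longrightarrow> (\<And>x. 0 \<le> h x) \<Longrightarrow> (LINT x|M. h x * X x) = 0"
 shows "AE x in M. X x = 0"
proof (rule AE_zero_if_borel_integrals_zero[OF sets_M X])
 have Cc0: "(LINT x|M. f x * X x) = 0" if f: "f \<in> Cc" "\<And>x. 0 \<le> f x" for f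
 proof -
  obtain B where B: "\<And>x. \<bar>f x\<bar> \<le> B" by (rule Cc_bounded[OF f(1)]) blast
  have fX: "integrable M (\<lambda>x. f x * X x)"
   using B by (intro integrable_mult_bounded[OF X Cc_meas[OF f(1)], of B]) auto
  have le: "\<bar>LINT x|M. f x * X x\<bar> \<le> e * (LINT x|M. \<bar>X x\<bar>)" if e: "e > 0" for e
  proof -
   obtain v where v: "v \<in> Dc" "\<And>x. \<bar>f x - v x\<bar> < e"
    using regular f(1) e unfolding regular_form_def by blast
   obtain C where C: "C > 0" "\<And>x. \<bar>v x\<bar> \<le> C" by (rule Cc_bounded[of v]) (use v in blast)+
   \<comment> \<open>Since \<open>f \<ge> 0\<close>, passing to the positive part of
     \<open>v\<close> does not increase the error, and it makes \<open>v\<close> an admissible test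
     function.\<close>
   let ?h = "clip C v"
   have h: "?h \<in> Dc" using C by (intro clip_Dc v) simp
   have h0: "0 \<le> ?h x" for x using clip_bounds[of C v x] C by simp
   have "?h x \<le> C" for x using clip_bounds[of C v x] C by simp
   then have hX: "integrable M (\<lambda>x. ?h x * X x)"
    using h h0 by (intro integrable_mult_bounded[OF X D_meas, of _ C]) auto
   have fh: "\<bar>f x - ?h x\<bar> \<le> e" for x
    using v(2)[of x] C(2)[of x] f(2)[of x] by (auto simp: clip_def min_def max_def abs_le_iff abs_less_iff)
   have "\<bar>LINT x|M. f x * X x\<bar> = \<bar>LINT x|M. f x * X x - ?h x * X x\<bar>"
    using fX hX orth[OF h h0] by simp
   also have "\<dots> \<le> (LINT x|M. e * \<bar>X x\<bar>)"
   proof (rule order_trans[OF integral_abs_bound integral_mono])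
    show "integrable M (\<lambda>x. \<bar>f x * X x - ?h x * X x\<bar>)" using fX hX by simp
    show "integrable M (\<lambda>x. e * \<bar>X x\<bar>)" using X by simp
    show "\<bar>f x * X x - ?h x * X x\<bar> \<le> e * \<bar>X x\<bar>" for x
     using mult_right_mono[OF fh abs_ge_zero, of x "X x"] by (simp add: abs_mult left_diff_distrib flip: abs_mult)
   qed
   finally show ?thesis by simp
  qed
  have "((\<lambda>e. e * (LINT x|M. \<bar>X x\<bar>)) \<longlongrightarrow> 0 * (LINT x|M. \<bar>X x\<bar>)) (at_right 0)"
   by (intro tendsto_intros)
  then have "\<bar>LINT x|M. f x * X x\<bar> \<le> 0 * (LINT x|M. \<bar>X x\<bar>)"
   by (rule tendsto_lowerbound[OF _ eventually_mono[OF eventually_at_right_less le]]) auto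
  then show ?thesis by simp
 qed
 fix C :: "'a set" assume C: "closed C"
 show "(LINT x:C|M. X x) = 0"
 proof (cases "C = {}")
  case True then show ?thesis by (simp add: set_lebesgue_integral_def)
 next
  case False
  \<comment> \<open>The first factor is 1 on \<open>C\<close> and 0 at a given point off
    \<open>C\<close> once \<open>n\<close> is large; the second confines the support to a sublevel
    set of \<rho> and tends to 1.\<close>
  let ?f = "\<lambda>n x. max 0 (1 - real n * infdist x C) * max 0 (min 1 (real n - \<rho> x))"
  have f: "?f n \<in> Cc" for n
  proof (rule CcI[OF _ rho_compact[of "real n"]])
   show "continuous_on UNIV (?f n)"
    by (intro continuous_intros rho_cont)
   show "?f n x = 0" if "x \<notin> closure {x. \<rho> x < real n}" for x
   proof -
    have "x \<notin> {x. \<rho> x < real n}" using that closure_subset[of "{x. \<rho> x < real n}"] by blast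
    then have "real n \<le> \<rho> x" by simp
    then show ?thesis by (simp add: max_def min_def)
   qed
  qed
  have fb: "\<bar>?f n x\<bar> \<le> 1" for n x
  proof -
   have "0 \<le> real n * infdist x C" by (simp add: infdist_nonneg)
   then have "max 0 (1 - real n * infdist x C) \<le> 1" by simp
   then have "?f n x \<le> 1 * 1" by (intro mult_mono) auto
   moreover have "0 \<le> ?f n x" by (intro mult_nonneg_nonneg) auto
   ultimately show ?thesis by simp
  qed
  have lim: "(\<lambda>n. ?f n x) \<longlonglongrightarrow> indicator C x" for x
  proof -
   obtain n0 :: nat where n0: "real n0 \<ge> \<rho> x + 1" using real_arch_simple by blast
   show ?thesis
   proof (cases "x \<in> C")
    case True
    have "eventually (\<lambda>n. ?f n x = indicator C x) sequentially"
     using eventually_ge_at_top[of n0]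
    proof eventually_elim
     case (elim n)
     then have "real n \<ge> \<rho> x + 1" using n0 by linarith
     then show ?case using True C False by (simp add: in_closed_iff_infdist_zero)
    qed
    then show ?thesis by (rule tendsto_eventually)
   next
    case F: False
    then have pos: "infdist x C > 0"
     using C False by (metis in_closed_iff_infdist_zero infdist_nonneg le_less)
    obtain n1 :: nat where n1: "real n1 \<ge> 1 / infdist x C" using real_arch_simple by blast
    have "eventually (\<lambda>n. ?f n x = indicator C x) sequentially"
     using eventually_ge_at_top[of n1]
    proof eventually_elim
     case (elim n)
     then have "real n \<ge> 1 / infdist x C" using n1 by linarith
     then have "1 - real n * infdist x C \<le> 0" using pos by (simp add: field_simps)
     then show ?case using F by simp
    qed
    then show ?thesis by (rule tendsto_eventually)
   qed
  qed
  have "(\<lambda>n. LINT x|M. ?f n x * X x) \<longlonglongrightarrow> (LINT x|M. indicator C x * X x)"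
  proof (rule integral_dominated_convergence[where w = "\<lambda>x. \<bar>X x\<bar>"])
   show "(\<lambda>x. indicator C x * X x) \<in> borel_measurable M"
    using C X sets_M by (intro borel_measurable_times borel_measurable_indicator) auto
   show "(\<lambda>x. ?f n x * X x) \<in> borel_measurable M" for n
    by (rule borel_measurable_times[OF Cc_meas[OF f] borel_measurable_integrable[OF X]])
   show "AE x in M. (\<lambda>n. ?f n x * X x) \<longlonglongrightarrow> indicator C x * X x"
    by (intro AE_I2 tendsto_mult lim tendsto_const)
   show "AE x in M. norm (?f n x * X x) \<le> \<bar>X x\<bar>" for n
    using mult_right_mono[OF fb abs_ge_zero, of n _ "X _"] by (simp add: abs_mult)
  qed (use X in simp)
  moreover have "(LINT x|M. ?f n x * X x) = 0" for n by (rule Cc0[OF f]) simp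
  ultimately show ?thesis by (simp add: set_lebesgue_integral_def LIMSEQ_const_iff)
 qed
qed

section \<open>Pointwise bilinear calculus and Leibniz rule for \<Gamma>\<close>

lemma Gam_clauses:
 "\<And>u v. u \<in> D \<Longrightarrow> v \<in> D \<Longrightarrow> integrable M (\<Gamma> u v) \<and> (AE x in M. \<Gamma> u v x = \<Gamma> v u x) \<and> A u v = (LINT x|M. \<Gamma> u v x)"
 "\<And>u. u \<in> D \<Longrightarrow> AE x in M. 0 \<le> \<Gamma> u u x"
 "\<And>v. v \<in> D \<Longrightarrow> ae_linear_on M D (\<lambda>u. \<Gamma> u v)"
 "\<And>u v h. u \<in> sub_bdd M D \<Longrightarrow> v \<in> sub_bdd M D \<Longrightarrow> h \<in> sub_bdd M D \<Longrightarrow> 2 * (LINT x|M. h x * \<Gamma> u v x)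
      = A (\<lambda>x. u x * h x) v + A (\<lambda>x. v x * h x) u - A (\<lambda>x. u x * v x) h"
 using carre unfolding carre_du_champ_def by blast+

lemma Gam_int: "u \<in> D \<Longrightarrow> v \<in> D \<Longrightarrow> integrable M (\<Gamma> u v)"
 and Gam_sym: "u \<in> D \<Longrightarrow> v \<in> D \<Longrightarrow> AE x in M. \<Gamma> u v x = \<Gamma> v u x"
 and A_Gam: "u \<in> D \<Longrightarrow> v \<in> D \<Longrightarrow> A u v = (LINT x|M. \<Gamma> u v x)"
 using Gam_clauses(1)[of u v] by auto

lemmas Gam_nonneg = Gam_clauses(2)

lemma Gam_lin1: "u \<in> D \<Longrightarrow> v \<in> D \<Longrightarrow> w \<in> D \<Longrightarrow> AE x in M. \<Gamma> (\<lambda>y. a * u y + b * v y) w x = a * \<Gamma> u w x + b * \<Gamma> v w x"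
 using Gam_clauses(3)[of w] unfolding ae_linear_on_def by blast

lemma Gam_cong1: "u \<in> D \<Longrightarrow> v \<in> D \<Longrightarrow> w \<in> D \<Longrightarrow> (AE x in M. u x = v x) \<Longrightarrow> AE x in M. \<Gamma> u w x = \<Gamma> v w x"
 using Gam_clauses(3)[of w] unfolding ae_linear_on_def by blast

lemma Gam_lin2:
 assumes "u \<in> D" "v \<in> D" "w \<in> D"
 shows "AE x in M. \<Gamma> w (\<lambda>y. a * u y + b * v y) x = a * \<Gamma> w u x + b * \<Gamma> w v x"
 using Gam_lin1[OF assms, of a b] Gam_sym[OF assms(3) D_lin[OF assms(1,2), of a b]]
  Gam_sym[OF assms(1,3)] Gam_sym[OF assms(2,3)]
 by eventually_elim simp

lemma Gam_diff1:
 assumes "u \<in> D" "v \<in> D" "w \<in> D"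
 shows "AE x in M. \<Gamma> (\<lambda>y. u y - v y) w x = \<Gamma> u w x - \<Gamma> v w x"
 using Gam_lin1[OF assms, of 1 "-1"] by simp

lemma Gam_add1:
 assumes "u \<in> D" "v \<in> D" "w \<in> D"
 shows "AE x in M. \<Gamma> (\<lambda>y. u y + v y) w x = \<Gamma> u w x + \<Gamma> v w x"
 using Gam_lin1[OF assms, of 1 1] by simp

lemma Gam_scale1:
 assumes "u \<in> D" "w \<in> D"
 shows "AE x in M. \<Gamma> (\<lambda>y. a * u y) w x = a * \<Gamma> u w x"
 using Gam_lin1[OF assms(1,1,2), of a 0] by simp

lemma Gam_quadratic:
 assumes "u \<in> D" "v \<in> D"
 shows "AE x in M. \<Gamma> (\<lambda>y. a * u y + b * v y) (\<lambda>y. a * u y + b * v y) x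
   = a\<^sup>2 * \<Gamma> u u x + 2 * a * b * \<Gamma> u v x + b\<^sup>2 * \<Gamma> v v x"
 using Gam_lin1[OF assms D_lin[OF assms, of a b], of a b] Gam_lin2[OF assms assms(1), of a b]
  Gam_lin2[OF assms assms(2), of a b] Gam_sym[OF assms]
proof eventually_elim
 case (elim x)
 show ?case unfolding elim(1-3) elim(4)[symmetric] by (simp add: power2_eq_square algebra_simps)
qed

text \<open>Nonnegativity of \<open>\<Gamma>(u + q v, u + q v)\<close> holds off a null set
  depending on \<open>q\<close>. For rational \<open>q\<close> one null set serves, and at each
  remaining point continuity in \<open>q\<close> gives all real arguments.\<close>

lemma Gam_Cauchy_Schwarz:
 assumes "u \<in> D" "v \<in> D"
 shows "AE x in M. \<bar>\<Gamma> u v x\<bar> \<le> sqrt (\<Gamma> u u x) * sqrt (\<Gamma> v v x)"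
proof -
 have "AE x in M. \<forall>q::rat. 0 \<le> \<Gamma> u u x + 2 * of_rat q * \<Gamma> u v x + (of_rat q)\<^sup>2 * \<Gamma> v v x"
  unfolding AE_all_countable
 proof
  fix q :: rat
  show "AE x in M. 0 \<le> \<Gamma> u u x + 2 * of_rat q * \<Gamma> u v x + (of_rat q)\<^sup>2 * \<Gamma> v v x"
   using Gam_quadratic[OF assms, of 1 "of_rat q"] Gam_nonneg[OF D_lin[OF assms, of 1 "of_rat q"]]
   by eventually_elim simp
 qed
 then show ?thesis
 proof eventually_elim
  case (elim x)
  have "(\<Gamma> u v x)\<^sup>2 \<le> \<Gamma> u u x * \<Gamma> v v x"
  proof (rule quadratic_discriminant_le)
   fix s :: real
   let ?f = "\<lambda>s. \<Gamma> u u x + 2 * s * \<Gamma> u v x + s\<^sup>2 * \<Gamma> v v x"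
   show "0 \<le> ?f s"
   proof (rule ccontr)
    assume "\<not> 0 \<le> ?f s"
    then have "s \<in> {s. ?f s < 0}" by simp
    moreover have "open {s. ?f s < 0}" by (intro open_Collect_less continuous_intros)
    ultimately obtain e where e: "e > 0" "ball s e \<subseteq> {s. ?f s < 0}" using openE by blast
    obtain q where q: "s < of_rat q" "of_rat q < s + e" using of_rat_dense[of s "s + e"] e by auto
    then have "of_rat q \<in> ball s e" by (simp add: dist_real_def)
    then have "?f (of_rat q) < 0" using e(2) by blast
    then show False using elim[rule_format, of q] by linarith
   qed
  qed
  from real_sqrt_le_mono[OF this] show ?case by (simp add: real_sqrt_mult)
 qed
qed

lemma sqrt_Gam_L2:
 assumes "u \<in> D"
 shows "(\<lambda>x. sqrt (\<Gamma> u u x)) \<in> Lspace 2 M" "(LINT x|M. (sqrt (\<Gamma> u u x))\<^sup>2) = E u"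
proof -
 have ae: "AE x in M. (sqrt (\<Gamma> u u x))\<^sup>2 = \<Gamma> u u x" using Gam_nonneg[OF assms] by eventually_elim simp
 have m: "\<Gamma> u u \<in> borel_measurable M" using Gam_int[OF assms assms] by simp
 have "integrable M (\<lambda>x. (sqrt (\<Gamma> u u x))\<^sup>2)"
  using Gam_int[OF assms assms] integrable_cong_AE[OF _ _ ae] m by simp
 then show "(\<lambda>x. sqrt (\<Gamma> u u x)) \<in> Lspace 2 M" using m by (simp add: Lspace2_iff)
 show "(LINT x|M. (sqrt (\<Gamma> u u x))\<^sup>2) = E u"
  unfolding A_Gam[OF assms assms] using m by (intro integral_cong_AE ae) auto
qed

lemma Gam_L1_bound:
 assumes "u \<in> D" "v \<in> D"
 shows "(LINT x|M. \<bar>\<Gamma> u v x\<bar>) \<le> sqrt (E u) * sqrt (E v)"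
proof -
 have "(LINT x|M. \<bar>\<Gamma> u v x\<bar>) \<le> (LINT x|M. sqrt (\<Gamma> u u x) * sqrt (\<Gamma> v v x))"
  using Gam_Cauchy_Schwarz[OF assms] Gam_int[OF assms]
  by (intro integral_mono_AE Lspace2_mult_integrable sqrt_Gam_L2 assms) auto
 also have "\<dots> \<le> sqrt (E u) * sqrt (E v)"
  using Lspace2_Cauchy_Schwarz_abs[OF sqrt_Gam_L2(1)[OF assms(1)] sqrt_Gam_L2(1)[OF assms(2)]]
  unfolding sqrt_Gam_L2(2)[OF assms(1)] sqrt_Gam_L2(2)[OF assms(2)] by linarith
 finally show ?thesis .
qed

lemma Gam_L1_tendsto:
 assumes u: "\<And>n. u n \<in> D" "v \<in> D" "w \<in> D" and lim: "(\<lambda>n. E (\<lambda>x. u n x - v x)) \<longlonglongrightarrow> 0"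
 shows "(\<lambda>n. LINT x|M. \<bar>\<Gamma> (u n) w x - \<Gamma> v w x\<bar>) \<longlonglongrightarrow> 0"
proof -
 have "(\<lambda>n. sqrt (E (\<lambda>x. u n x - v x)) * sqrt (E w)) \<longlonglongrightarrow> sqrt 0 * sqrt (E w)"
  by (intro tendsto_intros lim)
 then have l: "(\<lambda>n. sqrt (E (\<lambda>x. u n x - v x)) * sqrt (E w)) \<longlonglongrightarrow> 0" by simp
 show ?thesis
 proof (rule Lim_null_comparison[OF always_eventually[OF allI] l])
  fix n
  have ae: "AE x in M. \<bar>\<Gamma> (u n) w x - \<Gamma> v w x\<bar> = \<bar>\<Gamma> (\<lambda>x. u n x - v x) w x\<bar>"
   using Gam_diff1[OF u(1) u(2,3), of n] by eventually_elim simp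
  have "(LINT x|M. \<bar>\<Gamma> (u n) w x - \<Gamma> v w x\<bar>) = (LINT x|M. \<bar>\<Gamma> (\<lambda>x. u n x - v x) w x\<bar>)"
   using u Gam_int[of "u n" w] Gam_int[of v w] Gam_int[OF D_diff[OF u(1) u(2)] u(3), of n]
   by (intro integral_cong_AE ae) auto
  also have "\<dots> \<le> sqrt (E (\<lambda>x. u n x - v x)) * sqrt (E w)"
   using u by (intro Gam_L1_bound D_diff)
  finally show "norm (LINT x|M. \<bar>\<Gamma> (u n) w x - \<Gamma> v w x\<bar>) \<le> sqrt (E (\<lambda>x. u n x - v x)) * sqrt (E w)"
   by simp
 qed
qed

lemma Dc_dense:
 assumes u: "u \<in> D"
 obtains v where "\<And>n. v n \<in> Dc" "(\<lambda>n. E (\<lambda>x. v n x - u x)) \<longlonglongrightarrow> 0"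
  "(\<lambda>n. LINT x|M. (v n x - u x)\<^sup>2) \<longlonglongrightarrow> 0"
proof -
 have "\<forall>n. \<exists>v. v \<in> Dc \<and> form_norm M A (\<lambda>x. u x - v x) < 1 / Suc n"
 proof
  fix n
  have "0 < 1 / real (Suc n)" by simp
  then show "\<exists>v. v \<in> Dc \<and> form_norm M A (\<lambda>x. u x - v x) < 1 / Suc n"
   using regular u unfolding regular_form_def by blast
 qed
 then obtain v where v: "\<And>n. v n \<in> Dc" "\<And>n. form_norm M A (\<lambda>x. u x - v n x) < 1 / Suc n" by metis
 have vD: "v n \<in> D" for n using v(1)[of n] by simp
 have nn: "0 \<le> E (\<lambda>x. v n x - u x)" "0 \<le> (LINT x|M. (v n x - u x)\<^sup>2)" for n
  using vD u by (auto intro!: E_nonneg D_diff integral_nonneg_AE)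
 have fn: "form_norm M A (\<lambda>x. u x - v n x) = sqrt (E (\<lambda>x. v n x - u x) + (LINT x|M. (v n x - u x)\<^sup>2))" for n
 proof -
  have "E (\<lambda>x. u x - v n x) = E (\<lambda>x. v n x - u x)" using vD[of n] u by (simp add: A_simps)
  moreover have "(\<lambda>x. (u x - v n x) * (u x - v n x)) = (\<lambda>x. (v n x - u x)\<^sup>2)"
   by (simp add: fun_eq_iff power2_eq_square algebra_simps)
  ultimately show ?thesis by (simp add: form_norm_def form1_def inner2_def)
 qed
 have le: "E (\<lambda>x. v n x - u x) + (LINT x|M. (v n x - u x)\<^sup>2) \<le> (1 / Suc n)\<^sup>2" for n
 proof -
  have "(sqrt (E (\<lambda>x. v n x - u x) + (LINT x|M. (v n x - u x)\<^sup>2)))\<^sup>2 \<le> (1 / Suc n)\<^sup>2"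
   using v(2)[of n] nn[of n] unfolding fn by (intro power_mono) auto
  then show ?thesis using nn[of n] by simp
 qed
 have "(\<lambda>n. (1 / real (Suc n))\<^sup>2) \<longlonglongrightarrow> 0\<^sup>2"
  by (intro tendsto_intros LIMSEQ_Suc[OF lim_1_over_n])
 then have z: "(\<lambda>n. (1 / real (Suc n))\<^sup>2) \<longlonglongrightarrow> 0" by simp
 show thesis
 proof (rule that[OF v(1)])
  have "norm (E (\<lambda>x. v n x - u x)) \<le> (1 / real (Suc n))\<^sup>2" for n
   using le[of n] nn[of n] by (simp only: real_norm_def)
  then show "(\<lambda>n. E (\<lambda>x. v n x - u x)) \<longlonglongrightarrow> 0"
   by (intro Lim_null_comparison[OF always_eventually[OF allI] z])
  have "norm (LINT x|M. (v n x - u x)\<^sup>2) \<le> (1 / real (Suc n))\<^sup>2" for n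
   using le[of n] nn[of n] by (simp only: real_norm_def)
  then show "(\<lambda>n. LINT x|M. (v n x - u x)\<^sup>2) \<longlonglongrightarrow> 0"
   by (intro Lim_null_comparison[OF always_eventually[OF allI] z])
 qed
qed

lemma Dc_bdd:
 assumes "u \<in> Dc"
 shows "u \<in> sub_bdd M D"
proof -
 obtain B where B: "\<And>x. \<bar>u x\<bar> \<le> B" by (rule Cc_bounded[of u]) (use assms in blast)+
 then have "ae_bounded M u" unfolding ae_bounded_def by (intro exI[of _ B] AE_I2)
 then show ?thesis using assms by (simp add: sub_bdd_def)
qed

text \<open>Tested with nonnegative \<open>h\<close> in \<open>Dc\<close>, both sides become values
  of the form by the defining identity of \<Gamma>, the right one with test function
  \<open>h u\<close>. Their equality is \<open>energy_polarization2\<close>.\<close>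

lemma Gam_square_nonneg:
 assumes u: "u \<in> Dc" "\<And>x. 0 \<le> u x" and v: "v \<in> Dc" "\<And>x. 0 \<le> v x"
 shows "AE x in M. \<Gamma> (\<lambda>x. u x * u x) v x = 2 * u x * \<Gamma> u v x"
proof -
 have uu: "(\<lambda>x. u x * u x) \<in> Dc" by (rule Dc_mult[OF u(1) u(1)])
 obtain B where B: "\<And>x. \<bar>u x\<bar> \<le> B" by (rule Cc_bounded[of u]) (use u in blast)+
 have i1: "integrable M (\<Gamma> (\<lambda>x. u x * u x) v)" using uu v by (intro Gam_int) auto
 have i2: "integrable M (\<lambda>x. u x * \<Gamma> u v x)"
  using u v B by (intro integrable_mult_bounded[of _ _ _ B] Gam_int D_meas) auto
 have "AE x in M. \<Gamma> (\<lambda>x. u x * u x) v x - 2 * (u x * \<Gamma> u v x) = 0"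
 proof (rule zero_if_orthogonal_to_Dc)
  show "integrable M (\<lambda>x. \<Gamma> (\<lambda>x. u x * u x) v x - 2 * (u x * \<Gamma> u v x))" using i1 i2 by simp
  fix h assume h: "h \<in> Dc" "\<And>x. 0 \<le> h x"
  obtain C where C: "\<And>x. \<bar>h x\<bar> \<le> C" by (rule Cc_bounded[of h]) (use h in blast)+
  have j1: "integrable M (\<lambda>x. h x * \<Gamma> (\<lambda>x. u x * u x) v x)" "integrable M (\<lambda>x. h x * (u x * \<Gamma> u v x))"
   using h C i1 i2 by (auto intro!: integrable_mult_bounded[of _ _ _ C] D_meas)
  have hu: "(\<lambda>x. h x * u x) \<in> Dc" by (rule Dc_mult[OF h(1) u(1)])
  have e1: "2 * (LINT x|M. h x * \<Gamma> (\<lambda>x. u x * u x) v x)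
   = A (\<lambda>x. u x * u x * h x) v + A (\<lambda>x. v x * h x) (\<lambda>x. u x * u x) - A (\<lambda>x. u x * u x * v x) h"
   by (rule Gam_clauses(4)) (intro Dc_bdd uu v h)+
  have e2: "2 * (LINT x|M. (h x * u x) * \<Gamma> u v x)
   = A (\<lambda>x. u x * (h x * u x)) v + A (\<lambda>x. v x * (h x * u x)) u - A (\<lambda>x. u x * v x) (\<lambda>x. h x * u x)"
   by (rule Gam_clauses(4)) (intro Dc_bdd u v hu)+
  have f: "(\<lambda>x. u x * (h x * u x)) = (\<lambda>x. u x * u x * h x)" "(\<lambda>x. v x * (h x * u x)) = (\<lambda>x. u x * v x * h x)"
   "(\<lambda>x. h x * u x) = (\<lambda>x. u x * h x)"
   by (auto simp: fun_eq_iff)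
  have s: "A (\<lambda>x. v x * h x) (\<lambda>x. u x * u x) = A (\<lambda>x. u x * u x) (\<lambda>x. v x * h x)"
   using Dc_mult[OF v(1) h(1)] uu by (intro A_sym) auto
  have cancel: "b + 2 * e = c + a + 2 * d \<Longrightarrow> a + b - c - 2 * (a + d - e) = 0" for a b c d e :: real by simp
  have z: "2 * (LINT x|M. h x * \<Gamma> (\<lambda>x. u x * u x) v x) - 2 * (2 * (LINT x|M. (h x * u x) * \<Gamma> u v x)) = 0"
   unfolding e1 e2 unfolding f s by (rule cancel[OF energy_polarization2[OF u v h]])
  have "(LINT x|M. h x * (\<Gamma> (\<lambda>x. u x * u x) v x - 2 * (u x * \<Gamma> u v x)))
    = (LINT x|M. h x * \<Gamma> (\<lambda>x. u x * u x) v x - 2 * (h x * (u x * \<Gamma> u v x)))"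
   by (intro Bochner_Integration.integral_cong) (auto simp: algebra_simps)
  also have "\<dots> = (LINT x|M. h x * \<Gamma> (\<lambda>x. u x * u x) v x) - 2 * (LINT x|M. h x * (u x * \<Gamma> u v x))"
   using j1 by simp
  also have "\<dots> = 0" using z by (simp add: mult.assoc)
  finally show "(LINT x|M. h x * (\<Gamma> (\<lambda>x. u x * u x) v x - 2 * (u x * \<Gamma> u v x))) = 0" .
 qed
 then show ?thesis by eventually_elim simp
qed

text \<open>Polarisation of \<open>Gam_square_nonneg\<close> through the square of
  \<open>u + w\<close>.\<close>

lemma Gam_mult_nonneg:
 assumes u: "u \<in> Dc" "\<And>x. 0 \<le> u x" and w: "w \<in> Dc" "\<And>x. 0 \<le> w x" and v: "v \<in> Dc" "\<And>x. 0 \<le> v x"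
 shows "AE x in M. \<Gamma> (\<lambda>x. u x * w x) v x = u x * \<Gamma> w v x + w x * \<Gamma> u v x"
proof -
 have D: "u \<in> D" "w \<in> D" "v \<in> D" "(\<lambda>x. u x * u x) \<in> D" "(\<lambda>x. w x * w x) \<in> D" "(\<lambda>x. u x * w x) \<in> D"
  using u w v Dc_mult[OF u(1) u(1)] Dc_mult[OF w(1) w(1)] Dc_mult[OF u(1) w(1)] by auto
 have eq: "(\<lambda>x. (u x + w x) * (u x + w x)) = (\<lambda>x. (u x * u x + w x * w x) + 2 * (u x * w x))"
  by (auto simp: fun_eq_iff algebra_simps)
 have "AE x in M. \<Gamma> (\<lambda>x. (u x + w x) * (u x + w x)) v x = 2 * (u x + w x) * \<Gamma> (\<lambda>x. u x + w x) v x"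
  using u w v by (intro Gam_square_nonneg Dc_add) auto
 then show ?thesis
  using Gam_square_nonneg[OF u v] Gam_square_nonneg[OF w v] Gam_add1[OF D(1,2,3)]
   Gam_add1[OF D_add[OF D(4,5)] D_scale[OF D(6), of 2] D(3)] Gam_add1[OF D(4,5,3)] Gam_scale1[OF D(6,3), of 2]
  unfolding eq
 proof eventually_elim
  case (elim x)
  then show ?case by (simp add: algebra_simps)
 qed
qed

text \<open>With bounded coefficients both sides depend continuously on \<open>w\<close>, from the
  energy seminorm into L1, so the identity passes from the dense class \<open>Dc\<close> to
  \<open>D\<close>.\<close>

lemma Gam_extend:
 assumes D: "f \<in> D" "g \<in> D" "k \<in> D" "w \<in> D"
  and m: "a \<in> borel_measurable M" "b \<in> borel_measurable M" "AE x in M. \<bar>a x\<bar> \<le> c" "AE x in M. \<bar>b x\<bar> \<le> c"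
  and eq: "\<And>w. w \<in> Dc \<Longrightarrow> AE x in M. \<Gamma> f w x = a x * \<Gamma> g w x + b x * \<Gamma> k w x"
 shows "AE x in M. \<Gamma> f w x = a x * \<Gamma> g w x + b x * \<Gamma> k w x"
proof -
 obtain v where v: "\<And>n. v n \<in> Dc" "(\<lambda>n. E (\<lambda>x. v n x - w x)) \<longlonglongrightarrow> 0" by (rule Dc_dense[OF D(4)]) blast
 have vD: "v n \<in> D" for n using v(1)[of n] by simp
 have L1: "(\<lambda>n. LINT x|M. \<bar>\<Gamma> q (v n) x - \<Gamma> q w x\<bar>) \<longlonglongrightarrow> 0" if q: "q \<in> D" for q
 proof -
  have "(LINT x|M. \<bar>\<Gamma> q (v n) x - \<Gamma> q w x\<bar>) = (LINT x|M. \<bar>\<Gamma> (v n) q x - \<Gamma> w q x\<bar>)" for n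
  proof (rule integral_cong_AE)
   show "AE x in M. \<bar>\<Gamma> q (v n) x - \<Gamma> q w x\<bar> = \<bar>\<Gamma> (v n) q x - \<Gamma> w q x\<bar>"
    using Gam_sym[OF q vD[of n]] Gam_sym[OF q D(4)] by eventually_elim simp
  qed (use Gam_int q vD D(4) in auto)
  then show ?thesis using Gam_L1_tendsto[OF vD D(4) q v(2)] by simp
 qed
 have i: "integrable M (\<lambda>x. a x * \<Gamma> g q x + b x * \<Gamma> k q x)" if "q \<in> D" for q
  using D that m by (intro Bochner_Integration.integrable_add integrable_mult_bounded[of _ _ _ c] Gam_int)
 show ?thesis
 proof (rule L1_limit_unique[of M "\<lambda>n. \<Gamma> f (v n)"])
  show "(\<lambda>n. LINT x|M. \<bar>\<Gamma> f (v n) x - \<Gamma> f w x\<bar>) \<longlonglongrightarrow> 0" by (rule L1[OF D(1)])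
  let ?r = "\<lambda>n. \<bar>c\<bar> * (LINT x|M. \<bar>\<Gamma> g (v n) x - \<Gamma> g w x\<bar>) + \<bar>c\<bar> * (LINT x|M. \<bar>\<Gamma> k (v n) x - \<Gamma> k w x\<bar>)"
  have "?r \<longlonglongrightarrow> \<bar>c\<bar> * 0 + \<bar>c\<bar> * 0" by (intro tendsto_intros L1 D)
  then have l: "?r \<longlonglongrightarrow> 0" by simp
  show "(\<lambda>n. LINT x|M. \<bar>\<Gamma> f (v n) x - (a x * \<Gamma> g w x + b x * \<Gamma> k w x)\<bar>) \<longlonglongrightarrow> 0"
  proof (rule Lim_null_comparison[OF always_eventually[OF allI] l])
   fix n
   have "(LINT x|M. \<bar>\<Gamma> f (v n) x - (a x * \<Gamma> g w x + b x * \<Gamma> k w x)\<bar>)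
    \<le> (LINT x|M. \<bar>c\<bar> * \<bar>\<Gamma> g (v n) x - \<Gamma> g w x\<bar> + \<bar>c\<bar> * \<bar>\<Gamma> k (v n) x - \<Gamma> k w x\<bar>)"
   proof (rule integral_mono_AE)
    show "AE x in M. \<bar>\<Gamma> f (v n) x - (a x * \<Gamma> g w x + b x * \<Gamma> k w x)\<bar>
     \<le> \<bar>c\<bar> * \<bar>\<Gamma> g (v n) x - \<Gamma> g w x\<bar> + \<bar>c\<bar> * \<bar>\<Gamma> k (v n) x - \<Gamma> k w x\<bar>"
     using eq[OF v(1)[of n]] m(3,4)
    proof eventually_elim
     case (elim x)
     have "\<Gamma> f (v n) x - (a x * \<Gamma> g w x + b x * \<Gamma> k w x)
       = a x * (\<Gamma> g (v n) x - \<Gamma> g w x) + b x * (\<Gamma> k (v n) x - \<Gamma> k w x)"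
      using elim by (simp add: algebra_simps)
     moreover have "\<bar>a x * (\<Gamma> g (v n) x - \<Gamma> g w x)\<bar> \<le> \<bar>c\<bar> * \<bar>\<Gamma> g (v n) x - \<Gamma> g w x\<bar>"
      "\<bar>b x * (\<Gamma> k (v n) x - \<Gamma> k w x)\<bar> \<le> \<bar>c\<bar> * \<bar>\<Gamma> k (v n) x - \<Gamma> k w x\<bar>"
      using elim(2,3) by (auto simp: abs_mult intro!: mult_right_mono)
     ultimately show ?case by linarith
    qed
   qed (use i[OF D(4)] Gam_int D vD in auto)
   also have "\<dots> = ?r n" using Gam_int D vD by simp
   finally show "norm (LINT x|M. \<bar>\<Gamma> f (v n) x - (a x * \<Gamma> g w x + b x * \<Gamma> k w x)\<bar>) \<le> ?r n" by simp
  qed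
 qed (use i[OF D(4)] Gam_int D vD in auto)
qed

text \<open>The signs of \<open>v\<close>, \<open>u\<close> and \<open>w\<close> are freed one at a
  time by splitting into positive and negative parts; \<open>Gam_extend\<close> then admits every
  \<open>v\<close> in \<open>D\<close>.\<close>

lemma Gam_mult_Dc:
 assumes u: "u \<in> Dc" and w: "w \<in> Dc" and v: "v \<in> D"
 shows "AE x in M. \<Gamma> (\<lambda>x. u x * w x) v x = u x * \<Gamma> w v x + w x * \<Gamma> u v x"
proof -
 have step1: "AE x in M. \<Gamma> (\<lambda>x. u x * w x) v x = u x * \<Gamma> w v x + w x * \<Gamma> u v x"
  if u: "u \<in> Dc" "\<And>x. 0 \<le> u x" and w: "w \<in> Dc" "\<And>x. 0 \<le> w x" and v: "v \<in> Dc" for u w v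
 proof -
  obtain p m where pm: "p \<in> Dc" "m \<in> Dc" "\<And>x. 0 \<le> p x" "\<And>x. 0 \<le> m x" "v = (\<lambda>x. p x - m x)"
   by (rule Dc_decomp[OF v]) blast
  have D: "p \<in> D" "m \<in> D" "u \<in> D" "w \<in> D" "(\<lambda>x. u x * w x) \<in> D" using pm u w Dc_mult[OF u(1) w(1)] by auto
  have v': "v = (\<lambda>x. 1 * p x + (-1) * m x)" using pm(5) by simp
  show ?thesis
   using Gam_mult_nonneg[OF u w pm(1,3)] Gam_mult_nonneg[OF u w pm(2,4)]
    Gam_lin2[OF D(1,2,3), of 1 "-1"] Gam_lin2[OF D(1,2,4), of 1 "-1"] Gam_lin2[OF D(1,2,5), of 1 "-1"]
   unfolding v'
  proof eventually_elim
   case (elim x)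
   show ?case unfolding elim(3,4,5) elim(1,2) by (simp add: algebra_simps)
  qed
 qed
 have lhs: "AE x in M. \<Gamma> (\<lambda>x. p x * w x - m x * w x) v x = (p x - m x) * \<Gamma> w v x + w x * \<Gamma> (\<lambda>x. p x - m x) v x"
  if "AE x in M. \<Gamma> (\<lambda>x. p x * w x) v x = p x * \<Gamma> w v x + w x * \<Gamma> p v x"
   "AE x in M. \<Gamma> (\<lambda>x. m x * w x) v x = m x * \<Gamma> w v x + w x * \<Gamma> m v x"
   "p \<in> Dc" "m \<in> Dc" "w \<in> Dc" "v \<in> Dc" for p m w v
 proof -
  have D: "p \<in> D" "m \<in> D" "v \<in> D" "(\<lambda>x. p x * w x) \<in> D" "(\<lambda>x. m x * w x) \<in> D"
   using that(3-6) Dc_mult[OF that(3,5)] Dc_mult[OF that(4,5)] by auto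
  show ?thesis
   using that(1,2) Gam_diff1[OF D(4,5,3)] Gam_diff1[OF D(1,2,3)]
  proof eventually_elim
   case (elim x)
   show ?case unfolding elim(3,4) elim(1,2) by (simp add: algebra_simps)
  qed
 qed
 have step2: "AE x in M. \<Gamma> (\<lambda>x. u x * w x) v x = u x * \<Gamma> w v x + w x * \<Gamma> u v x"
  if u: "u \<in> Dc" and w: "w \<in> Dc" "\<And>x. 0 \<le> w x" and v: "v \<in> Dc" for u w v
 proof -
  obtain p m where pm: "p \<in> Dc" "m \<in> Dc" "\<And>x. 0 \<le> p x" "\<And>x. 0 \<le> m x" "u = (\<lambda>x. p x - m x)"
   by (rule Dc_decomp[OF u]) blast
  have "(\<lambda>x. u x * w x) = (\<lambda>x. p x * w x - m x * w x)" by (simp add: pm(5) algebra_simps)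
  then show ?thesis
   using lhs[OF step1[OF pm(1,3) w v] step1[OF pm(2,4) w v] pm(1,2) w(1) v] pm(5) by simp
 qed
 have step3: "AE x in M. \<Gamma> (\<lambda>x. u x * w x) v x = u x * \<Gamma> w v x + w x * \<Gamma> u v x"
  if u: "u \<in> Dc" and w: "w \<in> Dc" and v: "v \<in> Dc" for u w v
 proof -
  obtain p m where pm: "p \<in> Dc" "m \<in> Dc" "\<And>x. 0 \<le> p x" "\<And>x. 0 \<le> m x" "w = (\<lambda>x. p x - m x)"
   by (rule Dc_decomp[OF w]) blast
  have sw: "AE x in M. \<Gamma> (\<lambda>x. q x * u x) v x = q x * \<Gamma> u v x + u x * \<Gamma> q v x"
   if "q \<in> Dc" "\<And>x. 0 \<le> q x" for q
  proof -
   have c: "(\<lambda>x. q x * u x) = (\<lambda>x. u x * q x)" by (simp add: mult.commute)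
   show ?thesis unfolding c using step2[OF u that v] by eventually_elim simp
  qed
  have "(\<lambda>x. u x * w x) = (\<lambda>x. p x * u x - m x * u x)" by (simp add: pm(5) algebra_simps)
  then show ?thesis
   using lhs[OF sw[OF pm(1,3)] sw[OF pm(2,4)] pm(1,2) u v] pm(5) by (simp add: add.commute)
 qed
 obtain B where B: "\<And>x. \<bar>u x\<bar> \<le> B" by (rule Cc_bounded[of u]) (use u in blast)+
 obtain C where C: "\<And>x. \<bar>w x\<bar> \<le> C" by (rule Cc_bounded[of w]) (use w in blast)+
 have D: "(\<lambda>x. u x * w x) \<in> D" "w \<in> D" "u \<in> D" using u w Dc_mult[OF u w] by auto
 have uB: "AE x in M. \<bar>u x\<bar> \<le> max B C"
 proof (rule AE_I2)
  fix x show "\<bar>u x\<bar> \<le> max B C" using B[of x] by linarith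
 qed
 have wC: "AE x in M. \<bar>w x\<bar> \<le> max B C"
 proof (rule AE_I2)
  fix x show "\<bar>w x\<bar> \<le> max B C" using C[of x] by linarith
 qed
 have um: "u \<in> borel_measurable M" by (rule D_meas[OF D(3)])
 have wm: "w \<in> borel_measurable M" by (rule D_meas[OF D(2)])
 have eq: "\<And>v'. v' \<in> Dc \<Longrightarrow> AE x in M. \<Gamma> (\<lambda>x. u x * w x) v' x = u x * \<Gamma> w v' x + w x * \<Gamma> u v' x"
  by (rule step3[OF u w])
 show ?thesis by (rule Gam_extend[OF D v um wm uB wC eq])
qed

end

text \<open>The C1 building block of the truncations below: \<open>cutoff\<close>,
  \<open>soft_ramp\<close> and the linearly extended square in \<open>D_bdd_mult\<close> are made of
  shifts and reflections of it.\<close>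

lemma DERIV_pos_part_squared:
 "((\<lambda>y. (max y 0)\<^sup>2) has_real_derivative 2 * max y 0) (at y)" for y :: real
proof -
 consider "y > 0" | "y < 0" | "y = 0" by linarith
 then show ?thesis
 proof cases
  case 1
  have "((\<lambda>y. y\<^sup>2) has_real_derivative 2 * max y 0) (at y)"
   using 1 by (auto intro!: derivative_eq_intros)
  then show ?thesis
   by (rule DERIV_cong_ev[THEN iffD1, rotated -1, OF _ refl _ refl])
     (use 1 in \<open>auto intro!: eventually_mono[OF order_tendstoD(1)[OF tendsto_ident_at 1]] simp: eventually_nhds_metric dist_real_def intro!: exI[of _ y]\<close>)
 next
  case 2
  have "((\<lambda>y. 0) has_real_derivative 2 * max y 0) (at y)"
   using 2 by (auto intro!: derivative_eq_intros)
  then show ?thesis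
   by (rule DERIV_cong_ev[THEN iffD1, rotated -1, OF _ refl _ refl])
     (use 2 in \<open>auto simp: eventually_nhds_metric dist_real_def intro!: exI[of _ "-y"]\<close>)
 next
  case 3
  have "((\<lambda>h. (max h 0)\<^sup>2 / h) \<longlongrightarrow> 0) (at (0::real))"
  proof (rule Lim_null_comparison)
   show "eventually (\<lambda>h. norm ((max h 0)\<^sup>2 / h) \<le> \<bar>h\<bar>) (at (0::real))"
    by (auto simp: max_def power2_eq_square intro!: always_eventually)
   show "((\<lambda>h. \<bar>h\<bar>) \<longlongrightarrow> 0) (at (0::real))" by (rule tendsto_eq_intros refl | simp)+
  qed
  then show ?thesis using 3 by (simp add: DERIV_def)
 qed
qed

lemma DERIV_bounded_lipschitz:
 fixes F :: "real \<Rightarrow> real"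
 assumes "\<And>r. (F has_real_derivative F' r) (at r)" "\<And>r. \<bar>F' r\<bar> \<le> L"
 shows "\<bar>F s - F t\<bar> \<le> L * \<bar>s - t\<bar>"
proof -
 have "norm (F s - F t) \<le> L * norm (s - t)"
  by (rule field_differentiable_bound[where S = UNIV and f' = F']) (use assms in simp_all)
 then show ?thesis by simp
qed

section \<open>Chain rule and locality for the carre du champ\<close>

context local_form
begin

lemma D_compose_meas:
 assumes "continuous_on UNIV (F :: real \<Rightarrow> real)" "u \<in> D"
 shows "(\<lambda>x. F (u x)) \<in> borel_measurable M"
 using measurable_compose[OF D_meas[OF assms(2)] borel_measurable_continuous_onI[OF assms(1)]] .

lemma Gam_sq_int_bounded:
 assumes "u \<in> D" "w \<in> D" "a \<in> borel_measurable M" "\<And>x. \<bar>a x\<bar> \<le> c"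
 shows "integrable M (\<lambda>x. a x * \<Gamma> u w x)"
 by (rule integrable_mult_bounded[OF Gam_int[OF assms(1,2)] assms(3), of c]) (use assms(4) in simp)

text \<open>\<open>repr f a u\<close> is the chain rule \<open>\<Gamma>(f, \<cdot>) = a \<Gamma>(u, \<cdot>)\<close>.\<close>

definition repr :: "('a \<Rightarrow> real) \<Rightarrow> ('a \<Rightarrow> real) \<Rightarrow> ('a \<Rightarrow> real) \<Rightarrow> bool" where
 "repr f a u \<longleftrightarrow> f \<in> D \<and> u \<in> D \<and> (\<forall>w\<in>D. AE x in M. \<Gamma> f w x = a x * \<Gamma> u w x)"

lemma repr_power:
 assumes u: "u \<in> Dc"
 shows "(\<lambda>x. u x ^ Suc k) \<in> Dc \<and> repr (\<lambda>x. u x ^ Suc k) (\<lambda>x. real (Suc k) * u x ^ k) u"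
proof (induction k)
 case 0
 then show ?case using u by (simp add: repr_def)
next
 case (Suc k)
 have m: "(\<lambda>x. u x * u x ^ Suc k) \<in> Dc" using Dc_mult[OF u] Suc by blast
 have "AE x in M. \<Gamma> (\<lambda>x. u x * u x ^ Suc k) w x = real (Suc (Suc k)) * u x ^ Suc k * \<Gamma> u w x" if w: "w \<in> D" for w
 proof -
  have "AE x in M. \<Gamma> (\<lambda>x. u x ^ Suc k) w x = (real (Suc k) * u x ^ k) * \<Gamma> u w x"
   using Suc w unfolding repr_def by blast
  moreover have "AE x in M. \<Gamma> (\<lambda>x. u x * u x ^ Suc k) w x = u x * \<Gamma> (\<lambda>x. u x ^ Suc k) w x + u x ^ Suc k * \<Gamma> u w x"
   using Suc u w by (intro Gam_mult_Dc) auto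
  ultimately show ?thesis by eventually_elim (simp add: algebra_simps)
 qed
 then show ?case using m u unfolding repr_def by simp
qed

text \<open>Normalised so that the factor, not the function, has the given coefficients: Weierstrass
  approximation will be applied to the derivative.\<close>

lemma repr_polynomial:
 assumes u: "u \<in> Dc"
 shows "repr (\<lambda>x. \<Sum>i\<le>n. a i / real (Suc i) * u x ^ Suc i) (\<lambda>x. \<Sum>i\<le>n. a i * u x ^ i) u"
proof -
 have pD: "(\<lambda>x. u x ^ Suc i) \<in> D" for i using repr_power[OF u, of i] by (simp add: repr_def)
 have uD: "u \<in> D" using u by simp
 show ?thesis
 proof (induction n)
  case 0
  have "AE x in M. \<Gamma> (\<lambda>x. a 0 * u x) w x = a 0 * \<Gamma> u w x" if "w \<in> D" for w
   by (rule Gam_scale1[OF uD that])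
  then show ?case using uD D_scale[OF uD, of "a 0"] by (simp add: repr_def)
 next
  case (Suc n)
  let ?p = "\<lambda>x. \<Sum>i\<le>n. a i / real (Suc i) * u x ^ Suc i" and ?q = "\<lambda>x. a (Suc n) / real (Suc (Suc n)) * u x ^ Suc (Suc n)"
  have D: "?p \<in> D" "?q \<in> D" using Suc unfolding repr_def by (blast, intro D_scale pD)
  have "AE x in M. \<Gamma> (\<lambda>x. ?p x + ?q x) w x = ((\<Sum>i\<le>n. a i * u x ^ i) + a (Suc n) * u x ^ Suc n) * \<Gamma> u w x" if w: "w \<in> D" for w
  proof -
   have "AE x in M. \<Gamma> ?p w x = (\<Sum>i\<le>n. a i * u x ^ i) * \<Gamma> u w x"
    using Suc w unfolding repr_def by blast
   moreover have "AE x in M. \<Gamma> ?q w x = a (Suc n) / real (Suc (Suc n)) * \<Gamma> (\<lambda>x. u x ^ Suc (Suc n)) w x"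
    by (rule Gam_scale1[OF pD w])
   moreover have "AE x in M. \<Gamma> (\<lambda>x. u x ^ Suc (Suc n)) w x = (real (Suc (Suc n)) * u x ^ Suc n) * \<Gamma> u w x"
    using repr_power[OF u, of "Suc n"] w unfolding repr_def by blast
   ultimately show ?thesis using Gam_add1[OF D w]
   proof eventually_elim
    case (elim x)
    have "a (Suc n) / real (Suc (Suc n)) * ((real (Suc (Suc n)) * u x ^ Suc n) * \<Gamma> u w x) = a (Suc n) * u x ^ Suc n * \<Gamma> u w x"
     by simp
    then show ?case unfolding elim by (simp only: distrib_right)
   qed
  qed
  then show ?case using uD D_add[OF D] unfolding repr_def by simp
 qed
qed

lemma tendsto_inverse_sq: "(\<lambda>n. (1 / real (Suc n))\<^sup>2 * c) \<longlonglongrightarrow> 0"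
proof -
 have "(\<lambda>n. (1 / real (Suc n))\<^sup>2 * c) \<longlonglongrightarrow> 0\<^sup>2 * c"
  by (intro tendsto_intros LIMSEQ_Suc[OF lim_1_over_n])
 then show ?thesis by simp
qed

text \<open>Closedness of the chain rule, with inner functions \<open>v n\<close> and factors
  \<open>a n\<close> varying together. In the energy of \<open>f m - f n\<close> each
  \<open>\<Gamma>(v i, v j)\<close> is exchanged for \<open>\<Gamma>(u, u)\<close> at a cost that
  vanishes with the energy of \<open>v n - u\<close>. What is left is the integral of
  \<open>(a m - a n)\<^sup>2 \<Gamma>(u, u)\<close>, small by dominated convergence. It serves for
  polynomial approximation, for approximation of \<open>u\<close>, and for
  \<open>arctan\<close>.\<close>

lemma repr_limit:
 assumes rep: "\<And>n. repr (f n) (a n) (v n)" and u: "u \<in> D" and vE: "(\<lambda>n. E (\<lambda>x. v n x - u x)) \<longlonglongrightarrow> 0"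
  and am: "\<And>n. a n \<in> borel_measurable M" and bm: "b \<in> borel_measurable M"
  and L: "\<And>n x. \<bar>a n x\<bar> \<le> L" and L': "\<And>x. \<bar>b x\<bar> \<le> L"
  and aae: "AE x in M. (\<lambda>n. a n x) \<longlonglongrightarrow> b x"
  and FL2: "g \<in> Lspace 2 M" and L2: "(\<lambda>n. LINT x|M. (f n x - g x)\<^sup>2) \<longlonglongrightarrow> 0"
 shows "repr g b u"
proof -
 have L0: "0 \<le> L" using L[of 0] by (rule order_trans[OF abs_ge_zero])
 have vD: "v n \<in> D" and fD: "f n \<in> D" for n using rep[of n] unfolding repr_def by blast+
 let ?s = "\<lambda>n. sqrt (E (\<lambda>x. v n x - u x))"
 have s0: "?s \<longlonglongrightarrow> 0" using tendsto_real_sqrt[OF vE] by simp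
 have "(\<lambda>n. sqrt (E (v n))) \<longlonglongrightarrow> sqrt (E u)"
  by (intro tendsto_real_sqrt A_tendsto vD u vE)
 then have "Bseq (\<lambda>n. sqrt (E (v n)))" using convergentI convergent_imp_Bseq by blast
 then obtain K0 where K0: "\<And>n. norm (sqrt (E (v n))) \<le> K0" unfolding Bseq_def by blast
 define K where "K = max K0 (sqrt (E u))"
 have K: "sqrt (E (v n)) \<le> K" "sqrt (E u) \<le> K" for n using K0[of n] by (auto simp: K_def)
 have Gd: "(LINT x|M. \<bar>\<Gamma> (v m) (v n) x - \<Gamma> u u x\<bar>) \<le> K * (?s m + ?s n)" for m n
 proof -
  have D: "(\<lambda>x. v m x - u x) \<in> D" "(\<lambda>x. v n x - u x) \<in> D" using vD u by (auto intro: D_diff)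
  have "(LINT x|M. \<bar>\<Gamma> (v m) (v n) x - \<Gamma> u u x\<bar>) \<le> (LINT x|M. \<bar>\<Gamma> (\<lambda>x. v m x - u x) (v n) x\<bar> + \<bar>\<Gamma> (\<lambda>x. v n x - u x) u x\<bar>)"
  proof (rule integral_mono_AE)
   show "AE x in M. \<bar>\<Gamma> (v m) (v n) x - \<Gamma> u u x\<bar> \<le> \<bar>\<Gamma> (\<lambda>x. v m x - u x) (v n) x\<bar> + \<bar>\<Gamma> (\<lambda>x. v n x - u x) u x\<bar>"
    using Gam_diff1[OF vD u vD, of m n] Gam_diff1[OF vD u u, of n] Gam_sym[OF u vD, of n]
    by eventually_elim linarith
  qed (use Gam_int[OF vD vD, of m n] Gam_int[OF u u] Gam_int[OF D(1) vD, of n] Gam_int[OF D(2) u] in auto)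
  also have "\<dots> = (LINT x|M. \<bar>\<Gamma> (\<lambda>x. v m x - u x) (v n) x\<bar>) + (LINT x|M. \<bar>\<Gamma> (\<lambda>x. v n x - u x) u x\<bar>)"
   using Gam_int[OF D(1) vD, of n] Gam_int[OF D(2) u] by simp
  also have "\<dots> \<le> ?s m * sqrt (E (v n)) + ?s n * sqrt (E u)"
   by (intro add_mono Gam_L1_bound D vD u)
  also have "\<dots> \<le> ?s m * K + ?s n * K"
   using D by (intro add_mono mult_left_mono K real_sqrt_ge_zero E_nonneg)
  finally show ?thesis by (simp add: algebra_simps)
 qed
 let ?t = "\<lambda>n. LINT x|M. (a n x - b x)\<^sup>2 * \<Gamma> u u x"
 have ab: "\<bar>a n x - b x\<bar> \<le> 2 * L" for n x using L[of n x] L'[of x] by linarith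
 have tdom: "(\<lambda>n. LINT x|M. B n x * G x) \<longlonglongrightarrow> 0"
  if B: "\<And>n. B n \<in> borel_measurable M" "\<And>n x. \<bar>B n x\<bar> \<le> C" "AE x in M. (\<lambda>n. B n x) \<longlonglongrightarrow> 0" and G: "integrable M G"
  for B and C :: real and G
 proof -
  have "(\<lambda>n. LINT x|M. B n x * G x) \<longlonglongrightarrow> (LINT x|M. 0)"
  proof (rule integral_dominated_convergence[where w = "\<lambda>x. C * \<bar>G x\<bar>"])
   show "AE x in M. (\<lambda>n. B n x * G x) \<longlonglongrightarrow> 0"
    using B(3) by eventually_elim (rule tendsto_mult_left_zero)
   show "AE x in M. norm (B n x * G x) \<le> C * \<bar>G x\<bar>" for n
    using B(2) by (intro AE_I2) (auto simp: abs_mult intro: mult_right_mono)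
   show "(\<lambda>x. B n x * G x) \<in> borel_measurable M" for n
    by (intro borel_measurable_times B(1) borel_measurable_integrable G)
   show "integrable M (\<lambda>x. C * \<bar>G x\<bar>)" by (intro integrable_mult_right integrable_abs G)
  qed (rule borel_measurable_const)
  then show ?thesis by simp
 qed
 have dae: "AE x in M. (\<lambda>n. a n x - b x) \<longlonglongrightarrow> 0"
  using aae by eventually_elim (rule LIM_zero)
 have dm: "(\<lambda>x. a n x - b x) \<in> borel_measurable M" for n by (intro borel_measurable_diff am bm)
 have t0: "?t \<longlonglongrightarrow> 0"
 proof (rule tdom[where C = "(2 * L)\<^sup>2"])
  show "\<bar>(a n x - b x)\<^sup>2\<bar> \<le> (2 * L)\<^sup>2" for n x
   using power_mono[OF ab abs_ge_zero, of n x 2] by simp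
  show "AE x in M. (\<lambda>n. (a n x - b x)\<^sup>2) \<longlonglongrightarrow> 0"
   using dae by eventually_elim (auto dest: tendsto_power[where n = 2])
 qed (intro borel_measurable_power dm, rule Gam_int[OF u u])
 have Guu: "integrable M (\<lambda>x. b x * \<Gamma> f g x)" if "b \<in> borel_measurable M" "\<And>x. \<bar>b x\<bar> \<le> C" "f \<in> D" "g \<in> D" for b and C :: real and f g
  using that by (intro Gam_sq_int_bounded)
 have aa: "\<bar>a m x * a n x\<bar> \<le> L\<^sup>2" for m n x
  unfolding abs_mult power2_eq_square by (intro mult_mono L abs_ge_zero L0)
 \<comment> \<open>\<open>X\<close> writes inner products through the factors, \<open>Y\<close>
   exchanges the energy density, and \<open>Z\<close> compares the factors by way of
   \<open>b\<close>.\<close>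
 have cau: "E (\<lambda>x. f m x - f n x) \<le> (4 * L\<^sup>2 * K * ?s m + 2 * ?t m) + (4 * L\<^sup>2 * K * ?s n + 2 * ?t n)" for m n
 proof -
  have aam: "(\<lambda>x. a i x * a j x) \<in> borel_measurable M" for i j by (intro borel_measurable_times am)
  have iA: "integrable M (\<lambda>x. (a i x * a j x) * \<Gamma> (v i) (v j) x)" "integrable M (\<lambda>x. (a i x * a j x) * \<Gamma> u u x)" for i j
   using aam aa vD u by (auto intro!: Guu[where C = "L\<^sup>2"])
  have X: "A (f i) (f j) = (LINT x|M. (a i x * a j x) * \<Gamma> (v i) (v j) x)" for i j
  proof -
   have "AE x in M. \<Gamma> (f i) (f j) x = a i x * \<Gamma> (v i) (f j) x" using rep[of i] fD[of j] unfolding repr_def by blast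
   moreover have "AE x in M. \<Gamma> (f j) (v i) x = a j x * \<Gamma> (v j) (v i) x" using rep[of j] vD[of i] unfolding repr_def by blast
   ultimately have "AE x in M. \<Gamma> (f i) (f j) x = (a i x * a j x) * \<Gamma> (v i) (v j) x"
    using Gam_sym[OF vD fD, of i j] Gam_sym[OF vD vD, of i j] by eventually_elim simp
   then show ?thesis unfolding A_Gam[OF fD fD] using Gam_int[OF fD fD, of i j] iA(1)[of i j]
    by (intro integral_cong_AE) auto
  qed
  have Y: "\<bar>(LINT x|M. (a i x * a j x) * \<Gamma> (v i) (v j) x) - (LINT x|M. (a i x * a j x) * \<Gamma> u u x)\<bar> \<le> L\<^sup>2 * (K * (?s i + ?s j))" for i j
  proof -
   have "\<bar>(LINT x|M. (a i x * a j x) * \<Gamma> (v i) (v j) x) - (LINT x|M. (a i x * a j x) * \<Gamma> u u x)\<bar>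
    = \<bar>LINT x|M. (a i x * a j x) * \<Gamma> (v i) (v j) x - (a i x * a j x) * \<Gamma> u u x\<bar>"
    using iA[of i j] by simp
   also have "\<dots> \<le> (LINT x|M. L\<^sup>2 * \<bar>\<Gamma> (v i) (v j) x - \<Gamma> u u x\<bar>)"
   proof (rule order_trans[OF integral_abs_bound integral_mono])
    show "\<bar>(a i x * a j x) * \<Gamma> (v i) (v j) x - (a i x * a j x) * \<Gamma> u u x\<bar> \<le> L\<^sup>2 * \<bar>\<Gamma> (v i) (v j) x - \<Gamma> u u x\<bar>" for x
     unfolding right_diff_distrib[symmetric] abs_mult[of "a i x * a j x"] by (intro mult_right_mono aa) simp
   qed (use iA[of i j] Gam_int[OF vD vD, of i j] Gam_int[OF u u] in auto)
   also have "\<dots> \<le> L\<^sup>2 * (K * (?s i + ?s j))" using Gd[of i j] by (simp add: mult_left_mono)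
   finally show ?thesis .
  qed
  have Z: "(LINT x|M. (a m x * a m x) * \<Gamma> u u x) - 2 * (LINT x|M. (a m x * a n x) * \<Gamma> u u x) + (LINT x|M. (a n x * a n x) * \<Gamma> u u x)
    \<le> 2 * ?t m + 2 * ?t n"
  proof -
   have it: "integrable M (\<lambda>x. (a i x - b x)\<^sup>2 * \<Gamma> u u x)" for i
    using power_mono[OF ab abs_ge_zero, of i _ 2] dm[of i] u
    by (intro Guu[where C = "(2 * L)\<^sup>2"]) auto
   have "(LINT x|M. (a m x * a m x) * \<Gamma> u u x) - 2 * (LINT x|M. (a m x * a n x) * \<Gamma> u u x) + (LINT x|M. (a n x * a n x) * \<Gamma> u u x)
    = (LINT x|M. (a m x * a m x) * \<Gamma> u u x - 2 * ((a m x * a n x) * \<Gamma> u u x) + (a n x * a n x) * \<Gamma> u u x)"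
    using iA(2)[of m m] iA(2)[of m n] iA(2)[of n n] by simp
   also have "\<dots> \<le> (LINT x|M. 2 * ((a m x - b x)\<^sup>2 * \<Gamma> u u x) + 2 * ((a n x - b x)\<^sup>2 * \<Gamma> u u x))"
   proof (rule integral_mono_AE)
    show "AE x in M. (a m x * a m x) * \<Gamma> u u x - 2 * ((a m x * a n x) * \<Gamma> u u x) + (a n x * a n x) * \<Gamma> u u x
     \<le> 2 * ((a m x - b x)\<^sup>2 * \<Gamma> u u x) + 2 * ((a n x - b x)\<^sup>2 * \<Gamma> u u x)"
     using Gam_nonneg[OF u]
    proof eventually_elim
     case (elim x)
     have "(a m x - a n x)\<^sup>2 * \<Gamma> u u x \<le> (2 * (a m x - b x)\<^sup>2 + 2 * (a n x - b x)\<^sup>2) * \<Gamma> u u x"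
      by (intro mult_right_mono sq_diff_le elim)
     then show ?case by (simp add: power2_eq_square algebra_simps)
    qed
   qed (use iA(2)[of m m] iA(2)[of m n] iA(2)[of n n] it[of m] it[of n] in auto)
   also have "\<dots> = 2 * ?t m + 2 * ?t n" using it[of m] it[of n] by simp
   finally show ?thesis .
  qed
  have "E (\<lambda>x. f m x - f n x) = E (f m) - 2 * A (f m) (f n) + E (f n)"
   using fD A_sym[OF fD fD, of m n] by (simp add: A_simps)
  also have "\<dots> \<le> (2 * ?t m + 2 * ?t n) + (L\<^sup>2 * (K * (?s m + ?s m)) + 2 * (L\<^sup>2 * (K * (?s m + ?s n))) + L\<^sup>2 * (K * (?s n + ?s n)))"
   unfolding X using Y[of m m] Y[of m n] Y[of n n] Z by linarith
  also have "\<dots> = (4 * L\<^sup>2 * K * ?s m + 2 * ?t m) + (4 * L\<^sup>2 * K * ?s n + 2 * ?t n)"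
   by (simp add: algebra_simps)
  finally show ?thesis .
 qed
 have "(\<lambda>n. 4 * L\<^sup>2 * K * ?s n + 2 * ?t n) \<longlonglongrightarrow> 4 * L\<^sup>2 * K * 0 + 2 * 0"
  by (intro tendsto_add tendsto_mult_left s0 t0)
 then have c0: "(\<lambda>n. 4 * L\<^sup>2 * K * ?s n + 2 * ?t n) \<longlonglongrightarrow> 0" by simp
 note lim = closed_limit[where u = f and v = g and c = "\<lambda>n. 4 * L\<^sup>2 * K * ?s n + 2 * ?t n",
   OF fD FL2 c0 cau L2]
 have "AE x in M. \<Gamma> g w x = b x * \<Gamma> u w x" if w: "w \<in> D" for w
 proof (rule L1_limit_unique[of M "\<lambda>n. \<Gamma> (f n) w"])
  show "integrable M (\<Gamma> (f n) w)" for n by (rule Gam_int[OF fD w])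
  show "integrable M (\<Gamma> g w)" by (rule Gam_int[OF lim(1) w])
  show i: "integrable M (\<lambda>x. b x * \<Gamma> u w x)"
   by (rule Gam_sq_int_bounded[OF u w bm L'])
  show "(\<lambda>n. LINT x|M. \<bar>\<Gamma> (f n) w x - \<Gamma> g w x\<bar>) \<longlonglongrightarrow> 0"
   by (rule Gam_L1_tendsto[OF fD lim(1) w lim(2)])
  let ?b = "\<lambda>n. L * (LINT x|M. \<bar>\<Gamma> (v n) w x - \<Gamma> u w x\<bar>) + (LINT x|M. \<bar>a n x - b x\<bar> * \<bar>\<Gamma> u w x\<bar>)"
  have d1: "(\<lambda>n. LINT x|M. \<bar>a n x - b x\<bar> * \<bar>\<Gamma> u w x\<bar>) \<longlonglongrightarrow> 0"
  proof (rule tdom[where C = "2 * L"])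
   show "AE x in M. (\<lambda>n. \<bar>a n x - b x\<bar>) \<longlonglongrightarrow> 0"
    using dae by eventually_elim (auto dest: tendsto_rabs)
   show "\<bar>\<bar>a n x - b x\<bar>\<bar> \<le> 2 * L" for n x using ab by simp
   show "integrable M (\<lambda>x. \<bar>\<Gamma> u w x\<bar>)" using Gam_int[OF u w] by simp
   show "(\<lambda>x. \<bar>a n x - b x\<bar>) \<in> borel_measurable M" for n by (intro borel_measurable_abs dm)
  qed
  have "?b \<longlonglongrightarrow> L * 0 + 0"
   by (intro tendsto_add tendsto_mult_left d1 Gam_L1_tendsto[OF vD u w vE])
  then have b0: "?b \<longlonglongrightarrow> 0" by simp
  show "(\<lambda>n. LINT x|M. \<bar>\<Gamma> (f n) w x - b x * \<Gamma> u w x\<bar>) \<longlonglongrightarrow> 0"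
  proof (rule Lim_null_comparison[OF always_eventually[OF allI] b0])
   fix n
   have ae: "AE x in M. \<Gamma> (f n) w x = a n x * \<Gamma> (v n) w x" using rep[of n] w unfolding repr_def by blast
   have i2: "integrable M (\<lambda>x. \<bar>a n x - b x\<bar> * \<bar>\<Gamma> u w x\<bar>)"
    using Guu[OF dm ab u w, of n] integrable_abs[of M "\<lambda>x. (a n x - b x) * \<Gamma> u w x"] by (simp add: abs_mult)
   have i3: "integrable M (\<lambda>x. \<bar>\<Gamma> (v n) w x - \<Gamma> u w x\<bar>)" using Gam_int[OF vD w, of n] Gam_int[OF u w] by simp
   have "(LINT x|M. \<bar>\<Gamma> (f n) w x - b x * \<Gamma> u w x\<bar>) \<le> (LINT x|M. L * \<bar>\<Gamma> (v n) w x - \<Gamma> u w x\<bar> + \<bar>a n x - b x\<bar> * \<bar>\<Gamma> u w x\<bar>)"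
   proof (rule integral_mono_AE)
    show "AE x in M. \<bar>\<Gamma> (f n) w x - b x * \<Gamma> u w x\<bar> \<le> L * \<bar>\<Gamma> (v n) w x - \<Gamma> u w x\<bar> + \<bar>a n x - b x\<bar> * \<bar>\<Gamma> u w x\<bar>"
     using ae
    proof eventually_elim
     case (elim x)
     have "\<Gamma> (f n) w x - b x * \<Gamma> u w x = a n x * (\<Gamma> (v n) w x - \<Gamma> u w x) + (a n x - b x) * \<Gamma> u w x"
      unfolding elim by (simp add: algebra_simps)
     moreover have "\<bar>a n x * (\<Gamma> (v n) w x - \<Gamma> u w x)\<bar> \<le> L * \<bar>\<Gamma> (v n) w x - \<Gamma> u w x\<bar>"
      unfolding abs_mult by (intro mult_right_mono L) simp
     moreover have "\<bar>(a n x - b x) * \<Gamma> u w x\<bar> = \<bar>a n x - b x\<bar> * \<bar>\<Gamma> u w x\<bar>" by (rule abs_mult)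
     ultimately show ?case by linarith
    qed
   qed (use Gam_int[OF fD w, of n] i i2 i3 in auto)
   also have "\<dots> = ?b n" using i2 i3 by simp
   finally show "norm (LINT x|M. \<bar>\<Gamma> (f n) w x - b x * \<Gamma> u w x\<bar>) \<le> ?b n" by simp
  qed
 qed
 then show "repr g b u" using lim(1) u by (simp add: repr_def)
qed

text \<open>As \<open>u\<close> has values in \<open>[-B, B]\<close>, polynomials approximate
  \<open>F'\<close> uniformly there. Their primitives approximate \<open>F\<close> with an error
  proportional to \<open>\<bar>u\<bar>\<close>, which gives convergence in L2.\<close>

lemma chain_rule_Dc:
 assumes u: "u \<in> Dc" and F: "\<And>r. (F has_real_derivative F' r) (at r)" and F'c: "continuous_on UNIV F'" and F0: "F 0 = 0"
 shows "repr (\<lambda>x. F (u x)) (\<lambda>x. F' (u x)) u"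
proof -
 have uD: "u \<in> D" using u by simp
 obtain B where B: "B > 0" "\<And>x. \<bar>u x\<bar> \<le> B" by (rule Cc_bounded[of u]) (use u in blast)+
 have uI: "u x \<in> {-B..B}" for x using B(2)[of x] by (auto simp: abs_le_iff)
 have "\<exists>a N. \<forall>r\<in>{-B..B}. \<bar>F' r - (\<Sum>i\<le>N. a i * r ^ i)\<bar> < 1 / real (Suc n)" for n
 proof -
  obtain g where g: "real_polynomial_function g" "\<And>r. r \<in> {-B..B} \<Longrightarrow> \<bar>F' r - g r\<bar> < 1 / real (Suc n)"
   using Stone_Weierstrass_real_polynomial_function[of "{-B..B}" F' "1 / real (Suc n)"]
    continuous_on_subset[OF F'c, of "{-B..B}"] by auto
  then obtain a N where "g = (\<lambda>r. \<Sum>i\<le>N. a i * r ^ i)" by (auto simp: real_polynomial_function_iff_sum)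
  then show ?thesis using g(2) by blast
 qed
 then obtain a N where aN: "\<And>n r. r \<in> {-B..B} \<Longrightarrow> \<bar>F' r - (\<Sum>i\<le>N n. a n i * r ^ i)\<bar> < 1 / real (Suc n)" by metis
 let ?g = "\<lambda>n r. \<Sum>i\<le>N n. a n i * r ^ i" and ?P = "\<lambda>n r. \<Sum>i\<le>N n. a n i / real (Suc i) * r ^ Suc i"
 let ?v = "\<lambda>n x. ?P n (u x)"
 have rep: "repr (?v n) (\<lambda>x. ?g n (u x)) u" for n by (rule repr_polynomial[OF u])
 then have vD: "?v n \<in> D" for n unfolding repr_def by blast
 have gm: "(\<lambda>x. ?g n (u x)) \<in> borel_measurable M" for n
  using uD by (intro borel_measurable_sum borel_measurable_times borel_measurable_const borel_measurable_power D_meas)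
 have gF: "\<bar>F' (u x) - ?g n (u x)\<bar> \<le> 1 / real (Suc n)" for n x using aN[OF uI, of x n] by simp
 have Pder: "((\<lambda>r. F r - ?P n r) has_real_derivative F' r - ?g n r) (at r)" for n r
 proof -
  have "((\<lambda>r. a n i / real (Suc i) * r ^ Suc i) has_real_derivative a n i * r ^ i) (at r)" for i
  proof -
   have "((\<lambda>r. a n i / real (Suc i) * r ^ Suc i) has_real_derivative a n i / real (Suc i) * (real (Suc i) * r ^ i)) (at r)"
    by (rule DERIV_cmult) (rule DERIV_cong[OF DERIV_pow], simp)
   then show ?thesis by simp
  qed
  then have "(?P n has_real_derivative ?g n r) (at r)" by (intro DERIV_sum)
  then show ?thesis by (intro DERIV_diff F)
 qed
 have PF: "\<bar>?P n (u x) - F (u x)\<bar> \<le> 1 / real (Suc n) * \<bar>u x\<bar>" for n x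
 proof -
  have "norm ((F (u x) - ?P n (u x)) - (F 0 - ?P n 0)) \<le> 1 / real (Suc n) * norm (u x - 0)"
  proof (rule field_differentiable_bound[of "{-B..B}" "\<lambda>r. F r - ?P n r" "\<lambda>r. F' r - ?g n r"])
   show "((\<lambda>r. F r - ?P n r) has_field_derivative F' r - ?g n r) (at r within {-B..B})" if "r \<in> {-B..B}" for r
    by (rule has_field_derivative_at_within[OF Pder])
   show "norm (F' r - ?g n r) \<le> 1 / real (Suc n)" if "r \<in> {-B..B}" for r
    using aN[OF that, of n] by simp
  qed (use uI[of x] B(1) in auto)
  then show ?thesis using F0 by (simp add: abs_minus_commute)
 qed
 have Fc: "continuous_on UNIV F"
  by (rule DERIV_continuous_on[OF has_field_derivative_at_within[OF F]])
 have u2: "integrable M (\<lambda>x. (u x)\<^sup>2)" using D_L2[OF uD] by (simp add: Lspace2_iff)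
 have Fm: "(\<lambda>x. F (u x)) \<in> borel_measurable M" by (rule D_compose_meas[OF Fc uD])
 have dm: "(\<lambda>x. ?v n x - F (u x)) \<in> borel_measurable M" for n by (intro borel_measurable_diff D_meas vD Fm)
 have sq: "(?v n x - F (u x))\<^sup>2 \<le> (1 / real (Suc n))\<^sup>2 * (u x)\<^sup>2" for n x
  using power_mono[OF PF abs_ge_zero, of n x 2] by (simp add: power_mult_distrib power_divide)
 have d2: "integrable M (\<lambda>x. (?v n x - F (u x))\<^sup>2)" for n
 proof (rule Bochner_Integration.integrable_bound)
  show "integrable M (\<lambda>x. (1 / real (Suc n))\<^sup>2 * (u x)\<^sup>2)" using u2 by simp
  show "(\<lambda>x. (?v n x - F (u x))\<^sup>2) \<in> borel_measurable M" by (intro borel_measurable_power dm)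
  show "AE x in M. norm ((?v n x - F (u x))\<^sup>2) \<le> norm ((1 / real (Suc n))\<^sup>2 * (u x)\<^sup>2)"
   using sq by (intro AE_I2) simp
 qed
 have FL2: "(\<lambda>x. F (u x)) \<in> Lspace 2 M"
 proof -
  have "(\<lambda>x. ?v 0 x - F (u x)) \<in> Lspace 2 M" using dm d2 by (simp add: Lspace2_iff)
  from Lspace2_diff[OF D_L2[OF vD[of 0]] this] show ?thesis by simp
 qed
 have L2: "(\<lambda>n. LINT x|M. (?v n x - F (u x))\<^sup>2) \<longlonglongrightarrow> 0"
 proof (rule Lim_null_comparison[OF always_eventually[OF allI] tendsto_inverse_sq])
  fix n
  have "(LINT x|M. (?v n x - F (u x))\<^sup>2) \<le> (LINT x|M. (1 / real (Suc n))\<^sup>2 * (u x)\<^sup>2)"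
   using u2 by (intro integral_mono d2 sq) simp
  then show "norm (LINT x|M. (?v n x - F (u x))\<^sup>2) \<le> (1 / real (Suc n))\<^sup>2 * (LINT x|M. (u x)\<^sup>2)"
   by (simp add: integral_nonneg_AE)
 qed
 have "compact (F' ` {-B..B})"
  by (intro compact_continuous_image continuous_on_subset[OF F'c]) auto
 then obtain K where K: "\<And>r. r \<in> {-B..B} \<Longrightarrow> \<bar>F' r\<bar> \<le> K"
  using compact_imp_bounded[of "F' ` {-B..B}"] unfolding bounded_iff by (metis image_eqI real_norm_def)
 show ?thesis
 proof (rule repr_limit[OF rep uD _ gm D_compose_meas[OF F'c uD] _ _ AE_I2 FL2 L2])
  show "(\<lambda>n. E (\<lambda>x. u x - u x)) \<longlonglongrightarrow> 0" using A_zero1[OF D_zero] by simp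
  show "\<bar>F' (u x)\<bar> \<le> K + 1" for x using K[OF uI, of x] by simp
  show "\<bar>?g n (u x)\<bar> \<le> K + 1" for n x
  proof -
   have "1 / real (Suc n) \<le> 1" by simp
   then show ?thesis using gF[of x n] K[OF uI, of x] by linarith
  qed
  show "(\<lambda>n. ?g n (u x)) \<longlonglongrightarrow> F' (u x)" for x
  proof (rule Lim_null[THEN iffD2, OF Lim_null_comparison[OF always_eventually[OF allI] LIMSEQ_Suc[OF lim_1_over_n]]])
   show "norm (?g n (u x) - F' (u x)) \<le> 1 / real (Suc n)" for n
    using gF[of x n] by (simp only: real_norm_def abs_minus_commute)
  qed
 qed
qed

text \<open>\<open>u\<close> is approximated from \<open>Dc\<close> along a subsequence converging
  almost everywhere, so that the factors \<open>F' (v n)\<close> converge too. The bound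
  \<open>L\<close> takes over the part that boundedness of \<open>u\<close> plays in
  \<open>chain_rule_Dc\<close>.\<close>

lemma chain_rule:
 assumes u: "u \<in> D" and F: "\<And>r. (F has_real_derivative F' r) (at r)" and F'c: "continuous_on UNIV F'"
  and F0: "F 0 = 0" and L: "\<And>r. \<bar>F' r\<bar> \<le> L"
 shows "repr (\<lambda>x. F (u x)) (\<lambda>x. F' (u x)) u"
proof -
 obtain v0 where v0: "\<And>n. v0 n \<in> Dc" "(\<lambda>n. E (\<lambda>x. v0 n x - u x)) \<longlonglongrightarrow> 0" "(\<lambda>n. LINT x|M. (v0 n x - u x)\<^sup>2) \<longlonglongrightarrow> 0"
  by (rule Dc_dense[OF u]) blast
 have v0D: "v0 n \<in> D" for n using v0(1)[of n] by simp
 obtain r where r: "strict_mono r" "AE x in M. (\<lambda>n. v0 (r n) x) \<longlonglongrightarrow> u x"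
  by (rule L2_tendsto_AE_subseq[OF D_L2[OF v0D] D_L2[OF u] v0(3)]) blast
 define v where "v = (\<lambda>n. v0 (r n))"
 have vc: "v n \<in> Dc" for n using v0(1) by (simp add: v_def)
 have vD: "v n \<in> D" for n using vc[of n] by simp
 have vE: "(\<lambda>n. E (\<lambda>x. v n x - u x)) \<longlonglongrightarrow> 0" unfolding v_def
  using LIMSEQ_subseq_LIMSEQ[OF v0(2) r(1)] by (simp add: o_def)
 have vL: "(\<lambda>n. LINT x|M. (v n x - u x)\<^sup>2) \<longlonglongrightarrow> 0" unfolding v_def
  using LIMSEQ_subseq_LIMSEQ[OF v0(3) r(1)] by (simp add: o_def)
 have vae: "AE x in M. (\<lambda>n. v n x) \<longlonglongrightarrow> u x" using r(2) by (simp add: v_def)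
 let ?f = "\<lambda>n x. F (v n x)"
 have rep: "repr (?f n) (\<lambda>x. F' (v n x)) (v n)" for n by (rule chain_rule_Dc[OF vc F F'c F0])
 have fD: "?f n \<in> D" for n using rep[of n] unfolding repr_def by blast
 have am: "(\<lambda>x. F' (v n x)) \<in> borel_measurable M" for n by (rule D_compose_meas[OF F'c vD])
 have aum: "(\<lambda>x. F' (u x)) \<in> borel_measurable M" by (rule D_compose_meas[OF F'c u])
 have aae: "AE x in M. (\<lambda>n. F' (v n x)) \<longlonglongrightarrow> F' (u x)"
  using vae
 proof eventually_elim
  case (elim x)
  have "isCont F' (u x)" using F'c by (simp add: continuous_on_eq_continuous_at)
  then show ?case using elim by (rule isCont_tendsto_compose)
 qed
 have Fc: "continuous_on UNIV F"
  by (rule DERIV_continuous_on[OF has_field_derivative_at_within[OF F]])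
 have lip: "\<bar>F s - F t\<bar> \<le> L * \<bar>s - t\<bar>" for s t
  by (rule DERIV_bounded_lipschitz[OF F L])
 have Fm: "(\<lambda>x. F (u x)) \<in> borel_measurable M" by (rule D_compose_meas[OF Fc u])
 have FL2: "(\<lambda>x. F (u x)) \<in> Lspace 2 M"
 proof -
  have "integrable M (\<lambda>x. (F (u x))\<^sup>2)"
  proof (rule Bochner_Integration.integrable_bound)
   show "integrable M (\<lambda>x. L\<^sup>2 * (u x)\<^sup>2)" using D_L2[OF u] by (simp add: Lspace2_iff)
   show "(\<lambda>x. (F (u x))\<^sup>2) \<in> borel_measurable M" by (intro borel_measurable_power Fm)
   show "AE x in M. norm ((F (u x))\<^sup>2) \<le> norm (L\<^sup>2 * (u x)\<^sup>2)"
    using power_mono[OF lip[of _ 0] abs_ge_zero, of _ 2] F0 by (intro AE_I2) (simp add: power_mult_distrib)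
  qed
  then show ?thesis using Fm by (simp add: Lspace2_iff)
 qed
 have L2: "(\<lambda>n. LINT x|M. (?f n x - F (u x))\<^sup>2) \<longlonglongrightarrow> 0"
 proof (rule Lim_null_comparison[OF always_eventually[OF allI]])
  show "(\<lambda>n. L\<^sup>2 * (LINT x|M. (v n x - u x)\<^sup>2)) \<longlonglongrightarrow> 0" using tendsto_mult_right_zero[OF vL] by simp
  fix n
  have "(LINT x|M. (?f n x - F (u x))\<^sup>2) \<le> (LINT x|M. L\<^sup>2 * (v n x - u x)\<^sup>2)"
  proof (rule integral_mono)
   show "integrable M (\<lambda>x. (?f n x - F (u x))\<^sup>2)"
    using Lspace2_diff[OF D_L2[OF fD] FL2] by (simp add: Lspace2_iff)
   show "integrable M (\<lambda>x. L\<^sup>2 * (v n x - u x)\<^sup>2)"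
    using Lspace2_diff[OF D_L2[OF vD] D_L2[OF u]] by (simp add: Lspace2_iff)
   show "(?f n x - F (u x))\<^sup>2 \<le> L\<^sup>2 * (v n x - u x)\<^sup>2" for x
    using power_mono[OF lip abs_ge_zero, of "v n x" "u x" 2] by (simp add: power_mult_distrib)
  qed
  then show "norm (LINT x|M. (?f n x - F (u x))\<^sup>2) \<le> L\<^sup>2 * (LINT x|M. (v n x - u x)\<^sup>2)"
   by (simp add: integral_nonneg_AE)
 qed
 show ?thesis by (rule repr_limit[OF rep u vE am aum L L aae FL2 L2])
qed

text \<open>\<open>arctan (n u) / n\<close> tends to 0 while its chain rule factor tends to the indicator function of \<open>{u = 0}\<close>.\<close>

lemma Gam_zero_level:
 assumes u: "u \<in> D"
 shows "AE x in M. u x = 0 \<longrightarrow> \<Gamma> u u x = 0"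
proof -
 let ?F = "\<lambda>n r. arctan (real (Suc n) * r) / real (Suc n)" and ?F' = "\<lambda>n r. 1 / (1 + (real (Suc n) * r)\<^sup>2)"
 have pos: "0 < 1 + (real (Suc n) * r)\<^sup>2" for n r by (rule add_pos_nonneg) auto
 have der: "(?F n has_real_derivative ?F' n r) (at r)" for n r
 proof -
  have "(?F n has_real_derivative (inverse (1 + (real (Suc n) * r)\<^sup>2) * real (Suc n)) / real (Suc n)) (at r)"
   by (rule DERIV_cdivide, rule DERIV_chain2[OF DERIV_arctan]) (rule DERIV_cmult_Id)
  then show ?thesis by (simp add: inverse_eq_divide)
 qed
 have cont: "continuous_on UNIV (?F' n)" for n
  using pos[of n] by (intro continuous_intros) (auto simp: less_imp_neq[THEN not_sym])
 have b1: "\<bar>?F' n r\<bar> \<le> 1" for n r using pos[of n r] by simp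
 have rep: "repr (\<lambda>x. ?F n (u x)) (\<lambda>x. ?F' n (u x)) u" for n
  by (rule chain_rule[OF u der cont _ b1]) simp
 let ?v = "\<lambda>n x. ?F n (u x)" and ?i = "\<lambda>x. indicator {0} (u x) :: real"
 have vD: "?v n \<in> D" for n using rep[of n] unfolding repr_def by blast
 have am: "(\<lambda>x. ?F' n (u x)) \<in> borel_measurable M" for n by (rule D_compose_meas[OF cont u])
 have im: "?i \<in> borel_measurable M"
  using measurable_compose[OF D_meas[OF u], of "indicator {0} :: real \<Rightarrow> real"] by simp
 have lim1: "(\<lambda>n. ?F' n (u x)) \<longlonglongrightarrow> ?i x" for x
 proof (cases "u x = 0")
  case False
  have "filterlim (\<lambda>n. real (Suc n)) at_top sequentially"
   by (rule filterlim_compose[OF filterlim_real_sequentially filterlim_Suc])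
  then have "filterlim (\<lambda>n. (real (Suc n))\<^sup>2 * (u x)\<^sup>2) at_top sequentially"
   using False by (intro filterlim_at_top_mult_tendsto_pos[OF tendsto_const] filterlim_pow_at_top) auto
  then have "filterlim (\<lambda>n. 1 + (real (Suc n) * u x)\<^sup>2) at_top sequentially"
   by (intro filterlim_tendsto_add_at_top[OF tendsto_const]) (simp add: power_mult_distrib)
  then have "(\<lambda>n. inverse (1 + (real (Suc n) * u x)\<^sup>2)) \<longlonglongrightarrow> 0" by (rule tendsto_inverse_0_at_top)
  then show ?thesis using False by (simp add: inverse_eq_divide)
 qed simp
 have at: "\<bar>?F n r\<bar> \<le> \<bar>r\<bar>" for n r
  using DERIV_bounded_lipschitz[of "?F n" "?F' n" 1 r 0, OF der b1] by simp
 have u2: "integrable M (\<lambda>x. (u x)\<^sup>2)" using D_L2[OF u] by (simp add: Lspace2_iff)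
 have v0: "(\<lambda>n. ?v n x) \<longlonglongrightarrow> 0" for x
 proof (rule Lim_null_comparison[OF always_eventually[OF allI]])
  show "norm (?v n x) \<le> (pi / 2) * (1 / real (Suc n))" for n
  proof -
   have "\<bar>arctan (real (Suc n) * u x)\<bar> \<le> pi / 2"
    using arctan_bounded[of "real (Suc n) * u x"] by (simp only: abs_le_iff) linarith
   then have "\<bar>arctan (real (Suc n) * u x)\<bar> / real (Suc n) \<le> pi / 2 / real (Suc n)"
    by (rule divide_right_mono) simp
   then show ?thesis by (simp add: abs_divide del: of_nat_Suc)
  qed
  show "(\<lambda>n. (pi / 2) * (1 / real (Suc n))) \<longlonglongrightarrow> 0"
   by (rule tendsto_mult_right_zero[OF LIMSEQ_Suc[OF lim_1_over_n]])
 qed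
 have "(\<lambda>n. LINT x|M. (?v n x)\<^sup>2) \<longlonglongrightarrow> (LINT x|M. 0)"
 proof (rule integral_dominated_convergence[where w = "\<lambda>x. (u x)\<^sup>2"])
  show "AE x in M. (\<lambda>n. (?v n x)\<^sup>2) \<longlonglongrightarrow> 0"
   using tendsto_power[OF v0, of _ 2] by (intro AE_I2) simp
  show "AE x in M. norm ((?v n x)\<^sup>2) \<le> (u x)\<^sup>2" for n
   using power_mono[OF at abs_ge_zero, of n _ 2] by (intro AE_I2) (simp only: power2_abs real_norm_def abs_power2)
  show "(\<lambda>x. (?v n x)\<^sup>2) \<in> borel_measurable M" for n by (intro borel_measurable_power D_meas vD)
 qed (use u2 in simp_all)
 then have L2: "(\<lambda>n. LINT x|M. (?v n x - 0)\<^sup>2) \<longlonglongrightarrow> 0" by simp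
 have "repr (\<lambda>_. 0) ?i u"
 proof (rule repr_limit[OF rep u _ am im b1 _ AE_I2[OF lim1] D_L2[OF D_zero] L2])
  show "(\<lambda>n. E (\<lambda>x. u x - u x)) \<longlonglongrightarrow> 0" using A_zero1[OF D_zero] by simp
 qed (simp add: indicator_def)
 then have "AE x in M. \<Gamma> (\<lambda>_. 0) u x = ?i x * \<Gamma> u u x" using u unfolding repr_def by blast
 moreover have "AE x in M. \<Gamma> (\<lambda>_. 0) u x = 0" using Gam_scale1[OF u u, of 0] by simp
 ultimately show ?thesis by eventually_elim auto
qed

text \<open>On \<open>{u = v}\<close> the energy density of the difference vanishes by
  \<open>Gam_zero_level\<close>, and Cauchy-Schwarz carries this over to the mixed density with
  \<open>w\<close>.\<close>

lemma Gam_level: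
 assumes "u \<in> D" "v \<in> D" "w \<in> D"
 shows "AE x in M. u x = v x \<longrightarrow> \<Gamma> u w x = \<Gamma> v w x"
 using Gam_zero_level[OF D_diff[OF assms(1,2)]] Gam_Cauchy_Schwarz[OF D_diff[OF assms(1,2)] assms(3)] Gam_diff1[OF assms]
 by eventually_elim auto

text \<open>The square is not globally Lipschitz, so the chain rule is applied to a C1 function that
  equals it on \<open>[-B, B]\<close> and is linear outside. Products follow by polarisation, for
  which \<open>B\<close> must also bound \<open>u + v\<close>.\<close>

lemma D_bdd_mult:
 assumes u: "u \<in> sub_bdd M D" and v: "v \<in> sub_bdd M D"
 shows "(\<lambda>x. u x * v x) \<in> sub_bdd M D"
  "w \<in> D \<Longrightarrow> AE x in M. \<Gamma> (\<lambda>x. u x * v x) w x = u x * \<Gamma> v w x + v x * \<Gamma> u w x"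
proof -
 have D: "u \<in> D" "v \<in> D" using u v by (auto simp: sub_bdd_def)
 obtain a b where ab: "AE x in M. \<bar>u x\<bar> \<le> a" "AE x in M. \<bar>v x\<bar> \<le> b"
  using u v by (auto simp: sub_bdd_def ae_bounded_def)
 define B where "B = \<bar>a\<bar> + \<bar>b\<bar>"
 have B: "B \<ge> 0" by (simp add: B_def)
 have "AE x in M. \<bar>u x\<bar> \<le> B \<and> \<bar>v x\<bar> \<le> B \<and> \<bar>u x + v x\<bar> \<le> B"
  using ab unfolding B_def by eventually_elim linarith
 then have bd: "AE x in M. \<bar>u x\<bar> \<le> B" "AE x in M. \<bar>v x\<bar> \<le> B" "AE x in M. \<bar>u x + v x\<bar> \<le> B"
  by (auto elim: eventually_mono)
 let ?F = "\<lambda>r. r\<^sup>2 - ((max (r - B) 0)\<^sup>2 + (max (- r - B) 0)\<^sup>2)"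
 let ?F' = "\<lambda>r. 2 * r - (2 * max (r - B) 0 - 2 * max (- r - B) 0)"
 have der: "(?F has_real_derivative ?F' r) (at r)" for r
 proof -
  have 1: "((\<lambda>r. (max (r - B) 0)\<^sup>2) has_real_derivative 2 * max (r - B) 0 * 1) (at r)"
   by (rule DERIV_chain2[OF DERIV_pos_part_squared]) (auto intro!: derivative_eq_intros)
  have 2: "((\<lambda>r. (max (- r - B) 0)\<^sup>2) has_real_derivative 2 * max (- r - B) 0 * (- 1)) (at r)"
   by (rule DERIV_chain2[OF DERIV_pos_part_squared]) (auto intro!: derivative_eq_intros)
  have 3: "((\<lambda>r. r\<^sup>2) has_real_derivative 2 * r) (at r)" by (auto intro!: derivative_eq_intros)
  show ?thesis using DERIV_diff[OF 3 DERIV_add[OF 1 2]] by simp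
 qed
 have c: "continuous_on UNIV ?F'" by (intro continuous_intros)
 have lip: "\<bar>?F' r\<bar> \<le> 2 * B" for r using B by (auto simp: max_def abs_le_iff)
 have sq: "?F r = r\<^sup>2" "?F' r = 2 * r" if "\<bar>r\<bar> \<le> B" for r using that by (auto simp: max_def abs_le_iff)
 have main: "(\<lambda>x. f x * f x) \<in> D \<and> (\<forall>w\<in>D. AE x in M. \<Gamma> (\<lambda>x. f x * f x) w x = 2 * f x * \<Gamma> f w x)"
  if f: "f \<in> D" "AE x in M. \<bar>f x\<bar> \<le> B" for f
 proof -
  have rep: "repr (\<lambda>x. ?F (f x)) (\<lambda>x. ?F' (f x)) f" by (rule chain_rule[OF f(1) der c _ lip]) (use B in simp)
  then have FD: "(\<lambda>x. ?F (f x)) \<in> D" unfolding repr_def by blast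
  have ae: "AE x in M. ?F (f x) = f x * f x" using f(2)
   by eventually_elim (simp only: sq(1) power2_eq_square)
  have fD: "(\<lambda>x. f x * f x) \<in> D"
   by (rule D_cong[OF FD borel_measurable_times[OF D_meas[OF f(1)] D_meas[OF f(1)]] ae])
  have "AE x in M. \<Gamma> (\<lambda>x. f x * f x) w x = 2 * f x * \<Gamma> f w x" if w: "w \<in> D" for w
  proof -
   have "AE x in M. \<Gamma> (\<lambda>x. ?F (f x)) w x = ?F' (f x) * \<Gamma> f w x" using rep w unfolding repr_def by blast
   then show ?thesis using Gam_cong1[OF FD fD w ae] f(2)
    by eventually_elim (simp only: sq(2))
  qed
  then show ?thesis using fD by blast
 qed
 have s: "(\<lambda>x. u x + v x) \<in> D" by (rule D_add[OF D])
 note mu = main[OF D(1) bd(1)] and mv = main[OF D(2) bd(2)] and ms = main[OF s bd(3)]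
 have eq: "(\<lambda>x. u x * v x) = (\<lambda>x. (1/2) * ((u x + v x) * (u x + v x)) + (-1/2) * (u x * u x + v x * v x))"
  by (simp add: fun_eq_iff field_simps)
 have Ds: "(\<lambda>x. u x * u x + v x * v x) \<in> D" using mu mv by (intro D_add) auto
 have mD: "(\<lambda>x. u x * v x) \<in> D" unfolding eq using ms Ds by (intro D_lin) auto
 moreover have "AE x in M. \<bar>u x * v x\<bar> \<le> B * B"
  using bd(1,2) by eventually_elim (auto simp: abs_mult intro!: mult_mono B)
 ultimately show "(\<lambda>x. u x * v x) \<in> sub_bdd M D" by (auto simp: sub_bdd_def ae_bounded_def)
 assume w: "w \<in> D"
 have "AE x in M. \<Gamma> (\<lambda>x. u x * v x) w x = (1/2) * \<Gamma> (\<lambda>x. (u x + v x) * (u x + v x)) w x + (-1/2) * \<Gamma> (\<lambda>x. u x * u x + v x * v x) w x"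
  unfolding eq using ms by (intro Gam_lin1 Ds w) auto
 moreover have "AE x in M. \<Gamma> (\<lambda>x. u x * u x + v x * v x) w x = \<Gamma> (\<lambda>x. u x * u x) w x + \<Gamma> (\<lambda>x. v x * v x) w x"
  using mu mv by (intro Gam_add1 w) auto
 moreover have "AE x in M. \<Gamma> (\<lambda>x. u x * u x) w x = 2 * u x * \<Gamma> u w x" using mu w by blast
 moreover have "AE x in M. \<Gamma> (\<lambda>x. v x * v x) w x = 2 * v x * \<Gamma> v w x" using mv w by blast
 moreover have "AE x in M. \<Gamma> (\<lambda>x. (u x + v x) * (u x + v x)) w x = 2 * (u x + v x) * \<Gamma> (\<lambda>x. u x + v x) w x" using ms w by blast
 ultimately show "AE x in M. \<Gamma> (\<lambda>x. u x * v x) w x = u x * \<Gamma> v w x + v x * \<Gamma> u w x"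
  using Gam_add1[OF D w]
 proof eventually_elim
  case (elim x)
  show ?case unfolding elim(1) elim(2,5) elim(3,4,6) by (simp add: algebra_simps)
 qed
qed

end

section \<open>Sub-Markovian contraction semigroups on finite measure spaces\<close>

lemma Lspace1_iff: "f \<in> Lspace 1 M \<longleftrightarrow> integrable M f"
proof
 assume "f \<in> Lspace 1 M"
 then have "f \<in> borel_measurable M" "integrable M (\<lambda>x. \<bar>f x\<bar>)" by (simp_all add: Lspace_def)
 then show "integrable M f" by (rule integrable_abs_cancel[rotated])
qed (simp add: Lspace_def)

lemma Lnorm1_eq: "Lnorm 1 M f = (LINT x|M. \<bar>f x\<bar>)"
 by (simp add: Lnorm_def)

text \<open>On a finite measure space both admissible norms dominate the L1 norm; the time
  derivatives below are stated in L1 so that \<open>p = 1\<close> and \<open>p = 2\<close> are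
  treated together.\<close>

locale contraction_semigroup =
 fixes M :: "'a measure" and p :: nat and S :: "real \<Rightarrow> ('a \<Rightarrow> real) \<Rightarrow> 'a \<Rightarrow> real"
 assumes finite_M: "emeasure M (space M) < \<infinity>"
  and p: "p = 1 \<or> p = 2"
  and C0: "C0_contraction_semigroup p M S"
  and markov: "sub_Markovian p M S"
begin

abbreviation "Lp \<equiv> Lspace p M"
abbreviation "nrm \<equiv> Lnorm p M"

sublocale finite_measure M
 by (rule finite_measureI) (use finite_M in auto)

lemma Lp_meas: "f \<in> Lp \<Longrightarrow> f \<in> borel_measurable M"
 by (simp add: Lspace_def)

lemma Lp_lin:
 assumes "f \<in> Lp" "g \<in> Lp"
 shows "(\<lambda>x. a * f x + b * g x) \<in> Lp"
 using p
proof
 assume "p = 1" then show ?thesis using assms by (simp only: Lspace1_iff) simp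
next
 assume "p = 2" then show ?thesis using assms by (simp add: Lspace2_lin)
qed

lemma Lp_add: "f \<in> Lp \<Longrightarrow> g \<in> Lp \<Longrightarrow> (\<lambda>x. f x + g x) \<in> Lp"
 using Lp_lin[of f g 1 1] by simp
lemma Lp_diff: "f \<in> Lp \<Longrightarrow> g \<in> Lp \<Longrightarrow> (\<lambda>x. f x - g x) \<in> Lp"
 using Lp_lin[of f g 1 "-1"] by simp
lemma Lp_scale: "f \<in> Lp \<Longrightarrow> (\<lambda>x. a * f x) \<in> Lp"
 using Lp_lin[of f f a 0] by simp

lemma Lp_bounded:
 assumes "f \<in> borel_measurable M" "AE x in M. \<bar>f x\<bar> \<le> c"
 shows "f \<in> Lp"
proof -
 have "integrable M (\<lambda>x. \<bar>f x\<bar> ^ p)"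
 proof (rule integrable_const_bound[where B = "c ^ p"])
  show "AE x in M. norm (\<bar>f x\<bar> ^ p) \<le> c ^ p"
   using assms(2) by eventually_elim (auto intro: power_mono)
 qed (use assms in simp)
 then show ?thesis using assms by (simp add: Lspace_def)
qed

lemma Lp_zero: "(\<lambda>_. 0) \<in> Lp"
 by (rule Lp_bounded[of _ 0]) auto

lemma Lp_sum: "finite I \<Longrightarrow> (\<And>i. i \<in> I \<Longrightarrow> f i \<in> Lp) \<Longrightarrow> (\<lambda>x. \<Sum>i\<in>I. f i x) \<in> Lp"
 by (induction I rule: finite_induct) (auto simp: Lp_zero intro!: Lp_add)

lemma nrm_nonneg: "0 \<le> nrm f"
 unfolding Lnorm_def by (intro real_root_ge_zero integral_nonneg_AE) simp

lemma nrm_cong: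
 assumes "AE x in M. f x = g x" "f \<in> borel_measurable M" "g \<in> borel_measurable M"
 shows "nrm f = nrm g"
proof -
 have "(LINT x|M. \<bar>f x\<bar> ^ p) = (LINT x|M. \<bar>g x\<bar> ^ p)"
  using assms by (intro integral_cong_AE) auto
 then show ?thesis by (simp add: Lnorm_def)
qed

lemma nrm_scale: "nrm (\<lambda>x. a * f x) = \<bar>a\<bar> * nrm f"
proof -
 have "(LINT x|M. \<bar>a * f x\<bar> ^ p) = \<bar>a\<bar> ^ p * (LINT x|M. \<bar>f x\<bar> ^ p)"
  by (simp add: abs_mult power_mult_distrib)
 moreover have "p > 0" using p by auto
 ultimately show ?thesis by (simp add: Lnorm_def real_root_mult real_root_power_cancel)
qed

lemma nrm_triangle:
 assumes "f \<in> Lp" "g \<in> Lp"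
 shows "nrm (\<lambda>x. f x + g x) \<le> nrm f + nrm g"
 using p
proof
 assume p1: "p = 1"
 have i: "integrable M f" "integrable M g" using assms by (simp_all only: p1 Lspace1_iff)
 have "(LINT x|M. \<bar>f x + g x\<bar>) \<le> (LINT x|M. \<bar>f x\<bar> + \<bar>g x\<bar>)"
  using i by (intro integral_mono) auto
 also have "\<dots> = (LINT x|M. \<bar>f x\<bar>) + (LINT x|M. \<bar>g x\<bar>)" using i by simp
 finally show ?thesis by (simp only: p1 Lnorm1_eq)
next
 assume p2: "p = 2"
 have L: "f \<in> Lspace 2 M" "g \<in> Lspace 2 M" using assms by (simp_all add: p2)
 let ?a = "LINT x|M. (f x)\<^sup>2" and ?b = "LINT x|M. (g x)\<^sup>2"
 have nn: "0 \<le> ?a" "0 \<le> ?b" by (auto intro: integral_nonneg_AE)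
 have "(LINT x|M. (f x + g x)\<^sup>2) = (LINT x|M. (f x)\<^sup>2 + 2 * (f x * g x) + (g x)\<^sup>2)"
  by (intro Bochner_Integration.integral_cong) (auto simp: power2_eq_square algebra_simps)
 also have "\<dots> = ?a + 2 * (LINT x|M. f x * g x) + ?b"
  using L Lspace2_mult_integrable[OF L] by (simp add: Lspace2_iff)
 also have "\<dots> \<le> ?a + 2 * (sqrt ?a * sqrt ?b) + ?b"
  using Lspace2_Cauchy_Schwarz_abs[OF L] by simp
 also have "\<dots> = (sqrt ?a + sqrt ?b)\<^sup>2" using nn by (simp add: power2_sum)
 finally have "sqrt (LINT x|M. (f x + g x)\<^sup>2) \<le> sqrt ?a + sqrt ?b"
  using nn by (intro real_le_lsqrt) auto
 then show ?thesis by (simp add: p2 Lnorm2_eq)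
qed

lemma nrm_diff_triangle:
 assumes "f \<in> Lp" "g \<in> Lp" "h \<in> Lp"
 shows "nrm (\<lambda>x. f x - g x) \<le> nrm (\<lambda>x. f x - h x) + nrm (\<lambda>x. h x - g x)"
 using nrm_triangle[OF Lp_diff[OF assms(1,3)] Lp_diff[OF assms(3,2)]] by simp

lemma nrm_diff_commute: "nrm (\<lambda>x. f x - g x) = nrm (\<lambda>x. g x - f x)"
 using nrm_scale[of "-1" "\<lambda>x. f x - g x"] by simp

lemma nrm_zero: "nrm (\<lambda>_. 0) = 0"
 using nrm_scale[of 0 "\<lambda>_. 0"] by simp

lemma nrm_sum:
 "finite I \<Longrightarrow> (\<And>i. i \<in> I \<Longrightarrow> f i \<in> Lp) \<Longrightarrow> nrm (\<lambda>x. \<Sum>i\<in>I. f i x) \<le> (\<Sum>i\<in>I. nrm (f i))"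
proof (induction I rule: finite_induct)
 case empty then show ?case by (simp add: nrm_zero)
next
 case (insert i I)
 have "nrm (\<lambda>x. f i x + (\<Sum>i\<in>I. f i x)) \<le> nrm (f i) + nrm (\<lambda>x. \<Sum>i\<in>I. f i x)"
  using insert by (intro nrm_triangle Lp_sum) auto
 also have "\<dots> \<le> nrm (f i) + (\<Sum>i\<in>I. nrm (f i))" using insert by simp
 finally show ?case using insert(1,2) by simp
qed

text \<open>An embedding constant of \<open>Lp\<close> into L1 for both exponents: the summand 1
  serves \<open>p = 1\<close>, the square root \<open>p = 2\<close>.\<close>

definition "K1 = 1 + sqrt (measure M (space M))"

lemma K1_pos: "K1 > 0" by (simp add: K1_def add_pos_nonneg)

lemma L1_le_nrm:
 assumes "f \<in> Lp"
 shows "integrable M f" "(LINT x|M. \<bar>f x\<bar>) \<le> K1 * nrm f"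
proof -
 have "integrable M f \<and> (LINT x|M. \<bar>f x\<bar>) \<le> K1 * nrm f"
  using p
 proof
  assume p1: "p = 1"
  have "1 * nrm f \<le> K1 * nrm f" by (intro mult_right_mono nrm_nonneg) (simp add: K1_def)
  then show ?thesis using assms by (simp only: p1 Lspace1_iff Lnorm1_eq) simp
 next
  assume p2: "p = 2"
  have L: "f \<in> Lspace 2 M" "(\<lambda>x. \<bar>f x\<bar>) \<in> Lspace 2 M" "(\<lambda>_. 1) \<in> Lspace 2 M" using assms by (auto simp: p2 Lspace2_iff)
  have "\<bar>LINT x|M. \<bar>f x\<bar> * 1\<bar> \<le> sqrt (LINT x|M. \<bar>f x\<bar>\<^sup>2) * sqrt (LINT x|M. 1\<^sup>2)"
   by (rule Lspace2_Cauchy_Schwarz_abs[OF L(2,3)])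
  then have "(LINT x|M. \<bar>f x\<bar>) \<le> nrm f * sqrt (measure M (space M))"
   by (simp add: p2 Lnorm2_eq)
  also have "\<dots> \<le> K1 * nrm f" using nrm_nonneg[of f] by (simp add: K1_def algebra_simps)
  finally show ?thesis using Lspace2_mult_integrable[OF L(1,3)] by simp
 qed
 then show "integrable M f" "(LINT x|M. \<bar>f x\<bar>) \<le> K1 * nrm f" by auto
qed

lemma nrm_tendsto_bounded:
 assumes f: "\<And>n. f n \<in> borel_measurable M" "\<And>n. AE x in M. \<bar>f n x\<bar> \<le> c"
  and lim: "((\<lambda>n. LINT x|M. \<bar>f n x\<bar>) \<longlongrightarrow> 0) F"
 shows "((\<lambda>n. nrm (f n)) \<longlongrightarrow> 0) F"
 using p
proof
 assume "p = 1" then show ?thesis using lim by (simp only: Lnorm1_eq)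
next
 assume p2: "p = 2"
 have "((\<lambda>n. sqrt (\<bar>c\<bar> * (LINT x|M. \<bar>f n x\<bar>))) \<longlongrightarrow> sqrt (\<bar>c\<bar> * 0)) F"
  by (intro tendsto_intros lim)
 then have l: "((\<lambda>n. sqrt (\<bar>c\<bar> * (LINT x|M. \<bar>f n x\<bar>))) \<longlongrightarrow> 0) F" by simp
 show ?thesis
 proof (rule Lim_null_comparison[OF always_eventually[OF allI] l])
  fix n
  have i: "integrable M (f n)" by (rule L1_le_nrm[OF Lp_bounded[OF f]])
  have "(LINT x|M. (f n x)\<^sup>2) \<le> (LINT x|M. \<bar>c\<bar> * \<bar>f n x\<bar>)"
  proof (rule integral_mono_AE)
   show "integrable M (\<lambda>x. (f n x)\<^sup>2)" using Lp_bounded[OF f, of n] by (simp add: p2 Lspace2_iff)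
   show "AE x in M. (f n x)\<^sup>2 \<le> \<bar>c\<bar> * \<bar>f n x\<bar>"
    using f(2)[of n]
   proof eventually_elim
    case (elim x)
    have "(f n x)\<^sup>2 = \<bar>f n x\<bar> * \<bar>f n x\<bar>" by (simp add: power2_eq_square)
    also have "\<dots> \<le> \<bar>c\<bar> * \<bar>f n x\<bar>" using elim by (intro mult_right_mono) auto
    finally show ?case .
   qed
  qed (use i in simp)
  then show "norm (nrm (f n)) \<le> sqrt (\<bar>c\<bar> * (LINT x|M. \<bar>f n x\<bar>))"
   using nrm_nonneg[of "f n"] by (simp add: p2 Lnorm2_eq)
 qed
qed

text \<open>Completeness that keeps the bound \<open>c\<close>: a subsequence converges almost
  everywhere because the sequence is Cauchy in L1, its limit inherits the bound, and dominated
  convergence together with the Cauchy property returns to the norm.\<close>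

lemma bounded_complete:
 assumes R: "\<And>j. R j \<in> borel_measurable M" "\<And>j::nat. AE x in M. \<bar>R j x\<bar> \<le> c"
  and cau: "\<And>e. e > 0 \<Longrightarrow> \<exists>n0. \<forall>i\<ge>n0. \<forall>j\<ge>n0. nrm (\<lambda>x. R i x - R j x) < e"
 obtains R' where "R' \<in> borel_measurable M" "AE x in M. \<bar>R' x\<bar> \<le> c" "(\<lambda>j. nrm (\<lambda>x. R j x - R' x)) \<longlonglongrightarrow> 0"
proof -
 have Lp: "R j \<in> Lp" for j by (rule Lp_bounded[OF R])
 have cauL1: "\<exists>n0. \<forall>i\<ge>n0. \<forall>j\<ge>n0. (LINT x|M. norm (R i x - R j x)) < e" if e: "e > 0" for e
 proof -
  have "0 < e / K1" using K1_pos e by simp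
  then obtain n0 where n0: "\<And>i j. i \<ge> n0 \<Longrightarrow> j \<ge> n0 \<Longrightarrow> nrm (\<lambda>x. R i x - R j x) < e / K1"
   using cau by blast
  have "(LINT x|M. norm (R i x - R j x)) < e" if "i \<ge> n0" "j \<ge> n0" for i j
  proof -
   have "(LINT x|M. \<bar>R i x - R j x\<bar>) \<le> K1 * nrm (\<lambda>x. R i x - R j x)" by (rule L1_le_nrm(2)[OF Lp_diff[OF Lp Lp]])
   also have "\<dots> < e" using n0[OF that] K1_pos by (simp add: pos_less_divide_eq mult.commute)
   finally show ?thesis by simp
  qed
  then show ?thesis by blast
 qed
 obtain r where r: "strict_mono r" and ae: "AE x in M. Cauchy (\<lambda>i. R (r i) x)"
  by (rule cauchy_L1_AE_cauchy_subseq[OF L1_le_nrm(1)[OF Lp] cauL1]) blast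
 have conv: "AE x in M. convergent (\<lambda>k. R (r k) x)" using ae by eventually_elim (simp add: Cauchy_convergent_iff)
 define R' where "R' = (\<lambda>x. lim (\<lambda>k. R (r k) x))"
 have lim: "AE x in M. (\<lambda>k. R (r k) x) \<longlonglongrightarrow> R' x"
  using conv by eventually_elim (simp add: R'_def convergent_LIMSEQ_iff)
 have R'm: "R' \<in> borel_measurable M" unfolding R'_def using R(1) by (intro borel_measurable_lim_metric)
 have "AE x in M. \<forall>k. \<bar>R (r k) x\<bar> \<le> c" using R(2) by (simp add: AE_all_countable)
 then have R'b: "AE x in M. \<bar>R' x\<bar> \<le> c"
  using lim
 proof eventually_elim
  case (elim x)
  show ?case by (rule LIMSEQ_le_const2[OF tendsto_rabs[OF elim(2)]]) (use elim(1) in auto)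
 qed
 have R'L: "R' \<in> Lp" by (rule Lp_bounded[OF R'm R'b])
 have db: "AE x in M. \<bar>R j x - R' x\<bar> \<le> 2 * c" for j
  using R(2)[of j] R'b by eventually_elim linarith
 have "(\<lambda>k. LINT x|M. \<bar>R (r k) x - R' x\<bar>) \<longlonglongrightarrow> (LINT x|M. 0)"
 proof (rule integral_dominated_convergence[where w = "\<lambda>_. 2 * c"])
  show "AE x in M. (\<lambda>k. \<bar>R (r k) x - R' x\<bar>) \<longlonglongrightarrow> 0"
   using lim by eventually_elim (auto dest: LIM_zero intro: tendsto_rabs_zero)
  show "AE x in M. norm \<bar>R (r k) x - R' x\<bar> \<le> 2 * c" for k using db[of "r k"] by simp
 qed (use R(1) R'm in auto)
 then have l0: "(\<lambda>k. nrm (\<lambda>x. R (r k) x - R' x)) \<longlonglongrightarrow> 0"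
  using R(1) R'm by (intro nrm_tendsto_bounded[of _ "2 * c"] db) auto
 have sub: "\<exists>k0. \<forall>k\<ge>k0. nrm (\<lambda>x. R (r k) x - R' x) < e" if "e > 0" for e
  using order_tendstoD(2)[OF l0 that] unfolding eventually_sequentially by blast
 have "(\<lambda>j. nrm (\<lambda>x. R j x - R' x)) \<longlonglongrightarrow> 0"
 proof (rule LIMSEQ_I)
  fix e :: real assume e: "0 < e"
  obtain n0 where n0: "\<And>i j. i \<ge> n0 \<Longrightarrow> j \<ge> n0 \<Longrightarrow> nrm (\<lambda>x. R i x - R j x) < e / 2" using cau[of "e / 2"] e by auto
  obtain k0 where k0: "\<And>k. k \<ge> k0 \<Longrightarrow> nrm (\<lambda>x. R (r k) x - R' x) < e / 2" using sub[of "e / 2"] e by auto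
  have "norm (nrm (\<lambda>x. R j x - R' x) - 0) < e" if j: "j \<ge> n0" for j
  proof -
   let ?k = "max k0 n0"
   have "nrm (\<lambda>x. R j x - R' x) \<le> nrm (\<lambda>x. R j x - R (r ?k) x) + nrm (\<lambda>x. R (r ?k) x - R' x)"
    by (rule nrm_diff_triangle[OF Lp R'L Lp])
   also have "\<dots> < e / 2 + e / 2"
    using j seq_suble[OF r, of ?k] by (intro add_strict_mono n0 k0) auto
   finally show ?thesis using nrm_nonneg by simp
  qed
  then show "\<exists>no. \<forall>n\<ge>no. norm (nrm (\<lambda>x. R n x - R' x) - 0) < e" by blast
 qed
 then show thesis using R'm R'b that by blast
qed

text \<open>The semigroup is given for positive times only. Time 0 is made the identity, in
  agreement with \<open>approx_op\<close>.\<close>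

definition Sx :: "real \<Rightarrow> ('a \<Rightarrow> real) \<Rightarrow> 'a \<Rightarrow> real" where
 "Sx s f = (if s = 0 then f else S s f)"

lemma S_clauses:
 "t > 0 \<Longrightarrow> ae_linear_on M Lp (S t)"
 "t > 0 \<Longrightarrow> f \<in> Lp \<Longrightarrow> S t f \<in> Lp"
 "t > 0 \<Longrightarrow> f \<in> Lp \<Longrightarrow> nrm (S t f) \<le> nrm f"
 "s > 0 \<Longrightarrow> t > 0 \<Longrightarrow> f \<in> Lp \<Longrightarrow> AE x in M. S (s + t) f x = S s (S t f) x"
 "f \<in> Lp \<Longrightarrow> ((\<lambda>t. nrm (\<lambda>x. S t f x - f x)) \<longlongrightarrow> 0) (at_right 0)"
 using C0 unfolding C0_contraction_semigroup_def by blast+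

lemma Sx_Lp: "s \<ge> 0 \<Longrightarrow> f \<in> Lp \<Longrightarrow> Sx s f \<in> Lp"
 using S_clauses(2)[of s f] by (simp add: Sx_def)

lemma Sx_meas: "s \<ge> 0 \<Longrightarrow> f \<in> Lp \<Longrightarrow> Sx s f \<in> borel_measurable M"
 by (rule Lp_meas[OF Sx_Lp])

lemma Sx_nrm: "s \<ge> 0 \<Longrightarrow> f \<in> Lp \<Longrightarrow> nrm (Sx s f) \<le> nrm f"
 using S_clauses(3)[of s f] by (simp add: Sx_def)

lemma Sx_lin:
 assumes "s \<ge> 0" "f \<in> Lp" "g \<in> Lp"
 shows "AE x in M. Sx s (\<lambda>y. a * f y + b * g y) x = a * Sx s f x + b * Sx s g x"
proof (cases "s = 0")
 case False
 then have "ae_linear_on M Lp (S s)" using S_clauses(1)[of s] assms by simp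
 then show ?thesis using assms False unfolding ae_linear_on_def by (simp add: Sx_def)
qed (simp add: Sx_def)

lemma Sx_add:
 assumes "s \<ge> 0" "t \<ge> 0" "f \<in> Lp"
 shows "AE x in M. Sx (s + t) f x = Sx s (Sx t f) x"
 using S_clauses(4)[of s t f] assms by (auto simp: Sx_def)

lemma Sx_diff:
 assumes "s \<ge> 0" "f \<in> Lp" "g \<in> Lp"
 shows "AE x in M. Sx s (\<lambda>y. f y - g y) x = Sx s f x - Sx s g x"
 using Sx_lin[OF assms, of 1 "-1"] by simp

lemma Sx_dist:
 assumes "s \<ge> 0" "f \<in> Lp" "g \<in> Lp"
 shows "nrm (\<lambda>x. Sx s f x - Sx s g x) \<le> nrm (\<lambda>x. f x - g x)"
proof -
 have "nrm (\<lambda>x. Sx s f x - Sx s g x) = nrm (Sx s (\<lambda>x. f x - g x))"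
  using Sx_diff[OF assms] by (intro nrm_cong Lp_meas Lp_diff Sx_Lp assms) auto
 also have "\<dots> \<le> nrm (\<lambda>x. f x - g x)" by (intro Sx_nrm Lp_diff assms)
 finally show ?thesis .
qed

text \<open>Contractivity removes the common initial time \<open>r\<close>, so continuity at time 0
  becomes continuity uniform in time.\<close>

lemma Sx_time:
 assumes "0 \<le> r" "r \<le> s" "f \<in> Lp"
 shows "nrm (\<lambda>x. Sx s f x - Sx r f x) \<le> nrm (\<lambda>x. Sx (s - r) f x - f x)"
proof -
 have ae: "AE x in M. Sx s f x = Sx r (Sx (s - r) f) x" using Sx_add[of r "s - r" f] assms by simp
 have "nrm (\<lambda>x. Sx s f x - Sx r f x) = nrm (\<lambda>x. Sx r (Sx (s - r) f) x - Sx r f x)"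
  using ae assms by (intro nrm_cong Lp_meas Lp_diff Sx_Lp) auto
 also have "\<dots> \<le> nrm (\<lambda>x. Sx (s - r) f x - f x)" using assms by (intro Sx_dist Sx_Lp) auto
 finally show ?thesis .
qed

lemma Sx_small:
 assumes "f \<in> Lp" "e > 0"
 obtains d where "d > 0" "\<And>s. 0 \<le> s \<Longrightarrow> s < d \<Longrightarrow> nrm (\<lambda>x. Sx s f x - f x) < e"
proof -
 have "eventually (\<lambda>t. nrm (\<lambda>x. S t f x - f x) < e) (at_right 0)"
  by (rule order_tendstoD(2)[OF S_clauses(5)[OF assms(1)] assms(2)])
 then obtain d where d: "d > 0" "\<And>s. 0 < s \<Longrightarrow> s < d \<Longrightarrow> nrm (\<lambda>x. S s f x - f x) < e"
  unfolding eventually_at_right_field by auto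
 have "nrm (\<lambda>x. Sx s f x - f x) < e" if "0 \<le> s" "s < d" for s
  using d(2)[of s] that assms(2) by (cases "s = 0") (auto simp: Sx_def nrm_zero)
 then show thesis using d(1) that by blast
qed

lemma Sx_uniform:
 assumes "f \<in> Lp" "e > 0"
 obtains d where "d > 0" "\<And>r s. 0 \<le> r \<Longrightarrow> 0 \<le> s \<Longrightarrow> \<bar>s - r\<bar> < d \<Longrightarrow> nrm (\<lambda>x. Sx s f x - Sx r f x) < e"
proof -
 obtain d where d: "d > 0" "\<And>s. 0 \<le> s \<Longrightarrow> s < d \<Longrightarrow> nrm (\<lambda>x. Sx s f x - f x) < e"
  by (rule Sx_small[OF assms]) blast
 have le: "nrm (\<lambda>x. Sx s f x - Sx r f x) < e" if "0 \<le> r" "r \<le> s" "s - r < d" for r s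
  using Sx_time[OF that(1,2) assms(1)] d(2)[of "s - r"] that by simp
 have "nrm (\<lambda>x. Sx s f x - Sx r f x) < e" if "0 \<le> r" "0 \<le> s" "\<bar>s - r\<bar> < d" for r s
 proof (cases "r \<le> s")
  case True then show ?thesis using le[of r s] that by simp
 next
  case False then show ?thesis using le[of s r] that nrm_diff_commute[of "Sx s f" "Sx r f"] by simp
 qed
 then show thesis using d(1) that by blast
qed

lemma Sx_between:
 assumes f: "f \<in> Lp" "AE x in M. 0 \<le> f x \<and> f x \<le> c" and c: "c > 0" and s: "s \<ge> 0"
 shows "AE x in M. 0 \<le> Sx s f x \<and> Sx s f x \<le> c"
proof (cases "s = 0")
 case True then show ?thesis using f by (simp add: Sx_def)
next
 case False
 have g: "(\<lambda>x. (1/c) * f x) \<in> Lp" by (rule Lp_scale[OF f(1)])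
 have "AE x in M. 0 \<le> (1/c) * f x \<and> (1/c) * f x \<le> 1"
  using f(2) by eventually_elim (use c in \<open>simp add: field_simps\<close>)
 then have "AE x in M. 0 \<le> S s (\<lambda>x. (1/c) * f x) x \<and> S s (\<lambda>x. (1/c) * f x) x \<le> 1"
  using markov g s False unfolding sub_Markovian_def by simp
 moreover have "AE x in M. Sx s (\<lambda>x. (1/c) * f x) x = (1/c) * Sx s f x"
  using Sx_lin[OF s f(1) f(1), of "1/c" 0] by simp
 ultimately show ?thesis
 proof eventually_elim
  case (elim x)
  let ?y = "S s (\<lambda>x. (1/c) * f x) x"
  have "Sx s f x = c * ?y" using elim(2) c False by (simp add: Sx_def)
  moreover have "0 \<le> c * ?y" using elim(1) c by (intro mult_nonneg_nonneg) auto
  moreover have "c * ?y \<le> c * 1" using elim(1) c by (intro mult_left_mono) auto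
  ultimately show ?case by simp
 qed
qed

lemma Sx_bounded:
 assumes f: "f \<in> borel_measurable M" "AE x in M. \<bar>f x\<bar> \<le> c" and c: "c > 0" and s: "s \<ge> 0"
 shows "AE x in M. \<bar>Sx s f x\<bar> \<le> c"
proof -
 let ?p = "\<lambda>x. max (f x) 0" and ?m = "\<lambda>x. max (- f x) 0"
 have b: "AE x in M. 0 \<le> ?p x \<and> ?p x \<le> c" "AE x in M. 0 \<le> ?m x \<and> ?m x \<le> c"
  using f(2) c by (auto elim!: eventually_mono)
 have L: "?p \<in> Lp" "?m \<in> Lp"
  using b f(1) by (auto intro!: Lp_bounded[of _ c] elim: eventually_mono)
 have "(\<lambda>x. ?p x - ?m x) = f" by (auto simp: max_def)
 then have "AE x in M. Sx s f x = Sx s ?p x - Sx s ?m x" using Sx_diff[OF s L] by simp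
 then show ?thesis using Sx_between[OF L(1) b(1) c s] Sx_between[OF L(2) b(2) c s]
  by eventually_elim auto
qed

lemma Sx_mono:
 assumes f: "f \<in> borel_measurable M" "AE x in M. \<bar>f x\<bar> \<le> c" and g: "g \<in> borel_measurable M" "AE x in M. \<bar>g x\<bar> \<le> c"
  and le: "AE x in M. f x \<le> g x" and c: "c > 0" and s: "s \<ge> 0"
 shows "AE x in M. Sx s f x \<le> Sx s g x"
proof -
 have L: "f \<in> Lp" "g \<in> Lp" using f g by (auto intro: Lp_bounded)
 have "AE x in M. 0 \<le> g x - f x \<and> g x - f x \<le> 2 * c" using f(2) g(2) le by eventually_elim auto
 from Sx_between[OF Lp_diff[OF L(2,1)] this _ s] c
 have "AE x in M. 0 \<le> Sx s (\<lambda>x. g x - f x) x \<and> Sx s (\<lambda>x. g x - f x) x \<le> 2 * c" by simp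
 then show ?thesis using Sx_diff[OF s L(2,1)] by eventually_elim simp
qed

end

lemma sum_div_group:
 fixes f :: "nat \<Rightarrow> real"
 assumes "q > 0"
 shows "(\<Sum>l<N * q. f (l div q)) = real q * (\<Sum>i<N. f i)"
proof -
 have "(\<Sum>l<N * q. f (l div q)) = (\<Sum>i<N. \<Sum>l = i * q..<i * q + q. f (l div q))"
  by (rule sum.nat_group[symmetric])
 also have "\<dots> = (\<Sum>i<N. \<Sum>l = i * q..<i * q + q. f i)"
 proof (intro sum.cong refl)
  fix i l assume "l \<in> {i * q..<i * q + q}"
  then have "l div q = i" using assms by (intro div_nat_eqI) (auto simp: algebra_simps)
  then show "f (l div q) = f i" by simp
 qed
 also have "\<dots> = real q * (\<Sum>i<N. f i)" by (simp add: sum_distrib_left)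
 finally show ?thesis .
qed

text \<open>A window of length \<open>n\<close> shifted by \<open>m\<close> changes only at its two
  ends; this is how a long average is differentiated.\<close>

lemma sum_shift_difference:
 fixes f :: "nat \<Rightarrow> real"
 shows "(\<Sum>i<n. f (m + i)) - (\<Sum>i<n. f i) = (\<Sum>i<m. f (n + i)) - (\<Sum>i<m. f i)"
proof -
 have split: "(\<Sum>i<a + b. f i) = (\<Sum>i<a. f i) + (\<Sum>i<b. f (a + i))" for a b
  by (induction b) (simp_all add: add.assoc)
 show ?thesis using split[of n m] split[of m n] by (simp add: add.commute)
qed

section \<open>Density of bounded functions in the domain of the generator\<close>

context contraction_semigroup
begin

lemma Sx_sum:
 assumes "s \<ge> 0" "finite I" "\<And>i. i \<in> I \<Longrightarrow> f i \<in> Lp"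
 shows "AE x in M. Sx s (\<lambda>y. a * (\<Sum>i\<in>I. f i y)) x = a * (\<Sum>i\<in>I. Sx s (f i) x)"
 using assms(2,3)
proof (induction I rule: finite_induct)
 case empty
 have "AE x in M. Sx s (\<lambda>y. 0 * 0 + 0 * 0) x = 0 * Sx s (\<lambda>_. 0) x + 0 * Sx s (\<lambda>_. 0) x"
  by (rule Sx_lin[OF assms(1) Lp_zero Lp_zero])
 then show ?case by simp
next
 case (insert i I)
 have L: "f i \<in> Lp" "(\<lambda>y. a * (\<Sum>i\<in>I. f i y)) \<in> Lp" using insert by (auto intro!: Lp_scale Lp_sum)
 have eq: "(\<lambda>y. a * (\<Sum>i\<in>insert i I. f i y)) = (\<lambda>y. a * f i y + 1 * (a * (\<Sum>i\<in>I. f i y)))"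
  using insert by (simp add: distrib_left)
 have IH: "AE x in M. Sx s (\<lambda>y. a * (\<Sum>i\<in>I. f i y)) x = a * (\<Sum>i\<in>I. Sx s (f i) x)"
  using insert by blast
 show ?case unfolding eq
  using Sx_lin[OF assms(1) L, of a 1] IH
 proof eventually_elim
  case (elim x) then show ?case using insert(1,2) by (simp add: distrib_left)
 qed
qed

lemma nrm_average:
 assumes "\<And>i. i < N \<Longrightarrow> f i \<in> Lp" "\<And>i. i < N \<Longrightarrow> nrm (f i) \<le> e" "n > 0"
 shows "nrm (\<lambda>x. 1 / n * (\<Sum>i<N. f i x)) \<le> real N / n * e"
proof -
 have "nrm (\<lambda>x. \<Sum>i<N. f i x) \<le> (\<Sum>i<N. nrm (f i))" using assms(1) by (intro nrm_sum) auto
 also have "\<dots> \<le> real N * e" using sum_mono[of "{..<N}" "\<lambda>i. nrm (f i)" "\<lambda>_. e"] assms(2) by simp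
 finally show ?thesis unfolding nrm_scale using assms(3) by (simp add: field_simps)
qed

text \<open>\<open>R\<close> is the average of \<open>S\<^sub>s g\<close> over \<open>0 \<le> s \<le> b\<close>, built from Riemann sums to avoid vector valued integrals.\<close>

lemma averages:
 assumes g: "g \<in> borel_measurable M" "AE x in M. \<bar>g x\<bar> \<le> c" and c: "c > 0" and b: "b > 0"
  and small: "\<And>s. 0 \<le> s \<Longrightarrow> s \<le> b \<Longrightarrow> nrm (\<lambda>x. Sx s g x - g x) \<le> e0"
 obtains R where "R \<in> gen_dom p M S" "AE x in M. \<bar>R x\<bar> \<le> c" "nrm (\<lambda>x. R x - g x) \<le> e0"
proof -
 have gL: "g \<in> Lp" by (rule Lp_bounded[OF g])
 define \<delta> where "\<delta> = (\<lambda>j::nat. b / 2 ^ j)"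
 have \<delta>: "\<delta> j > 0" "2 ^ j * \<delta> j = b" for j using b by (auto simp: \<delta>_def)
 have \<delta>0: "\<delta> \<longlonglongrightarrow> 0"
  using tendsto_mult_right_zero[OF LIMSEQ_realpow_zero[of "1/2"], of b] unfolding \<delta>_def by (simp add: power_divide)
 let ?T = "\<lambda>i j. Sx (real i * \<delta> j) g"
 define A where "A = (\<lambda>j x. 1 / 2 ^ j * (\<Sum>i<2 ^ j. ?T i j x))"
 have SgL: "?T i j \<in> Lp" for i j using \<delta>(1)[of j] gL by (intro Sx_Lp) auto
 have AL: "A j \<in> Lp" for j unfolding A_def by (intro Lp_scale Lp_sum SgL) auto
 have Ab: "AE x in M. \<bar>A j x\<bar> \<le> c" for j
 proof -
  have "AE x in M. \<forall>i. \<bar>?T i j x\<bar> \<le> c"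
   unfolding AE_all_countable using \<delta>(1)[of j] by (intro allI Sx_bounded[OF g c]) auto
  then show ?thesis
  proof eventually_elim
   case (elim x)
   have "\<bar>\<Sum>i<2 ^ j. ?T i j x\<bar> \<le> (\<Sum>i<(2::nat) ^ j. c)"
    by (rule order_trans[OF sum_abs sum_mono]) (use elim in blast)
   then have "\<bar>\<Sum>i<2 ^ j. ?T i j x\<bar> \<le> 2 ^ j * c" by simp
   then show ?case unfolding A_def abs_mult by (simp add: field_simps)
  qed
 qed
 \<comment> \<open>A coarse average is a fine one with each time rounded down to the coarse mesh, so
   uniform continuity in time controls the difference.\<close>
 have refine: "nrm (\<lambda>x. A k x - A j x) \<le> e" if jk: "j \<le> k"
  and d: "\<And>r s. 0 \<le> r \<Longrightarrow> 0 \<le> s \<Longrightarrow> \<bar>s - r\<bar> < d \<Longrightarrow> nrm (\<lambda>x. Sx s g x - Sx r g x) < e" and dj: "\<delta> j < d" for j k d e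
 proof -
  define q :: nat where "q = 2 ^ (k - j)"
  have q: "q > 0" "(2::nat) ^ k = 2 ^ j * q" "(2::real) ^ k = 2 ^ j * real q"
   using jk by (auto simp: q_def simp flip: power_add)
  have \<delta>q: "\<delta> j = real q * \<delta> k" using q(3) by (simp add: \<delta>_def q(1))
  have Aj: "A j x = 1 / 2 ^ k * (\<Sum>l<2 ^ k. ?T (l div q) j x)" for x
   unfolding A_def q(2) sum_div_group[OF q(1), of "\<lambda>i. ?T i j x"] using q(1) by (simp add: q(3))
  have "nrm (\<lambda>x. A k x - A j x) = nrm (\<lambda>x. 1 / 2 ^ k * (\<Sum>l<2 ^ k. ?T l k x - ?T (l div q) j x))"
   unfolding Aj by (simp add: A_def sum_subtractf right_diff_distrib)
  also have "\<dots> \<le> real (2 ^ k) / 2 ^ k * e"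
  proof (rule nrm_average)
   fix l :: nat
   show "(\<lambda>x. ?T l k x - ?T (l div q) j x) \<in> Lp" by (intro Lp_diff SgL)
   have le: "l div q * q \<le> l" by simp
   have lt: "l < l div q * q + q" using q(1) by (metis div_mult_mod_eq mod_less_divisor add_strict_left_mono)
   have "real (l div q) * \<delta> j = real (l div q * q) * \<delta> k" by (simp add: \<delta>q)
   moreover have "real l * \<delta> k - real (l div q * q) * \<delta> k = (real l - real (l div q * q)) * \<delta> k" by (simp add: left_diff_distrib)
   moreover have "(real l - real (l div q * q)) * \<delta> k \<le> real q * \<delta> k"
   proof (rule mult_right_mono)
    show "real l - real (l div q * q) \<le> real q" using lt by linarith
   qed (use \<delta>(1)[of k] in simp)
   moreover have "0 \<le> (real l - real (l div q * q)) * \<delta> k"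
    using le \<delta>(1)[of k] by (intro mult_nonneg_nonneg) (auto simp only: of_nat_le_iff diff_ge_0_iff_ge)
   ultimately have "\<bar>real l * \<delta> k - real (l div q) * \<delta> j\<bar> < d" using dj \<delta>q by simp
   then have "nrm (\<lambda>x. ?T l k x - ?T (l div q) j x) < e"
    using \<delta>(1)[of k] \<delta>(1)[of j] by (intro d) auto
   then show "nrm (\<lambda>x. ?T l k x - ?T (l div q) j x) \<le> e" by simp
  qed simp
  finally show ?thesis by simp
 qed
 have cau: "\<exists>n0. \<forall>i\<ge>n0. \<forall>j\<ge>n0. nrm (\<lambda>x. A i x - A j x) < e" if e: "e > 0" for e
 proof -
  obtain d where d: "d > 0" "\<And>r s. 0 \<le> r \<Longrightarrow> 0 \<le> s \<Longrightarrow> \<bar>s - r\<bar> < d \<Longrightarrow> nrm (\<lambda>x. Sx s g x - Sx r g x) < e / 3"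
   by (rule Sx_uniform[OF gL, of "e / 3"]) (use e in auto)
  obtain n0 where n0: "\<delta> n0 < d"
   using order_tendstoD(2)[OF \<delta>0 d(1)] unfolding eventually_sequentially by blast
  have "nrm (\<lambda>x. A i x - A j x) < e" if "i \<ge> n0" "j \<ge> n0" for i j
  proof -
   have "nrm (\<lambda>x. A i x - A j x) \<le> nrm (\<lambda>x. A i x - A n0 x) + nrm (\<lambda>x. A n0 x - A j x)"
    by (rule nrm_diff_triangle[OF AL AL AL])
   also have "\<dots> \<le> e / 3 + e / 3"
    using refine[OF that(1) d(2) n0] refine[OF that(2) d(2) n0] nrm_diff_commute[of "A n0" "A j"] by simp
   finally show ?thesis using e by simp
  qed
  then show ?thesis by blast
 qed
 obtain R where R: "R \<in> borel_measurable M" "AE x in M. \<bar>R x\<bar> \<le> c" "(\<lambda>j. nrm (\<lambda>x. A j x - R x)) \<longlonglongrightarrow> 0"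
  by (rule bounded_complete[OF Lp_meas[OF AL] Ab cau]) blast
 have RL: "R \<in> Lp" by (rule Lp_bounded[OF R(1,2)])
 have "nrm (\<lambda>x. A j x - g x) \<le> e0" for j
 proof -
  have "nrm (\<lambda>x. A j x - g x) = nrm (\<lambda>x. 1 / 2 ^ j * (\<Sum>i<2 ^ j. ?T i j x - g x))"
   by (simp add: A_def sum_subtractf right_diff_distrib)
  also have "\<dots> \<le> real (2 ^ j) / 2 ^ j * e0"
  proof (rule nrm_average)
   fix i :: nat assume "i < 2 ^ j"
   then have "real i * \<delta> j \<le> 2 ^ j * \<delta> j" using \<delta>(1)[of j] by (intro mult_right_mono) (auto simp: less_imp_le)
   then show "nrm (\<lambda>x. ?T i j x - g x) \<le> e0" using \<delta>[of j] by (intro small) auto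
   show "(\<lambda>x. ?T i j x - g x) \<in> Lp" by (intro Lp_diff SgL gL)
  qed simp
  finally show ?thesis by simp
 qed
 then have le: "nrm (\<lambda>x. R x - g x) \<le> nrm (\<lambda>x. A j x - R x) + e0" for j
  using nrm_diff_triangle[OF RL gL AL, of j] nrm_diff_commute[of R "A j"] add_left_mono by (metis order_trans)
 have "(\<lambda>j. nrm (\<lambda>x. A j x - R x) + e0) \<longlonglongrightarrow> 0 + e0" by (intro tendsto_intros R(3))
 then have Rg: "nrm (\<lambda>x. R x - g x) \<le> e0" using LIMSEQ_le_const[of "\<lambda>j. nrm (\<lambda>x. A j x - R x) + e0" "0 + e0" "nrm (\<lambda>x. R x - g x)"] le by auto
 \<comment> \<open>\<open>k\<close> divided by \<open>b\<close> will be the value of the generator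
   at the average, as in the fundamental theorem of calculus.\<close>
 define k where "k = (\<lambda>x. Sx b g x - g x)"
 have kL: "k \<in> Lp" unfolding k_def using b gL by (intro Lp_diff Sx_Lp) auto
 \<comment> \<open>For fixed \<open>h\<close> the discretisation error \<eta> is made arbitrarily
   small by refining the mesh; what remains is \<open>h * e\<close>, still small after division by
   \<open>h\<close>.\<close>
 have key: "nrm (\<lambda>x. (Sx h R x - R x) - h / b * k x) \<le> h * e + \<eta>"
  if h: "0 < h" "h < d" "h < b" and d: "\<And>s. 0 \<le> s \<Longrightarrow> s < d \<Longrightarrow> nrm (\<lambda>x. Sx s k x - k x) < e * b" and \<eta>: "\<eta> > 0" for h d e \<eta>
 proof -
  have "nrm (\<lambda>x. Sx 0 k x - k x) < e * b" by (rule d) (use h in simp_all)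
  then have "0 < e * b" using nrm_nonneg[of "\<lambda>x. Sx 0 k x - k x"] by linarith
  then have e: "e > 0" using b by (simp add: zero_less_mult_iff)
  obtain d' where d': "d' > 0" "\<And>s. 0 \<le> s \<Longrightarrow> s < d' \<Longrightarrow> nrm (\<lambda>x. Sx s g x - g x) < \<eta> / 4"
   by (rule Sx_small[OF gL, of "\<eta> / 4"]) (use \<eta> in auto)
  have "eventually (\<lambda>j. \<delta> j * (nrm k / b) < \<eta> / 4) sequentially"
   using \<eta> by (intro order_tendstoD(2)[OF tendsto_mult_left_zero[OF \<delta>0]]) simp
  moreover have "eventually (\<lambda>j. \<delta> j < d') sequentially" by (rule order_tendstoD(2)[OF \<delta>0 d'(1)])
  moreover have "eventually (\<lambda>j. nrm (\<lambda>x. A j x - R x) < \<eta> / 4) sequentially"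
   using \<eta> by (intro order_tendstoD(2)[OF R(3)]) simp
  ultimately have "eventually (\<lambda>j. \<delta> j * (nrm k / b) < \<eta> / 4 \<and> \<delta> j < d' \<and> nrm (\<lambda>x. A j x - R x) < \<eta> / 4) sequentially"
   by (intro eventually_conj)
  then obtain j where j: "\<delta> j * (nrm k / b) < \<eta> / 4" "\<delta> j < d'" "nrm (\<lambda>x. A j x - R x) < \<eta> / 4"
   unfolding eventually_sequentially by blast
  \<comment> \<open>The number of mesh steps that fit into \<open>h\<close>: shifting the index by
    \<open>m\<close> is a time shift by \<open>h\<close> up to one mesh width.\<close>
  define m where "m = nat \<lfloor>h / \<delta> j\<rfloor>"
  have fl: "real m = of_int \<lfloor>h / \<delta> j\<rfloor>" using h \<delta>(1)[of j] by (simp add: m_def)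
  have "real m \<le> h / \<delta> j" "h / \<delta> j < real m + 1" unfolding fl by linarith+
  then have m: "real m * \<delta> j \<le> h" "h < real m * \<delta> j + \<delta> j"
   using \<delta>(1)[of j] by (simp_all add: field_simps)
  \<comment> \<open>\<open>P0\<close> is the increment of \<open>R\<close> and \<open>P1\<close>
    that of the Riemann sum; \<open>P2\<close> rounds the shift to the mesh, \<open>P3\<close>
    replaces the \<open>m\<close> end terms by \<open>k\<close>, and \<open>P4\<close> puts
    \<open>h\<close> for the length of \<open>m\<close> mesh steps.\<close>
  let ?P0 = "\<lambda>x. Sx h R x - R x" and ?P1 = "\<lambda>x. Sx h (A j) x - A j x"
   and ?P2 = "\<lambda>x. 1 / 2 ^ j * (\<Sum>i<2 ^ j. ?T (m + i) j x - ?T i j x)"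
   and ?P3 = "\<lambda>x. real m / 2 ^ j * k x" and ?P4 = "\<lambda>x. h / b * k x"
  have PL: "?P0 \<in> Lp" "?P1 \<in> Lp" "?P2 \<in> Lp" "?P3 \<in> Lp" "?P4 \<in> Lp"
   by ((intro Lp_diff Lp_scale Lp_sum SgL RL AL kL Sx_Lp less_imp_le[OF h(1)] finite_lessThan)+)
  have 01: "nrm (\<lambda>x. ?P0 x - ?P1 x) \<le> \<eta> / 2"
  proof -
   have "nrm (\<lambda>x. ?P0 x - ?P1 x) = nrm (\<lambda>x. (Sx h R x - Sx h (A j) x) + (A j x - R x))" by (simp add: algebra_simps)
   also have "\<dots> \<le> nrm (\<lambda>x. Sx h R x - Sx h (A j) x) + nrm (\<lambda>x. A j x - R x)"
    using h by (intro nrm_triangle Lp_diff Sx_Lp RL AL) auto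
   also have "\<dots> \<le> nrm (\<lambda>x. R x - A j x) + nrm (\<lambda>x. A j x - R x)"
    using h by (intro add_right_mono Sx_dist RL AL) auto
   finally show ?thesis using j(3) nrm_diff_commute[of R "A j"] by simp
  qed
  have 12: "nrm (\<lambda>x. ?P1 x - ?P2 x) \<le> \<eta> / 4"
  proof -
   have "AE x in M. Sx h (A j) x = 1 / 2 ^ j * (\<Sum>i<2 ^ j. Sx h (?T i j) x)"
    unfolding A_def using h by (intro Sx_sum SgL) auto
   then have "AE x in M. ?P1 x - ?P2 x = 1 / 2 ^ j * (\<Sum>i<2 ^ j. Sx h (?T i j) x - ?T (m + i) j x)"
    by eventually_elim (simp add: A_def sum_subtractf right_diff_distrib)
   then have "nrm (\<lambda>x. ?P1 x - ?P2 x) = nrm (\<lambda>x. 1 / 2 ^ j * (\<Sum>i<2 ^ j. Sx h (?T i j) x - ?T (m + i) j x))"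
    using h by (intro nrm_cong Lp_meas Lp_diff PL Lp_scale Lp_sum Sx_Lp SgL) auto
   also have "\<dots> \<le> real (2 ^ j) / 2 ^ j * (\<eta> / 4)"
   proof (rule nrm_average)
    fix i :: nat
    have i0: "0 \<le> real i * \<delta> j" using \<delta>(1)[of j] by simp
    have L: "Sx (h + real i * \<delta> j) g \<in> Lp" using h i0 gL by (intro Sx_Lp) auto
    show "(\<lambda>x. Sx h (?T i j) x - ?T (m + i) j x) \<in> Lp"
     using h by (intro Lp_diff Sx_Lp SgL) auto
    have "AE x in M. Sx (h + real i * \<delta> j) g x = Sx h (?T i j) x"
     using h i0 gL by (intro Sx_add) auto
    then have "nrm (\<lambda>x. Sx h (?T i j) x - ?T (m + i) j x)
     = nrm (\<lambda>x. Sx (h + real i * \<delta> j) g x - ?T (m + i) j x)"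
     using h by (intro nrm_cong Lp_meas Lp_diff Sx_Lp SgL L) (auto elim: eventually_mono)
    also have "\<dots> \<le> nrm (\<lambda>x. Sx (h + real i * \<delta> j - real (m + i) * \<delta> j) g x - g x)"
     using m \<delta>(1)[of j] by (intro Sx_time gL) (auto simp: algebra_simps)
    also have "\<dots> < \<eta> / 4"
     using m j(2) by (intro d'(2)) (auto simp: algebra_simps)
    finally have "nrm (\<lambda>x. Sx h (?T i j) x - ?T (m + i) j x) < \<eta> / 4" .
    then show "nrm (\<lambda>x. Sx h (?T i j) x - ?T (m + i) j x) \<le> \<eta> / 4" by simp
   qed simp
   finally show ?thesis by simp
  qed
  have 23: "nrm (\<lambda>x. ?P2 x - ?P3 x) \<le> h * e"
  proof -
   have "?P2 x - ?P3 x = 1 / 2 ^ j * (\<Sum>i<m. ?T (2 ^ j + i) j x - ?T i j x - k x)" for x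
   proof -
    have "(\<Sum>i<2 ^ j. ?T (m + i) j x - ?T i j x)
     = (\<Sum>i<m. ?T (2 ^ j + i) j x - ?T i j x)"
     unfolding sum_subtractf by (rule sum_shift_difference)
    then have "?P2 x = 1 / 2 ^ j * (\<Sum>i<m. ?T (2 ^ j + i) j x - ?T i j x)" by (rule arg_cong)
    moreover have "?P3 x = 1 / 2 ^ j * (\<Sum>i<m. k x)" by simp
    ultimately show ?thesis by (simp only: sum_subtractf right_diff_distrib)
   qed
   then have "nrm (\<lambda>x. ?P2 x - ?P3 x) = nrm (\<lambda>x. 1 / 2 ^ j * (\<Sum>i<m. ?T (2 ^ j + i) j x - ?T i j x - k x))"
    by (simp only:)
   also have "\<dots> \<le> real m / 2 ^ j * (e * b)"
   proof (rule nrm_average)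
    fix i assume i: "i < m"
    show L: "(\<lambda>x. ?T (2 ^ j + i) j x - ?T i j x - k x) \<in> Lp"
     by (intro Lp_diff SgL kL)
    have i0: "0 \<le> real i * \<delta> j" using \<delta>(1)[of j] by simp
    have tm: "real (2 ^ j + i) * \<delta> j = real i * \<delta> j + b" using \<delta>(2)[of j] by (simp add: algebra_simps)
    have "AE x in M. Sx (real i * \<delta> j) k x = Sx (real i * \<delta> j) (Sx b g) x - ?T i j x"
     unfolding k_def using b i0 gL by (intro Sx_diff Sx_Lp) auto
    moreover have "AE x in M. Sx (real i * \<delta> j + b) g x = Sx (real i * \<delta> j) (Sx b g) x"
     using b i0 gL by (intro Sx_add) auto
    ultimately have "AE x in M. ?T (2 ^ j + i) j x - ?T i j x - k x = Sx (real i * \<delta> j) k x - k x"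
     unfolding tm by eventually_elim simp
    then have "nrm (\<lambda>x. ?T (2 ^ j + i) j x - ?T i j x - k x) = nrm (\<lambda>x. Sx (real i * \<delta> j) k x - k x)"
     using i0 by (intro nrm_cong Lp_meas L Lp_diff Sx_Lp kL)
    also have "\<dots> < e * b"
    proof (rule d[OF i0])
     have "real i * \<delta> j \<le> real m * \<delta> j" using i \<delta>(1)[of j] by (intro mult_right_mono) auto
     then show "real i * \<delta> j < d" using m h by linarith
    qed
    finally show "nrm (\<lambda>x. ?T (2 ^ j + i) j x - ?T i j x - k x) \<le> e * b" by simp
   qed simp
   also have "\<dots> = (real m * \<delta> j) * e" using b by (simp add: \<delta>_def)
   also have "\<dots> \<le> h * e" using m e by (intro mult_right_mono) auto
   finally show ?thesis .
  qed
  have 34: "nrm (\<lambda>x. ?P3 x - ?P4 x) \<le> \<eta> / 4"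
  proof -
   have mb: "real m / 2 ^ j = real m * \<delta> j / b" using b by (simp add: \<delta>_def)
   have "nrm (\<lambda>x. ?P3 x - ?P4 x) = \<bar>(real m * \<delta> j - h) / b\<bar> * nrm k"
    unfolding mb nrm_scale[symmetric] by (simp add: diff_divide_distrib left_diff_distrib)
   also have "\<dots> \<le> \<delta> j / b * nrm k"
   proof (rule mult_right_mono[OF _ nrm_nonneg])
    have "\<bar>real m * \<delta> j - h\<bar> \<le> \<delta> j" using m by linarith
    then show "\<bar>(real m * \<delta> j - h) / b\<bar> \<le> \<delta> j / b" using b by (simp add: abs_divide divide_right_mono)
   qed
   also have "\<dots> \<le> \<eta> / 4" using j(1) by simp
   finally show ?thesis .
  qed
  have "nrm (\<lambda>x. ?P0 x - ?P4 x) \<le> nrm (\<lambda>x. ?P0 x - ?P1 x) + nrm (\<lambda>x. ?P1 x - ?P4 x)"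
   by (rule nrm_diff_triangle[OF PL(1,5,2)])
  moreover have "nrm (\<lambda>x. ?P1 x - ?P4 x) \<le> nrm (\<lambda>x. ?P1 x - ?P2 x) + nrm (\<lambda>x. ?P2 x - ?P4 x)"
   by (rule nrm_diff_triangle[OF PL(2,5,3)])
  moreover have "nrm (\<lambda>x. ?P2 x - ?P4 x) \<le> nrm (\<lambda>x. ?P2 x - ?P3 x) + nrm (\<lambda>x. ?P3 x - ?P4 x)"
   by (rule nrm_diff_triangle[OF PL(3,5,4)])
  ultimately show ?thesis using 01 12 23 34 by linarith
 qed
 have "gen_graph p M S R (\<lambda>x. 1 / b * k x)"
  unfolding gen_graph_def
 proof (intro conjI RL Lp_scale kL tendstoI)
  fix e :: real assume e: "0 < e"
  obtain d where d: "d > 0" "\<And>s. 0 \<le> s \<Longrightarrow> s < d \<Longrightarrow> nrm (\<lambda>x. Sx s k x - k x) < (e / 2) * b"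
   by (rule Sx_small[OF kL, of "(e / 2) * b"]) (use e b in auto)
  have "dist (nrm (\<lambda>x. (S h R x - R x) / h - 1 / b * k x)) 0 < e" if h: "0 < h" "h < min d b" for h
  proof -
   have "nrm (\<lambda>x. (Sx h R x - R x) - h / b * k x) \<le> h * (e / 2)"
   proof (rule field_le_epsilon)
    fix \<eta> :: real assume "0 < \<eta>"
    then show "nrm (\<lambda>x. (Sx h R x - R x) - h / b * k x) \<le> h * (e / 2) + \<eta>"
     using h d(2) by (intro key[of h d]) auto
   qed
   then have "\<bar>1 / h\<bar> * nrm (\<lambda>x. (Sx h R x - R x) - h / b * k x) \<le> \<bar>1 / h\<bar> * (h * (e / 2))"
    by (rule mult_left_mono) simp
   also have "\<dots> = e / 2" using h by simp
   finally have "nrm (\<lambda>x. 1 / h * ((Sx h R x - R x) - h / b * k x)) \<le> e / 2" by (simp only: nrm_scale)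
   moreover have "(\<lambda>x. 1 / h * ((Sx h R x - R x) - h / b * k x)) = (\<lambda>x. (S h R x - R x) / h - 1 / b * k x)"
    using h by (simp add: fun_eq_iff Sx_def field_simps)
   ultimately show ?thesis using e nrm_nonneg by simp
  qed
  then show "eventually (\<lambda>h. dist (nrm (\<lambda>x. (S h R x - R x) / h - 1 / b * k x)) 0 < e) (at_right 0)"
   unfolding eventually_at_right_field using d(1) b by (intro exI[of _ "min d b"]) auto
 qed
 then have "R \<in> gen_dom p M S" by (auto simp: gen_dom_def)
 then show thesis using R(2) Rg that by blast
qed

text \<open>Averages over short time intervals. That the bound \<open>c\<close> survives averaging
  is used in \<open>mass_loss\<close> to pass to the limit in weighted squares.\<close>

lemma gen_dom_dense:
 assumes g: "g \<in> borel_measurable M" "AE x in M. \<bar>g x\<bar> \<le> c" and c: "c > 0" and e: "e > 0"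
 obtains R where "R \<in> gen_dom p M S" "AE x in M. \<bar>R x\<bar> \<le> c" "nrm (\<lambda>x. R x - g x) \<le> e"
proof -
 obtain d where d: "d > 0" "\<And>s. 0 \<le> s \<Longrightarrow> s < d \<Longrightarrow> nrm (\<lambda>x. Sx s g x - g x) < e"
  by (rule Sx_small[OF Lp_bounded[OF g] e]) blast
 have d2: "0 < d / 2" using d(1) by simp
 have small: "nrm (\<lambda>x. Sx s g x - g x) \<le> e" if "0 \<le> s" "s \<le> d / 2" for s
  using d(2)[of s] d(1) that by simp
 show thesis by (rule averages[OF g c d2 small]) (assumption | rule that)+
qed

section \<open>Generators and time derivatives of integrals along the flow\<close>

lemma generator_graph: "f \<in> gen_dom p M S \<Longrightarrow> gen_graph p M S f (generator p M S f)"
proof -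
 assume "f \<in> gen_dom p M S"
 then obtain g where "gen_graph p M S f g" by (auto simp: gen_dom_def)
 then show ?thesis unfolding generator_def by (rule someI[where P = "gen_graph p M S f"])
qed

lemma graph_Lp: "gen_graph p M S f g \<Longrightarrow> f \<in> Lp" "gen_graph p M S f g \<Longrightarrow> g \<in> Lp"
 by (simp_all add: gen_graph_def)

definition "quot h f = (\<lambda>x. 1 / h * Sx h f x + (- 1 / h) * f x)"

lemma quot_Lp: "h > 0 \<Longrightarrow> f \<in> Lp \<Longrightarrow> quot h f \<in> Lp"
 unfolding quot_def by (intro Lp_lin Sx_Lp) auto

lemma graph_limit:
 assumes "gen_graph p M S f g"
 shows "((\<lambda>h. nrm (\<lambda>x. quot h f x - g x)) \<longlongrightarrow> 0) (at_right 0)"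
proof -
 have "((\<lambda>h. nrm (\<lambda>x. (S h f x - f x) / h - g x)) \<longlongrightarrow> 0) (at_right 0)"
  using assms by (simp add: gen_graph_def)
 then show ?thesis
 proof (rule Lim_transform_eventually)
  show "eventually (\<lambda>h. nrm (\<lambda>x. (S h f x - f x) / h - g x) = nrm (\<lambda>x. quot h f x - g x)) (at_right 0)"
   by (rule eventually_mono[OF eventually_at_right_less]) (simp add: quot_def Sx_def diff_divide_distrib)
 qed
qed

lemma graph_unique:
 assumes "gen_graph p M S f g" "gen_graph p M S f g'"
 shows "AE x in M. g x = g' x"
proof -
 note L = graph_Lp[OF assms(1)] graph_Lp[OF assms(2)]
 have "((\<lambda>h. nrm (\<lambda>x. quot h f x - g x) + nrm (\<lambda>x. quot h f x - g' x)) \<longlongrightarrow> 0 + 0) (at_right 0)"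
  by (intro tendsto_add graph_limit assms)
 moreover have le: "nrm (\<lambda>x. g x - g' x) \<le> nrm (\<lambda>x. quot h f x - g x) + nrm (\<lambda>x. quot h f x - g' x)" if "0 < h" for h
  using nrm_diff_triangle[OF L(2,4) quot_Lp[OF that L(1)]] nrm_diff_commute[of g "quot h f"] by simp
 ultimately have "nrm (\<lambda>x. g x - g' x) \<le> 0 + 0"
  by (rule tendsto_lowerbound[OF _ eventually_mono[OF eventually_at_right_less]]) auto
 then have "K1 * nrm (\<lambda>x. g x - g' x) = 0" using nrm_nonneg[of "\<lambda>x. g x - g' x"] by simp
 then have "(LINT x|M. \<bar>g x - g' x\<bar>) \<le> 0" using L1_le_nrm(2)[OF Lp_diff[OF L(2,4)]] by linarith
 moreover have "0 \<le> (LINT x|M. \<bar>g x - g' x\<bar>)" by (rule integral_nonneg_AE) simp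
 ultimately have "(LINT x|M. \<bar>g x - g' x\<bar>) = 0" by simp
 then have "AE x in M. \<bar>g x - g' x\<bar> = 0"
  using L1_le_nrm(1)[OF Lp_diff[OF L(2,4)]] by (subst (asm) integral_nonneg_eq_0_iff_AE) auto
 then show ?thesis by simp
qed

lemma Sx_quot:
 assumes "s \<ge> 0" "h > 0" "f \<in> Lp"
 shows "AE x in M. Sx s (quot h f) x = 1 / h * Sx (s + h) f x + (- 1 / h) * Sx s f x"
  "AE x in M. Sx s (quot h f) x = quot h (Sx s f) x"
proof -
 have h: "0 \<le> h" using assms by simp
 have 1: "AE x in M. Sx s (quot h f) x = 1 / h * Sx s (Sx h f) x + (- 1 / h) * Sx s f x"
  unfolding quot_def by (intro Sx_lin Sx_Lp assms h)
 have 2: "AE x in M. Sx (s + h) f x = Sx s (Sx h f) x" by (intro Sx_add assms h)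
 have 3: "AE x in M. Sx (s + h) f x = Sx h (Sx s f) x" using Sx_add[OF h assms(1,3)] by (simp add: add.commute)
 show "AE x in M. Sx s (quot h f) x = 1 / h * Sx (s + h) f x + (- 1 / h) * Sx s f x"
  using 1 2 by eventually_elim (simp only:)
 show "AE x in M. Sx s (quot h f) x = quot h (Sx s f) x"
  using 1 2 3 by eventually_elim (simp only: quot_def)
qed

lemma graph_Sx:
 assumes g: "gen_graph p M S f g" and s: "s \<ge> 0"
 shows "gen_graph p M S (Sx s f) (Sx s g)"
proof -
 note L = graph_Lp[OF g]
 have "((\<lambda>h. nrm (\<lambda>x. (S h (Sx s f) x - Sx s f x) / h - Sx s g x)) \<longlongrightarrow> 0) (at_right 0)"
 proof (rule Lim_null_comparison[OF eventually_mono[OF eventually_at_right_less] graph_limit[OF g]])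
  fix h :: real assume h: "0 < h"
  have "AE x in M. (S h (Sx s f) x - Sx s f x) / h - Sx s g x = Sx s (quot h f) x - Sx s g x"
   using Sx_quot(2)[OF s h L(1)] by eventually_elim (use h in \<open>simp add: quot_def Sx_def diff_divide_distrib\<close>)
  moreover have "(\<lambda>x. (S h (Sx s f) x - Sx s f x) / h - Sx s g x) \<in> borel_measurable M"
   using Sx_meas[OF less_imp_le[OF h] Sx_Lp[OF s L(1)]] Sx_meas[OF s L(1)] Sx_meas[OF s L(2)] h by (simp add: Sx_def)
  ultimately have "nrm (\<lambda>x. (S h (Sx s f) x - Sx s f x) / h - Sx s g x) = nrm (\<lambda>x. Sx s (quot h f) x - Sx s g x)"
   by (rule nrm_cong) (intro Lp_meas Lp_diff Sx_Lp quot_Lp h s L)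
  also have "\<dots> \<le> nrm (\<lambda>x. quot h f x - g x)" by (intro Sx_dist s quot_Lp h L)
  finally show "norm (nrm (\<lambda>x. (S h (Sx s f) x - Sx s f x) / h - Sx s g x)) \<le> nrm (\<lambda>x. quot h f x - g x)"
   using nrm_nonneg by simp
 qed
 then show ?thesis using Sx_Lp[OF s L(1)] Sx_Lp[OF s L(2)] by (simp add: gen_graph_def)
qed

lemma Sx_gen_dom: "f \<in> gen_dom p M S \<Longrightarrow> s \<ge> 0 \<Longrightarrow> Sx s f \<in> gen_dom p M S"
 using graph_Sx[OF generator_graph] unfolding gen_dom_def by blast

lemma generator_Sx:
 assumes "f \<in> gen_dom p M S" "s \<ge> 0"
 shows "AE x in M. generator p M S (Sx s f) x = Sx s (generator p M S f) x"
 by (rule graph_unique[OF generator_graph[OF Sx_gen_dom[OF assms]] graph_Sx[OF generator_graph[OF assms(1)] assms(2)]])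

text \<open>The derivative is two-sided. On either side of \<open>s\<close> the difference quotient
  is \<open>Sx m\<close> applied to the forward quotient with step \<open>\<bar>y - s\<bar>\<close>,
  where \<open>m\<close> is the earlier of the two times; contractivity and continuity in time do
  the rest.\<close>

lemma Sx_L1_derivative:
 assumes g: "gen_graph p M S f g" and s: "s > 0"
 shows "((\<lambda>y. LINT x|M. \<bar>(Sx y f x - Sx s f x) / (y - s) - Sx s g x\<bar>) \<longlongrightarrow> 0) (at s)"
proof (rule tendstoI)
 fix e :: real assume e: "0 < e"
 note L = graph_Lp[OF g]
 define e' where "e' = e / K1"
 have e': "e' > 0" "K1 * e' = e" using e K1_pos by (auto simp: e'_def)
 have "eventually (\<lambda>h. nrm (\<lambda>x. quot h f x - g x) < e' / 2) (at_right 0)"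
  using e' by (intro order_tendstoD(2)[OF graph_limit[OF g]]) auto
 then obtain d1 where d1: "d1 > 0" "\<And>h. 0 < h \<Longrightarrow> h < d1 \<Longrightarrow> nrm (\<lambda>x. quot h f x - g x) < e' / 2"
  unfolding eventually_at_right_field by auto
 obtain d2 where d2: "d2 > 0" "\<And>r s. 0 \<le> r \<Longrightarrow> 0 \<le> s \<Longrightarrow> \<bar>s - r\<bar> < d2 \<Longrightarrow> nrm (\<lambda>x. Sx s g x - Sx r g x) < e' / 2"
  by (rule Sx_uniform[OF L(2), of "e' / 2"]) (use e' in auto)
 define d where "d = min s (min d1 d2)"
 have d: "d > 0" using s d1 d2 by (simp add: d_def)
 have "dist (LINT x|M. \<bar>(Sx y f x - Sx s f x) / (y - s) - Sx s g x\<bar>) 0 < e" if y: "y \<noteq> s" "dist y s < d" for y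
 proof -
  have y0: "0 < y" "\<bar>y - s\<bar> < d1" "\<bar>s - y\<bar> < d2" using y by (auto simp: d_def dist_real_def)
  define m h where "m = min y s" and "h = \<bar>y - s\<bar>"
  have m: "m \<ge> 0" "h > 0" "h < d1" "m + h = max y s" using y0 s y by (auto simp: m_def h_def)
  have ml: "\<bar>s - m\<bar> < d2" using y0 d2(1) by (auto simp: m_def min_def)
  let ?D = "\<lambda>x. (Sx y f x - Sx s f x) / (y - s)"
  have q: "AE x in M. ?D x = Sx m (quot h f) x"
   using Sx_quot(1)[OF m(1,2) L(1)]
  proof eventually_elim
   case (elim x)
   show ?case
   proof (cases "y > s")
    case True
    then show ?thesis unfolding elim using m(4) by (simp add: m_def h_def diff_divide_distrib)
   next
    case False
    then have "y < s" using y by simp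
    then have "m + h = s" "m = y" "1 / h = - 1 / (y - s)" using m(4) by (auto simp: m_def h_def divide_simps)
    then show ?thesis unfolding elim by (simp add: diff_divide_distrib)
   qed
  qed
  have DL: "?D \<in> Lp"
  proof -
   have "(\<lambda>x. 1 / (y - s) * (Sx y f x - Sx s f x)) \<in> Lp" using y0 s L by (intro Lp_scale Lp_diff Sx_Lp) auto
   then show ?thesis by simp
  qed
  have "nrm (\<lambda>x. ?D x - Sx s g x) = nrm (\<lambda>x. Sx m (quot h f) x - Sx s g x)"
   using q s m(1) by (intro nrm_cong Lp_meas Lp_diff DL Sx_Lp quot_Lp m(2) L) auto
  also have "\<dots> \<le> nrm (\<lambda>x. Sx m (quot h f) x - Sx m g x) + nrm (\<lambda>x. Sx m g x - Sx s g x)"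
   using s m by (intro nrm_diff_triangle Sx_Lp quot_Lp L) auto
  also have "\<dots> \<le> nrm (\<lambda>x. quot h f x - g x) + nrm (\<lambda>x. Sx m g x - Sx s g x)"
   using m by (intro add_right_mono Sx_dist quot_Lp L) auto
  also have "\<dots> < e' / 2 + e' / 2"
   using m s ml by (intro add_strict_mono d1(2) d2(2)) auto
  finally have n: "nrm (\<lambda>x. ?D x - Sx s g x) < e'" by simp
  have "(LINT x|M. \<bar>?D x - Sx s g x\<bar>) \<le> K1 * nrm (\<lambda>x. ?D x - Sx s g x)"
   using s by (intro L1_le_nrm(2) Lp_diff DL Sx_Lp L) auto
  also have "\<dots> < K1 * e'" using n K1_pos by (rule mult_strict_left_mono)
  finally have "(LINT x|M. \<bar>?D x - Sx s g x\<bar>) < e" using e' by simp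
  moreover have "0 \<le> (LINT x|M. \<bar>?D x - Sx s g x\<bar>)" by (rule integral_nonneg_AE) simp
  ultimately show ?thesis by (simp add: dist_real_def)
 qed
 then show "eventually (\<lambda>y. dist (LINT x|M. \<bar>(Sx y f x - Sx s f x) / (y - s) - Sx s g x\<bar>) 0 < e) (at s)"
  using d unfolding eventually_at by blast
qed

lemma Sx_L1_continuous:
 assumes f: "f \<in> Lp" and s: "s \<ge> 0"
 shows "((\<lambda>y. LINT x|M. \<bar>Sx y f x - Sx s f x\<bar>) \<longlongrightarrow> 0) (at s within {0..})"
proof (rule tendstoI)
 fix e :: real assume e: "0 < e"
 have e': "e / K1 > 0" using e K1_pos by simp
 obtain d where d: "d > 0" "\<And>r s. 0 \<le> r \<Longrightarrow> 0 \<le> s \<Longrightarrow> \<bar>s - r\<bar> < d \<Longrightarrow> nrm (\<lambda>x. Sx s f x - Sx r f x) < e / K1"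
  by (rule Sx_uniform[OF f e']) blast
 have "dist (LINT x|M. \<bar>Sx y f x - Sx s f x\<bar>) 0 < e" if y: "y \<in> {0..}" "dist y s < d" for y
 proof -
  have "(LINT x|M. \<bar>Sx y f x - Sx s f x\<bar>) \<le> K1 * nrm (\<lambda>x. Sx y f x - Sx s f x)"
   using y s by (intro L1_le_nrm(2) Lp_diff Sx_Lp f) auto
  also have "\<dots> < K1 * (e / K1)" using y s K1_pos by (intro mult_strict_left_mono d(2)) (auto simp: dist_real_def)
  finally have "(LINT x|M. \<bar>Sx y f x - Sx s f x\<bar>) < e" using K1_pos by simp
  moreover have "0 \<le> (LINT x|M. \<bar>Sx y f x - Sx s f x\<bar>)" by (rule integral_nonneg_AE) simp
  ultimately show ?thesis by (simp add: dist_real_def)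
 qed
 then show "eventually (\<lambda>y. dist (LINT x|M. \<bar>Sx y f x - Sx s f x\<bar>) 0 < e) (at s within {0..})"
  using d(1) unfolding eventually_at by blast
qed

lemma integral_mult_le:
 fixes h w :: "'a \<Rightarrow> real"
 assumes "integrable M h" "w \<in> borel_measurable M" "AE x in M. \<bar>w x\<bar> \<le> W"
 shows "integrable M (\<lambda>x. h x * w x)" "\<bar>LINT x|M. h x * w x\<bar> \<le> W * (LINT x|M. \<bar>h x\<bar>)"
proof -
 show i: "integrable M (\<lambda>x. h x * w x)"
 proof (rule Bochner_Integration.integrable_bound)
  show "integrable M (\<lambda>x. W * h x)" using assms(1) by simp
  show "(\<lambda>x. h x * w x) \<in> borel_measurable M" using assms(1,2) by simp
  show "AE x in M. norm (h x * w x) \<le> norm (W * h x)"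
   using assms(3)
  proof eventually_elim
   case (elim x)
   have "\<bar>w x\<bar> * \<bar>h x\<bar> \<le> \<bar>W\<bar> * \<bar>h x\<bar>" using elim by (intro mult_right_mono) auto
   then show ?case by (simp add: abs_mult mult.commute)
  qed
 qed
 have "\<bar>LINT x|M. h x * w x\<bar> \<le> (LINT x|M. \<bar>h x * w x\<bar>)" by (rule integral_abs_bound)
 also have "\<dots> \<le> (LINT x|M. W * \<bar>h x\<bar>)"
 proof (rule integral_mono_AE)
  show "AE x in M. \<bar>h x * w x\<bar> \<le> W * \<bar>h x\<bar>"
   using assms(3)
  proof eventually_elim
   case (elim x)
   have "\<bar>w x\<bar> * \<bar>h x\<bar> \<le> W * \<bar>h x\<bar>" using elim by (intro mult_right_mono) auto
   then show ?case by (simp add: abs_mult mult.commute)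
  qed
 qed (use i assms(1) in auto)
 finally show "\<bar>LINT x|M. h x * w x\<bar> \<le> W * (LINT x|M. \<bar>h x\<bar>)" by simp
qed

lemma DERIV_linear_functional:
 assumes g: "gen_graph p M S f g" and s: "s > 0" and w: "w \<in> borel_measurable M" "AE x in M. \<bar>w x\<bar> \<le> W"
 shows "((\<lambda>s. LINT x|M. Sx s f x * w x) has_real_derivative (LINT x|M. Sx s g x * w x)) (at s)"
 unfolding has_field_derivative_iff
proof (rule LIM_zero_cancel, rule Lim_null_comparison)
 note L = graph_Lp[OF g]
 show "((\<lambda>y. W * (LINT x|M. \<bar>(Sx y f x - Sx s f x) / (y - s) - Sx s g x\<bar>)) \<longlongrightarrow> 0) (at s)"
  by (rule tendsto_mult_right_zero[OF Sx_L1_derivative[OF g s]])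
 have "eventually (\<lambda>y. y > 0 \<and> y \<noteq> s) (at s)"
  using s by (intro eventually_conj order_tendstoD(1)[OF tendsto_ident_at]) (auto simp: eventually_at_filter)
 then show "eventually (\<lambda>y. norm (((LINT x|M. Sx y f x * w x) - (LINT x|M. Sx s f x * w x)) / (y - s) - (LINT x|M. Sx s g x * w x))
  \<le> W * (LINT x|M. \<bar>(Sx y f x - Sx s f x) / (y - s) - Sx s g x\<bar>)) (at s)"
 proof eventually_elim
  case (elim y)
  have i: "integrable M (Sx y f)" "integrable M (Sx s f)" "integrable M (Sx s g)"
   using elim s by (auto intro!: L1_le_nrm(1) Sx_Lp L)
  have iw: "integrable M (\<lambda>x. Sx y f x * w x)" "integrable M (\<lambda>x. Sx s f x * w x)" "integrable M (\<lambda>x. Sx s g x * w x)"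
   by (rule integral_mult_le(1)[OF _ w]; rule i)+
  have "((LINT x|M. Sx y f x * w x) - (LINT x|M. Sx s f x * w x)) / (y - s) - (LINT x|M. Sx s g x * w x)
   = (LINT x|M. ((Sx y f x - Sx s f x) / (y - s) - Sx s g x) * w x)"
  proof -
   have "(LINT x|M. ((Sx y f x - Sx s f x) / (y - s) - Sx s g x) * w x)
    = (LINT x|M. (Sx y f x * w x - Sx s f x * w x) / (y - s) - Sx s g x * w x)"
    by (intro Bochner_Integration.integral_cong) (auto simp: left_diff_distrib)
   then show ?thesis using iw by simp
  qed
  moreover have "\<bar>LINT x|M. ((Sx y f x - Sx s f x) / (y - s) - Sx s g x) * w x\<bar>
    \<le> W * (LINT x|M. \<bar>(Sx y f x - Sx s f x) / (y - s) - Sx s g x\<bar>)"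
   using i by (intro integral_mult_le(2)[OF _ w]) auto
  ultimately show ?case by simp
 qed
qed

text \<open>\<open>G\<close> is only integrable, and convergence of \<open>a\<close> in L1 along a
  filter gives no almost everywhere limit to which dominated convergence could apply. Cutting
  \<open>\<bar>G\<bar>\<close> at a level \<open>n\<close> separates a part small in L1, met with
  the bound \<open>C\<close>, from a bounded part, met with the L1 norm of \<open>a\<close>.\<close>

lemma integral_product_tendsto_zero:
 fixes a :: "real \<Rightarrow> 'a \<Rightarrow> real"
 assumes G: "integrable M G" and a: "eventually (\<lambda>y. a y \<in> borel_measurable M \<and> (AE x in M. \<bar>a y x\<bar> \<le> C)) F"
  and lim: "((\<lambda>y. LINT x|M. \<bar>a y x\<bar>) \<longlongrightarrow> 0) F" and C: "C > 0"
 shows "((\<lambda>y. LINT x|M. \<bar>G x\<bar> * \<bar>a y x\<bar>) \<longlongrightarrow> 0) F"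
proof (rule tendstoI)
 fix e :: real assume e: "0 < e"
 let ?H = "\<lambda>n x. max (\<bar>G x\<bar> - real n) 0"
 have iG: "integrable M (?H n)" for n using G by simp
 have "(\<lambda>n. LINT x|M. ?H n x) \<longlonglongrightarrow> (LINT x|M. 0)"
 proof (rule integral_dominated_convergence[where w = "\<lambda>x. \<bar>G x\<bar>"])
  show "AE x in M. (\<lambda>n. ?H n x) \<longlonglongrightarrow> 0"
  proof (rule AE_I2)
   fix x
   obtain n0 :: nat where "real n0 \<ge> \<bar>G x\<bar>" using real_arch_simple by blast
   then have "eventually (\<lambda>n. ?H n x = 0) sequentially"
    by (intro eventually_mono[OF eventually_ge_at_top[of n0]]) auto
   then show "(\<lambda>n. ?H n x) \<longlonglongrightarrow> 0" by (rule tendsto_eventually)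
  qed
 qed (use G in auto)
 then have "eventually (\<lambda>n. (LINT x|M. ?H n x) < e / (2 * C)) sequentially"
  using e C by (intro order_tendstoD(2)) auto
 then obtain n where n: "(LINT x|M. ?H n x) < e / (2 * C)"
  unfolding eventually_sequentially by blast
 have "eventually (\<lambda>y. (LINT x|M. \<bar>a y x\<bar>) < e / (2 * (real n + 1))) F"
  using e by (intro order_tendstoD(2)[OF lim]) auto
 then show "eventually (\<lambda>y. dist (LINT x|M. \<bar>G x\<bar> * \<bar>a y x\<bar>) 0 < e) F"
  using a
 proof eventually_elim
  case (elim y)
  have ia: "integrable M (a y)" using elim by (intro integrable_const_bound[of _ C]) auto
  have "(LINT x|M. \<bar>G x\<bar> * \<bar>a y x\<bar>) \<le> (LINT x|M. C * ?H n x + real n * \<bar>a y x\<bar>)"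
  proof (rule integral_mono_AE)
   show "integrable M (\<lambda>x. \<bar>G x\<bar> * \<bar>a y x\<bar>)" using elim by (intro integral_mult_le(1)[of _ _ C]) (use G in auto)
   show "AE x in M. \<bar>G x\<bar> * \<bar>a y x\<bar> \<le> C * ?H n x + real n * \<bar>a y x\<bar>"
    using conjunct2[OF elim(2)]
   proof eventually_elim
    case (elim x)
    have "\<bar>G x\<bar> * \<bar>a y x\<bar> \<le> (?H n x + real n) * \<bar>a y x\<bar>" by (intro mult_right_mono) auto
    moreover have "?H n x * \<bar>a y x\<bar> \<le> C * ?H n x" unfolding mult.commute[of C] using elim by (intro mult_left_mono) auto
    ultimately show ?case unfolding distrib_right by linarith
   qed
  qed (use iG ia in auto)
  also have "\<dots> = C * (LINT x|M. ?H n x) + real n * (LINT x|M. \<bar>a y x\<bar>)"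
   using iG ia by simp
  also have "\<dots> < e / 2 + e / 2"
  proof (rule add_less_le_mono)
   show "C * (LINT x|M. ?H n x) < e / 2"
    using mult_strict_left_mono[OF n C] C by simp
   have "0 \<le> (LINT x|M. \<bar>a y x\<bar>)" by (rule integral_nonneg_AE) simp
   then have "real n * (LINT x|M. \<bar>a y x\<bar>) \<le> (real n + 1) * (LINT x|M. \<bar>a y x\<bar>)" by (intro mult_right_mono) auto
   also have "\<dots> \<le> (real n + 1) * (e / (2 * (real n + 1)))" using elim(1) by (intro mult_left_mono) auto
   also have "\<dots> = e / 2" by (simp add: field_simps)
   finally show "real n * (LINT x|M. \<bar>a y x\<bar>) \<le> e / 2" .
  qed
  finally have "(LINT x|M. \<bar>G x\<bar> * \<bar>a y x\<bar>) < e" by simp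
  moreover have "0 \<le> (LINT x|M. \<bar>G x\<bar> * \<bar>a y x\<bar>)" by (rule integral_nonneg_AE) simp
  ultimately show ?case by (simp add: dist_real_def)
 qed
qed

text \<open>With \<open>q\<close> the error of the difference quotient, \<open>(a\<^sup>2 -
  b\<^sup>2) / (y - s) - 2 g b = q (a + b) + g (a - b)\<close>. The first term is small by the L1
  derivative and the bound on the flow, the second by \<open>integral_product_tendsto_zero\<close>.
  This covers \<open>p = 1\<close>, where \<open>g\<close> is only integrable.\<close>

lemma DERIV_weighted_square:
 assumes g: "gen_graph p M S f g" and s: "s > 0" and f: "AE x in M. \<bar>f x\<bar> \<le> c" and c: "c > 0"
  and w: "w \<in> borel_measurable M" "AE x in M. \<bar>w x\<bar> \<le> W" and W: "W > 0"
 shows "((\<lambda>s. LINT x|M. (Sx s f x)\<^sup>2 * w x) has_real_derivative 2 * (LINT x|M. Sx s g x * (Sx s f x * w x))) (at s)"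
 unfolding has_field_derivative_iff
proof (rule LIM_zero_cancel, rule Lim_null_comparison)
 note L = graph_Lp[OF g]
 let ?D = "\<lambda>y. LINT x|M. \<bar>(Sx y f x - Sx s f x) / (y - s) - Sx s g x\<bar>"
  and ?R = "\<lambda>y. LINT x|M. \<bar>Sx s g x\<bar> * \<bar>Sx y f x - Sx s f x\<bar>"
 have pos: "eventually (\<lambda>y. y > 0 \<and> y \<noteq> s) (at s)"
  using s by (intro eventually_conj order_tendstoD(1)[OF tendsto_ident_at]) (auto simp: eventually_at_filter)
 have b: "AE x in M. \<bar>Sx y f x\<bar> \<le> c" if "y > 0" for y
  using that by (intro Sx_bounded Lp_meas L f c) auto
 have m: "Sx y f \<in> borel_measurable M" if "y > 0" for y using that by (intro Sx_meas L) auto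
 have R0: "(?R \<longlongrightarrow> 0) (at s)"
 proof (rule integral_product_tendsto_zero)
  show "integrable M (Sx s g)" using s by (intro L1_le_nrm(1) Sx_Lp L) auto
  show "eventually (\<lambda>y. (\<lambda>x. Sx y f x - Sx s f x) \<in> borel_measurable M \<and> (AE x in M. \<bar>Sx y f x - Sx s f x\<bar> \<le> 2 * c)) (at s)"
   using pos
  proof eventually_elim
   case (elim y)
   have "AE x in M. \<bar>Sx y f x - Sx s f x\<bar> \<le> 2 * c" using b[of y] b[OF s] elim by (auto elim: eventually_elim2)
   then show ?case using m[of y] m[OF s] elim by auto
  qed
  have ev: "eventually (\<lambda>y. y \<in> {0..}) (at s)" using pos by eventually_elim auto
  have "at s within {0..} = at s" by (rule at_within_open_subset[of s "{0<..}"]) (use s in auto)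
  then show "((\<lambda>y. LINT x|M. \<bar>Sx y f x - Sx s f x\<bar>) \<longlongrightarrow> 0) (at s)"
   using Sx_L1_continuous[OF L(1), of s] s by simp
 qed (use c in simp)
 have "((\<lambda>y. 2 * c * W * ?D y + W * ?R y) \<longlongrightarrow> 2 * c * W * 0 + W * 0) (at s)"
  by (intro tendsto_add tendsto_mult_left Sx_L1_derivative[OF g s] R0)
 then show "((\<lambda>y. 2 * c * W * ?D y + W * ?R y) \<longlongrightarrow> 0) (at s)" by simp
 show "eventually (\<lambda>y. norm (((LINT x|M. (Sx y f x)\<^sup>2 * w x) - (LINT x|M. (Sx s f x)\<^sup>2 * w x)) / (y - s) - 2 * (LINT x|M. Sx s g x * (Sx s f x * w x)))
  \<le> 2 * c * W * ?D y + W * ?R y) (at s)"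
  using pos
 proof eventually_elim
  case (elim y)
  then have y: "y > 0" "y \<noteq> s" by auto
  let ?a = "Sx y f" and ?b = "Sx s f" and ?g = "Sx s g"
  let ?q = "\<lambda>x. (?a x - ?b x) / (y - s) - ?g x"
  have i: "integrable M ?a" "integrable M ?b" "integrable M ?g" using y s by (auto intro!: L1_le_nrm(1) Sx_Lp L)
  have bw: "AE x in M. \<bar>?a x * w x\<bar> \<le> c * W" "AE x in M. \<bar>?b x * w x\<bar> \<le> c * W"
   using b[OF y(1)] b[OF s] w(2) by (eventually_elim, simp add: abs_mult mult_mono less_imp_le[OF c])+
  have mw: "(\<lambda>x. ?a x * w x) \<in> borel_measurable M" "(\<lambda>x. ?b x * w x) \<in> borel_measurable M"
   using m[OF y(1)] m[OF s] w(1) by auto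
  have ab: "AE x in M. \<bar>?a x * w x + ?b x * w x\<bar> \<le> 2 * c * W" using bw by eventually_elim linarith
  have mab: "(\<lambda>x. ?a x * w x + ?b x * w x) \<in> borel_measurable M" using mw by simp
  have iq: "integrable M ?q" using i by auto
  have id: "integrable M (\<lambda>x. ?g x * (?a x - ?b x))"
  proof (rule integral_mult_le(1)[OF i(3)])
   show "(\<lambda>x. ?a x - ?b x) \<in> borel_measurable M" using m[OF y(1)] m[OF s] by simp
   show "AE x in M. \<bar>?a x - ?b x\<bar> \<le> 2 * c" using b[OF y(1)] b[OF s] by eventually_elim linarith
  qed
  have I: "integrable M (\<lambda>x. ?a x * (?a x * w x))" "integrable M (\<lambda>x. ?b x * (?b x * w x))" "integrable M (\<lambda>x. ?g x * (?b x * w x))"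
   using i by (auto intro!: integral_mult_le(1)[OF _ mw(1) bw(1)] integral_mult_le(1)[OF _ mw(2) bw(2)])
  have I2: "integrable M (\<lambda>x. ?q x * (?a x * w x + ?b x * w x))" "integrable M (\<lambda>x. ?g x * (?a x - ?b x) * w x)"
   by (rule integral_mult_le(1)[OF iq mab ab]) (rule integral_mult_le(1)[OF id w])
  have "((LINT x|M. (?a x)\<^sup>2 * w x) - (LINT x|M. (?b x)\<^sup>2 * w x)) / (y - s) - 2 * (LINT x|M. ?g x * (?b x * w x))
   = (LINT x|M. (?a x * (?a x * w x) - ?b x * (?b x * w x)) / (y - s) - 2 * (?g x * (?b x * w x)))"
   using I by (simp add: power2_eq_square mult.assoc)
  also have "\<dots> = (LINT x|M. ?q x * (?a x * w x + ?b x * w x) + ?g x * (?a x - ?b x) * w x)"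
  proof (rule Bochner_Integration.integral_cong[OF refl])
   fix x
   have "(?a x * (?a x * w x) - ?b x * (?b x * w x)) / (y - s) = (?a x - ?b x) / (y - s) * (?a x * w x + ?b x * w x)"
   proof -
    have "?a x * (?a x * w x) - ?b x * (?b x * w x) = (?a x - ?b x) * (?a x * w x + ?b x * w x)"
     by (simp add: algebra_simps)
    then show ?thesis by (simp only: times_divide_eq_left)
   qed
   then show "(?a x * (?a x * w x) - ?b x * (?b x * w x)) / (y - s) - 2 * (?g x * (?b x * w x)) = ?q x * (?a x * w x + ?b x * w x) + ?g x * (?a x - ?b x) * w x"
    by (simp only: left_diff_distrib right_diff_distrib distrib_left)
  qed
  also have "\<dots> = (LINT x|M. ?q x * (?a x * w x + ?b x * w x)) + (LINT x|M. ?g x * (?a x - ?b x) * w x)"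
   using I2 by (rule Bochner_Integration.integral_add)
  finally have eq: "((LINT x|M. (?a x)\<^sup>2 * w x) - (LINT x|M. (?b x)\<^sup>2 * w x)) / (y - s) - 2 * (LINT x|M. ?g x * (?b x * w x))
   = (LINT x|M. ?q x * (?a x * w x + ?b x * w x)) + (LINT x|M. ?g x * (?a x - ?b x) * w x)" .
  have e1: "\<bar>LINT x|M. ?q x * (?a x * w x + ?b x * w x)\<bar> \<le> 2 * c * W * ?D y"
   by (rule integral_mult_le(2)[OF iq mab ab])
  have e2: "\<bar>LINT x|M. ?g x * (?a x - ?b x) * w x\<bar> \<le> W * ?R y"
   using integral_mult_le(2)[OF id w] by (simp add: abs_mult)
  show ?case unfolding eq real_norm_def using e1 e2 by linarith
 qed
qed

lemma continuous_linear_functional: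
 assumes f: "f \<in> Lp" and w: "w \<in> borel_measurable M" "AE x in M. \<bar>w x\<bar> \<le> W"
 shows "continuous_on {0..} (\<lambda>s. LINT x|M. Sx s f x * w x)"
 unfolding continuous_on_def
proof (intro ballI, rule LIM_zero_cancel, rule Lim_null_comparison)
 fix s :: real assume s: "s \<in> {0..}"
 show "((\<lambda>y. W * (LINT x|M. \<bar>Sx y f x - Sx s f x\<bar>)) \<longlongrightarrow> 0) (at s within {0..})"
  using s by (intro tendsto_mult_right_zero Sx_L1_continuous f) simp
 show "eventually (\<lambda>y. norm ((LINT x|M. Sx y f x * w x) - (LINT x|M. Sx s f x * w x)) \<le> W * (LINT x|M. \<bar>Sx y f x - Sx s f x\<bar>)) (at s within {0..})"
  unfolding eventually_at_filter
 proof (intro always_eventually allI impI)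
  fix y :: real assume "y \<in> {0..}"
  then have i: "integrable M (Sx y f)" "integrable M (Sx s f)" using s by (auto intro!: L1_le_nrm(1) Sx_Lp f)
  have "(LINT x|M. Sx y f x * w x) - (LINT x|M. Sx s f x * w x) = (LINT x|M. (Sx y f x - Sx s f x) * w x)"
   using integral_mult_le(1)[OF i(1) w] integral_mult_le(1)[OF i(2) w] by (simp add: left_diff_distrib)
  then show "norm ((LINT x|M. Sx y f x * w x) - (LINT x|M. Sx s f x * w x)) \<le> W * (LINT x|M. \<bar>Sx y f x - Sx s f x\<bar>)"
   using integral_mult_le(2)[OF _ w, of "\<lambda>x. Sx y f x - Sx s f x"] i by simp
 qed
qed

lemma continuous_weighted_square:
 assumes f: "f \<in> borel_measurable M" "AE x in M. \<bar>f x\<bar> \<le> c" and c: "c > 0"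
  and w: "w \<in> borel_measurable M" "AE x in M. \<bar>w x\<bar> \<le> W"
 shows "continuous_on {0..} (\<lambda>s. LINT x|M. (Sx s f x)\<^sup>2 * w x)"
 unfolding continuous_on_def
proof (intro ballI, rule LIM_zero_cancel, rule Lim_null_comparison)
 have fL: "f \<in> Lp" by (rule Lp_bounded[OF f])
 fix s :: real assume s: "s \<in> {0..}"
 show "((\<lambda>y. 2 * c * W * (LINT x|M. \<bar>Sx y f x - Sx s f x\<bar>)) \<longlongrightarrow> 0) (at s within {0..})"
  using s by (intro tendsto_mult_right_zero Sx_L1_continuous fL) simp
 show "eventually (\<lambda>y. norm ((LINT x|M. (Sx y f x)\<^sup>2 * w x) - (LINT x|M. (Sx s f x)\<^sup>2 * w x)) \<le> 2 * c * W * (LINT x|M. \<bar>Sx y f x - Sx s f x\<bar>)) (at s within {0..})"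
  unfolding eventually_at_filter
 proof (intro always_eventually allI impI)
  fix y :: real assume y: "y \<in> {0..}"
  let ?a = "Sx y f" and ?b = "Sx s f"
  have i: "integrable M ?a" "integrable M ?b" using s y by (auto intro!: L1_le_nrm(1) Sx_Lp fL)
  have b: "AE x in M. \<bar>?a x\<bar> \<le> c" "AE x in M. \<bar>?b x\<bar> \<le> c" using s y by (auto intro!: Sx_bounded f c)
  have bw: "AE x in M. \<bar>?a x * w x\<bar> \<le> c * W" "AE x in M. \<bar>?b x * w x\<bar> \<le> c * W"
   using b w(2) by (eventually_elim, simp add: abs_mult mult_mono less_imp_le[OF c])+
  have mw: "(\<lambda>x. ?a x * w x) \<in> borel_measurable M" "(\<lambda>x. ?b x * w x) \<in> borel_measurable M"
   using i w(1) by auto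
  have ab: "AE x in M. \<bar>?a x * w x + ?b x * w x\<bar> \<le> 2 * c * W" using bw by eventually_elim linarith
  have mab: "(\<lambda>x. ?a x * w x + ?b x * w x) \<in> borel_measurable M" using mw by simp
  have I: "integrable M (\<lambda>x. ?a x * (?a x * w x))" "integrable M (\<lambda>x. ?b x * (?b x * w x))"
   by (rule integral_mult_le(1)[OF i(1) mw(1) bw(1)]) (rule integral_mult_le(1)[OF i(2) mw(2) bw(2)])
  have "(LINT x|M. (?a x)\<^sup>2 * w x) - (LINT x|M. (?b x)\<^sup>2 * w x) = (LINT x|M. ?a x * (?a x * w x) - ?b x * (?b x * w x))"
   using I by (simp add: power2_eq_square mult.assoc)
  also have "\<dots> = (LINT x|M. (?a x - ?b x) * (?a x * w x + ?b x * w x))"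
   by (intro Bochner_Integration.integral_cong) (auto simp: algebra_simps)
  finally have eq: "(LINT x|M. (?a x)\<^sup>2 * w x) - (LINT x|M. (?b x)\<^sup>2 * w x) = (LINT x|M. (?a x - ?b x) * (?a x * w x + ?b x * w x))" .
  show "norm ((LINT x|M. (?a x)\<^sup>2 * w x) - (LINT x|M. (?b x)\<^sup>2 * w x)) \<le> 2 * c * W * (LINT x|M. \<bar>?a x - ?b x\<bar>)"
   unfolding eq real_norm_def using i by (intro integral_mult_le(2)[OF _ mab ab]) auto
 qed
qed

end

section \<open>Weighted estimates\<close>

text \<open>A quadratic spline, of class C1 as the chain rule for \<open>N\<close> demands; its
  derivative is a tent over \<open>[2 R, 4 R]\<close> with peak \<open>1 / R\<close> at
  \<open>3 R\<close>. It is the complement of the cut-off of the flux argument, so that it vanishes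
  at 0 and fits the chain rule for \<Gamma>.\<close>

definition cutoff :: "real \<Rightarrow> real \<Rightarrow> real" where
 "cutoff R r = ((max (r - 2 * R) 0)\<^sup>2 - 2 * (max (r - 3 * R) 0)\<^sup>2 + (max (r - 4 * R) 0)\<^sup>2) / (2 * R\<^sup>2)"

definition cutoff_deriv :: "real \<Rightarrow> real \<Rightarrow> real" where
 "cutoff_deriv R r = (max (r - 2 * R) 0 - 2 * max (r - 3 * R) 0 + max (r - 4 * R) 0) / R\<^sup>2"

lemma DERIV_shifted_pos_part: "((\<lambda>r. (max (r - a) 0)\<^sup>2) has_real_derivative 2 * max (r - a) 0) (at (r::real))"
proof -
 have "((\<lambda>r. r - a) has_real_derivative 1) (at r)" by (auto intro!: derivative_eq_intros)
 from DERIV_chain2[OF DERIV_pos_part_squared this] show ?thesis by simp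
qed

lemma cutoff:
 assumes R: "R > 0"
 shows "(cutoff R has_real_derivative cutoff_deriv R r) (at r)" "continuous_on UNIV (cutoff_deriv R)"
  "r \<le> 2 * R \<Longrightarrow> cutoff R r = 0" "4 * R \<le> r \<Longrightarrow> cutoff R r = 1" "0 \<le> cutoff R r" "cutoff R r \<le> 1"
  "\<bar>cutoff_deriv R r\<bar> \<le> 1 / R" "r \<le> 2 * R \<or> 4 * R \<le> r \<Longrightarrow> cutoff_deriv R r = 0"
  "r < 4 * R \<Longrightarrow> cutoff R r < 1"
proof -
 show "(cutoff R has_real_derivative cutoff_deriv R r) (at r)"
  using DERIV_cdivide[OF DERIV_add[OF DERIV_diff[OF DERIV_shifted_pos_part[of "2 * R"] DERIV_cmult[OF DERIV_shifted_pos_part[of "3 * R"], of 2]]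
   DERIV_shifted_pos_part[of "4 * R"]], of "2 * R\<^sup>2" r]
  unfolding cutoff_def [abs_def] cutoff_deriv_def by (rule DERIV_cong) (use R in \<open>simp add: divide_simps\<close>)
 show "continuous_on UNIV (cutoff_deriv R)"
  unfolding cutoff_deriv_def [abs_def] by (intro continuous_intros) (use R in simp)
 have R2: "0 < R\<^sup>2" using R by simp
 consider "r \<le> 2 * R" | "2 * R \<le> r" "r \<le> 3 * R" | "3 * R \<le> r" "r \<le> 4 * R" | "4 * R \<le> r" by linarith
 then have *: "0 \<le> cutoff R r \<and> cutoff R r \<le> 1 \<and> \<bar>cutoff_deriv R r\<bar> \<le> 1 / R
   \<and> (r \<le> 2 * R \<longrightarrow> cutoff R r = 0) \<and> (4 * R \<le> r \<longrightarrow> cutoff R r = 1)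
   \<and> (r \<le> 2 * R \<or> 4 * R \<le> r \<longrightarrow> cutoff_deriv R r = 0) \<and> (r < 4 * R \<longrightarrow> cutoff R r < 1)"
 proof cases
  case 1
  then have "max (r - 2 * R) 0 = 0" "max (r - 3 * R) 0 = 0" "max (r - 4 * R) 0 = 0" using R by auto
  then have "cutoff R r = 0" "cutoff_deriv R r = 0" by (simp_all add: cutoff_def cutoff_deriv_def)
  then show ?thesis using 1 R by simp
 next
  case 2
  then have m: "max (r - 2 * R) 0 = r - 2 * R" "max (r - 3 * R) 0 = 0" "max (r - 4 * R) 0 = 0" using R by auto
  have f: "cutoff R r = (r - 2 * R)\<^sup>2 / (2 * R\<^sup>2)" "cutoff_deriv R r = (r - 2 * R) / R\<^sup>2"
   by (simp_all add: cutoff_def cutoff_deriv_def m)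
  have "(r - 2 * R)\<^sup>2 \<le> R\<^sup>2" using 2 by (intro power_mono) auto
  then have "(r - 2 * R)\<^sup>2 \<le> 2 * R\<^sup>2" using R2 by linarith
  moreover have "(r - 2 * R) / R\<^sup>2 \<le> R / R\<^sup>2" using 2 R2 by (intro divide_right_mono) auto
  moreover have "R / R\<^sup>2 = 1 / R" by (simp add: power2_eq_square)
  moreover have "0 \<le> (r - 2 * R) / R\<^sup>2" using 2 by simp
  moreover have "(r - 2 * R)\<^sup>2 < 2 * R\<^sup>2" using R2 \<open>(r - 2 * R)\<^sup>2 \<le> R\<^sup>2\<close> by linarith
  moreover from this have "(r - 2 * R)\<^sup>2 / (2 * R\<^sup>2) < 1" using R2 by simp
  ultimately show ?thesis using 2 R unfolding f by auto
 next
  case 3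
  then have m: "max (r - 2 * R) 0 = r - 2 * R" "max (r - 3 * R) 0 = r - 3 * R" "max (r - 4 * R) 0 = 0" using R by auto
  have f: "cutoff R r = 1 - (4 * R - r)\<^sup>2 / (2 * R\<^sup>2)" "cutoff_deriv R r = (4 * R - r) / R\<^sup>2"
   using R unfolding cutoff_def cutoff_deriv_def m by (simp_all add: field_simps power2_eq_square)
  have "(4 * R - r)\<^sup>2 \<le> R\<^sup>2" using 3 by (intro power_mono) auto
  then have "(4 * R - r)\<^sup>2 \<le> 2 * R\<^sup>2" using R2 by linarith
  then have "(4 * R - r)\<^sup>2 / (2 * R\<^sup>2) \<le> 1" using R2 by simp
  moreover have "(4 * R - r) / R\<^sup>2 \<le> R / R\<^sup>2" using 3 R2 by (intro divide_right_mono) auto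
  moreover have "R / R\<^sup>2 = 1 / R" by (simp add: power2_eq_square)
  moreover have "0 \<le> (4 * R - r) / R\<^sup>2" "0 \<le> (4 * R - r)\<^sup>2 / (2 * R\<^sup>2)" using 3 by simp_all
  moreover have "r < 4 * R \<Longrightarrow> 0 < (4 * R - r)\<^sup>2 / (2 * R\<^sup>2)" using R by simp
  ultimately show ?thesis using 3 R unfolding f by auto
 next
  case 4
  then have m: "max (r - 2 * R) 0 = r - 2 * R" "max (r - 3 * R) 0 = r - 3 * R" "max (r - 4 * R) 0 = r - 4 * R" using R by auto
  have "cutoff R r = 1" "cutoff_deriv R r = 0"
   using R unfolding cutoff_def cutoff_deriv_def m by (simp_all add: field_simps power2_eq_square)
  then show ?thesis using 4 R by simp
 qed
 show "r \<le> 2 * R \<Longrightarrow> cutoff R r = 0" "4 * R \<le> r \<Longrightarrow> cutoff R r = 1" "0 \<le> cutoff R r" "cutoff R r \<le> 1"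
  "\<bar>cutoff_deriv R r\<bar> \<le> 1 / R" "r \<le> 2 * R \<or> 4 * R \<le> r \<Longrightarrow> cutoff_deriv R r = 0"
  "r < 4 * R \<Longrightarrow> cutoff R r < 1" using * by simp_all
qed

lemma cutoff_continuous: "R > 0 \<Longrightarrow> continuous_on UNIV (cutoff R)"
 by (rule DERIV_continuous_on[OF has_field_derivative_at_within[OF cutoff(1)]])

section \<open>Local consequences of the standing hypotheses; weighted energy and flux\<close>

locale conservativeness_setting =
 fixes \<mu> :: "'a::{metric_space, second_countable_topology} measure"
  and V DE DN :: "('a \<Rightarrow> real) set"
  and A E0 :: "('a \<Rightarrow> real) \<Rightarrow> ('a \<Rightarrow> real) \<Rightarrow> real"
  and U T T' :: "real \<Rightarrow> ('a \<Rightarrow> real) \<Rightarrow> 'a \<Rightarrow> real"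
  and S :: "nat \<Rightarrow> real \<Rightarrow> ('a \<Rightarrow> real) \<Rightarrow> 'a \<Rightarrow> real"
  and \<Gamma> :: "('a \<Rightarrow> real) \<Rightarrow> ('a \<Rightarrow> real) \<Rightarrow> 'a \<Rightarrow> real"
  and N :: "('a \<Rightarrow> real) \<Rightarrow> 'a \<Rightarrow> real"
  and \<rho> :: "'a \<Rightarrow> real" and K0 K :: "'a set" and p :: nat and t :: real
 assumes state_space: "state_space \<mu>"
  and setting: "gen_Dirichlet_setting \<mu> V A U T T'"
  and t_pos: "t > 0"
  and H1: "cond_H1 \<mu> T' t (exhaustion \<rho>) p S"
  and H2: "cond_H2 \<mu> (exhaustion \<rho>) p S DE E0 \<Gamma> DN N"
  and H3: "cond_H3 \<mu> DE \<Gamma> N \<rho> K0"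
  and K_compact: "compact K" and K0_K: "K0 \<subseteq> K"
begin

abbreviation "W n \<equiv> exhaustion \<rho> n"

lemma sets_mu: "sets \<mu> = sets borel" and finite_cpt: "compact C \<Longrightarrow> emeasure \<mu> C < \<infinity>"
 using state_space by (auto simp: state_space_def)

lemma rho_nonneg: "0 \<le> \<rho> x" and rho_continuous: "continuous_on UNIV \<rho>" and rho_loc: "\<rho> \<in> sub_loc \<mu> DE"
 and sublevel_rc: "r > 0 \<Longrightarrow> open (sublevel \<rho> r) \<and> compact (closure (sublevel \<rho> r))"
 using H3 by (auto simp: cond_H3_def relatively_compact_def)

lemma sublevel_compact: "compact (closure {x. \<rho> x < r})"
proof (cases "r > 0")
 case True then show ?thesis using sublevel_rc[of r] by (simp add: sublevel_def)
next
 case False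
 then have "{x. \<rho> x < r} = {}" using rho_nonneg by (auto simp: not_less intro: order_trans)
 then show ?thesis by simp
qed

sublocale form: local_form \<mu> DE E0 \<Gamma> \<rho>
proof
 show "sets \<mu> = sets borel" by (rule sets_mu)
 show "\<And>C. compact C \<Longrightarrow> emeasure \<mu> C < \<infinity>" by (rule finite_cpt)
 show "continuous_on UNIV \<rho>" by (rule rho_continuous)
 show "\<And>r. compact (closure {x. \<rho> x < r})" by (rule sublevel_compact)
qed (use H2 in \<open>simp_all only: cond_H2_def\<close>)

lemma W_iff: "x \<in> W n \<longleftrightarrow> \<rho> x < 4 * real n"
 by (simp add: exhaustion_def sublevel_def)

lemma sublevel_sets: "sublevel \<rho> r \<in> sets \<mu>"
proof -
 have "open (sublevel \<rho> r)" unfolding sublevel_def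
  using rho_continuous by (intro open_Collect_less continuous_on_const)
 then show ?thesis by (simp add: sets_mu)
qed

lemma sublevel_finite: "emeasure \<mu> (sublevel \<rho> r) < \<infinity>"
proof -
 have "emeasure \<mu> (sublevel \<rho> r) \<le> emeasure \<mu> (closure (sublevel \<rho> r))"
  by (intro emeasure_mono closure_subset) (simp add: sets_mu)
 also have "\<dots> < \<infinity>" using sublevel_compact[of r] by (intro finite_cpt) (simp add: sublevel_def)
 finally show ?thesis .
qed

lemma W_sets: "W n \<in> sets \<mu>" and W_finite: "emeasure \<mu> (W n) < \<infinity>"
 unfolding exhaustion_def by (rule sublevel_sets sublevel_finite)+

lemma W_open: "open (W n)" and W_rc: "compact (closure (W n))" and W_borel: "W n \<in> sets borel"
 unfolding exhaustion_def sublevel_def using rho_continuous sublevel_compact[of "4 * real n"]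
 by (auto intro!: open_Collect_less continuous_on_const borel_open)

lemma W_mono: "m \<le> n \<Longrightarrow> W m \<subseteq> W n"
 by (auto simp: W_iff)

lemma semigroup: "n \<ge> 1 \<Longrightarrow> contraction_semigroup (restrict_space \<mu> (W n)) p (S n)"
 using H1 W_finite[of n] W_sets[of n]
 by unfold_locales (auto simp: cond_H1_def emeasure_restrict_space space_restrict_space form.space_M)

lemma N_clauses:
 "DN \<subseteq> Lspace 2 \<mu>" "ae_subspace \<mu> DN" "ae_linear_on \<mu> DN N"
 "v \<in> DN \<Longrightarrow> N v \<in> sub_loc \<mu> (Lspace 1 \<mu>)"
 "sub_bdd \<mu> DE \<subseteq> DN"
 "n \<ge> 1 \<Longrightarrow> u \<in> sub_loc_bdd \<mu> DE \<Longrightarrow> cut (W n) u \<in> DN"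
 using H2 unfolding cond_H2_def by blast+

lemma N_const: "v \<in> sub_bdd \<mu> DE \<Longrightarrow> B \<in> sets borel \<Longrightarrow> AE x\<in>B in \<mu>. v x = c \<Longrightarrow> AE x\<in>B in \<mu>. N v x = 0"
 using H2 unfolding cond_H2_def by blast

lemma N_int: "v \<in> sub_cpt \<mu> (sub_bdd \<mu> DE) \<Longrightarrow> (LINT x|\<mu>. N v x) = 0"
 using H2 unfolding cond_H2_def by blast

lemma N_chain: "v \<in> sub_bdd \<mu> DN \<Longrightarrow> \<phi> \<in> C1b \<Longrightarrow> (\<lambda>x. \<phi> (v x)) \<in> Lspace 2 \<mu> \<Longrightarrow>
  AE x in \<mu>. N (\<lambda>y. \<phi> (v y)) x = deriv \<phi> (v x) * N v x"
 using H2 unfolding cond_H2_def by blast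

lemma N_prod: "u \<in> sub_bdd \<mu> DN \<Longrightarrow> v \<in> sub_bdd \<mu> DN \<Longrightarrow>
  (\<lambda>x. u x * v x) \<in> DN \<and> (AE x in \<mu>. N (\<lambda>y. u y * v y) x = v x * N u x + u x * N v x)"
 using H2 unfolding cond_H2_def by blast

lemma form_identity:
 assumes "n \<ge> 1" "v \<in> sub_bdd (restrict_space \<mu> (W n)) (gen_dom p (restrict_space \<mu> (W n)) (S n))"
 shows "cut (W n) v \<in> sub_bdd \<mu> DE"
  and "u \<in> DE \<Longrightarrow> set_integrable \<mu> (W n) (\<lambda>x. generator p (restrict_space \<mu> (W n)) (S n) v x * u x)"
  and "u \<in> DE \<Longrightarrow> set_integrable \<mu> (W n) (\<lambda>x. u x * N (cut (W n) v) x)"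
  and "u \<in> DE \<Longrightarrow> - (LINT x:W n|\<mu>. generator p (restrict_space \<mu> (W n)) (S n) v x * u x)
         = (LINT x|\<mu>. \<Gamma> u (cut (W n) v) x) + (LINT x:W n|\<mu>. u x * N (cut (W n) v) x)"
 using H2 assms unfolding cond_H2_def by blast+

lemma N_lin: "u \<in> DN \<Longrightarrow> v \<in> DN \<Longrightarrow> AE x in \<mu>. N (\<lambda>y. a * u y + b * v y) x = a * N u x + b * N v x"
 and N_cong: "u \<in> DN \<Longrightarrow> v \<in> DN \<Longrightarrow> AE x in \<mu>. u x = v x \<Longrightarrow> AE x in \<mu>. N u x = N v x"
 using N_clauses(3) unfolding ae_linear_on_def by blast+

lemma DN_lin: "u \<in> DN \<Longrightarrow> v \<in> DN \<Longrightarrow> (\<lambda>x. a * u x + b * v x) \<in> DN"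
 using N_clauses(2) unfolding ae_subspace_def by blast

lemma N_meas: "v \<in> DN \<Longrightarrow> N v \<in> borel_measurable \<mu>"
 using N_clauses(4)[of v] by (simp add: sub_loc_def)

lemma bdd_DN: "u \<in> sub_bdd \<mu> DE \<Longrightarrow> u \<in> sub_bdd \<mu> DN"
 using N_clauses(5) by (auto simp: sub_bdd_def)

lemma bdd_lin:
 assumes "u \<in> sub_bdd \<mu> DE" "v \<in> sub_bdd \<mu> DE"
 shows "(\<lambda>x. a * u x + b * v x) \<in> sub_bdd \<mu> DE"
proof -
 obtain c d where "AE x in \<mu>. \<bar>u x\<bar> \<le> c" "AE x in \<mu>. \<bar>v x\<bar> \<le> d" using assms by (auto simp: sub_bdd_def ae_bounded_def)
 then have "AE x in \<mu>. \<bar>a * u x + b * v x\<bar> \<le> \<bar>a\<bar> * c + \<bar>b\<bar> * d"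
 proof eventually_elim
  case (elim x)
  have "\<bar>a * u x\<bar> \<le> \<bar>a\<bar> * c" "\<bar>b * v x\<bar> \<le> \<bar>b\<bar> * d" using elim by (auto simp: abs_mult intro: mult_left_mono)
  then show ?case by linarith
 qed
 then show ?thesis using assms form.D_lin[of u v a b] by (auto simp: sub_bdd_def ae_bounded_def)
qed

lemma bdd_add: "u \<in> sub_bdd \<mu> DE \<Longrightarrow> v \<in> sub_bdd \<mu> DE \<Longrightarrow> (\<lambda>x. u x + v x) \<in> sub_bdd \<mu> DE"
 using bdd_lin[of u v 1 1] by simp
lemma bdd_diff: "u \<in> sub_bdd \<mu> DE \<Longrightarrow> v \<in> sub_bdd \<mu> DE \<Longrightarrow> (\<lambda>x. u x - v x) \<in> sub_bdd \<mu> DE"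
 using bdd_lin[of u v 1 "-1"] by simp
lemma bdd_D: "u \<in> sub_bdd \<mu> DE \<Longrightarrow> u \<in> DE"
 by (simp add: sub_bdd_def)

lemma N_add: "u \<in> sub_bdd \<mu> DE \<Longrightarrow> v \<in> sub_bdd \<mu> DE \<Longrightarrow> AE x in \<mu>. N (\<lambda>y. u y + v y) x = N u x + N v x"
 using N_lin[of u v 1 1] N_clauses(5) by auto
lemma N_diff: "u \<in> sub_bdd \<mu> DE \<Longrightarrow> v \<in> sub_bdd \<mu> DE \<Longrightarrow> AE x in \<mu>. N (\<lambda>y. u y - v y) x = N u x - N v x"
 using N_lin[of u v 1 "-1"] N_clauses(5) by auto
lemma N_mult: "u \<in> sub_bdd \<mu> DE \<Longrightarrow> v \<in> sub_bdd \<mu> DE \<Longrightarrow> AE x in \<mu>. N (\<lambda>y. u y * v y) x = v x * N u x + u x * N v x"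
 using N_prod[OF bdd_DN bdd_DN, of u v] by blast

text \<open>\<rho> belongs to the form domain only locally; \<open>r\<close> is a bounded global
  element standing in for it on \<open>W n\<close>. The bounds valid everywhere keep the difference
  from \<open>cut (W n) \<rho>\<close> bounded in \<open>N_rho_eq\<close>.\<close>

definition rho_trunc :: "nat \<Rightarrow> ('a \<Rightarrow> real) \<Rightarrow> bool" where
 "rho_trunc n r \<longleftrightarrow> r \<in> sub_bdd \<mu> DE \<and> (\<forall>x. 0 \<le> r x \<and> r x \<le> 4 * real n) \<and> (AE x\<in>W n in \<mu>. r x = \<rho> x)"

lemma rho_trunc_exists: "\<exists>r. rho_trunc n r"
proof -
 obtain v where v: "v \<in> DE" "AE x\<in>W n in \<mu>. \<rho> x = v x"
  using rho_loc W_open[of n] W_rc[of n] by (auto simp: sub_loc_def relatively_compact_def)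
 let ?r = "clip (4 * real n) v"
 have b: "0 \<le> ?r x \<and> ?r x \<le> 4 * real n" for x by (rule clip_bounds) simp
 then have "ae_bounded \<mu> ?r" unfolding ae_bounded_def by (intro exI[of _ "4 * real n"] AE_I2) simp
 then have "?r \<in> sub_bdd \<mu> DE" using form.clip_D(1)[OF v(1), of "4 * real n"] by (simp add: sub_bdd_def)
 moreover have "AE x\<in>W n in \<mu>. ?r x = \<rho> x"
  using v(2)
 proof eventually_elim
  case (elim x)
  show ?case
  proof
   assume "x \<in> W n"
   then have "v x = \<rho> x" "\<rho> x \<le> 4 * real n" using elim by (auto simp: W_iff)
   then show "?r x = \<rho> x" using rho_nonneg[of x] by (simp add: clip_def)
  qed
 qed
 ultimately show ?thesis using b by (auto simp: rho_trunc_def)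
qed

text \<open>Constants need not lie in the form domain, and \<open>e\<close> replaces the constant 1
  on \<open>W n\<close>. Regularity provides approximations only, but doubling one that is within
  1/2 and truncating at 1 yields the exact value 1.\<close>

lemma cutoff_exists: "\<exists>e m. e \<in> form.Dc \<and> (\<forall>x. 0 \<le> e x \<and> e x \<le> 1) \<and> (\<forall>x\<in>W n. e x = 1) \<and> m \<ge> n \<and> (\<forall>x. x \<notin> W m \<longrightarrow> e x = 0)"
proof -
 let ?f = "\<lambda>x. max 0 (min 1 (4 * real n + 2 - \<rho> x))"
 have f: "?f \<in> Cc"
 proof (rule CcI[OF _ sublevel_compact[of "4 * real n + 2"]])
  show "continuous_on UNIV ?f" by (intro continuous_intros rho_continuous)
  show "?f x = 0" if "x \<notin> closure {x. \<rho> x < 4 * real n + 2}" for x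
  proof -
   have "x \<notin> {x. \<rho> x < 4 * real n + 2}" using that closure_subset[of "{x. \<rho> x < 4 * real n + 2}"] by blast
   then show ?thesis by (simp add: max_def min_def)
  qed
 qed
 have half: "(0::real) < 1 / 2" by simp
 obtain v where v: "v \<in> form.Dc" "\<And>x. \<bar>?f x - v x\<bar> < 1 / 2"
 proof -
  have "\<forall>f\<in>Cc. \<forall>e>0. \<exists>v\<in>form.Dc. \<forall>x. \<bar>f x - v x\<bar> < e"
   using form.regular unfolding regular_form_def by (rule conjunct2)
  from this[rule_format, OF f half] that show ?thesis by (elim bexE) (simp only:)
 qed
 define e where "e = clip 1 (\<lambda>x. 2 * v x)"
 have eDc: "e \<in> form.Dc" unfolding e_def by (intro form.clip_Dc form.Dc_scale v) simp
 have e1: "e x = 1" if "x \<in> W n" for x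
 proof -
  have "?f x = 1" using that by (simp add: W_iff)
  then have "2 * v x \<ge> 1" using v(2)[of x] by linarith
  then show ?thesis by (simp add: e_def clip_def)
 qed
 have eb: "0 \<le> e x \<and> e x \<le> 1" for x unfolding e_def by (rule clip_bounds) simp
 obtain C where C: "compact C" "\<And>x. x \<notin> C \<Longrightarrow> e x = 0" by (rule Cc_supportE[of e]) (use eDc in blast)+
 have "compact (\<rho> ` C)" by (intro compact_continuous_image continuous_on_subset[OF rho_continuous] C) simp
 then obtain B where B: "\<And>x. x \<in> C \<Longrightarrow> \<bar>\<rho> x\<bar> \<le> B"
  using compact_imp_bounded[of "\<rho> ` C"] unfolding bounded_iff by auto
 obtain m0 :: nat where m0: "real m0 > B" using reals_Archimedean2 by blast
 have "e x = 0" if "x \<notin> W (max m0 n)" for x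
 proof (rule C(2))
  show "x \<notin> C"
  proof
   assume "x \<in> C"
   then have "\<rho> x < 4 * real (max m0 n)" using B[of x] m0 rho_nonneg[of x] by (auto simp: of_nat_max max_def)
   then show False using that by (simp add: W_iff)
  qed
 qed
 then show ?thesis using eDc e1 eb by (intro exI[of _ e] exI[of _ "max m0 n"]) auto
qed

text \<open>One \<open>F\<close> has to serve both calculi: \<open>F 0 = 0\<close> and a bounded
  derivative for \<Gamma>, bounded value and derivative for \<open>N\<close>.\<close>

lemma chain_bdd:
 assumes r: "r \<in> sub_bdd \<mu> DE" and F: "\<And>x. (F has_real_derivative F' x) (at x)" "continuous_on UNIV F'"
  "F 0 = 0" "\<And>x. \<bar>F' x\<bar> \<le> L" "\<And>x. \<bar>F x\<bar> \<le> B"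
 shows "(\<lambda>x. F (r x)) \<in> sub_bdd \<mu> DE"
  "w \<in> DE \<Longrightarrow> AE x in \<mu>. \<Gamma> (\<lambda>x. F (r x)) w x = F' (r x) * \<Gamma> r w x"
  "AE x in \<mu>. N (\<lambda>x. F (r x)) x = F' (r x) * N r x"
proof -
 have rep: "form.repr (\<lambda>x. F (r x)) (\<lambda>x. F' (r x)) r"
  by (rule form.chain_rule[where F = F and F' = F' and L = L, OF bdd_D[OF r] F(1) F(2) F(3) F(4)])
 have "ae_bounded \<mu> (\<lambda>x. F (r x))" unfolding ae_bounded_def using F(5) by (intro exI[of _ B] AE_I2)
 then show b: "(\<lambda>x. F (r x)) \<in> sub_bdd \<mu> DE" using rep by (simp add: sub_bdd_def form.repr_def)
 show "w \<in> DE \<Longrightarrow> AE x in \<mu>. \<Gamma> (\<lambda>x. F (r x)) w x = F' (r x) * \<Gamma> r w x"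
  using rep unfolding form.repr_def by blast
 have dF: "deriv F = F'" using F(1) DERIV_imp_deriv by blast
 have "F \<in> C1b"
 proof -
  have "F differentiable (at x)" for x using F(1)[of x] by (auto simp: real_differentiable_def)
  moreover have "bounded (range F)" using F(5) by (auto simp: bounded_iff)
  moreover have "bounded (range F')" using F(4) by (auto simp: bounded_iff)
  ultimately show ?thesis using F(2) by (simp add: C1b_def dF)
 qed
 then show "AE x in \<mu>. N (\<lambda>x. F (r x)) x = F' (r x) * N r x"
  using N_chain[OF bdd_DN[OF r], of F] form.D_L2[OF bdd_D[OF b]] by (simp add: dF)
qed

text \<open>The domain of \<open>N\<close> contains cut-offs of bounded local functions, while
  \<rho> may be unbounded; truncating it at \<open>4 n\<close> changes nothing on
  \<open>W n\<close>.\<close>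

lemma cut_rho_DN:
 assumes n: "n \<ge> 1"
 shows "cut (W n) \<rho> \<in> DN"
proof -
 let ?u = "\<lambda>x. min (\<rho> x) (4 * real n)"
 have "?u \<in> sub_loc \<mu> DE"
  unfolding sub_loc_def
 proof (intro CollectI conjI allI impI)
  show "?u \<in> borel_measurable \<mu>" using form.rho_meas by simp
  fix G :: "'a set" assume "open G \<and> relatively_compact G"
  then obtain v where v: "v \<in> DE" "AE x\<in>G in \<mu>. \<rho> x = v x" using rho_loc unfolding sub_loc_def by blast
  have "AE x\<in>G in \<mu>. ?u x = clip (4 * real n) v x"
   using v(2)
  proof eventually_elim
   case (elim x)
   then show ?case using rho_nonneg[of x] by (auto simp: clip_def)
  qed
  then show "\<exists>v\<in>DE. AE x\<in>G in \<mu>. ?u x = v x" using form.clip_D(1)[OF v(1), of "4 * real n"] by auto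
 qed
 moreover have "\<forall>x. \<bar>?u x\<bar> \<le> 4 * real n" using rho_nonneg by (auto simp: abs_le_iff min_def)
 ultimately have "?u \<in> sub_loc_bdd \<mu> DE" unfolding sub_loc_bdd_def by blast
 then have "cut (W n) ?u \<in> DN" by (rule N_clauses(6)[OF n])
 moreover have "cut (W n) ?u = cut (W n) \<rho>" by (auto simp: cut_def W_iff indicator_def fun_eq_iff)
 ultimately show ?thesis by simp
qed

text \<open>
 \<open>cut (W n) \<rho>\<close> need not lie in the domain of the form, so locality of \<open>N\<close> is not available for it. The
 product rule is used instead, with a factor that is positive exactly on \<open>W n\<close>.
\<close>

lemma N_rho_eq:
 assumes n: "n \<ge> 1" and r: "rho_trunc n r"
 shows "AE x\<in>W n in \<mu>. N r x = N_rho N \<rho> n x"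
proof -
 have rb: "r \<in> sub_bdd \<mu> DE" "\<And>x. 0 \<le> r x" and rae: "AE x\<in>W n in \<mu>. r x = \<rho> x"
  using r by (auto simp: rho_trunc_def)
 let ?c = "cut (W n) \<rho>"
 have cDN: "?c \<in> DN" by (rule cut_rho_DN[OF n])
 have rDN: "r \<in> DN" using bdd_DN[OF rb(1)] by (simp add: sub_bdd_def)
 define d where "d = (\<lambda>x. 1 * ?c x + (-1) * r x)"
 have dDN: "d \<in> DN" unfolding d_def by (rule DN_lin[OF cDN rDN])
 have "\<bar>d x\<bar> \<le> 8 * real n" for x
 proof -
  have "0 \<le> ?c x \<and> ?c x \<le> 4 * real n" using rho_nonneg[of x] by (auto simp: cut_def indicator_def W_iff)
  then show ?thesis using r by (auto simp: d_def rho_trunc_def abs_le_iff) (smt (verit))+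
 qed
 then have "ae_bounded \<mu> d" unfolding ae_bounded_def by (intro exI[of _ "8 * real n"] AE_I2)
 then have db: "d \<in> sub_bdd \<mu> DN" using dDN by (simp add: sub_bdd_def)
 have d0: "AE x\<in>W n in \<mu>. d x = 0"
  using rae by eventually_elim (auto simp: d_def cut_def)
 obtain e m where e: "e \<in> form.Dc" "\<And>x. 0 \<le> e x \<and> e x \<le> 1" "\<And>x. x \<in> W n \<Longrightarrow> e x = 1" "m \<ge> n" "\<And>x. x \<notin> W m \<Longrightarrow> e x = 0"
  using cutoff_exists[of n] by blast
 \<comment> \<open>The stand-in \<open>r\<close> reflects \<rho> only inside \<open>W n\<close>,
   whereas the factor must be seen to vanish outside. Hence a second stand-in on the larger set
   \<open>W m\<close>, beyond which \<open>e\<close> is zero.\<close>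
 obtain r' where r': "rho_trunc m r'" using rho_trunc_exists by blast
 have n0: "real n > 0" using n by simp
 let ?H = "\<lambda>x. cutoff (real n) (r' x)"
 have Hbd: "?H \<in> sub_bdd \<mu> DE"
 proof (rule chain_bdd(1)[OF _ cutoff(1,2)[OF n0] _ cutoff(7)[OF n0]])
  show "r' \<in> sub_bdd \<mu> DE" using r' by (simp add: rho_trunc_def)
  show "cutoff (real n) 0 = 0" using cutoff(3)[OF n0] by simp
  show "\<bar>cutoff (real n) y\<bar> \<le> 1" for y using cutoff(5,6)[OF n0, of y] by simp
 qed
 have eb: "e \<in> sub_bdd \<mu> DE" by (rule form.Dc_bdd[OF e(1)])
 define q where "q = (\<lambda>x. e x - e x * ?H x)"
 have qb: "q \<in> sub_bdd \<mu> DE" unfolding q_def by (intro bdd_diff eb form.D_bdd_mult(1) Hbd)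
 have qv: "q x = e x * (1 - ?H x)" for x unfolding q_def by (simp add: algebra_simps)
 have r'ae: "AE x\<in>W m in \<mu>. r' x = \<rho> x" using r' by (simp add: rho_trunc_def)
 have zero: "AE x in \<mu>. q x * d x = 0"
  using r'ae d0
 proof eventually_elim
  case (elim x)
  consider "x \<in> W n" | "x \<notin> W n" "x \<in> W m" | "x \<notin> W m" by blast
  then show ?case
  proof cases
   case 2
   then have "4 * real n \<le> r' x" using elim(1) by (simp add: W_iff)
   then show ?thesis using cutoff(4)[OF n0] by (simp add: qv)
  qed (use elim(2) e(5) in \<open>simp_all add: qv\<close>)
 qed
 have prod: "(\<lambda>x. q x * d x) \<in> DN" "AE x in \<mu>. N (\<lambda>y. q y * d y) x = d x * N q x + q x * N d x"
  using N_prod[OF bdd_DN[OF qb] db] by blast+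
 have zDN: "(\<lambda>_. 0) \<in> DN" using N_clauses(2) unfolding ae_subspace_def by blast
 have "AE x in \<mu>. N (\<lambda>y. 0 * 0 + 0 * 0) x = 0 * N (\<lambda>_. 0) x + 0 * N (\<lambda>_. 0) x" by (rule N_lin[OF zDN zDN])
 then have N0: "AE x in \<mu>. N (\<lambda>_. 0) x = 0" by simp
 have Nz: "AE x in \<mu>. N (\<lambda>x. q x * d x) x = N (\<lambda>_. 0) x" by (rule N_cong[OF prod(1) zDN zero])
 have Nd: "AE x in \<mu>. N d x = 1 * N ?c x + (-1) * N r x" unfolding d_def by (rule N_lin[OF cDN rDN])
 show ?thesis
  using prod(2) N0 Nz Nd d0 r'ae
 proof eventually_elim
  case (elim x)
  show ?case
  proof
   assume x: "x \<in> W n"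
   then have "x \<in> W m" using W_mono[OF e(4)] by blast
   \<comment> \<open>Strictness matters: \<open>cutoff n\<close> reaches 1 exactly at
     \<open>4 n\<close>, the level that bounds \<open>W n\<close>.\<close>
   then have "r' x < 4 * real n" using elim(6) x by (simp add: W_iff)
   then have "q x > 0" using e(3)[OF x] cutoff(9)[OF n0] by (simp add: qv)
   moreover have "q x * N d x = 0" using elim(1,2,3,5) x by simp
   ultimately have "N d x = 0" by simp
   then show "N r x = N_rho N \<rho> n x" using elim(4) by (simp add: N_rho_def)
  qed
 qed
qed

abbreviation "\<Gamma>\<rho> \<equiv> carre_loc \<mu> DE \<Gamma> \<rho> \<rho>"

text \<open>\<open>carre_loc\<close> is a choice, so a witness is needed. The densities
  \<open>\<Gamma>(r n, r n)\<close> stabilise on each \<open>W k\<close> by locality, and a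
  relatively compact set lies in some \<open>W k\<close> because \<rho> is bounded on its
  closure.\<close>

lemma carre_loc_spec:
 "\<Gamma>\<rho> \<in> borel_measurable \<mu> \<and>
   (\<forall>G. \<forall>u'\<in>DE. \<forall>v'\<in>DE. open G \<and> relatively_compact G
    \<and> (AE x\<in>G in \<mu>. \<rho> x = u' x) \<and> (AE x\<in>G in \<mu>. \<rho> x = v' x)
    \<longrightarrow> (AE x\<in>G in \<mu>. \<Gamma>\<rho> x = \<Gamma> u' v' x))"
proof -
 obtain r where r: "\<And>n. rho_trunc n (r n)" using rho_trunc_exists by metis
 have rD: "r n \<in> DE" for n using r[of n] by (simp add: rho_trunc_def sub_bdd_def)
 have rae: "AE x\<in>W n in \<mu>. r n x = \<rho> x" for n using r[of n] by (simp add: rho_trunc_def)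
 define g where "g = (\<lambda>x. lim (\<lambda>n. \<Gamma> (r n) (r n) x))"
 have gm: "g \<in> borel_measurable \<mu>" unfolding g_def
  using form.Gam_int[OF rD rD] by (intro borel_measurable_lim_metric) auto
 have "AE x in \<mu>. \<forall>k l. k \<le> l \<longrightarrow> x \<in> W k \<longrightarrow> \<Gamma> (r l) (r l) x = \<Gamma> (r k) (r k) x"
  unfolding AE_all_countable
 proof (intro allI)
  fix k l
  show "AE x in \<mu>. k \<le> l \<longrightarrow> x \<in> W k \<longrightarrow> \<Gamma> (r l) (r l) x = \<Gamma> (r k) (r k) x"
   using form.Gam_level[OF rD rD rD, of l k l] form.Gam_level[OF rD rD rD, of l k k] form.Gam_sym[OF rD rD, of k l] rae[of k] rae[of l]
  proof eventually_elim
   case (elim x)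
   show ?case
   proof (intro impI)
    assume "k \<le> l" "x \<in> W k"
    then have "r l x = r k x" using elim(4,5) W_mono[of k l] by auto
    then show "\<Gamma> (r l) (r l) x = \<Gamma> (r k) (r k) x" using elim(1,2,3) by simp
   qed
  qed
 qed
 then have gW: "AE x in \<mu>. \<forall>k. x \<in> W k \<longrightarrow> g x = \<Gamma> (r k) (r k) x"
 proof eventually_elim
  case (elim x)
  show ?case
  proof (intro allI impI)
   fix k assume x: "x \<in> W k"
   have "(\<lambda>n. \<Gamma> (r n) (r n) x) \<longlonglongrightarrow> \<Gamma> (r k) (r k) x"
    by (rule tendsto_eventually[OF eventually_mono[OF eventually_ge_at_top[of k]]]) (use elim x in blast)
   then show "g x = \<Gamma> (r k) (r k) x" unfolding g_def by (rule limI)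
  qed
 qed
 have "\<exists>g. g \<in> borel_measurable \<mu> \<and> (\<forall>G. \<forall>u'\<in>DE. \<forall>v'\<in>DE. open G \<and> relatively_compact G
    \<and> (AE x\<in>G in \<mu>. \<rho> x = u' x) \<and> (AE x\<in>G in \<mu>. \<rho> x = v' x)
    \<longrightarrow> (AE x\<in>G in \<mu>. g x = \<Gamma> u' v' x))"
 proof (intro exI[of _ g] conjI gm allI ballI impI)
  fix G u' v' assume u': "u' \<in> DE" and v': "v' \<in> DE"
   and G: "open G \<and> relatively_compact G \<and> (AE x\<in>G in \<mu>. \<rho> x = u' x) \<and> (AE x\<in>G in \<mu>. \<rho> x = v' x)"
  have "compact (\<rho> ` closure G)" using G
   by (intro compact_continuous_image continuous_on_subset[OF rho_continuous]) (auto simp: relatively_compact_def)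
  then obtain B where B: "\<And>x. x \<in> closure G \<Longrightarrow> \<bar>\<rho> x\<bar> \<le> B"
   using compact_imp_bounded[of "\<rho> ` closure G"] unfolding bounded_iff by auto
  obtain k :: nat where k: "real k > B" using reals_Archimedean2 by blast
  have GW: "x \<in> W k" if "x \<in> G" for x
   using B[of x] that closure_subset[of G] k rho_nonneg[of x] by (auto simp: W_iff)
  have Gu: "AE x\<in>G in \<mu>. \<rho> x = u' x" and Gv: "AE x\<in>G in \<mu>. \<rho> x = v' x" using G by auto
  show "AE x\<in>G in \<mu>. g x = \<Gamma> u' v' x"
   using gW rae[of k] Gu Gv form.Gam_level[OF u' rD v', of k] form.Gam_level[OF v' rD rD, of k k] form.Gam_sym[OF rD v', of k]
  proof eventually_elim
   case (elim x)
   show ?case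
   proof
    assume x: "x \<in> G"
    then have "u' x = r k x" "v' x = r k x" using elim(2,3,4) GW by auto
    then show "g x = \<Gamma> u' v' x" using elim(1,5,6,7) GW[OF x] by simp
   qed
  qed
 qed
 from someI_ex[OF this] show ?thesis unfolding carre_loc_def .
qed

lemma Gam_rho_meas: "\<Gamma>\<rho> \<in> borel_measurable \<mu>"
 using carre_loc_spec by blast

lemma Gam_rho_eq:
 assumes r: "rho_trunc n r"
 shows "AE x\<in>W n in \<mu>. \<Gamma> r r x = \<Gamma>\<rho> x" "AE x\<in>W n in \<mu>. 0 \<le> \<Gamma>\<rho> x"
proof -
 have "AE x\<in>W n in \<mu>. \<rho> x = r x" using r by (auto simp: rho_trunc_def)
 then have "AE x\<in>W n in \<mu>. \<Gamma>\<rho> x = \<Gamma> r r x"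
  using carre_loc_spec r W_open[of n] W_rc[of n] unfolding rho_trunc_def sub_bdd_def relatively_compact_def by blast
 then show "AE x\<in>W n in \<mu>. \<Gamma> r r x = \<Gamma>\<rho> x" by eventually_elim auto
 moreover have "AE x in \<mu>. 0 \<le> \<Gamma> r r x" using r by (intro form.Gam_nonneg) (simp add: rho_trunc_def sub_bdd_def)
 ultimately show "AE x\<in>W n in \<mu>. 0 \<le> \<Gamma>\<rho> x" by eventually_elim auto
qed

text \<open>Off \<open>W n\<close> the function is constant, so \<open>N f\<close> vanishes there;
  on the relatively compact \<open>W n\<close> local integrability is integrability. The integral
  over \<open>W n\<close> is thus the one over the whole space, which is 0.\<close>

lemma N_compact_support:
 assumes f: "f \<in> sub_bdd \<mu> DE" "\<And>x. x \<notin> W n \<Longrightarrow> f x = 0"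
 shows "set_integrable \<mu> (W n) (N f)" "(LINT x:W n|\<mu>. N f x) = 0"
proof -
 have "- W n \<in> sets borel" using W_borel[of n] by auto
 moreover have "AE x\<in>- W n in \<mu>. f x = 0" using f(2) by (intro AE_I2) auto
 ultimately have off: "AE x\<in>- W n in \<mu>. N f x = 0" by (rule N_const[OF f(1)])
 have "N f \<in> sub_loc \<mu> (Lspace 1 \<mu>)" using N_clauses(4)[of f] N_clauses(5) f(1) by blast
 then obtain w where w: "w \<in> Lspace 1 \<mu>" "AE x\<in>W n in \<mu>. N f x = w x"
  using W_open[of n] W_rc[of n] unfolding sub_loc_def relatively_compact_def by blast
 have Nm: "N f \<in> borel_measurable \<mu>" using N_meas[of f] N_clauses(5) f(1) by blast
 have "integrable \<mu> (\<lambda>x. indicator (W n) x *\<^sub>R w x)"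
  using integrable_mult_indicator[OF W_sets w(1)[unfolded Lspace1_iff]] .
 moreover have "AE x in \<mu>. indicator (W n) x *\<^sub>R w x = indicator (W n) x *\<^sub>R N f x"
  using w(2) by eventually_elim (auto simp: indicator_def)
 ultimately have i: "integrable \<mu> (\<lambda>x. indicator (W n) x *\<^sub>R N f x)"
  using Nm W_sets borel_measurable_integrable[OF w(1)[unfolded Lspace1_iff]] by (subst (asm) integrable_cong_AE) auto
 then show "set_integrable \<mu> (W n) (N f)" by (simp add: set_integrable_def)
 have ae: "AE x in \<mu>. indicator (W n) x *\<^sub>R N f x = N f x"
  using off by eventually_elim (auto simp: indicator_def)
 have "compact (ess_supp \<mu> f)"
  by (rule ess_supp_compact[OF W_rc[of n]]) (use f(2) closure_subset[of "W n"] in blast)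
 then have "(LINT x|\<mu>. N f x) = 0" using f(1) by (intro N_int) (simp add: sub_cpt_def)
 moreover have "(LINT x|\<mu>. indicator (W n) x *\<^sub>R N f x) = (LINT x|\<mu>. N f x)"
  using Nm W_sets by (intro integral_cong_AE ae) auto
 ultimately show "(LINT x:W n|\<mu>. N f x) = 0" by (simp add: set_lebesgue_integral_def)
qed

text \<open>The conditions under which \<open>exp (\<Phi> r) - 1\<close> is a C1 function of
  \<open>r\<close>, bounded with bounded derivative and zero at 0, so that both calculi apply to
  it.\<close>

definition weight :: "(real \<Rightarrow> real) \<Rightarrow> (real \<Rightarrow> real) \<Rightarrow> bool" where
 "weight \<Phi> \<psi> \<longleftrightarrow> (\<forall>r. (\<Phi> has_real_derivative \<psi> r) (at r)) \<and> continuous_on UNIV \<psi> \<and> \<Phi> 0 = 0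
  \<and> (\<exists>L. \<forall>r. 0 \<le> \<psi> r \<and> \<psi> r \<le> L) \<and> (\<exists>B. \<forall>r. 0 \<le> \<Phi> r \<and> \<Phi> r \<le> B)"

lemma weight_function:
 assumes w: "weight \<Phi> \<psi>" and r: "rho_trunc n r"
 shows "(\<lambda>x. exp (\<Phi> (r x)) - 1) \<in> sub_bdd \<mu> DE"
  "w \<in> DE \<Longrightarrow> AE x in \<mu>. \<Gamma> (\<lambda>x. exp (\<Phi> (r x)) - 1) w x = (exp (\<Phi> (r x)) * \<psi> (r x)) * \<Gamma> r w x"
  "AE x in \<mu>. N (\<lambda>x. exp (\<Phi> (r x)) - 1) x = (exp (\<Phi> (r x)) * \<psi> (r x)) * N r x"
proof -
 have rb: "r \<in> sub_bdd \<mu> DE" using r by (simp add: rho_trunc_def)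
 obtain L where L: "\<And>r. 0 \<le> \<psi> r \<and> \<psi> r \<le> L" using w unfolding weight_def by blast
 obtain B where B: "\<And>r. 0 \<le> \<Phi> r \<and> \<Phi> r \<le> B" using w unfolding weight_def by blast
 have d: "(\<Phi> has_real_derivative \<psi> y) (at y)" for y using w unfolding weight_def by blast
 have \<Phi>c: "continuous_on UNIV \<Phi>" by (rule DERIV_continuous_on[OF has_field_derivative_at_within[OF d]])
 have d': "((\<lambda>y. exp (\<Phi> y) - 1) has_real_derivative exp (\<Phi> y) * \<psi> y) (at y)" for y
  using DERIV_diff[OF DERIV_chain2[OF DERIV_exp d] DERIV_const[of 1]] by simp
 have c': "continuous_on UNIV (\<lambda>y. exp (\<Phi> y) * \<psi> y)"
  using w \<Phi>c unfolding weight_def by (intro continuous_intros) auto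
 have z: "exp (\<Phi> 0) - 1 = 0" using w unfolding weight_def by simp
 have b1: "\<bar>exp (\<Phi> y) * \<psi> y\<bar> \<le> exp B * L" for y
  unfolding abs_mult using L[of y] B[of y] by (intro mult_mono) auto
 have b2: "\<bar>exp (\<Phi> y) - 1\<bar> \<le> exp B" for y
 proof -
  have "1 \<le> exp (\<Phi> y)" "exp (\<Phi> y) \<le> exp B" using B[of y] by auto
  then show ?thesis unfolding abs_le_iff by linarith
 qed
 note C = chain_bdd[OF rb, where F = "\<lambda>y. exp (\<Phi> y) - 1" and F' = "\<lambda>y. exp (\<Phi> y) * \<psi> y", OF d' c' z b1 b2]
 show "(\<lambda>x. exp (\<Phi> (r x)) - 1) \<in> sub_bdd \<mu> DE" by (rule C(1))
 show "w \<in> DE \<Longrightarrow> AE x in \<mu>. \<Gamma> (\<lambda>x. exp (\<Phi> (r x)) - 1) w x = (exp (\<Phi> (r x)) * \<psi> (r x)) * \<Gamma> r w x" by (rule C(2))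
 show "AE x in \<mu>. N (\<lambda>x. exp (\<Phi> (r x)) - 1) x = (exp (\<Phi> (r x)) * \<psi> (r x)) * N r x" by (rule C(3))
qed

abbreviation "Mn n \<equiv> restrict_space \<mu> (W n)"
abbreviation "Gen n \<equiv> generator p (Mn n) (S n)"
abbreviation "dom_bdd n \<equiv> sub_bdd (Mn n) (gen_dom p (Mn n) (S n))"

text \<open>The product of \<open>exp (\<Phi> r)\<close> and \<open>v\<close>, written through
  \<open>exp (\<Phi> r) - 1\<close> because that function is known to lie in the form
  domain.\<close>

definition weighted :: "nat \<Rightarrow> (real \<Rightarrow> real) \<Rightarrow> ('a \<Rightarrow> real) \<Rightarrow> ('a \<Rightarrow> real) \<Rightarrow> 'a \<Rightarrow> real" where
 "weighted n \<Phi> r v = (\<lambda>x. cut (W n) v x + cut (W n) v x * (exp (\<Phi> (r x)) - 1))"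

lemma weighted_basic:
 assumes n: "n \<ge> 1" and v: "v \<in> dom_bdd n" and w: "weight \<Phi> \<psi>" and r: "rho_trunc n r"
 shows "cut (W n) v \<in> sub_bdd \<mu> DE" "weighted n \<Phi> r v \<in> sub_bdd \<mu> DE"
  "g \<in> DE \<Longrightarrow> AE x in \<mu>. \<Gamma> (weighted n \<Phi> r v) g x
    = exp (\<Phi> (r x)) * \<Gamma> (cut (W n) v) g x + cut (W n) v x * \<Gamma> (\<lambda>x. exp (\<Phi> (r x)) - 1) g x"
  "weighted n \<Phi> r v x = exp (\<Phi> (r x)) * cut (W n) v x"
  "x \<notin> W n \<Longrightarrow> weighted n \<Phi> r v x = 0"
proof -
 show v': "cut (W n) v \<in> sub_bdd \<mu> DE" by (rule form_identity(1)[OF n v])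
 note P = weight_function(1)[OF w r]
 have vP: "(\<lambda>x. cut (W n) v x * (exp (\<Phi> (r x)) - 1)) \<in> sub_bdd \<mu> DE" by (rule form.D_bdd_mult(1)[OF v' P])
 show "weighted n \<Phi> r v \<in> sub_bdd \<mu> DE" unfolding weighted_def by (rule bdd_add[OF v' vP])
 show "weighted n \<Phi> r v x = exp (\<Phi> (r x)) * cut (W n) v x" by (simp add: weighted_def algebra_simps)
 show "x \<notin> W n \<Longrightarrow> weighted n \<Phi> r v x = 0" by (simp add: weighted_def cut_def)
 assume g: "g \<in> DE"
 show "AE x in \<mu>. \<Gamma> (weighted n \<Phi> r v) g x
    = exp (\<Phi> (r x)) * \<Gamma> (cut (W n) v) g x + cut (W n) v x * \<Gamma> (\<lambda>x. exp (\<Phi> (r x)) - 1) g x"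
  using form.Gam_add1[OF bdd_D[OF v'] bdd_D[OF vP] g] form.D_bdd_mult(2)[OF v' P g] unfolding weighted_def
  by eventually_elim (simp add: algebra_simps)
qed

lemma bdd_sq_integrable:
 assumes "f \<in> sub_bdd \<mu> DE" "g \<in> sub_bdd \<mu> DE" "integrable \<mu> X"
 shows "integrable \<mu> (\<lambda>x. (f x * g x) * X x)"
proof -
 obtain c where c: "AE x in \<mu>. \<bar>f x * g x\<bar> \<le> c"
  using form.D_bdd_mult(1)[OF assms(1,2)] by (auto simp: sub_bdd_def ae_bounded_def)
 show ?thesis
  by (rule integrable_mult_bounded[OF assms(3) form.D_meas[OF bdd_D[OF form.D_bdd_mult(1)[OF assms(1,2)]]] c])
qed

text \<open>The test function is \<open>z = exp (\<Phi>) u = exp (2 \<Phi>) v\<close>. With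
  \<open>P = exp (\<Phi>) - 1\<close> the cross terms cancel:
  \<open>\<Gamma>(z, v) = \<Gamma>(u, u) - v\<^sup>2 \<Gamma>(P, P)\<close>. Likewise
  \<open>z N v = N(u\<^sup>2) / 2 - u v N P\<close>, where the first term integrates to 0. The two
  remainders add up to \<open>u\<^sup>2\<close> times the quantity bounded by
  \<open>B\<close>.\<close>

lemma weighted_energy:
 assumes n: "n \<ge> 1" and v: "v \<in> dom_bdd n" and w: "weight \<Phi> \<psi>" and r: "rho_trunc n r"
  and B: "AE x\<in>W n in \<mu>. (\<psi> (\<rho> x))\<^sup>2 * \<Gamma>\<rho> x + \<psi> (\<rho> x) * N_rho N \<rho> n x \<le> B"
 defines "u \<equiv> weighted n \<Phi> r v"
 shows "(LINT x:W n|\<mu>. Gen n v x * (u x * exp (\<Phi> (r x)))) \<le> - E0 u u + B * (LINT x|\<mu>. (u x)\<^sup>2)"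
proof -
 define v' where "v' = cut (W n) v"
 define P where "P = (\<lambda>x. exp (\<Phi> (r x)) - 1)"
 have v'b: "v' \<in> sub_bdd \<mu> DE" unfolding v'_def by (rule weighted_basic(1)[OF n v w r])
 have Pb: "P \<in> sub_bdd \<mu> DE" unfolding P_def by (rule weight_function(1)[OF w r])
 have ub: "u \<in> sub_bdd \<mu> DE" unfolding u_def by (rule weighted_basic(2)[OF n v w r])
 have Gu: "AE x in \<mu>. \<Gamma> u g x = (1 + P x) * \<Gamma> v' g x + v' x * \<Gamma> P g x" if "g \<in> DE" for g
  using weighted_basic(3)[OF n v w r that] by (simp add: u_def v'_def P_def)
 have uv: "u x = (1 + P x) * v' x" for x using weighted_basic(4)[OF n v w r, of x] by (simp add: u_def v'_def P_def)
 have u0: "x \<notin> W n \<Longrightarrow> u x = 0" "x \<notin> W n \<Longrightarrow> v' x = 0" for x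
  using weighted_basic(5)[OF n v w r, of x] by (auto simp: u_def v'_def cut_def)
 have rb: "r \<in> sub_bdd \<mu> DE" using r by (simp add: rho_trunc_def)
 note D = bdd_D[OF v'b] bdd_D[OF Pb] bdd_D[OF ub] bdd_D[OF rb]
 have uPb: "(\<lambda>x. u x * P x) \<in> sub_bdd \<mu> DE" by (rule form.D_bdd_mult(1)[OF ub Pb])
 define z where "z = (\<lambda>x. u x + u x * P x)"
 have zb: "z \<in> sub_bdd \<mu> DE" unfolding z_def by (rule bdd_add[OF ub uPb])
 have zu: "z x = u x * (1 + P x)" for x by (simp add: z_def algebra_simps)
 have uu: "(\<lambda>x. u x * u x) \<in> sub_bdd \<mu> DE" by (rule form.D_bdd_mult(1)[OF ub ub])
 have I1: "AE x in \<mu>. \<Gamma> z v' x = \<Gamma> u u x - (v' x * v' x) * \<Gamma> P P x"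
  using form.Gam_add1[OF D(3) bdd_D[OF uPb] D(1)] form.D_bdd_mult(2)[OF ub Pb D(1)] Gu[OF D(1)] Gu[OF D(3)] Gu[OF D(2)]
   form.Gam_sym[OF D(1,3)] form.Gam_sym[OF D(1,2)] form.Gam_sym[OF D(2,3)]
 proof eventually_elim
  case (elim x)
  have a: "\<Gamma> z v' x = (1 + P x) * \<Gamma> u v' x + u x * \<Gamma> P v' x"
   using elim(1,2) unfolding z_def by (simp add: algebra_simps)
  have b: "\<Gamma> u u x = (1 + P x) * \<Gamma> u v' x + v' x * \<Gamma> u P x" using elim(4,6,8) by simp
  have c: "\<Gamma> u P x = (1 + P x) * \<Gamma> P v' x + v' x * \<Gamma> P P x" using elim(5,7) by simp
  show ?case unfolding a b c uv by (simp add: algebra_simps)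
 qed
 have NPb: "N P \<in> borel_measurable \<mu>" using N_meas[of P] N_clauses(5) Pb by blast
 have I2: "AE x in \<mu>. z x * N v' x = (1/2) * N (\<lambda>x. u x * u x) x - (u x * v' x) * N P x"
 proof -
  have vP: "(\<lambda>x. v' x * P x) \<in> sub_bdd \<mu> DE" by (rule form.D_bdd_mult(1)[OF v'b Pb])
  have "AE x in \<mu>. N (\<lambda>x. v' x + v' x * P x) x = N v' x + N (\<lambda>x. v' x * P x) x" by (rule N_add[OF v'b vP])
  moreover have "(\<lambda>x. v' x + v' x * P x) = u" by (simp add: uv algebra_simps fun_eq_iff)
  ultimately have "AE x in \<mu>. N u x = N v' x + N (\<lambda>x. v' x * P x) x" by simp
  then show ?thesis using N_mult[OF v'b Pb] N_mult[OF ub ub]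
  proof eventually_elim
   case (elim x)
   show ?case unfolding elim zu by (simp add: algebra_simps)
  qed
 qed
 note GI = form.Gam_int[OF D(3,3)] form.Gam_int[OF D(2,2)] form.Gam_int[OF bdd_D[OF zb] D(1)]
 have iPP: "integrable \<mu> (\<lambda>x. (v' x * v' x) * \<Gamma> P P x)" by (rule bdd_sq_integrable[OF v'b v'b GI(2)])
 have "(LINT x|\<mu>. \<Gamma> z v' x) = (LINT x|\<mu>. \<Gamma> u u x - (v' x * v' x) * \<Gamma> P P x)"
  using GI iPP by (intro integral_cong_AE I1) auto
 also have "\<dots> = E0 u u - (LINT x|\<mu>. (v' x * v' x) * \<Gamma> P P x)"
  using GI iPP by (simp add: form.A_Gam[OF D(3,3)])
 finally have J1: "(LINT x|\<mu>. \<Gamma> z v' x) = E0 u u - (LINT x|\<mu>. (v' x * v' x) * \<Gamma> P P x)" .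
 have sN: "set_integrable \<mu> (W n) (N (\<lambda>x. u x * u x))" "(LINT x:W n|\<mu>. N (\<lambda>x. u x * u x) x) = 0"
  using N_compact_support[OF uu, of n] u0 by auto
 have sz: "set_integrable \<mu> (W n) (\<lambda>x. z x * N v' x)"
  using form_identity(3)[OF n v bdd_D[OF zb]] by (simp add: v'_def)
 let ?Y = "\<lambda>x. (u x * v' x) * N P x"
 have Ym: "?Y \<in> borel_measurable \<mu>" by (intro borel_measurable_times NPb form.D_meas[OF D(1)] form.D_meas[OF D(3)])
 \<comment> \<open>Integrability of the last term of \<open>I2\<close> is read off from the other
   two, which are integrable on \<open>W n\<close>.\<close>
 have iY: "integrable \<mu> (\<lambda>x. indicator (W n) x *\<^sub>R ?Y x)"
  "(LINT x:W n|\<mu>. z x * N v' x) = - (LINT x|\<mu>. indicator (W n) x *\<^sub>R ?Y x)"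
 proof -
  let ?X = "\<lambda>x. (1/2) * (indicator (W n) x *\<^sub>R N (\<lambda>x. u x * u x) x) - indicator (W n) x *\<^sub>R (z x * N v' x)"
  have iX: "integrable \<mu> ?X" using sN(1) sz by (simp add: set_integrable_def)
  have ae: "AE x in \<mu>. ?X x = indicator (W n) x *\<^sub>R ?Y x"
   using I2 by eventually_elim (auto simp: indicator_def)
  show "integrable \<mu> (\<lambda>x. indicator (W n) x *\<^sub>R ?Y x)"
   using iX integrable_cong_AE[OF _ _ ae] Ym W_sets[of n] by auto
  have "(LINT x|\<mu>. indicator (W n) x *\<^sub>R ?Y x) = (LINT x|\<mu>. ?X x)"
   using iX Ym W_sets[of n] ae by (intro integral_cong_AE) auto
  also have "\<dots> = (1/2) * (LINT x:W n|\<mu>. N (\<lambda>x. u x * u x) x) - (LINT x:W n|\<mu>. z x * N v' x)"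
   using sN(1) sz by (simp add: set_integrable_def set_lebesgue_integral_def)
  finally show "(LINT x:W n|\<mu>. z x * N v' x) = - (LINT x|\<mu>. indicator (W n) x *\<^sub>R ?Y x)" using sN(2) by simp
 qed
 have u2: "integrable \<mu> (\<lambda>x. (u x)\<^sup>2)" using form.D_L2[OF D(3)] by (simp add: Lspace2_iff)
 have rae: "AE x\<in>W n in \<mu>. r x = \<rho> x" using r by (simp add: rho_trunc_def)
 have pt: "AE x in \<mu>. (v' x * v' x) * \<Gamma> P P x + indicator (W n) x *\<^sub>R ?Y x \<le> B * (u x)\<^sup>2"
  using B rae Gam_rho_eq(1)[OF r] N_rho_eq[OF n r] weight_function(2)[OF w r D(2)[unfolded P_def]]
   weight_function(2)[OF w r D(4)] weight_function(3)[OF w r] form.Gam_sym[OF D(4,2)]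
 proof eventually_elim
  case (elim x)
  show ?case
  proof (cases "x \<in> W n")
   case False
   then show ?thesis using u0[of x] by simp
  next
   case True
   let ?e = "exp (\<Phi> (\<rho> x))" and ?s = "\<psi> (\<rho> x)"
   have rx: "r x = \<rho> x" using elim(2) True by simp
   have e: "1 + P x = ?e" by (simp add: P_def rx)
   have PP: "\<Gamma> P P x = (?e * ?s) * ((?e * ?s) * \<Gamma>\<rho> x)"
    using elim(3,5,6,8) True by (simp add: P_def[symmetric] rx)
   have NP: "N P x = (?e * ?s) * N_rho N \<rho> n x" using elim(4,7) True by (simp add: P_def[symmetric] rx)
   have "(v' x * v' x) * \<Gamma> P P x + ?Y x = (u x)\<^sup>2 * (?s\<^sup>2 * \<Gamma>\<rho> x + ?s * N_rho N \<rho> n x)"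
    unfolding PP NP uv e by (simp add: power2_eq_square algebra_simps)
   also have "\<dots> \<le> (u x)\<^sup>2 * B" using elim(1) True by (intro mult_left_mono) auto
   finally show ?thesis using True by (simp add: mult.commute)
  qed
 qed
 have le: "(LINT x|\<mu>. (v' x * v' x) * \<Gamma> P P x) + (LINT x|\<mu>. indicator (W n) x *\<^sub>R ?Y x) \<le> B * (LINT x|\<mu>. (u x)\<^sup>2)"
 proof -
  have "(LINT x|\<mu>. (v' x * v' x) * \<Gamma> P P x) + (LINT x|\<mu>. indicator (W n) x *\<^sub>R ?Y x)
   = (LINT x|\<mu>. (v' x * v' x) * \<Gamma> P P x + indicator (W n) x *\<^sub>R ?Y x)"
   by (rule Bochner_Integration.integral_add[OF iPP iY(1), symmetric])
  also have "\<dots> \<le> (LINT x|\<mu>. B * (u x)\<^sup>2)"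
   by (rule integral_mono_AE[OF Bochner_Integration.integrable_add[OF iPP iY(1)] integrable_mult_right[OF u2] pt])
  finally show ?thesis by simp
 qed
 have eq: "u x * exp (\<Phi> (r x)) = z x" for x by (simp add: zu P_def)
 have "- (LINT x:W n|\<mu>. Gen n v x * z x) = (LINT x|\<mu>. \<Gamma> z v' x) + (LINT x:W n|\<mu>. z x * N v' x)"
  using form_identity(4)[OF n v bdd_D[OF zb]] by (simp only: v'_def)
 then show ?thesis unfolding eq J1 iY(2) using le by linarith
qed

text \<open>Only the annulus contributes, since \<open>F'\<close> vanishes elsewhere on
  \<open>W n\<close>. There \<open>exp (\<Phi>) \<Gamma>(v, \<rho>) = \<Gamma>(u, \<rho>) - u \<psi>
  \<Gamma>(\<rho>, \<rho>)\<close> bounds the gradient part by \<open>u\<close> and its energy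
  density, divided by \<open>Q0\<close>. As \<open>N (f v)\<close> integrates to 0, the product rule
  moves \<open>N\<close> from \<open>v\<close> to \<open>f\<close>, where
  \<open>N f = - F' N(\<rho>)\<close>. Cauchy-Schwarz on the annulus then produces the growth
  quantity.\<close>

lemma weighted_flux:
 assumes n: "n \<ge> 1" and v: "v \<in> dom_bdd n" and w: "weight \<Phi> \<psi>" and r: "rho_trunc n r"
  and F: "\<And>y. (F has_real_derivative F' y) (at y)" "continuous_on UNIV F'" "F 0 = 0" "\<And>y. \<bar>F' y\<bar> \<le> 1 / R" "\<And>y. \<bar>F y\<bar> \<le> C"
  and R: "R > 0" and Q0: "Q0 > 0" and An: "An \<in> sets \<mu>" "An \<subseteq> W n"
  and off: "\<And>x. x \<in> W n \<Longrightarrow> x \<notin> An \<Longrightarrow> F' (\<rho> x) = 0"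
  and a: "AE x\<in>An in \<mu>. \<Gamma>\<rho> x \<le> a" and b: "AE x\<in>An in \<mu>. \<psi> (\<rho> x) * \<Gamma>\<rho> x \<le> b" and ab: "0 \<le> a" "0 \<le> b"
  and Q: "\<And>x. x \<in> An \<Longrightarrow> Q0 \<le> exp (\<Phi> (\<rho> x))"
  and NL2: "(\<lambda>x. indicator An x * N_rho N \<rho> n x) \<in> Lspace 2 \<mu>"
  and \<nu>: "sqrt (LINT x|\<mu>. (indicator An x * N_rho N \<rho> n x)\<^sup>2) \<le> \<nu>"
 defines "u \<equiv> weighted n \<Phi> r v"
 obtains f where "f \<in> DE" "AE x\<in>W n in \<mu>. f x = 1 - F (\<rho> x)"
  "\<bar>LINT x:W n|\<mu>. Gen n v x * f x\<bar>
   \<le> 1 / (R * Q0) * ((sqrt a + b) * sqrt (measure \<mu> An) + \<nu>) * (sqrt (E0 u u) + sqrt (LINT x|\<mu>. (u x)\<^sup>2))"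
proof -
 define v' where "v' = cut (W n) v"
 define P where "P = (\<lambda>x. exp (\<Phi> (r x)) - 1)"
 have v'b: "v' \<in> sub_bdd \<mu> DE" unfolding v'_def by (rule weighted_basic(1)[OF n v w r])
 have Pb: "P \<in> sub_bdd \<mu> DE" unfolding P_def by (rule weight_function(1)[OF w r])
 have ub: "u \<in> sub_bdd \<mu> DE" unfolding u_def by (rule weighted_basic(2)[OF n v w r])
 have Gu: "AE x in \<mu>. \<Gamma> u g x = exp (\<Phi> (r x)) * \<Gamma> v' g x + v' x * \<Gamma> P g x" if "g \<in> DE" for g
  using weighted_basic(3)[OF n v w r that] by (simp add: u_def v'_def P_def)
 have uv: "u x = exp (\<Phi> (r x)) * v' x" for x using weighted_basic(4)[OF n v w r, of x] by (simp add: u_def v'_def)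
 have v0: "x \<notin> W n \<Longrightarrow> v' x = 0" for x by (simp add: v'_def cut_def)
 have rb: "r \<in> sub_bdd \<mu> DE" using r by (simp add: rho_trunc_def)
 note D = bdd_D[OF v'b] bdd_D[OF Pb] bdd_D[OF ub] bdd_D[OF rb]
 have rae: "AE x\<in>W n in \<mu>. r x = \<rho> x" using r by (simp add: rho_trunc_def)
 obtain e where e: "e \<in> form.Dc" "\<And>x. x \<in> W n \<Longrightarrow> e x = 1" using cutoff_exists[of n] by blast
 have eb: "e \<in> sub_bdd \<mu> DE" by (rule form.Dc_bdd[OF e(1)])
 define h where "h = (\<lambda>x. F (r x))"
 note H = chain_bdd[OF rb, where F = F and F' = F', OF F(1) F(2) F(3) F(4) F(5), folded h_def]
 have hb: "h \<in> sub_bdd \<mu> DE" by (rule H(1))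
 have ehb: "(\<lambda>x. e x * h x) \<in> sub_bdd \<mu> DE" by (rule form.D_bdd_mult(1)[OF eb hb])
 have eeb: "(\<lambda>x. e x * e x) \<in> sub_bdd \<mu> DE" by (rule form.D_bdd_mult(1)[OF eb eb])
 define f where "f = (\<lambda>x. e x - e x * h x)"
 have fb: "f \<in> sub_bdd \<mu> DE" unfolding f_def by (rule bdd_diff[OF eb ehb])
 note D' = bdd_D[OF eb] bdd_D[OF hb] bdd_D[OF ehb] bdd_D[OF eeb] bdd_D[OF fb]
 have fval: "AE x\<in>W n in \<mu>. f x = 1 - F (\<rho> x)"
  using rae by eventually_elim (auto simp: f_def h_def e(2))
 \<comment> \<open>On \<open>W n\<close> both \<open>e\<close> and its square are 1, so locality and
   the product rule give \<open>\<Gamma>(e, v') = 2 \<Gamma>(e, v')\<close> there.\<close>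
 have ee: "AE x in \<mu>. x \<in> W n \<longrightarrow> \<Gamma> e v' x = 0"
  using form.Gam_level[OF D'(4) D'(1) D(1)] form.D_bdd_mult(2)[OF eb eb D(1)]
  by eventually_elim (use e(2) in auto)
 \<comment> \<open>Outside \<open>W n\<close> the function \<open>v'\<close> agrees with 0, and
   locality compares it with the zero function.\<close>
 have voff: "AE x in \<mu>. x \<notin> W n \<longrightarrow> \<Gamma> f v' x = 0"
 proof -
  have "AE x in \<mu>. \<Gamma> (\<lambda>y. 0 * v' y) f x = 0 * \<Gamma> v' f x" by (rule form.Gam_scale1[OF D(1) D'(5)])
  then have z: "AE x in \<mu>. \<Gamma> (\<lambda>_. 0) f x = 0" by simp
  show ?thesis using form.Gam_level[OF D(1) form.D_zero D'(5)] z form.Gam_sym[OF D(1) D'(5)]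
   by eventually_elim (use v0 in auto)
 qed
 let ?k = "1 / (R * Q0)"
 have k: "?k > 0" using R Q0 by simp
 let ?sq = "\<lambda>x. sqrt (\<Gamma> u u x)"
 let ?b1 = "\<lambda>x. ?k * (sqrt a * (indicator An x * ?sq x) + b * (indicator An x * \<bar>u x\<bar>))"
 have bound1: "AE x in \<mu>. \<bar>\<Gamma> f v' x\<bar> \<le> ?b1 x"
  using form.Gam_diff1[OF D'(1,3) D(1)] form.D_bdd_mult(2)[OF eb hb D(1)] H(2)[OF D(1)] ee voff rae
   form.Gam_Cauchy_Schwarz[OF D(3,4)] Gu[OF D(4)] weight_function(2)[OF w r D(4), folded P_def]
   Gam_rho_eq[OF r] a b form.Gam_sym[OF D(1,4)] form.Gam_nonneg[OF D(3)]
 proof eventually_elim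
  case (elim x)
  have nn: "0 \<le> ?b1 x" using k ab elim(15) by (intro mult_nonneg_nonneg add_nonneg_nonneg) auto
  show ?case
  proof (cases "x \<in> W n")
   case False
   then show ?thesis using elim(5) nn by simp
  next
   case True
   have rx: "r x = \<rho> x" using elim(6) True by simp
   have fx: "\<Gamma> f v' x = - (F' (\<rho> x) * \<Gamma> r v' x)"
    using elim(1,2,3,4) True e(2)[OF True] unfolding f_def by (simp add: rx)
   show ?thesis
   proof (cases "x \<in> An")
    case False
    then show ?thesis using fx off[OF True False] nn by simp
   next
    case A: True
    let ?q = "exp (\<Phi> (\<rho> x))" and ?s = "\<psi> (\<rho> x)"
    have Gr: "0 \<le> \<Gamma>\<rho> x" "\<Gamma> r r x = \<Gamma>\<rho> x" "\<Gamma>\<rho> x \<le> a" "?s * \<Gamma>\<rho> x \<le> b" using elim(10-13) True A by auto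
    have s0: "0 \<le> ?s" using w unfolding weight_def by blast
    have "\<Gamma> u r x = ?q * \<Gamma> v' r x + v' x * (?q * ?s * \<Gamma>\<rho> x)" using elim(8,9) Gr(2) by (simp add: rx)
    then have "?q * \<Gamma> v' r x = \<Gamma> u r x - u x * (?s * \<Gamma>\<rho> x)" unfolding uv by (simp add: rx)
    then have "\<bar>?q * \<Gamma> v' r x\<bar> \<le> \<bar>\<Gamma> u r x\<bar> + \<bar>u x * (?s * \<Gamma>\<rho> x)\<bar>" by simp
    also have "\<dots> \<le> ?sq x * sqrt a + \<bar>u x\<bar> * b"
    proof (rule add_mono)
     have "\<bar>\<Gamma> u r x\<bar> \<le> ?sq x * sqrt (\<Gamma>\<rho> x)" using elim(7) Gr(2) by simp
     also have "\<dots> \<le> ?sq x * sqrt a" using Gr elim(15) by (intro mult_left_mono) auto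
     finally show "\<bar>\<Gamma> u r x\<bar> \<le> ?sq x * sqrt a" .
     show "\<bar>u x * (?s * \<Gamma>\<rho> x)\<bar> \<le> \<bar>u x\<bar> * b"
      unfolding abs_mult[of "u x"] using Gr s0 by (intro mult_left_mono) auto
    qed
    finally have q1: "?q * \<bar>\<Gamma> v' r x\<bar> \<le> ?sq x * sqrt a + \<bar>u x\<bar> * b" by (simp add: abs_mult)
    have "Q0 * \<bar>\<Gamma> v' r x\<bar> \<le> ?q * \<bar>\<Gamma> v' r x\<bar>" using Q[OF A] by (intro mult_right_mono) auto
    then have "\<bar>\<Gamma> v' r x\<bar> \<le> (?sq x * sqrt a + \<bar>u x\<bar> * b) / Q0" using q1 Q0 by (simp add: field_simps)
    then have "\<bar>F' (\<rho> x)\<bar> * \<bar>\<Gamma> v' r x\<bar> \<le> 1 / R * ((?sq x * sqrt a + \<bar>u x\<bar> * b) / Q0)"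
     using F(4)[of "\<rho> x"] R by (intro mult_mono) auto
    moreover have "\<bar>\<Gamma> f v' x\<bar> = \<bar>F' (\<rho> x)\<bar> * \<bar>\<Gamma> v' r x\<bar>" unfolding fx using elim(14) by (simp add: abs_mult)
    ultimately show ?thesis using A by (simp add: field_simps)
   qed
  qed
 qed
 have mAn: "emeasure \<mu> An < \<infinity>" using emeasure_mono[OF An(2) W_sets] W_finite[of n] by (rule order_le_less_trans)
 have indL2: "(\<lambda>x. indicator An x) \<in> Lspace 2 \<mu>" "(LINT x|\<mu>. (indicator An x :: real)\<^sup>2) = measure \<mu> An"
 proof -
  have i: "(\<lambda>x. (indicator An x :: real)\<^sup>2) = indicator An" by (auto simp: indicator_def fun_eq_iff)
  show "(\<lambda>x. indicator An x) \<in> Lspace 2 \<mu>" using An mAn by (simp add: Lspace2_iff i)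
  show "(LINT x|\<mu>. (indicator An x :: real)\<^sup>2) = measure \<mu> An" using An mAn by (simp add: i)
 qed
 have uL2: "(\<lambda>x. \<bar>u x\<bar>) \<in> Lspace 2 \<mu>" using form.D_L2[OF D(3)] by (auto simp: Lspace2_iff)
 have sqL2: "?sq \<in> Lspace 2 \<mu>" "(LINT x|\<mu>. (?sq x)\<^sup>2) = E0 u u" by (rule form.sqrt_Gam_L2[OF D(3)])+
 let ?m = "sqrt (measure \<mu> An)" and ?e = "sqrt (E0 u u)" and ?h = "sqrt (LINT x|\<mu>. (u x)\<^sup>2)"
 have c1: "(LINT x|\<mu>. indicator An x * ?sq x) \<le> ?m * ?e" "(LINT x|\<mu>. indicator An x * \<bar>u x\<bar>) \<le> ?m * ?h"
  using Lspace2_Cauchy_Schwarz_abs[OF indL2(1) sqL2(1)] Lspace2_Cauchy_Schwarz_abs[OF indL2(1) uL2]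
  unfolding indL2(2) sqL2(2) by auto
 have i1: "integrable \<mu> (\<lambda>x. indicator An x * ?sq x)" "integrable \<mu> (\<lambda>x. indicator An x * \<bar>u x\<bar>)"
  by (rule Lspace2_mult_integrable[OF indL2(1) sqL2(1)]) (rule Lspace2_mult_integrable[OF indL2(1) uL2])
 have T1: "\<bar>LINT x|\<mu>. \<Gamma> f v' x\<bar> \<le> ?k * (sqrt a * (?m * ?e) + b * (?m * ?h))"
 proof -
  have "\<bar>LINT x|\<mu>. \<Gamma> f v' x\<bar> \<le> (LINT x|\<mu>. \<bar>\<Gamma> f v' x\<bar>)" by (rule integral_abs_bound)
  also have "\<dots> \<le> (LINT x|\<mu>. ?b1 x)"
  proof (rule integral_mono_AE[OF _ _ bound1])
   show "integrable \<mu> (\<lambda>x. \<bar>\<Gamma> f v' x\<bar>)" using form.Gam_int[OF D'(5) D(1)] by (rule integrable_abs)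
   show "integrable \<mu> ?b1" using i1 by (intro integrable_mult_right Bochner_Integration.integrable_add)
  qed
  also have "\<dots> = ?k * (sqrt a * (LINT x|\<mu>. indicator An x * ?sq x) + b * (LINT x|\<mu>. indicator An x * \<bar>u x\<bar>))"
   using i1 by (subst integral_mult_right_zero, subst Bochner_Integration.integral_add) auto
  also have "\<dots> \<le> ?k * (sqrt a * (?m * ?e) + b * (?m * ?h))"
   using k ab c1 by (intro mult_left_mono add_mono) auto
  finally show ?thesis .
 qed
 have fvb: "(\<lambda>x. f x * v' x) \<in> sub_bdd \<mu> DE" by (rule form.D_bdd_mult(1)[OF fb v'b])
 have sN: "set_integrable \<mu> (W n) (N (\<lambda>x. f x * v' x))" "(LINT x:W n|\<mu>. N (\<lambda>x. f x * v' x) x) = 0"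
  using N_compact_support[OF fvb, of n] v0 by auto
 have sz: "set_integrable \<mu> (W n) (\<lambda>x. f x * N v' x)"
  using form_identity(3)[OF n v D'(5)] by (simp add: v'_def)
 have Nf: "AE x in \<mu>. x \<in> W n \<longrightarrow> N f x = - (F' (\<rho> x) * N_rho N \<rho> n x)"
 proof -
  have "AE x\<in>W n in \<mu>. e x = 1" using e(2) by (intro AE_I2) auto
  then have "AE x\<in>W n in \<mu>. N e x = 0" by (rule N_const[OF eb W_borel])
  then show ?thesis
   using N_diff[OF eb ehb, folded f_def] N_mult[OF eb hb] H(3) rae N_rho_eq[OF n r]
   by eventually_elim (auto simp: e(2) h_def)
 qed
 let ?Y = "\<lambda>x. indicator (W n) x *\<^sub>R (v' x * N f x)"
 have Nfm: "N f \<in> borel_measurable \<mu>" using N_meas[of f] N_clauses(5) fb by blast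
 have Ym: "?Y \<in> borel_measurable \<mu>" using Nfm form.D_meas[OF D(1)] W_sets[of n] by simp
 let ?X = "\<lambda>x. indicator (W n) x *\<^sub>R N (\<lambda>x. f x * v' x) x - indicator (W n) x *\<^sub>R (f x * N v' x)"
 have iX: "integrable \<mu> ?X" using sN(1) sz by (simp add: set_integrable_def)
 have aeX: "AE x in \<mu>. ?X x = ?Y x"
  using N_mult[OF fb v'b] by eventually_elim (auto simp: indicator_def)
 have iY: "integrable \<mu> ?Y" by (rule integrable_cong_AE[THEN iffD1, OF borel_measurable_integrable[OF iX] Ym aeX iX])
 have "(LINT x|\<mu>. ?Y x) = (LINT x|\<mu>. ?X x)"
  using iX Ym aeX by (intro integral_cong_AE) auto
 also have "\<dots> = (LINT x:W n|\<mu>. N (\<lambda>x. f x * v' x) x) - (LINT x:W n|\<mu>. f x * N v' x)"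
  using sN(1) sz by (simp add: set_integrable_def set_lebesgue_integral_def)
 finally have eqY: "(LINT x:W n|\<mu>. f x * N v' x) = - (LINT x|\<mu>. ?Y x)" using sN(2) by simp
 let ?NA = "\<lambda>x. \<bar>indicator An x * N_rho N \<rho> n x\<bar>"
 have NAL2: "?NA \<in> Lspace 2 \<mu>" using NL2 by (auto simp: Lspace2_iff)
 have bound2: "AE x in \<mu>. \<bar>?Y x\<bar> \<le> ?k * (\<bar>u x\<bar> * ?NA x)"
  using Nf rae
 proof eventually_elim
  case (elim x)
  have nn: "0 \<le> ?k * (\<bar>u x\<bar> * ?NA x)" using k by (intro mult_nonneg_nonneg) auto
  show ?case
  proof (cases "x \<in> W n \<and> x \<in> An")
   case False
   then have "?Y x = 0" using elim(1) off[of x] by (auto simp: indicator_def)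
   then show ?thesis using nn by (simp only: abs_zero)
  next
   case True
   have rx: "r x = \<rho> x" using elim(2) True by simp
   have "Q0 * \<bar>v' x\<bar> \<le> exp (\<Phi> (\<rho> x)) * \<bar>v' x\<bar>" using Q[of x] True by (intro mult_right_mono) auto
   also have "\<dots> = \<bar>u x\<bar>" by (simp add: uv rx abs_mult)
   finally have "\<bar>v' x\<bar> \<le> \<bar>u x\<bar> / Q0" using Q0 by (simp add: field_simps)
   then have "\<bar>v' x\<bar> * (\<bar>F' (\<rho> x)\<bar> * \<bar>N_rho N \<rho> n x\<bar>) \<le> \<bar>u x\<bar> / Q0 * (1 / R * \<bar>N_rho N \<rho> n x\<bar>)"
    using F(4)[of "\<rho> x"] Q0 by (intro mult_mono mult_right_mono) auto
   then show ?thesis using True elim(1) by (simp add: abs_mult algebra_simps)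
  qed
 qed
 have T2: "\<bar>LINT x|\<mu>. ?Y x\<bar> \<le> ?k * (?h * \<nu>)"
 proof -
  have iu: "integrable \<mu> (\<lambda>x. \<bar>u x\<bar> * ?NA x)" by (rule Lspace2_mult_integrable[OF uL2 NAL2])
  have "\<bar>LINT x|\<mu>. ?Y x\<bar> \<le> (LINT x|\<mu>. \<bar>?Y x\<bar>)" by (rule integral_abs_bound)
  also have "\<dots> \<le> (LINT x|\<mu>. ?k * (\<bar>u x\<bar> * ?NA x))"
   by (rule integral_mono_AE[OF integrable_abs[OF iY] integrable_mult_right[OF iu] bound2])
  also have "\<dots> = ?k * (LINT x|\<mu>. \<bar>u x\<bar> * ?NA x)" by (rule integral_mult_right_zero)
  also have "\<dots> \<le> ?k * (?h * \<nu>)"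
  proof (rule mult_left_mono)
   have "(LINT x|\<mu>. \<bar>u x\<bar> * ?NA x) \<le> ?h * sqrt (LINT x|\<mu>. (indicator An x * N_rho N \<rho> n x)\<^sup>2)"
    using Lspace2_Cauchy_Schwarz_abs[OF uL2 NAL2] by simp
   also have "\<dots> \<le> ?h * \<nu>" using \<nu> by (intro mult_left_mono real_sqrt_ge_zero integral_nonneg_AE) auto
   finally show "(LINT x|\<mu>. \<bar>u x\<bar> * ?NA x) \<le> ?h * \<nu>" .
  qed (use k in simp)
  finally show ?thesis .
 qed
 have "- (LINT x:W n|\<mu>. Gen n v x * f x) = (LINT x|\<mu>. \<Gamma> f v' x) + (LINT x:W n|\<mu>. f x * N v' x)"
  using form_identity(4)[OF n v D'(5)] by (simp only: v'_def)
 then have "\<bar>LINT x:W n|\<mu>. Gen n v x * f x\<bar> \<le> ?k * (sqrt a * (?m * ?e) + b * (?m * ?h)) + ?k * (?h * \<nu>)"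
  unfolding eqY using T1 T2 by linarith
 also have "\<dots> = ?k * (sqrt a * ?m * ?e + (b * ?m + \<nu>) * ?h)" by (simp add: algebra_simps)
 also have "\<dots> \<le> ?k * (((sqrt a + b) * ?m + \<nu>) * ?e + ((sqrt a + b) * ?m + \<nu>) * ?h)"
 proof (rule mult_left_mono)
  have e0: "0 \<le> ?e" using form.E_nonneg[OF D(3)] by simp
  have h0: "0 \<le> ?h" by (simp add: integral_nonneg_AE)
  have n0: "0 \<le> \<nu>" by (rule order_trans[OF real_sqrt_ge_zero[OF integral_nonneg_AE] \<nu>]) simp
  have "sqrt a * ?m * ?e \<le> ((sqrt a + b) * ?m + \<nu>) * ?e"
   using e0 ab n0 by (intro mult_right_mono) (auto simp: algebra_simps)
  moreover have "(b * ?m + \<nu>) * ?h \<le> ((sqrt a + b) * ?m + \<nu>) * ?h"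
   using h0 ab by (intro mult_right_mono) (auto simp: algebra_simps)
  ultimately show "sqrt a * ?m * ?e + (b * ?m + \<nu>) * ?h \<le> ((sqrt a + b) * ?m + \<nu>) * ?e + ((sqrt a + b) * ?m + \<nu>) * ?h" by linarith
 qed (use k in simp)
 also have "\<dots> = ?k * ((sqrt a + b) * ?m + \<nu>) * (?e + ?h)" by (simp add: algebra_simps)
 finally show thesis by (rule that[OF D'(5) fval])
qed

end

text \<open>\<open>F\<close> is the mass, \<open>h\<close> the weighted square and \<open>D\<close>
  the energy. Gronwall bounds \<open>h\<close>, and the differential inequality bounds
  \<open>D\<close> by a derivative. Instead of integrating \<open>D\<close> in time, a function
  \<open>P\<close> whose derivative dominates \<open>\<bar>l\<bar>\<close> is compared with
  \<open>F\<close> by monotonicity, so no measurability of \<open>D\<close> in time is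
  involved.\<close>

lemma flux_comparison:
 fixes F h D l h' :: "real \<Rightarrow> real"
 assumes t: "0 \<le> t" and cont: "continuous_on {0..t} F" "continuous_on {0..t} h"
  and F: "\<And>s. 0 < s \<Longrightarrow> s < t \<Longrightarrow> (F has_real_derivative l s) (at s)"
  and h: "\<And>s. 0 < s \<Longrightarrow> s < t \<Longrightarrow> (h has_real_derivative h' s) (at s)"
  and l: "\<And>s. 0 < s \<Longrightarrow> s < t \<Longrightarrow> \<bar>l s\<bar> \<le> \<kappa> * (sqrt (D s) + sqrt (h s))"
  and h': "\<And>s. 0 < s \<Longrightarrow> s < t \<Longrightarrow> h' s \<le> 2 * (- D s + B * h s)"
  and nonneg: "\<And>s. 0 \<le> s \<Longrightarrow> s \<le> t \<Longrightarrow> 0 \<le> h s" "\<And>s. 0 < s \<Longrightarrow> s < t \<Longrightarrow> 0 \<le> D s" "0 \<le> \<kappa>" "0 \<le> B"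
 shows "\<bar>F t - F 0\<bar> \<le> \<kappa> * (2 * t + (t + 1) * exp (2 * B * t) * h 0)"
proof -
 define G where "G s = h s * exp (- (2 * B * s))" for s
 define H where "H = exp (2 * B * t) * h 0"
 have G': "(G has_real_derivative (h' s - 2 * B * h s) * exp (- (2 * B * s))) (at s)" if "0 < s" "s < t" for s
  unfolding G_def by (rule derivative_eq_intros h[OF that] refl)+ (simp add: algebra_simps)
 have Gc: "continuous_on {0..t} G" unfolding G_def by (intro continuous_intros cont)
 have Gdecr: "G s \<le> h 0" if s: "0 \<le> s" "s \<le> t" for s
 proof -
  have "- G 0 \<le> - G s"
  proof (rule DERIV_nonneg_imp_increasing_open[OF s(1)])
   fix y assume y: "0 < y" "y < s"
   have "(h' y - 2 * B * h y) * exp (- (2 * B * y)) \<le> 0"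
    using h'[of y] nonneg(2)[of y] y s by (intro mult_nonpos_nonneg) auto
   then show "\<exists>z. ((\<lambda>s. - G s) has_real_derivative z) (at y) \<and> 0 \<le> z"
    using DERIV_minus[OF G'[of y]] y s by (intro exI conjI) auto
  qed (intro continuous_intros continuous_on_subset[OF Gc], use s in auto)
  then show ?thesis by (simp add: G_def)
 qed
 have hle: "h s \<le> H" if s: "0 \<le> s" "s \<le> t" for s
 proof -
  have "h s = G s * exp (2 * B * s)" unfolding G_def by (simp add: mult.assoc flip: exp_add)
  also have "\<dots> \<le> h 0 * exp (2 * B * t)"
   using Gdecr[OF s] nonneg(1)[of 0] nonneg(4) s t by (intro mult_mono) (auto intro: mult_left_mono)
  finally show ?thesis by (simp add: H_def mult.commute)
 qed
 \<comment> \<open>Up to \<kappa>, the flux is at most \<open>2 + H + D\<close> because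
   \<open>sqrt y \<le> 1 + y\<close>. The first two terms of \<open>P\<close> account for
   \<open>2 + H\<close>, and the term with \<open>G\<close> has derivative at least
   \<open>D\<close>.\<close>
 define P where "P s = \<kappa> * (2 * s + s * H - exp (2 * B * t) / 2 * G s)" for s
 define P' where "P' s = \<kappa> * (2 + H - exp (2 * B * t) / 2 * ((h' s - 2 * B * h s) * exp (- (2 * B * s))))" for s
 have P: "(P has_real_derivative P' s) (at s)" if "0 < s" "s < t" for s
  unfolding P_def P'_def by (rule derivative_eq_intros G'[OF that] refl)+ simp
 have Pc: "continuous_on {0..t} P" unfolding P_def by (intro continuous_intros Gc)
 have lP: "\<bar>l s\<bar> \<le> P' s" if s: "0 < s" "s < t" for s
 proof -
  have sq: "sqrt y \<le> 1 + y" if "0 \<le> y" for y :: real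
   using that by (intro real_le_lsqrt) (auto simp: power2_eq_square algebra_simps)
  have "1 \<le> exp (2 * B * t) * exp (- (2 * B * s))"
   using nonneg(4) s by (auto simp: mult_left_mono simp flip: exp_add)
  then have "D s * 1 \<le> D s * (exp (2 * B * t) * exp (- (2 * B * s)))" using nonneg(2)[OF s] by (rule mult_left_mono)
  moreover have "exp (2 * B * t) / 2 * ((h' s - 2 * B * h s) * exp (- (2 * B * s)))
    \<le> exp (2 * B * t) / 2 * ((- 2 * D s) * exp (- (2 * B * s)))"
   using h'[OF s] by (intro mult_left_mono mult_right_mono) auto
  ultimately have "sqrt (D s) + sqrt (h s) \<le> 2 + H - exp (2 * B * t) / 2 * ((h' s - 2 * B * h s) * exp (- (2 * B * s)))"
   using sq[OF nonneg(2)[OF s]] sq[of "h s"] nonneg(1)[of s] hle[of s] s by (simp add: algebra_simps)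
  then show ?thesis unfolding P'_def using l[OF s] nonneg(3) by (meson mult_left_mono order_trans)
 qed
 have "P 0 - F 0 \<le> P t - F t"
 proof (rule DERIV_nonneg_imp_increasing_open[OF t])
  fix s assume s: "0 < s" "s < t"
  show "\<exists>z. ((\<lambda>s. P s - F s) has_real_derivative z) (at s) \<and> 0 \<le> z"
   using DERIV_diff[OF P[OF s] F[OF s]] lP[OF s] by (intro exI conjI) auto
 qed (intro continuous_intros Pc cont)
 moreover have "P 0 + F 0 \<le> P t + F t"
 proof (rule DERIV_nonneg_imp_increasing_open[OF t])
  fix s assume s: "0 < s" "s < t"
  show "\<exists>z. ((\<lambda>s. P s + F s) has_real_derivative z) (at s) \<and> 0 \<le> z"
   using DERIV_add[OF P[OF s] F[OF s]] lP[OF s] by (intro exI conjI) auto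
 qed (intro continuous_intros Pc cont)
 ultimately have "\<bar>F t - F 0\<bar> \<le> P t - P 0" by linarith
 also have "P t - P 0 = \<kappa> * (2 * t + t * H - exp (2 * B * t) / 2 * G t + exp (2 * B * t) / 2 * h 0)"
  unfolding P_def by (simp add: G_def algebra_simps)
 also have "\<dots> \<le> \<kappa> * (2 * t + (t + 1) * H)"
 proof (rule mult_left_mono[OF _ nonneg(3)])
  have "0 \<le> exp (2 * B * t) / 2 * G t" "0 \<le> H" using nonneg(1)[of t] nonneg(1)[of 0] t by (simp_all add: G_def H_def)
  then show "2 * t + t * H - exp (2 * B * t) / 2 * G t + exp (2 * B * t) / 2 * h 0 \<le> 2 * t + (t + 1) * H"
   by (simp add: H_def algebra_simps)
 qed
 finally show ?thesis by (simp add: H_def mult.assoc)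
qed

section \<open>Loss of mass along the approximating flow\<close>

context conservativeness_setting
begin

abbreviation "flow n \<equiv> contraction_semigroup.Sx (S n)"

text \<open>Together with \<open>flux_bound\<close>, the interface between the estimates at a fixed
  time and the evolution. The constants must not depend on \<open>v\<close>, for they are used along
  the flow at every time and for a sequence of approximate initial functions.\<close>

definition energy_bound :: "nat \<Rightarrow> (real \<Rightarrow> real) \<Rightarrow> real \<Rightarrow> bool" where
 "energy_bound n \<Phi> B \<longleftrightarrow> 0 \<le> B \<and> (\<forall>v\<in>dom_bdd n. \<forall>r. rho_trunc n r \<longrightarrow>
   (LINT x:W n|\<mu>. Gen n v x * (weighted n \<Phi> r v x * exp (\<Phi> (r x))))
    \<le> - E0 (weighted n \<Phi> r v) (weighted n \<Phi> r v) + B * (LINT x|\<mu>. (weighted n \<Phi> r v x)\<^sup>2))"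

definition flux_bound :: "nat \<Rightarrow> (real \<Rightarrow> real) \<Rightarrow> (real \<Rightarrow> real) \<Rightarrow> real \<Rightarrow> bool" where
 "flux_bound n \<Phi> F \<kappa> \<longleftrightarrow> 0 \<le> \<kappa> \<and> (\<forall>v\<in>dom_bdd n. \<forall>r. rho_trunc n r \<longrightarrow>
   (\<exists>f\<in>DE. (AE x\<in>W n in \<mu>. f x = 1 - F (\<rho> x)) \<and> \<bar>LINT x:W n|\<mu>. Gen n v x * f x\<bar>
    \<le> \<kappa> * (sqrt (E0 (weighted n \<Phi> r v) (weighted n \<Phi> r v)) + sqrt (LINT x|\<mu>. (weighted n \<Phi> r v x)\<^sup>2))))"

lemma AE_Mn: "(AE x in Mn n. P x) \<longleftrightarrow> (AE x\<in>W n in \<mu>. P x)"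
 using W_sets[of n] by (subst AE_restrict_space_iff) (auto simp: form.space_M)

lemma integral_Mn: "(LINT x:W n|\<mu>. h x) = (LINT x|Mn n. (h x :: real))"
 using W_sets[of n] by (simp add: integral_restrict_space form.space_M set_lebesgue_integral_def)

lemma rho_compose_meas: "continuous_on UNIV h \<Longrightarrow> (\<lambda>x. h (\<rho> x)) \<in> borel_measurable \<mu>"
 using measurable_compose[OF form.rho_meas borel_measurable_continuous_onI[of h]] by simp

lemma weight_continuous: "weight \<Phi> \<psi> \<Longrightarrow> continuous_on UNIV \<Phi>"
 unfolding weight_def by (blast intro: DERIV_continuous_on has_field_derivative_at_within)

lemma weight_test:
 assumes w: "weight \<Phi> \<psi>"
 shows "\<exists>B. (\<lambda>x. exp (2 * \<Phi> (\<rho> x))) \<in> borel_measurable (Mn n) \<and> (AE x in Mn n. \<bar>exp (2 * \<Phi> (\<rho> x))\<bar> \<le> exp (2 * B))"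
proof -
 obtain B where "\<And>y. 0 \<le> \<Phi> y \<and> \<Phi> y \<le> B" using w unfolding weight_def by blast
 moreover have "(\<lambda>x. exp (2 * \<Phi> (\<rho> x))) \<in> borel_measurable (Mn n)"
  by (rule measurable_restrict_space1[OF rho_compose_meas[of "\<lambda>y. exp (2 * \<Phi> y)"]]) (intro continuous_intros weight_continuous[OF w])
 ultimately show ?thesis by (intro exI[of _ B] conjI AE_I2) simp_all
qed

lemma cutoff_test:
 fixes F :: "real \<Rightarrow> real"
 assumes F: "continuous_on UNIV F" "\<And>y. \<bar>F y\<bar> \<le> C"
 shows "(\<lambda>x. 1 - F (\<rho> x)) \<in> borel_measurable (Mn n)" "AE x in Mn n. \<bar>1 - F (\<rho> x)\<bar> \<le> 1 + C"
proof -
 show "(\<lambda>x. 1 - F (\<rho> x)) \<in> borel_measurable (Mn n)"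
  by (rule measurable_restrict_space1[OF rho_compose_meas[of "\<lambda>y. 1 - F y"]]) (intro continuous_intros F(1))
 show "AE x in Mn n. \<bar>1 - F (\<rho> x)\<bar> \<le> 1 + C"
  by (intro AE_I2 order_trans[OF abs_triangle_ineq4]) (use F(2) in simp)
qed

text \<open>\<open>flux_comparison\<close> along the flow, with \<open>D\<close> and
  \<open>h\<close> the energy and the squared norm of the weighted flow. The bounds apply at every
  time because the flow stays bounded and in the domain of the generator, with which it
  commutes.\<close>

lemma mass_loss_domain:
 assumes n: "n \<ge> 1" and w: "weight \<Phi> \<psi>" and EB: "energy_bound n \<Phi> B" and FB: "flux_bound n \<Phi> F \<kappa>"
  and F: "continuous_on UNIV F" "\<And>y. \<bar>F y\<bar> \<le> C"
  and v: "v \<in> gen_dom p (Mn n) (S n)" "AE x in Mn n. \<bar>v x\<bar> \<le> c" and c: "c > 0" and s: "s \<ge> 0"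
 shows "\<bar>(LINT x|Mn n. flow n s v x * (1 - F (\<rho> x))) - (LINT x|Mn n. v x * (1 - F (\<rho> x)))\<bar>
  \<le> \<kappa> * (2 * s + (s + 1) * exp (2 * B * s) * (LINT x|Mn n. (v x)\<^sup>2 * exp (2 * \<Phi> (\<rho> x))))"
proof -
 interpret sg: contraction_semigroup "Mn n" p "S n" by (rule semigroup[OF n])
 obtain r where r: "rho_trunc n r" using rho_trunc_exists by blast
 have rae: "AE x in Mn n. r x = \<rho> x" using r by (simp add: AE_Mn rho_trunc_def)
 have vg: "gen_graph p (Mn n) (S n) v (Gen n v)" by (rule sg.generator_graph[OF v(1)])
 have vLp: "v \<in> sg.Lp" by (rule sg.graph_Lp(1)[OF vg])
 have vm: "v \<in> borel_measurable (Mn n)" by (rule sg.Lp_meas[OF vLp])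
 define q where "q x = exp (2 * \<Phi> (\<rho> x))" for x
 define k where "k x = 1 - F (\<rho> x)" for x
 obtain Bd where qm: "q \<in> borel_measurable (Mn n)" and qb: "AE x in Mn n. \<bar>q x\<bar> \<le> exp (2 * Bd)"
  using weight_test[OF w] unfolding q_def [abs_def] by blast
 note km = cutoff_test[OF F, of n, folded k_def]
 have V: "flow n y v \<in> dom_bdd n" "flow n y v \<in> borel_measurable (Mn n)" if "y \<ge> 0" for y
  using sg.Sx_gen_dom[OF v(1) that] sg.Sx_bounded[OF vm v(2) c that] sg.Sx_meas[OF that vLp]
  by (auto simp: sub_bdd_def ae_bounded_def)
 define u where "u y = weighted n \<Phi> r (flow n y v)" for y
 define h where "h y = (LINT x|Mn n. (flow n y v x)\<^sup>2 * q x)" for y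
 have ub: "u y \<in> DE" if "y \<ge> 0" for y
  unfolding u_def by (rule bdd_D[OF weighted_basic(2)[OF n V(1)[OF that] w r]])
 have uv: "AE x in Mn n. u y x = exp (\<Phi> (\<rho> x)) * flow n y v x" if y: "y \<ge> 0" for y
 proof -
  have "AE x in Mn n. x \<in> W n" by (simp add: AE_Mn)
  then show ?thesis using rae
  proof eventually_elim
   case (elim x)
   then show ?case using weighted_basic(4)[OF n V(1)[OF y] w r, of x] by (simp add: u_def cut_def)
  qed
 qed
 have uM: "u y \<in> borel_measurable (Mn n)" if "y \<ge> 0" for y
  by (rule measurable_restrict_space1[OF form.D_meas[OF ub[OF that]]])
 have hu: "(LINT x|\<mu>. (u y x)\<^sup>2) = h y" if y: "y \<ge> 0" for y
 proof -
  have "(u y x)\<^sup>2 = indicator (W n) x *\<^sub>R (u y x)\<^sup>2" for x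
   using weighted_basic(5)[OF n V(1)[OF y] w r, of x] by (auto simp: u_def indicator_def)
  then have "(LINT x|\<mu>. (u y x)\<^sup>2) = (LINT x:W n|\<mu>. (u y x)\<^sup>2)" unfolding set_lebesgue_integral_def by presburger
  also have "\<dots> = (LINT x|Mn n. (u y x)\<^sup>2)" by (rule integral_Mn)
  also have "\<dots> = h y" unfolding h_def
  proof (rule integral_cong_AE)
   show "AE x in Mn n. (u y x)\<^sup>2 = (flow n y v x)\<^sup>2 * q x"
    using uv[OF y] by eventually_elim (simp add: q_def power_mult_distrib exp_double)
  qed (use uM[OF y] V(2)[OF y] qm in auto)
  finally show ?thesis .
 qed
 have gen: "AE x in Mn n. Gen n (flow n y v) x = flow n y (Gen n v) x" if "y \<ge> 0" for y
  by (rule sg.generator_Sx[OF v(1) that])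
 have gm: "flow n y (Gen n v) \<in> borel_measurable (Mn n)" if "y \<ge> 0" for y
  by (rule sg.Sx_meas[OF that sg.graph_Lp(2)[OF vg]])
 have Gm: "Gen n (flow n y v) \<in> borel_measurable (Mn n)" if "y \<ge> 0" for y
  by (rule sg.Lp_meas[OF sg.graph_Lp(2)[OF sg.generator_graph[OF sg.Sx_gen_dom[OF v(1) that]]]])
 have B0: "0 \<le> B" and \<kappa>0: "0 \<le> \<kappa>" using EB FB by (auto simp: energy_bound_def flux_bound_def)
 have "\<bar>(LINT x|Mn n. flow n s v x * k x) - (LINT x|Mn n. flow n 0 v x * k x)\<bar>
   \<le> \<kappa> * (2 * s + (s + 1) * exp (2 * B * s) * h 0)"
 proof (rule flux_comparison[where F = "\<lambda>y. LINT x|Mn n. flow n y v x * k x" and h = h and D = "\<lambda>y. E0 (u y) (u y)"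
    and l = "\<lambda>y. LINT x|Mn n. flow n y (Gen n v) x * k x"
    and h' = "\<lambda>y. 2 * (LINT x|Mn n. flow n y (Gen n v) x * (flow n y v x * q x))", OF s])
  show "continuous_on {0..s} (\<lambda>y. LINT x|Mn n. flow n y v x * k x)"
   by (rule continuous_on_subset[OF sg.continuous_linear_functional[OF vLp km]]) auto
  show "continuous_on {0..s} h" unfolding h_def
   by (rule continuous_on_subset[OF sg.continuous_weighted_square[OF vm v(2) c qm qb]]) auto
  fix y :: real
  show "0 \<le> h y" unfolding h_def q_def by (intro integral_nonneg_AE AE_I2) simp
  assume y: "0 < y"
  then have y0: "0 \<le> y" by simp
  show "((\<lambda>y. LINT x|Mn n. flow n y v x * k x) has_real_derivative (LINT x|Mn n. flow n y (Gen n v) x * k x)) (at y)"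
   by (rule sg.DERIV_linear_functional[OF vg y km])
  show "(h has_real_derivative 2 * (LINT x|Mn n. flow n y (Gen n v) x * (flow n y v x * q x))) (at y)"
   unfolding h_def by (rule sg.DERIV_weighted_square[OF vg y v(2) c qm qb]) simp
  show "0 \<le> E0 (u y) (u y)" by (rule form.E_nonneg[OF ub[OF y0]])
  show "\<bar>LINT x|Mn n. flow n y (Gen n v) x * k x\<bar> \<le> \<kappa> * (sqrt (E0 (u y) (u y)) + sqrt (h y))"
  proof -
   obtain f where f: "f \<in> DE" "AE x\<in>W n in \<mu>. f x = 1 - F (\<rho> x)"
    "\<bar>LINT x:W n|\<mu>. Gen n (flow n y v) x * f x\<bar> \<le> \<kappa> * (sqrt (E0 (u y) (u y)) + sqrt (LINT x|\<mu>. (u y x)\<^sup>2))"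
    using FB V(1)[OF y0] r unfolding flux_bound_def u_def by blast
   have "(LINT x:W n|\<mu>. Gen n (flow n y v) x * f x) = (LINT x|Mn n. Gen n (flow n y v) x * f x)" by (rule integral_Mn)
   also have "\<dots> = (LINT x|Mn n. flow n y (Gen n v) x * k x)"
   proof (rule integral_cong_AE)
    show "AE x in Mn n. Gen n (flow n y v) x * f x = flow n y (Gen n v) x * k x"
     using gen[OF y0] f(2)[folded AE_Mn] by eventually_elim (simp add: k_def)
    have "f \<in> borel_measurable (Mn n)" by (rule measurable_restrict_space1[OF form.D_meas[OF f(1)]])
    then show "(\<lambda>x. Gen n (flow n y v) x * f x) \<in> borel_measurable (Mn n)" using Gm[OF y0] by (rule borel_measurable_times[rotated])
    show "(\<lambda>x. flow n y (Gen n v) x * k x) \<in> borel_measurable (Mn n)" by (rule borel_measurable_times[OF gm[OF y0] km(1)])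
   qed
   finally show ?thesis using f(3) unfolding hu[OF y0] by simp
  qed
  show "2 * (LINT x|Mn n. flow n y (Gen n v) x * (flow n y v x * q x)) \<le> 2 * (- E0 (u y) (u y) + B * h y)"
  proof -
   have "(LINT x:W n|\<mu>. Gen n (flow n y v) x * (u y x * exp (\<Phi> (r x)))) \<le> - E0 (u y) (u y) + B * (LINT x|\<mu>. (u y x)\<^sup>2)"
    using EB V(1)[OF y0] r unfolding energy_bound_def u_def by blast
   moreover have "(LINT x:W n|\<mu>. Gen n (flow n y v) x * (u y x * exp (\<Phi> (r x))))
     = (LINT x|Mn n. Gen n (flow n y v) x * (u y x * exp (\<Phi> (r x))))" by (rule integral_Mn)
   moreover have "\<dots> = (LINT x|Mn n. flow n y (Gen n v) x * (flow n y v x * q x))"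
   proof (rule integral_cong_AE)
    show "AE x in Mn n. Gen n (flow n y v) x * (u y x * exp (\<Phi> (r x))) = flow n y (Gen n v) x * (flow n y v x * q x)"
     using gen[OF y0] uv[OF y0] rae by eventually_elim (simp add: q_def exp_double power2_eq_square)
    have "r \<in> borel_measurable \<mu>" using r by (intro form.D_meas bdd_D) (simp add: rho_trunc_def)
    then have "(\<lambda>x. exp (\<Phi> (r x))) \<in> borel_measurable \<mu>"
     using measurable_compose[OF _ borel_measurable_continuous_onI[of "\<lambda>y. exp (\<Phi> y)"]] weight_continuous[OF w] by (auto intro!: continuous_intros)
    then have "(\<lambda>x. exp (\<Phi> (r x))) \<in> borel_measurable (Mn n)" by (rule measurable_restrict_space1)
    then show "(\<lambda>x. Gen n (flow n y v) x * (u y x * exp (\<Phi> (r x)))) \<in> borel_measurable (Mn n)"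
     by (intro borel_measurable_times Gm uM y0)
    show "(\<lambda>x. flow n y (Gen n v) x * (flow n y v x * q x)) \<in> borel_measurable (Mn n)"
     by (intro borel_measurable_times gm V y0 qm)
   qed
   ultimately show ?thesis unfolding hu[OF y0] by (simp only: mult_left_mono)
  qed
 qed (rule \<kappa>0 B0)+
 then show ?thesis unfolding h_def q_def k_def by (simp add: sg.Sx_def)
qed

text \<open>Bounded domain elements approximate \<open>g\<close> under the same bound
  \<open>c\<close>. The linear terms converge with the norm, and so do the weighted squares, by
  \<open>R\<^sup>2 - g\<^sup>2 = (R - g) (R + g)\<close> and the common bound; \<kappa> and
  \<open>B\<close> stay fixed.\<close>

lemma mass_loss:
 assumes n: "n \<ge> 1" and w: "weight \<Phi> \<psi>" and EB: "energy_bound n \<Phi> B" and FB: "flux_bound n \<Phi> F \<kappa>"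
  and F: "continuous_on UNIV F" "\<And>y. \<bar>F y\<bar> \<le> C"
  and g: "g \<in> borel_measurable (Mn n)" "AE x in Mn n. \<bar>g x\<bar> \<le> c" and c: "c > 0" and s: "s \<ge> 0"
 shows "\<bar>(LINT x|Mn n. flow n s g x * (1 - F (\<rho> x))) - (LINT x|Mn n. g x * (1 - F (\<rho> x)))\<bar>
  \<le> \<kappa> * (2 * s + (s + 1) * exp (2 * B * s) * (LINT x|Mn n. (g x)\<^sup>2 * exp (2 * \<Phi> (\<rho> x))))"
proof -
 interpret sg: contraction_semigroup "Mn n" p "S n" by (rule semigroup[OF n])
 have "\<exists>R. R \<in> gen_dom p (Mn n) (S n) \<and> (AE x in Mn n. \<bar>R x\<bar> \<le> c) \<and> sg.nrm (\<lambda>x. R x - g x) \<le> 1 / Suc j" for j :: nat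
  using sg.gen_dom_dense[OF g c, of "1 / Suc j"] by auto
 then obtain R where R: "\<And>j. R j \<in> gen_dom p (Mn n) (S n)" "\<And>j. AE x in Mn n. \<bar>R j x\<bar> \<le> c"
  "\<And>j. sg.nrm (\<lambda>x. R j x - g x) \<le> 1 / Suc j" by metis
 have gLp: "g \<in> sg.Lp" by (rule sg.Lp_bounded[OF g])
 have RLp: "R j \<in> sg.Lp" for j by (rule sg.graph_Lp(1)[OF sg.generator_graph[OF R(1)]])
 have Rm: "R j \<in> borel_measurable (Mn n)" for j by (rule sg.Lp_meas[OF RLp])
 define q where "q x = exp (2 * \<Phi> (\<rho> x))" for x
 define k where "k x = 1 - F (\<rho> x)" for x
 obtain Bd where qm: "q \<in> borel_measurable (Mn n)" and qb: "AE x in Mn n. \<bar>q x\<bar> \<le> exp (2 * Bd)"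
  using weight_test[OF w] unfolding q_def [abs_def] by blast
 note km = cutoff_test[OF F, of n, folded k_def]
 have C0: "0 \<le> 1 + C" using F(2)[of 0] by linarith
 have lim0: "(\<lambda>j. a * (sg.K1 * (1 / real (Suc j)))) \<longlonglongrightarrow> 0" for a :: real
  using tendsto_mult_right_zero[OF tendsto_mult_right_zero[OF LIMSEQ_Suc[OF lim_1_over_n]], of a sg.K1] by simp
 have lin: "(\<lambda>j. LINT x|Mn n. flow n y (R j) x * k x) \<longlonglongrightarrow> (LINT x|Mn n. flow n y g x * k x)" if y: "y \<ge> 0" for y
 proof (rule Lim_null[THEN iffD2, OF Lim_null_comparison[OF _ lim0[of "1 + C"]]], intro always_eventually allI)
  fix j
  have d: "(\<lambda>x. flow n y (R j) x - flow n y g x) \<in> sg.Lp" by (intro sg.Lp_diff sg.Sx_Lp y RLp gLp)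
  note i = sg.integral_mult_le(1)[OF sg.L1_le_nrm(1)[OF sg.Sx_Lp[OF y RLp]] km]
   sg.integral_mult_le(1)[OF sg.L1_le_nrm(1)[OF sg.Sx_Lp[OF y gLp]] km]
  have 1: "(LINT x|Mn n. flow n y (R j) x * k x) - (LINT x|Mn n. flow n y g x * k x)
    = (LINT x|Mn n. (flow n y (R j) x - flow n y g x) * k x)"
   using Bochner_Integration.integral_diff[OF i] by (simp only: left_diff_distrib)
  have 2: "\<bar>LINT x|Mn n. (flow n y (R j) x - flow n y g x) * k x\<bar> \<le> (1 + C) * (LINT x|Mn n. \<bar>flow n y (R j) x - flow n y g x\<bar>)"
   by (rule sg.integral_mult_le(2)[OF sg.L1_le_nrm(1)[OF d] km])
  have 3: "sg.nrm (\<lambda>x. flow n y (R j) x - flow n y g x) \<le> 1 / real (Suc j)"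
   by (rule order_trans[OF sg.Sx_dist[OF y RLp gLp] R(3)])
  have 4: "(LINT x|Mn n. \<bar>flow n y (R j) x - flow n y g x\<bar>) \<le> sg.K1 * (1 / real (Suc j))"
   by (rule order_trans[OF sg.L1_le_nrm(2)[OF d] mult_left_mono[OF 3 less_imp_le[OF sg.K1_pos]]])
  show "norm ((LINT x|Mn n. flow n y (R j) x * k x) - (LINT x|Mn n. flow n y g x * k x))
    \<le> (1 + C) * (sg.K1 * (1 / real (Suc j)))"
   unfolding 1 real_norm_def by (rule order_trans[OF 2 mult_left_mono[OF 4 C0]])
 qed
 have sq: "(\<lambda>j. LINT x|Mn n. (R j x)\<^sup>2 * q x) \<longlonglongrightarrow> (LINT x|Mn n. (g x)\<^sup>2 * q x)"
 proof (rule Lim_null[THEN iffD2, OF Lim_null_comparison[OF _ lim0[of "2 * c * exp (2 * Bd)"]]], intro always_eventually allI)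
  fix j
  have d: "(\<lambda>x. R j x - g x) \<in> sg.Lp" by (intro sg.Lp_diff RLp gLp)
  let ?p = "\<lambda>x. (R j x + g x) * q x"
  have pm: "?p \<in> borel_measurable (Mn n)" using Rm[of j] g(1) qm by simp
  have pb: "AE x in Mn n. \<bar>?p x\<bar> \<le> 2 * c * exp (2 * Bd)"
   using R(2)[of j] g(2) qb
  proof eventually_elim
   case (elim x)
   then show ?case unfolding abs_mult by (intro mult_mono) auto
  qed
  have isq: "integrable (Mn n) (\<lambda>x. (f x)\<^sup>2 * q x)" if f: "f \<in> borel_measurable (Mn n)" "AE x in Mn n. \<bar>f x\<bar> \<le> c" for f
  proof (rule sg.integral_mult_le(1)[OF _ qm qb])
   show "integrable (Mn n) (\<lambda>x. (f x)\<^sup>2)"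
   proof (rule sg.integrable_const_bound[where B = "c\<^sup>2"])
    show "AE x in Mn n. norm ((f x)\<^sup>2) \<le> c\<^sup>2"
     using f(2) by eventually_elim (simp add: abs_le_square_iff[symmetric])
   qed (use f(1) in simp)
  qed
  have 1: "(LINT x|Mn n. (R j x)\<^sup>2 * q x) - (LINT x|Mn n. (g x)\<^sup>2 * q x) = (LINT x|Mn n. (R j x - g x) * ?p x)"
  proof -
   have "(R j x)\<^sup>2 * q x - (g x)\<^sup>2 * q x = (R j x - g x) * ?p x" for x by (simp add: algebra_simps power2_eq_square)
   then show ?thesis using Bochner_Integration.integral_diff[OF isq[OF Rm R(2)] isq[OF g], of j] by presburger
  qed
  have 2: "\<bar>LINT x|Mn n. (R j x - g x) * ?p x\<bar> \<le> 2 * c * exp (2 * Bd) * (LINT x|Mn n. \<bar>R j x - g x\<bar>)"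
   by (rule sg.integral_mult_le(2)[OF sg.L1_le_nrm(1)[OF d] pm pb])
  have 4: "(LINT x|Mn n. \<bar>R j x - g x\<bar>) \<le> sg.K1 * (1 / real (Suc j))"
   by (rule order_trans[OF sg.L1_le_nrm(2)[OF d] mult_left_mono[OF R(3) less_imp_le[OF sg.K1_pos]]])
  have 5: "0 \<le> 2 * c * exp (2 * Bd)" using c by simp
  show "norm ((LINT x|Mn n. (R j x)\<^sup>2 * q x) - (LINT x|Mn n. (g x)\<^sup>2 * q x))
    \<le> 2 * c * exp (2 * Bd) * (sg.K1 * (1 / real (Suc j)))"
   unfolding 1 real_norm_def by (rule order_trans[OF 2 mult_left_mono[OF 4 5]])
 qed
 have lin0: "(\<lambda>j. LINT x|Mn n. R j x * k x) \<longlonglongrightarrow> (LINT x|Mn n. g x * k x)"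
  using lin[of 0] by (simp add: sg.Sx_def)
 have "\<bar>(LINT x|Mn n. flow n s g x * k x) - (LINT x|Mn n. g x * k x)\<bar>
   \<le> \<kappa> * (2 * s + (s + 1) * exp (2 * B * s) * (LINT x|Mn n. (g x)\<^sup>2 * q x))"
 proof (rule LIMSEQ_le)
  show "(\<lambda>j. \<bar>(LINT x|Mn n. flow n s (R j) x * k x) - (LINT x|Mn n. R j x * k x)\<bar>)
    \<longlonglongrightarrow> \<bar>(LINT x|Mn n. flow n s g x * k x) - (LINT x|Mn n. g x * k x)\<bar>"
   by (intro tendsto_rabs tendsto_diff lin s lin0)
  show "(\<lambda>j. \<kappa> * (2 * s + (s + 1) * exp (2 * B * s) * (LINT x|Mn n. (R j x)\<^sup>2 * q x)))
    \<longlonglongrightarrow> \<kappa> * (2 * s + (s + 1) * exp (2 * B * s) * (LINT x|Mn n. (g x)\<^sup>2 * q x))"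
   by (intro tendsto_mult tendsto_add tendsto_const sq)
  show "\<exists>N. \<forall>j\<ge>N. \<bar>(LINT x|Mn n. flow n s (R j) x * k x) - (LINT x|Mn n. R j x * k x)\<bar>
   \<le> \<kappa> * (2 * s + (s + 1) * exp (2 * B * s) * (LINT x|Mn n. (R j x)\<^sup>2 * q x))"
   unfolding k_def q_def by (intro exI[of _ 0] allI impI) (rule mass_loss_domain[OF n w EB FB F R(1) R(2) c s])
 qed
 then show ?thesis unfolding k_def q_def .
qed

end

section \<open>Smoothed weights and the growth criterion\<close>

definition soft_ramp :: "real \<Rightarrow> real" where
 "soft_ramp y = ((max (y - 0) 0)\<^sup>2 - (max (y - 1) 0)\<^sup>2) / 2"

definition soft_step :: "real \<Rightarrow> real" where
 "soft_step y = max (y - 0) 0 - max (y - 1) 0"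

lemma soft_ramp_deriv: "(soft_ramp has_real_derivative soft_step y) (at y)"
 using DERIV_cdivide[OF DERIV_diff[OF DERIV_shifted_pos_part[of 0] DERIV_shifted_pos_part[of 1]], of 2 y]
 unfolding soft_ramp_def [abs_def] soft_step_def by (rule DERIV_cong) simp

lemma soft_step_bounds: "0 \<le> soft_step y" "soft_step y \<le> 1" "y \<le> 0 \<Longrightarrow> soft_step y = 0" "1 \<le> y \<Longrightarrow> soft_step y = 1"
 "x \<le> y \<Longrightarrow> soft_step x \<le> soft_step y"
 by (auto simp: soft_step_def max_def)

lemma soft_step_continuous: "continuous_on UNIV soft_step"
 unfolding soft_step_def [abs_def] by (intro continuous_intros)

text \<open>\<open>soft_ramp\<close> is a C1 version of the positive part with slope
  \<open>soft_step\<close>. Rounding the corner costs at most 1, which reappears in the lower bound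
  of \<open>weight_exists\<close>.\<close>

lemma soft_ramp_bounds:
 "y \<le> 0 \<Longrightarrow> soft_ramp y = 0" "y - 1 \<le> soft_ramp y"
 "x \<le> y \<Longrightarrow> soft_ramp x \<le> soft_ramp y" "x \<le> y \<Longrightarrow> soft_ramp y - soft_ramp x \<le> y - x"
proof -
 show "y \<le> 0 \<Longrightarrow> soft_ramp y = 0" by (simp add: soft_ramp_def)
 show m: "soft_ramp x \<le> soft_ramp y" if "x \<le> y" for x y
  using soft_ramp_deriv soft_step_bounds(1) by (intro DERIV_nonneg_imp_nondecreasing[OF that]) blast
 show "soft_ramp y - soft_ramp x \<le> y - x" if "x \<le> y" for x y
 proof -
  have "x - soft_ramp x \<le> y - soft_ramp y"
  proof (rule DERIV_nonneg_imp_nondecreasing[OF that])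
   show "\<exists>d. ((\<lambda>y. y - soft_ramp y) has_real_derivative d) (at z) \<and> 0 \<le> d" for z
    using DERIV_diff[OF DERIV_ident soft_ramp_deriv[of z]] soft_step_bounds(2)[of z] by (intro exI conjI) auto
  qed
  then show ?thesis by linarith
 qed
 show "y - 1 \<le> soft_ramp y"
 proof (cases "y \<le> 1")
  case True
  then have "soft_ramp y = (max y 0)\<^sup>2 / 2" by (simp add: soft_ramp_def)
  then show ?thesis using True by (smt (verit) zero_le_power2 divide_nonneg_pos)
 next
  case False
  then show ?thesis by (simp add: soft_ramp_def max_def power2_eq_square algebra_simps)
 qed
qed

text \<open>On a null set the essential supremum is \<open>-\<infinity>\<close>, which converts to
  the real number 0. Otherwise it lies between 0 and \<open>c\<close>, so the conversion to a real
  number loses nothing.\<close>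

lemma ess_sup_on_bounds:
 assumes A: "A \<in> sets M" and g: "g \<in> borel_measurable (restrict_space M A)" and b: "AE x\<in>A in M. \<bar>g x\<bar> \<le> c" and pos: "AE x\<in>A in M. 0 \<le> g x"
 shows "AE x\<in>A in M. g x \<le> ess_sup_on M A g" "0 \<le> ess_sup_on M A g"
proof -
 let ?M = "restrict_space M A" and ?s = "esssup (restrict_space M A) (\<lambda>x. ereal (g x))"
 have AEr: "(AE x in ?M. P x) \<longleftrightarrow> (AE x\<in>A in M. P x)" for P
  using A sets.sets_into_space[OF A] by (subst AE_restrict_space_iff) (auto simp: Int_absorb2)
 have gm: "(\<lambda>x. ereal (g x)) \<in> borel_measurable ?M" using g by simp
 have le: "AE x in ?M. ereal (g x) \<le> ?s" by (rule esssup_AE)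
 have "AE x in ?M. ereal (g x) \<le> ereal c" using b[folded AEr] by eventually_elim simp
 then have sc: "?s \<le> ereal c" by (rule esssup_I[OF gm])
 have "(AE x\<in>A in M. g x \<le> ess_sup_on M A g) \<and> 0 \<le> ess_sup_on M A g"
 proof (cases "emeasure ?M (space ?M) = 0")
  case True
  then have "?s = - \<infinity>" by (rule esssup_zero_space[OF _ gm])
  moreover have "AE x in ?M. False" using True by (subst AE_iff_measurable[of "space ?M"]) auto
  ultimately show ?thesis unfolding ess_sup_on_def AEr[symmetric] by auto
 next
  case False
  have s0: "0 \<le> ?s"
  proof (rule ccontr)
   assume "\<not> 0 \<le> ?s"
   have "AE x in ?M. False"
    using le pos[folded AEr]
   proof eventually_elim
    case (elim x)
    then have "ereal 0 \<le> ?s" by (metis ereal_less_eq(3) order_trans)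
    with \<open>\<not> 0 \<le> ?s\<close> show ?case by (simp add: zero_ereal_def)
   qed
   then have "emeasure ?M (space ?M) = 0" by (simp add: ae_filter_eq_bot_iff[symmetric] trivial_limit_def)
   with False show False by simp
  qed
  then obtain y where y: "?s = ereal y" "0 \<le> y" using sc by (cases ?s) auto
  then show ?thesis using le unfolding ess_sup_on_def AEr[symmetric] by simp
 qed
 then show "AE x\<in>A in M. g x \<le> ess_sup_on M A g" "0 \<le> ess_sup_on M A g" by blast+
qed

text \<open>The common shape of the three cases: multiplied by a suitable positive factor, each
  pointwise hypothesis becomes \<open>criterion\<close>, and \<open>E\<close> is the exponent of the
  growth bound. In the error the factors \<open>exp (E R)\<close>,
  \<open>exp (\<kappa> \<phi> (4 R))\<close> from the energy and \<open>exp (- \<phi> (2 R))\<close>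
  from the weight meet; \<open>growth_limit\<close> makes their product vanish. Restricting to
  \<open>1 \<le> \<rho>\<close> keeps away from possible singularities of \<phi>' at 0.\<close>

locale growth_criterion = conservativeness_setting +
 fixes \<phi> \<phi>' :: "real \<Rightarrow> real" and c \<kappa> :: real and E :: "nat \<Rightarrow> real"
 assumes phi_deriv: "\<And>r. r > 0 \<Longrightarrow> (\<phi> has_real_derivative \<phi>' r) (at r)"
  and phi'_cont: "continuous_on {0<..} \<phi>'"
  and phi'_nonneg: "\<And>r. r > 0 \<Longrightarrow> 0 \<le> \<phi>' r"
  and phi_nonneg: "\<And>r. r > 0 \<Longrightarrow> 0 \<le> \<phi> r"
  and phi_top: "filterlim \<phi> at_top at_top"
  and c_pos: "c > 0" and kappa_pos: "\<kappa> > 0"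
  and criterion: "\<And>n. n \<ge> 1 \<Longrightarrow> AE x\<in>exhaustion \<rho> n - K in \<mu>. 1 \<le> \<rho> x \<longrightarrow>
    (\<phi>' (\<rho> x))\<^sup>2 * carre_loc \<mu> DE \<Gamma> \<rho> \<rho> x + \<phi>' (\<rho> x) * N_rho N \<rho> n x \<le> c * (\<phi> (\<rho> x) + 1)"
  and growth_bound: "\<forall>\<^sub>F R in sequentially. growth \<mu> \<rho> (carre_loc \<mu> DE \<Gamma> \<rho> \<rho>) (N_rho N \<rho>) \<phi> R \<le> real R * exp (E R)"
  and growth_limit: "filterlim (\<lambda>R. E R + \<kappa> * \<phi> (4 * real R) - \<phi> (2 * real R)) at_bot sequentially"
begin

lemma phi_mono:
 assumes "0 < r" "r \<le> s"
 shows "\<phi> r \<le> \<phi> s"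
proof (rule DERIV_nonneg_imp_nondecreasing[OF assms(2)])
 show "\<exists>d. (\<phi> has_real_derivative d) (at x) \<and> 0 \<le> d" if "r \<le> x" "x \<le> s" for x
  using phi_deriv[of x] phi'_nonneg[of x] that assms by auto
qed

text \<open>\<Phi> is \<open>\<phi> - \<phi> k\<close> with both corners rounded: it starts to grow
  beyond \<open>k\<close> and is constant once \<phi> exceeds \<open>\<phi> (4 R) + 1\<close>. Its
  slope is \<open>\<theta> \<phi>'\<close> with \<theta> in \<open>[0, 1]\<close>, nonzero only
  beyond \<open>k\<close>, where the criterion will be available, and where \<phi> is
  controlled.\<close>

lemma weight_exists:
 assumes k: "1 \<le> k" "k \<le> 2 * R"
 obtains \<Phi> \<psi> where "weight \<Phi> \<psi>" "\<And>r. r \<le> k \<Longrightarrow> \<Phi> r = 0"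
  "\<And>r. 2 * R \<le> r \<Longrightarrow> r \<le> 4 * R \<Longrightarrow> \<phi> (2 * R) - \<phi> k - 1 \<le> \<Phi> r"
  "\<And>r. \<exists>\<theta>. 0 \<le> \<theta> \<and> \<theta> \<le> 1 \<and> \<psi> r = \<theta> * \<phi>' r \<and> (\<theta> \<noteq> 0 \<longrightarrow> k < r \<and> \<phi> r \<le> \<phi> (4 * R) + 1)"
proof -
 define \<Phi> where "\<Phi> r = (if r \<le> 0 then 0 else soft_ramp (\<phi> r - \<phi> k) - soft_ramp (\<phi> r - \<phi> (4 * R)))" for r
 define \<theta> where "\<theta> r = (if r \<le> k then 0 else soft_step (\<phi> r - \<phi> k) - soft_step (\<phi> r - \<phi> (4 * R)))" for r
 have kR: "\<phi> k \<le> \<phi> (4 * R)" using k by (intro phi_mono) auto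
 have low: "\<phi> r \<le> \<phi> k" if "0 < r" "r \<le> k" for r using that by (rule phi_mono)
 have \<Phi>0: "\<Phi> r = 0" if "r \<le> k" for r
 proof (cases "0 < r")
  case True
  then have "\<phi> r - \<phi> k \<le> 0" "\<phi> r - \<phi> (4 * R) \<le> 0" using low[of r] that kR by auto
  then show ?thesis by (simp add: \<Phi>_def soft_ramp_bounds(1))
 qed (simp add: \<Phi>_def)
 have \<theta>eq: "\<theta> r = soft_step (\<phi> r - \<phi> k) - soft_step (\<phi> r - \<phi> (4 * R))" if "0 < r" for r
 proof (cases "r \<le> k")
  case True
  then have "\<phi> r - \<phi> k \<le> 0" "\<phi> r - \<phi> (4 * R) \<le> 0" using low[of r] that kR by auto
  then show ?thesis using True by (simp add: \<theta>_def soft_step_bounds(3))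
 qed (simp add: \<theta>_def)
 have \<theta>b: "0 \<le> \<theta> r" "\<theta> r \<le> 1" for r
  using soft_step_bounds(5)[of "\<phi> r - \<phi> (4 * R)" "\<phi> r - \<phi> k"] soft_step_bounds(1)[of "\<phi> r - \<phi> (4 * R)"]
   soft_step_bounds(2)[of "\<phi> r - \<phi> k"] kR by (auto simp: \<theta>_def)
 have \<theta>n: "\<theta> r \<noteq> 0 \<longrightarrow> k < r \<and> \<phi> r \<le> \<phi> (4 * R) + 1" for r
 proof (intro impI conjI)
  assume nz: "\<theta> r \<noteq> 0"
  show "k < r" using nz by (auto simp: \<theta>_def split: if_splits)
  show "\<phi> r \<le> \<phi> (4 * R) + 1"
  proof (rule ccontr)
   assume "\<not> \<phi> r \<le> \<phi> (4 * R) + 1"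
   then have "soft_step (\<phi> r - \<phi> k) = 1" "soft_step (\<phi> r - \<phi> (4 * R)) = 1" using kR by (simp_all add: soft_step_bounds(4))
   then show False using nz by (simp add: \<theta>_def split: if_splits)
  qed
 qed
 have der: "(\<Phi> has_real_derivative \<theta> r * \<phi>' r) (at r)" for r
 proof (cases "r < k")
  case True
  have "((\<lambda>_. 0) has_real_derivative 0) (at r)" by (rule DERIV_const)
  moreover have "\<forall>\<^sub>F x in nhds r. \<Phi> x = 0"
   using order_tendstoD(2)[OF filterlim_ident True] by eventually_elim (simp add: \<Phi>0)
  ultimately have "(\<Phi> has_real_derivative 0) (at r)" by (subst DERIV_cong_ev[OF refl _ refl])
  then show ?thesis using True by (simp add: \<theta>_def)
 next
  case False
  then have r0: "0 < r" using k by simp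
  have 1: "((\<lambda>r. \<phi> r - a) has_real_derivative \<phi>' r) (at r)" for a
   using DERIV_diff[OF phi_deriv[OF r0] DERIV_const] by simp
  have "((\<lambda>r. soft_ramp (\<phi> r - \<phi> k) - soft_ramp (\<phi> r - \<phi> (4 * R))) has_real_derivative
    soft_step (\<phi> r - \<phi> k) * \<phi>' r - soft_step (\<phi> r - \<phi> (4 * R)) * \<phi>' r) (at r)"
   by (intro DERIV_diff DERIV_chain2[OF soft_ramp_deriv 1])
  then have "((\<lambda>r. soft_ramp (\<phi> r - \<phi> k) - soft_ramp (\<phi> r - \<phi> (4 * R))) has_real_derivative \<theta> r * \<phi>' r) (at r)"
   by (simp add: \<theta>eq[OF r0] left_diff_distrib)
  moreover have "\<forall>\<^sub>F x in nhds r. \<Phi> x = soft_ramp (\<phi> x - \<phi> k) - soft_ramp (\<phi> x - \<phi> (4 * R))"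
   using order_tendstoD(1)[OF filterlim_ident r0] by eventually_elim (simp add: \<Phi>_def)
  ultimately show ?thesis by (subst DERIV_cong_ev[OF refl _ refl])
 qed
 have cont: "continuous_on UNIV (\<lambda>r. \<theta> r * \<phi>' r)"
 proof (rule continuous_at_imp_continuous_on, intro ballI)
  fix r :: real
  show "isCont (\<lambda>r. \<theta> r * \<phi>' r) r"
  proof (cases "r < k")
   case True
   have "\<forall>\<^sub>F x in nhds r. \<theta> x * \<phi>' x = 0"
    using order_tendstoD(2)[OF filterlim_ident True] by eventually_elim (simp add: \<theta>_def)
   then show ?thesis by (rule isCont_cong[THEN iffD2]) simp
  next
   case False
   then have r0: "0 < r" using k by simp
   have "\<forall>\<^sub>F x in nhds r. \<theta> x * \<phi>' x = (soft_step (\<phi> x - \<phi> k) - soft_step (\<phi> x - \<phi> (4 * R))) * \<phi>' x"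
    using order_tendstoD(1)[OF filterlim_ident r0] by eventually_elim (simp add: \<theta>eq)
   moreover have "isCont (\<lambda>x. (soft_step (\<phi> x - \<phi> k) - soft_step (\<phi> x - \<phi> (4 * R))) * \<phi>' x) r"
   proof -
    have s: "isCont soft_step y" for y using soft_step_continuous by (simp add: continuous_on_eq_continuous_at)
    have p: "isCont \<phi> r" by (rule DERIV_isCont[OF phi_deriv[OF r0]])
    have p': "isCont \<phi>' r" using phi'_cont r0 by (simp add: continuous_on_eq_continuous_at)
    have 1: "isCont (\<lambda>x. soft_step (\<phi> x - a)) r" for a
     by (rule isCont_o2[where f = "\<lambda>x. \<phi> x - a", OF _ s]) (intro continuous_intros p)
    show ?thesis by (intro continuous_intros 1 p')
   qed
   ultimately show ?thesis by (subst isCont_cong)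
  qed
 qed
 have bd: "\<exists>L. \<forall>r. 0 \<le> \<theta> r * \<phi>' r \<and> \<theta> r * \<phi>' r \<le> L"
 proof -
  \<comment> \<open>\<phi>' may be unbounded at infinity, but \<theta> vanishes wherever \<phi>
    exceeds \<open>\<phi> (4 R) + 1\<close>, in particular beyond \<open>r1\<close>; so only a
    compact interval matters.\<close>
  obtain r1 where r1: "\<And>r. r \<ge> r1 \<Longrightarrow> \<phi> r \<ge> \<phi> (4 * R) + 2"
   using filterlim_at_top[THEN iffD1, OF phi_top, rule_format, of "\<phi> (4 * R) + 2"] unfolding eventually_at_top_linorder by blast
  have "compact (\<phi>' ` {k..r1})"
   using k by (intro compact_continuous_image continuous_on_subset[OF phi'_cont]) auto
  then obtain L where "\<forall>r\<in>{k..r1}. \<bar>\<phi>' r\<bar> \<le> L"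
   using compact_imp_bounded[of "\<phi>' ` {k..r1}"] unfolding bounded_iff by auto
  then have L: "\<bar>\<phi>' r\<bar> \<le> L" if "k \<le> r" "r \<le> r1" for r using that by simp
  have "0 \<le> \<theta> r * \<phi>' r \<and> \<theta> r * \<phi>' r \<le> max L 0" for r
  proof (cases "\<theta> r = 0")
   case False
   then have r: "k < r" "\<phi> r \<le> \<phi> (4 * R) + 1" using \<theta>n by auto
   then have "r \<le> r1" using r1[of r] by (cases "r \<le> r1") auto
   then have "\<bar>\<phi>' r\<bar> \<le> L" using L r by simp
   moreover have "0 \<le> \<phi>' r" using phi'_nonneg[of r] r k by simp
   ultimately have "0 \<le> \<theta> r * \<phi>' r" "\<theta> r * \<phi>' r \<le> 1 * L"
    using \<theta>b[of r] by (simp, intro mult_mono) auto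
   then show ?thesis by simp
  qed simp
  then show ?thesis by blast
 qed
 have "0 \<le> \<Phi> r \<and> \<Phi> r \<le> \<phi> (4 * R) - \<phi> k" for r
  using soft_ramp_bounds(3,4)[of "\<phi> r - \<phi> (4 * R)" "\<phi> r - \<phi> k"] kR by (simp add: \<Phi>_def)
 then have bd': "\<exists>B. \<forall>r. 0 \<le> \<Phi> r \<and> \<Phi> r \<le> B" by blast
 have "weight \<Phi> (\<lambda>r. \<theta> r * \<phi>' r)"
  unfolding weight_def using der cont bd bd' \<Phi>0[of 0] k by simp
 moreover have "\<phi> (2 * R) - \<phi> k - 1 \<le> \<Phi> r" if r: "2 * R \<le> r" "r \<le> 4 * R" for r
 proof -
  have r0: "0 < r" "0 < 2 * R" using r k by auto
  have "soft_ramp (\<phi> r - \<phi> (4 * R)) = 0" using phi_mono[OF r0(1) r(2)] by (simp add: soft_ramp_bounds(1))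
  then show ?thesis using phi_mono[OF r0(2) r(1)] soft_ramp_bounds(2)[of "\<phi> r - \<phi> k"] r0 by (simp add: \<Phi>_def)
 qed
 ultimately show thesis using \<Phi>0 \<theta>b \<theta>n that[of \<Phi> "\<lambda>r. \<theta> r * \<phi>' r"] by blast
qed

abbreviation "growth_at R \<equiv> growth \<mu> \<rho> \<Gamma>\<rho> (N_rho N \<rho>) \<phi> R"

text \<open>Two stand-ins for \<rho> differ by a function that is constant on \<open>W m\<close>.
  This reconciles the growth quantity of the annulus \<open>R\<close>, formed with
  \<open>N_rho N \<rho> R\<close>, with the form identity on \<open>W n\<close> for larger
  \<open>n\<close>.\<close>

lemma N_rho_consistent:
 assumes m: "1 \<le> m" "m \<le> n"
 shows "AE x\<in>W m in \<mu>. N_rho N \<rho> n x = N_rho N \<rho> m x"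
proof -
 obtain r r' where r: "rho_trunc n r" "rho_trunc m r'" using rho_trunc_exists by blast
 have b: "r \<in> sub_bdd \<mu> DE" "r' \<in> sub_bdd \<mu> DE" using r by (auto simp: rho_trunc_def)
 have rae: "AE x\<in>W n in \<mu>. r x = \<rho> x" "AE x\<in>W m in \<mu>. r' x = \<rho> x" using r by (auto simp: rho_trunc_def)
 have sub: "x \<in> W n" if "x \<in> W m" for x using W_mono[OF m(2)] that by blast
 have "AE x\<in>W m in \<mu>. r x - r' x = 0"
  using rae by eventually_elim (use sub in auto)
 then have "AE x\<in>W m in \<mu>. N (\<lambda>x. r x - r' x) x = 0" by (rule N_const[OF bdd_diff[OF b] W_borel])
 moreover have "AE x in \<mu>. N (\<lambda>x. r x - r' x) x = N r x - N r' x" by (rule N_diff[OF b])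
 moreover have "AE x\<in>W n in \<mu>. N r x = N_rho N \<rho> n x" "AE x\<in>W m in \<mu>. N r' x = N_rho N \<rho> m x"
  using m by (auto intro!: N_rho_eq r)
 ultimately show ?thesis by eventually_elim (use sub in auto)
qed

lemma N_rho_meas: "1 \<le> n \<Longrightarrow> N_rho N \<rho> n \<in> borel_measurable \<mu>"
 unfolding N_rho_def by (rule N_meas[OF cut_rho_DN])

text \<open>\<open>weighted_flux\<close> for the cut-off at \<open>R\<close>: the constants
  \<open>a\<close>, \<open>b\<close> and \<nu> are the ingredients of the growth quantity. Any
  \<open>n \<ge> R\<close> is allowed, so the bound is uniform in the approximation.\<close>

lemma flux_instance:
 assumes R: "1 \<le> R" "R \<le> n" and K: "K \<subseteq> sublevel \<rho> (2 * real R)" and w: "weight \<Phi> \<psi>"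
  and low: "\<And>r. 2 * real R \<le> r \<Longrightarrow> r \<le> 4 * real R \<Longrightarrow> q \<le> \<Phi> r"
  and \<psi>: "\<And>r. \<exists>\<theta>. 0 \<le> \<theta> \<and> \<theta> \<le> 1 \<and> \<psi> r = \<theta> * \<phi>' r"
 shows "flux_bound n \<Phi> (cutoff (real R)) (1 / (real R * exp q) * growth_at R)" "0 \<le> growth_at R"
proof -
 let ?R = "real R" and ?An = "annulus \<rho> R" and ?C = "{x. 2 * real R \<le> \<rho> x \<and> \<rho> x \<le> 4 * real R}"
 have R0: "?R > 0" and n: "1 \<le> n" using R by auto
 have An: "?An \<in> sets \<mu>" unfolding annulus_def by (intro sets.Diff sublevel_sets)
 have AnW: "?An \<subseteq> W R" "?An \<subseteq> W n" "?An \<subseteq> ?C"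
  using R by (auto simp: annulus_def sublevel_def W_iff intro: less_le_trans)
 \<comment> \<open>The closed shell is compact and misses \<open>K0\<close>, so the local bounds on
   \<open>\<Gamma>(\<rho>, \<rho>)\<close> and \<open>N(\<rho>)\<close> hold on it, hence on the
   half-open annulus.\<close>
 have Cc: "compact ?C"
 proof -
  have cl: "closed ?C" using rho_continuous by (intro closed_Collect_conj closed_Collect_le continuous_on_const)
  have "?C \<subseteq> closure {x. \<rho> x < 4 * ?R + 1}" by (rule order_trans[OF _ closure_subset]) auto
  then have "closure {x. \<rho> x < 4 * ?R + 1} \<inter> ?C = ?C" by blast
  then show ?thesis using compact_Int_closed[OF sublevel_compact[of "4 * ?R + 1"] cl] by (simp only:)
 qed
 have disj: "?C \<inter> K0 = {}" using K K0_K by (force simp: sublevel_def)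
 have loc: "(\<exists>d. AE x\<in>?C in \<mu>. \<bar>\<Gamma>\<rho> x\<bar> \<le> d) \<and> (\<forall>n\<ge>1. \<exists>d. AE x\<in>?C \<inter> W n in \<mu>. \<bar>N_rho N \<rho> n x\<bar> \<le> d)"
  using H3 Cc disj unfolding cond_H3_def by blast
 obtain d1 where d1: "AE x\<in>?C in \<mu>. \<bar>\<Gamma>\<rho> x\<bar> \<le> d1" using loc by blast
 obtain d2 where d2: "AE x\<in>?C \<inter> W R in \<mu>. \<bar>N_rho N \<rho> R x\<bar> \<le> d2" using loc R(1) by blast
 obtain r' where r': "rho_trunc R r'" using rho_trunc_exists by blast
 have Gpos: "AE x\<in>W R in \<mu>. 0 \<le> \<Gamma>\<rho> x" by (rule Gam_rho_eq(2)[OF r'])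
 define a where "a = ess_sup_on \<mu> ?An \<Gamma>\<rho>"
 define b where "b = ess_sup_on \<mu> ?An (\<lambda>x. deriv \<phi> (\<rho> x) * \<Gamma>\<rho> x)"
 define \<nu> where "\<nu> = Lnorm 2 (restrict_space \<mu> ?An) (N_rho N \<rho> R)"
 have d\<phi>: "deriv \<phi> (\<rho> x) = \<phi>' (\<rho> x)" "0 \<le> \<phi>' (\<rho> x)" if "x \<in> ?C" for x
 proof -
  have "0 < \<rho> x" using that R0 by auto
  then show "deriv \<phi> (\<rho> x) = \<phi>' (\<rho> x)" "0 \<le> \<phi>' (\<rho> x)" using DERIV_imp_deriv[OF phi_deriv] phi'_nonneg by auto
 qed
 have a: "AE x\<in>?An in \<mu>. \<Gamma>\<rho> x \<le> a" "0 \<le> a"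
 proof -
  have "AE x\<in>?An in \<mu>. \<bar>\<Gamma>\<rho> x\<bar> \<le> d1" using d1 by eventually_elim (use AnW in blast)
  moreover have "AE x\<in>?An in \<mu>. 0 \<le> \<Gamma>\<rho> x" using Gpos by eventually_elim (use AnW in blast)
  ultimately show "AE x\<in>?An in \<mu>. \<Gamma>\<rho> x \<le> a" "0 \<le> a"
   using ess_sup_on_bounds[OF An measurable_restrict_space1[OF Gam_rho_meas]] unfolding a_def by blast+
 qed
 have b: "AE x\<in>?An in \<mu>. \<phi>' (\<rho> x) * \<Gamma>\<rho> x \<le> b" "0 \<le> b"
 proof -
  let ?g = "\<lambda>x. deriv \<phi> (\<rho> x) * \<Gamma>\<rho> x"
  have "compact (\<phi>' ` {2 * ?R..4 * ?R})"
   using R0 by (intro compact_continuous_image continuous_on_subset[OF phi'_cont]) auto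
  then obtain L where L: "\<forall>r\<in>{2 * ?R..4 * ?R}. \<bar>\<phi>' r\<bar> \<le> L"
   using compact_imp_bounded[of "\<phi>' ` {2 * ?R..4 * ?R}"] unfolding bounded_iff by auto
  have "AE x\<in>?An in \<mu>. \<bar>?g x\<bar> \<le> L * d1"
   using d1
  proof eventually_elim
   case (elim x)
   show ?case
   proof
    assume "x \<in> ?An"
    then have x: "x \<in> ?C" using AnW by blast
    then have "\<bar>\<phi>' (\<rho> x)\<bar> \<le> L" using L by auto
    then show "\<bar>?g x\<bar> \<le> L * d1" unfolding abs_mult d\<phi>(1)[OF x] using elim x by (intro mult_mono) auto
   qed
  qed
  moreover have "AE x\<in>?An in \<mu>. 0 \<le> ?g x"
   using Gpos
  proof eventually_elim
   case (elim x)
   show ?case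
   proof
    assume "x \<in> ?An"
    then have x: "x \<in> ?C" "x \<in> W R" using AnW by blast+
    then show "0 \<le> ?g x" using d\<phi>[OF x(1)] elim by simp
   qed
  qed
  moreover have "?g \<in> borel_measurable (restrict_space \<mu> ?An)"
  proof -
   \<comment> \<open>\<phi>' is continuous on the positive numbers only. Replacing \<rho> by
     \<open>max \<rho> (2 R)\<close> changes nothing on the annulus and gives a globally continuous
     function.\<close>
   have "continuous_on UNIV (\<lambda>r. \<phi>' (max r (2 * ?R)))"
    by (rule continuous_on_compose2[OF phi'_cont]) (use R0 in \<open>auto intro!: continuous_intros simp: less_max_iff_disj\<close>)
   then have "(\<lambda>x. \<phi>' (max (\<rho> x) (2 * ?R)) * \<Gamma>\<rho> x) \<in> borel_measurable \<mu>"
    by (intro borel_measurable_times Gam_rho_meas rho_compose_meas)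
   then have m: "(\<lambda>x. \<phi>' (max (\<rho> x) (2 * ?R)) * \<Gamma>\<rho> x) \<in> borel_measurable (restrict_space \<mu> ?An)" by (rule measurable_restrict_space1)
   have eq: "?g x = \<phi>' (max (\<rho> x) (2 * ?R)) * \<Gamma>\<rho> x" if "x \<in> space (restrict_space \<mu> ?An)" for x
   proof -
    have x: "x \<in> ?C" using that AnW by (auto simp: space_restrict_space)
    then have "max (\<rho> x) (2 * ?R) = \<rho> x" by simp
    then show ?thesis using d\<phi>(1)[OF x] by simp
   qed
   show ?thesis by (rule measurable_cong[THEN iffD2, OF eq m])
  qed
  ultimately have *: "AE x\<in>?An in \<mu>. ?g x \<le> b" "0 \<le> b"
   using ess_sup_on_bounds[OF An, of ?g] unfolding b_def by blast+
  show "0 \<le> b" by (rule *(2))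
  show "AE x\<in>?An in \<mu>. \<phi>' (\<rho> x) * \<Gamma>\<rho> x \<le> b"
   using *(1)
  proof eventually_elim
   case (elim x)
   show ?case
   proof
    assume A: "x \<in> ?An"
    then have "x \<in> ?C" using AnW by blast
    then show "\<phi>' (\<rho> x) * \<Gamma>\<rho> x \<le> b" using elim A d\<phi>(1)[of x] by simp
   qed
  qed
 qed
 have \<psi>b: "AE x\<in>?An in \<mu>. \<psi> (\<rho> x) * \<Gamma>\<rho> x \<le> b"
  using b(1) Gpos
 proof eventually_elim
  case (elim x)
  show ?case
  proof
   assume A: "x \<in> ?An"
   then have x: "x \<in> ?C" "x \<in> W R" using AnW by blast+
   obtain \<theta> where \<theta>: "0 \<le> \<theta>" "\<theta> \<le> 1" "\<psi> (\<rho> x) = \<theta> * \<phi>' (\<rho> x)" using \<psi> by blast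
   have "\<psi> (\<rho> x) * \<Gamma>\<rho> x = \<theta> * (\<phi>' (\<rho> x) * \<Gamma>\<rho> x)" unfolding \<theta>(3) by simp
   also have "\<dots> \<le> 1 * (\<phi>' (\<rho> x) * \<Gamma>\<rho> x)"
    using \<theta> d\<phi>(2)[OF x(1)] elim x by (intro mult_right_mono mult_nonneg_nonneg) auto
   also have "\<dots> \<le> b" using elim A by simp
   finally show "\<psi> (\<rho> x) * \<Gamma>\<rho> x \<le> b" .
  qed
 qed
 have NR: "AE x in \<mu>. indicator ?An x * N_rho N \<rho> n x = indicator ?An x * N_rho N \<rho> R x"
  using N_rho_consistent[OF R] by eventually_elim (use AnW in \<open>auto simp: indicator_def\<close>)
 have m: "(\<lambda>x. indicator ?An x * N_rho N \<rho> k x) \<in> borel_measurable \<mu>" if "1 \<le> k" for k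
  using An N_rho_meas[OF that] by simp
 have mAn: "emeasure \<mu> ?An < \<infinity>" using emeasure_mono[OF AnW(1) W_sets] W_finite[of R] by (rule order_le_less_trans)
 have iR: "integrable \<mu> (\<lambda>x. (indicator ?An x * N_rho N \<rho> R x)\<^sup>2)"
 proof (rule Bochner_Integration.integrable_bound[where f = "\<lambda>x. d2\<^sup>2 * indicator ?An x"])
  show "integrable \<mu> (\<lambda>x. d2\<^sup>2 * indicator ?An x :: real)" using An mAn by simp
  show "(\<lambda>x. (indicator ?An x * N_rho N \<rho> R x)\<^sup>2) \<in> borel_measurable \<mu>" using m[OF R(1)] by simp
  show "AE x in \<mu>. norm ((indicator ?An x * N_rho N \<rho> R x)\<^sup>2) \<le> norm (d2\<^sup>2 * indicator ?An x :: real)"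
   using d2
  proof eventually_elim
   case (elim x)
   show ?case
   proof (cases "x \<in> ?An")
    case True
    then have "\<bar>N_rho N \<rho> R x\<bar> \<le> d2" using elim AnW by blast
    then have "(N_rho N \<rho> R x)\<^sup>2 \<le> d2\<^sup>2" by (simp add: abs_le_square_iff[symmetric])
    then show ?thesis using True by simp
   qed simp
  qed
 qed
 have NL2: "(\<lambda>x. indicator ?An x * N_rho N \<rho> n x) \<in> Lspace 2 \<mu>"
  and eqN: "(LINT x|\<mu>. (indicator ?An x * N_rho N \<rho> n x)\<^sup>2) = (LINT x|\<mu>. (indicator ?An x * N_rho N \<rho> R x)\<^sup>2)"
 proof -
  have ae: "AE x in \<mu>. (indicator ?An x * N_rho N \<rho> R x)\<^sup>2 = (indicator ?An x * N_rho N \<rho> n x)\<^sup>2"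
   using NR by eventually_elim (simp only:)
  have mm: "(\<lambda>x. (indicator ?An x * N_rho N \<rho> n x)\<^sup>2) \<in> borel_measurable \<mu>" using m[OF n] by simp
  have "integrable \<mu> (\<lambda>x. (indicator ?An x * N_rho N \<rho> n x)\<^sup>2)"
   by (rule integrable_cong_AE[THEN iffD1, OF borel_measurable_integrable[OF iR] mm ae iR])
  then show "(\<lambda>x. indicator ?An x * N_rho N \<rho> n x) \<in> Lspace 2 \<mu>" unfolding Lspace2_iff using m[OF n] by blast
  show "(LINT x|\<mu>. (indicator ?An x * N_rho N \<rho> n x)\<^sup>2) = (LINT x|\<mu>. (indicator ?An x * N_rho N \<rho> R x)\<^sup>2)"
   by (rule integral_cong_AE[OF borel_measurable_integrable[OF iR] mm ae, symmetric])
 qed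
 have \<nu>eq: "sqrt (LINT x|\<mu>. (indicator ?An x * N_rho N \<rho> n x)\<^sup>2) = \<nu>"
 proof -
  have "(LINT x|restrict_space \<mu> ?An. (N_rho N \<rho> R x)\<^sup>2) = (LINT x|\<mu>. indicator ?An x *\<^sub>R (N_rho N \<rho> R x)\<^sup>2)"
   by (rule integral_restrict_space) (simp add: form.space_M An)
  moreover have "indicator ?An x *\<^sub>R (N_rho N \<rho> R x)\<^sup>2 = (indicator ?An x * N_rho N \<rho> R x)\<^sup>2" for x
   by (simp add: indicator_def)
  ultimately show ?thesis unfolding \<nu>_def Lnorm2_eq eqN by simp
 qed
 have \<nu>0: "0 \<le> \<nu>" unfolding \<nu>_def Lnorm2_eq by (intro real_sqrt_ge_zero integral_nonneg_AE AE_I2) simp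
 have gr: "growth_at R = (sqrt a + b) * sqrt (measure \<mu> ?An) + \<nu>"
  unfolding growth_def a_def b_def \<nu>_def by simp
 show g0: "0 \<le> growth_at R" unfolding gr using a b \<nu>0 by simp
 show "flux_bound n \<Phi> (cutoff ?R) (1 / (?R * exp q) * growth_at R)"
  unfolding flux_bound_def
 proof (intro conjI ballI allI impI)
  show "0 \<le> 1 / (?R * exp q) * growth_at R" using g0 R0 by simp
  fix v r assume v: "v \<in> dom_bdd n" and r: "rho_trunc n r"
  have c0: "cutoff ?R 0 = 0" using cutoff(3)[OF R0, of 0] R0 by simp
  have cb: "\<bar>cutoff ?R y\<bar> \<le> 1" for y using cutoff(5,6)[OF R0, of y] by simp
  have off: "cutoff_deriv ?R (\<rho> x) = 0" if "x \<in> W n" "x \<notin> ?An" for x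
   using that cutoff(8)[OF R0, of "\<rho> x"] by (auto simp: annulus_def sublevel_def)
  have Q: "exp q \<le> exp (\<Phi> (\<rho> x))" if "x \<in> ?An" for x
  proof -
   have "x \<in> ?C" using that AnW by blast
   then show ?thesis using low[of "\<rho> x"] by simp
  qed
  obtain f where "f \<in> DE" "AE x\<in>W n in \<mu>. f x = 1 - cutoff ?R (\<rho> x)"
   "\<bar>LINT x:W n|\<mu>. Gen n v x * f x\<bar> \<le> 1 / (?R * exp q) * ((sqrt a + b) * sqrt (measure \<mu> ?An) + \<nu>)
    * (sqrt (E0 (weighted n \<Phi> r v) (weighted n \<Phi> r v)) + sqrt (LINT x|\<mu>. (weighted n \<Phi> r v x)\<^sup>2))"
   by (rule weighted_flux[OF n v w r cutoff(1)[OF R0] cutoff(2)[OF R0] c0 cutoff(7)[OF R0] cb R0 exp_gt_zero An AnW(2) off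
      a(1) \<psi>b a(2) b(2) Q NL2 order_eq_refl[OF \<nu>eq]])
  then show "\<exists>f\<in>DE. (AE x\<in>W n in \<mu>. f x = 1 - cutoff ?R (\<rho> x)) \<and> \<bar>LINT x:W n|\<mu>. Gen n v x * f x\<bar>
    \<le> 1 / (?R * exp q) * growth_at R * (sqrt (E0 (weighted n \<Phi> r v) (weighted n \<Phi> r v)) + sqrt (LINT x|\<mu>. (weighted n \<Phi> r v x)\<^sup>2))"
   unfolding gr by (intro bexI[of _ f] conjI)
 qed
qed

text \<open>With \<open>\<psi> = \<theta> \<phi>'\<close> the quantity to be bounded is \<theta>
  times that of the criterion minus \<open>\<theta> (1 - \<theta>) \<phi>'\<^sup>2 \<Gamma>(\<rho>,
  \<rho>)\<close>, and \<Gamma> is nonnegative. Where \<theta> is not 0,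
  \<open>\<phi>(\<rho>) + 1 \<le> \<phi> (4 R) + 2\<close>, which is the origin of the 2.\<close>

lemma energy_instance:
 assumes R: "1 \<le> R" and n: "1 \<le> n" and k: "1 \<le> k" "K \<subseteq> sublevel \<rho> k" and w: "weight \<Phi> \<psi>"
  and \<psi>: "\<And>r. \<exists>\<theta>. 0 \<le> \<theta> \<and> \<theta> \<le> 1 \<and> \<psi> r = \<theta> * \<phi>' r \<and> (\<theta> \<noteq> 0 \<longrightarrow> k < r \<and> \<phi> r \<le> \<phi> (4 * real R) + 1)"
 shows "energy_bound n \<Phi> (c * (\<phi> (4 * real R) + 2))"
proof -
 let ?B = "c * (\<phi> (4 * real R) + 2)"
 have B0: "0 \<le> ?B" using c_pos phi_nonneg[of "4 * real R"] R by simp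
 obtain r' where r': "rho_trunc n r'" using rho_trunc_exists by blast
 have bd: "AE x\<in>W n in \<mu>. (\<psi> (\<rho> x))\<^sup>2 * \<Gamma>\<rho> x + \<psi> (\<rho> x) * N_rho N \<rho> n x \<le> ?B"
  using criterion[OF n] Gam_rho_eq(2)[OF r']
 proof eventually_elim
  case (elim x)
  show ?case
  proof
   assume x: "x \<in> W n"
   obtain \<theta> where \<theta>: "0 \<le> \<theta>" "\<theta> \<le> 1" "\<psi> (\<rho> x) = \<theta> * \<phi>' (\<rho> x)"
    "\<theta> \<noteq> 0 \<longrightarrow> k < \<rho> x \<and> \<phi> (\<rho> x) \<le> \<phi> (4 * real R) + 1" using \<psi> by blast
   show "(\<psi> (\<rho> x))\<^sup>2 * \<Gamma>\<rho> x + \<psi> (\<rho> x) * N_rho N \<rho> n x \<le> ?B"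
   proof (cases "\<theta> = 0")
    case True
    then show ?thesis using \<theta>(3) B0 by simp
   next
    case False
    then have r: "k < \<rho> x" "\<phi> (\<rho> x) \<le> \<phi> (4 * real R) + 1" using \<theta>(4) by auto
    then have "x \<notin> K" "1 \<le> \<rho> x" using k by (auto simp: sublevel_def)
    then have cr: "(\<phi>' (\<rho> x))\<^sup>2 * \<Gamma>\<rho> x + \<phi>' (\<rho> x) * N_rho N \<rho> n x \<le> c * (\<phi> (\<rho> x) + 1)" using elim(1) x by simp
    have "(\<psi> (\<rho> x))\<^sup>2 * \<Gamma>\<rho> x + \<psi> (\<rho> x) * N_rho N \<rho> n x
      = \<theta> * ((\<phi>' (\<rho> x))\<^sup>2 * \<Gamma>\<rho> x + \<phi>' (\<rho> x) * N_rho N \<rho> n x) - \<theta> * (1 - \<theta>) * ((\<phi>' (\<rho> x))\<^sup>2 * \<Gamma>\<rho> x)"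
     unfolding \<theta>(3) by (simp add: power2_eq_square algebra_simps)
    also have "\<dots> \<le> \<theta> * ((\<phi>' (\<rho> x))\<^sup>2 * \<Gamma>\<rho> x + \<phi>' (\<rho> x) * N_rho N \<rho> n x)"
     using \<theta> elim(2) x by simp
    also have "\<dots> \<le> \<theta> * (c * (\<phi> (\<rho> x) + 1))" by (rule mult_left_mono[OF cr \<theta>(1)])
    also have "\<dots> \<le> 1 * (c * (\<phi> (\<rho> x) + 1))"
     using \<theta> c_pos phi_nonneg[of "\<rho> x"] \<open>1 \<le> \<rho> x\<close> by (intro mult_right_mono) auto
    also have "\<dots> \<le> ?B" using r c_pos by simp
    finally show ?thesis .
   qed
  qed
 qed
 show ?thesis
  unfolding energy_bound_def using B0 weighted_energy[OF n _ w _ bd] by blast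
qed

text \<open>Chosen so that \<open>2 c s \<le> \<kappa>\<close> for every admissible
  \<open>s\<close>: the growth factor of the weighted square is then at most
  \<open>exp (\<kappa> (\<phi> (4 R) + 2))\<close>.\<close>

definition step_time :: real where
 "step_time = min 1 (\<kappa> / (2 * c))"

lemma step_time_pos: "0 < step_time"
 using kappa_pos c_pos by (simp add: step_time_def)

text \<open>Everything combines into \<open>exp (E R + \<kappa> \<phi> (4 R) - \<phi> (2 R))\<close>
  times a number that does not depend on \<open>R\<close>, \<open>n\<close>, \<open>g\<close> or
  \<open>s\<close>. On the support of \<open>g\<close> the weight is 1, so the initial weighted
  square is at most \<open>C\<^sup>2\<close> times the measure of the sublevel set of
  \<open>k\<close>, whatever \<open>R\<close> is.\<close>

lemma mass_loss_uniform:
 assumes k: "1 \<le> k" "K \<subseteq> sublevel \<rho> k" and C: "C > 0" and e: "e > 0"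
 shows "\<exists>R1. \<forall>R\<ge>R1. \<forall>n\<ge>R. \<forall>g s. g \<in> borel_measurable \<mu> \<longrightarrow> (AE x in \<mu>. \<bar>g x\<bar> \<le> C) \<longrightarrow> (\<forall>x. k \<le> \<rho> x \<longrightarrow> g x = 0) \<longrightarrow>
   0 \<le> s \<longrightarrow> s \<le> step_time \<longrightarrow>
   \<bar>(LINT x|Mn n. flow n s g x * (1 - cutoff (real R) (\<rho> x))) - (LINT x|Mn n. g x * (1 - cutoff (real R) (\<rho> x)))\<bar> \<le> e"
proof -
 define m where "m = measure \<mu> (sublevel \<rho> k)"
 \<comment> \<open>\<open>exp (\<phi> k + 1)\<close> repays the \<open>- \<phi> k - 1\<close> in the
   lower bound of the weight, the factors 2 come from \<open>s \<le> 1\<close>, and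
   \<open>exp (2 * \<kappa>)\<close> from the 2 in the energy bound.\<close>
 define A1 where "A1 = exp (\<phi> k + 1) * (2 + 2 * exp (2 * \<kappa>) * (C\<^sup>2 * m))"
 define G where "G R = exp (E R + \<kappa> * \<phi> (4 * real R) - \<phi> (2 * real R))" for R
 have "G \<longlonglongrightarrow> 0" unfolding G_def by (rule filterlim_compose[OF exp_at_bot growth_limit])
 then have "(\<lambda>R. G R * A1) \<longlonglongrightarrow> 0 * A1" by (intro tendsto_mult tendsto_const)
 then have "\<forall>\<^sub>F R in sequentially. G R * A1 < e" using e by (intro order_tendstoD) auto
 moreover have "\<forall>\<^sub>F R :: nat in sequentially. R \<ge> max 1 (nat \<lceil>k\<rceil>)" by (rule eventually_ge_at_top)
 ultimately have "\<forall>\<^sub>F R in sequentially. G R * A1 < e \<and> 1 \<le> R \<and> k \<le> real R \<and> growth_at R \<le> real R * exp (E R)"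
  using growth_bound
  by eventually_elim (auto simp: nat_ceiling_le_eq)
 then obtain R1 where R1: "\<And>R. R \<ge> R1 \<Longrightarrow> G R * A1 < e \<and> 1 \<le> R \<and> k \<le> real R \<and> growth_at R \<le> real R * exp (E R)"
  unfolding eventually_sequentially by blast
 show ?thesis
 proof (intro exI[of _ R1] allI impI)
  fix R n :: nat and g s
  assume "R1 \<le> R" and Rn: "R \<le> n" and g: "g \<in> borel_measurable \<mu>" "AE x in \<mu>. \<bar>g x\<bar> \<le> C" "\<forall>x. k \<le> \<rho> x \<longrightarrow> g x = 0"
   and s: "0 \<le> s" "s \<le> step_time"
  then have R: "G R * A1 < e" "1 \<le> R" "k \<le> real R" "growth_at R \<le> real R * exp (E R)" using R1 by auto
  have n: "1 \<le> n" using R Rn by simp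
  have R0: "real R > 0" using R by simp
  have k2: "k \<le> 2 * real R" using R by simp
  obtain \<Phi> \<psi> where w: "weight \<Phi> \<psi>" and \<Phi>0: "\<And>r. r \<le> k \<Longrightarrow> \<Phi> r = 0"
   and low: "\<And>r. 2 * real R \<le> r \<Longrightarrow> r \<le> 4 * real R \<Longrightarrow> \<phi> (2 * real R) - \<phi> k - 1 \<le> \<Phi> r"
   and \<psi>: "\<And>r. \<exists>\<theta>. 0 \<le> \<theta> \<and> \<theta> \<le> 1 \<and> \<psi> r = \<theta> * \<phi>' r \<and> (\<theta> \<noteq> 0 \<longrightarrow> k < r \<and> \<phi> r \<le> \<phi> (4 * real R) + 1)"
   by (rule weight_exists[OF k(1) k2]) blast
  let ?q = "\<phi> (2 * real R) - \<phi> k - 1" and ?B = "c * (\<phi> (4 * real R) + 2)"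
  have KR: "K \<subseteq> sublevel \<rho> (2 * real R)" using k(2) k2 by (force simp: sublevel_def)
  have \<psi>': "\<exists>\<theta>. 0 \<le> \<theta> \<and> \<theta> \<le> 1 \<and> \<psi> r = \<theta> * \<phi>' r" for r using \<psi>[of r] by blast
  note FB = flux_instance[OF R(2) Rn KR w low \<psi>']
  note EB = energy_instance[OF R(2) n k w \<psi>]
  have gM: "g \<in> borel_measurable (Mn n)" by (rule measurable_restrict_space1[OF g(1)])
  have gb: "AE x in Mn n. \<bar>g x\<bar> \<le> C" unfolding AE_Mn using g(2) by eventually_elim simp
  have cb: "\<bar>cutoff (real R) y\<bar> \<le> 1" for y using cutoff(5,6)[OF R0, of y] by simp
  let ?H = "LINT x|Mn n. (g x)\<^sup>2 * exp (2 * \<Phi> (\<rho> x))"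
  have H: "?H \<le> C\<^sup>2 * m" "0 \<le> ?H"
  proof -
   show "0 \<le> ?H" by (intro integral_nonneg_AE AE_I2) simp
   have "?H = (LINT x:W n|\<mu>. (g x)\<^sup>2 * exp (2 * \<Phi> (\<rho> x)))" by (rule integral_Mn[symmetric])
   also have "\<dots> \<le> (LINT x|\<mu>. C\<^sup>2 * indicator (sublevel \<rho> k) x)"
    unfolding set_lebesgue_integral_def
   proof (rule integral_mono_AE')
    show "integrable \<mu> (\<lambda>x. C\<^sup>2 * indicator (sublevel \<rho> k) x :: real)"
     using sublevel_sets sublevel_finite by simp
    show "AE x in \<mu>. indicator (W n) x *\<^sub>R ((g x)\<^sup>2 * exp (2 * \<Phi> (\<rho> x))) \<le> C\<^sup>2 * indicator (sublevel \<rho> k) x"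
     using g(2)
    proof eventually_elim
     case (elim x)
     show ?case
     proof (cases "\<rho> x < k")
      case True
      have "(g x)\<^sup>2 \<le> C\<^sup>2" using elim by (simp add: abs_le_square_iff[symmetric])
      then show ?thesis using True \<Phi>0[of "\<rho> x"] by (auto simp: indicator_def sublevel_def)
     next
      case False
      then show ?thesis using g(3) by (simp add: sublevel_def)
     qed
    qed
    show "AE x in \<mu>. 0 \<le> C\<^sup>2 * indicator (sublevel \<rho> k) x" by simp
   qed
   also have "\<dots> = C\<^sup>2 * m" using sublevel_sets sublevel_finite by (simp add: m_def)
   finally show "?H \<le> C\<^sup>2 * m" .
  qed
  have s1: "s \<le> 1" and s2: "2 * c * s \<le> \<kappa>" using s c_pos by (auto simp: step_time_def field_simps)
  have \<phi>4: "0 \<le> \<phi> (4 * real R)" using phi_nonneg R0 by simp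
  have ex: "exp (2 * ?B * s) \<le> exp (\<kappa> * \<phi> (4 * real R)) * exp (2 * \<kappa>)"
  proof -
   have "2 * ?B * s = (2 * c * s) * (\<phi> (4 * real R) + 2)" by (simp add: algebra_simps)
   also have "\<dots> \<le> \<kappa> * (\<phi> (4 * real R) + 2)" using s2 \<phi>4 by (intro mult_right_mono) auto
   finally show ?thesis by (simp add: algebra_simps flip: exp_add)
  qed
  have e1: "1 \<le> exp (\<kappa> * \<phi> (4 * real R))" using kappa_pos \<phi>4 by simp
  have est: "\<bar>(LINT x|Mn n. flow n s g x * (1 - cutoff (real R) (\<rho> x))) - (LINT x|Mn n. g x * (1 - cutoff (real R) (\<rho> x)))\<bar>
    \<le> 1 / (real R * exp ?q) * growth_at R * (2 * s + (s + 1) * exp (2 * ?B * s) * ?H)"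
   by (rule mass_loss[OF n w EB FB(1) cutoff_continuous[OF R0] cb gM gb C s(1)])
  have le: "1 / (real R * exp ?q) * growth_at R * (2 * s + (s + 1) * exp (2 * ?B * s) * ?H)
   \<le> 1 / (real R * exp ?q) * growth_at R * (exp (\<kappa> * \<phi> (4 * real R)) * (2 + 2 * exp (2 * \<kappa>) * (C\<^sup>2 * m)))"
  proof (rule mult_left_mono)
   have "2 * s \<le> exp (\<kappa> * \<phi> (4 * real R)) * 2" using s1 e1 by linarith
   moreover have "(s + 1) * exp (2 * ?B * s) * ?H \<le> 2 * (exp (\<kappa> * \<phi> (4 * real R)) * exp (2 * \<kappa>)) * (C\<^sup>2 * m)"
    using s s1 ex H by (intro mult_mono) auto
   ultimately show "2 * s + (s + 1) * exp (2 * ?B * s) * ?H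
     \<le> exp (\<kappa> * \<phi> (4 * real R)) * (2 + 2 * exp (2 * \<kappa>) * (C\<^sup>2 * m))" by (simp add: algebra_simps)
   show "0 \<le> 1 / (real R * exp ?q) * growth_at R" using FB(2) R0 by simp
  qed
  have le2: "1 / (real R * exp ?q) * growth_at R * (exp (\<kappa> * \<phi> (4 * real R)) * (2 + 2 * exp (2 * \<kappa>) * (C\<^sup>2 * m))) \<le> G R * A1"
  proof -
   let ?D = "2 + 2 * exp (2 * \<kappa>) * (C\<^sup>2 * m)" and ?Z = "exp (\<kappa> * \<phi> (4 * real R))"
   have D: "0 \<le> ?D" by (simp add: m_def)
   have 1: "exp ?q = exp (\<phi> (2 * real R)) / exp (\<phi> k + 1)" by (simp add: diff_diff_eq flip: exp_diff)
   have 2: "G R = exp (E R) * ?Z / exp (\<phi> (2 * real R))" unfolding G_def by (simp add: exp_diff exp_add)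
   have "1 / (y * (X / Y)) * (y * g) * (Z * D) = g * Z / X * (Y * D)" if "y > 0" "X > 0" "Y > 0" for y X Y g Z D :: real
    using that by simp
   then have eq: "1 / (real R * exp ?q) * (real R * exp (E R)) * (?Z * ?D) = G R * A1"
    unfolding 1 2 A1_def using R0 by (simp only: exp_gt_zero)
   have "1 / (real R * exp ?q) * growth_at R \<le> 1 / (real R * exp ?q) * (real R * exp (E R))"
    by (rule mult_left_mono[OF R(4)]) simp
   then have "1 / (real R * exp ?q) * growth_at R * (?Z * ?D) \<le> 1 / (real R * exp ?q) * (real R * exp (E R)) * (?Z * ?D)"
    by (rule mult_right_mono) (use D in simp)
   then show ?thesis unfolding eq .
  qed
  show "\<bar>(LINT x|Mn n. flow n s g x * (1 - cutoff (real R) (\<rho> x))) - (LINT x|Mn n. g x * (1 - cutoff (real R) (\<rho> x)))\<bar> \<le> e"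
   by (rule order_trans[OF est order_trans[OF le order_trans[OF le2 less_imp_le[OF R(1)]]]])
 qed
qed

section \<open>Iteration in time and passage to the adjoint semigroup\<close>

abbreviation "inner_cutoff R x \<equiv> 1 - cutoff (real R) (\<rho> x)"

lemma inner_cutoff:
 assumes "1 \<le> R"
 shows "0 \<le> inner_cutoff R x" "inner_cutoff R x \<le> 1" "\<rho> x \<le> 2 * real R \<Longrightarrow> inner_cutoff R x = 1" "x \<notin> W R \<Longrightarrow> inner_cutoff R x = 0"
proof -
 have R: "real R > 0" using assms by simp
 show "0 \<le> inner_cutoff R x" "inner_cutoff R x \<le> 1" using cutoff(5,6)[OF R, of "\<rho> x"] by simp_all
 show "\<rho> x \<le> 2 * real R \<Longrightarrow> inner_cutoff R x = 1" using cutoff(3)[OF R, of "\<rho> x"] by simp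
 show "x \<notin> W R \<Longrightarrow> inner_cutoff R x = 0" using cutoff(4)[OF R, of "\<rho> x"] by (simp add: W_iff)
qed

lemma inner_cutoff_meas: "1 \<le> R \<Longrightarrow> (\<lambda>x. inner_cutoff R x) \<in> borel_measurable \<mu>"
 by (rule rho_compose_meas) (intro continuous_intros cutoff_continuous, simp)

lemma K_bounded: "\<exists>k\<ge>1. K \<subseteq> sublevel \<rho> k"
proof -
 have "compact (\<rho> ` K)" by (intro compact_continuous_image continuous_on_subset[OF rho_continuous] K_compact) simp
 then obtain B where B: "\<forall>x\<in>K. \<bar>\<rho> x\<bar> \<le> B"
  using compact_imp_bounded[of "\<rho> ` K"] unfolding bounded_iff by auto
 have "K \<subseteq> sublevel \<rho> (max 1 (B + 1))" using B by (force simp: sublevel_def)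
 then show ?thesis by (intro exI[of _ "max 1 (B + 1)"]) simp
qed

text \<open>
 In every step the function is first cut off at a radius beyond which the previous steps put almost no mass,
 since the weight \<open>\<Phi>\<close> vanishes only on a bounded set.
\<close>

lemma mass_iterated:
 assumes \<tau>: "0 < \<tau>" "\<tau> \<le> step_time" and C: "C > 0" and e: "e > 0"
 shows "\<exists>R1. \<forall>R\<ge>R1. \<forall>n\<ge>R. \<forall>g. g \<in> borel_measurable \<mu> \<longrightarrow> (AE x in \<mu>. 0 \<le> g x \<and> g x \<le> C) \<longrightarrow> (\<forall>x. k \<le> \<rho> x \<longrightarrow> g x = 0) \<longrightarrow>
   (LINT x|Mn n. g x) - e \<le> (LINT x|Mn n. flow n (real j * \<tau>) g x * inner_cutoff R x)"
 using e
proof (induction j arbitrary: e)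
 case 0
 show ?case
 proof (intro exI[of _ "max 1 (nat \<lceil>k\<rceil>)"] allI impI)
  fix R n :: nat and g :: "'a \<Rightarrow> real" assume "max 1 (nat \<lceil>k\<rceil>) \<le> R" "R \<le> n" and g: "\<forall>x. k \<le> \<rho> x \<longrightarrow> g x = 0"
  then have R: "1 \<le> R" "k \<le> real R" "1 \<le> n" by (auto simp: nat_ceiling_le_eq)
  interpret sg: contraction_semigroup "Mn n" p "S n" by (rule semigroup[OF R(3)])
  have eq: "flow n (real 0 * \<tau>) g x * inner_cutoff R x = g x" for x
  proof (cases "k \<le> \<rho> x")
   case False
   then have "inner_cutoff R x = 1" using R by (intro inner_cutoff(3)) auto
   then show ?thesis by (simp add: sg.Sx_def)
  qed (simp add: g sg.Sx_def)
  show "(LINT x|Mn n. g x) - e \<le> (LINT x|Mn n. flow n (real 0 * \<tau>) g x * inner_cutoff R x)"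
   unfolding eq using 0 by simp
 qed
next
 case (Suc j)
 have e2: "0 < e / 2" using Suc.prems by simp
 obtain R0 where R0: "\<And>R n g. R0 \<le> R \<Longrightarrow> R \<le> n \<Longrightarrow> g \<in> borel_measurable \<mu> \<Longrightarrow> AE x in \<mu>. 0 \<le> g x \<and> g x \<le> C \<Longrightarrow>
   \<forall>x. k \<le> \<rho> x \<longrightarrow> g x = 0 \<Longrightarrow>
   (LINT x|Mn n. g x) - e / 2 \<le> (LINT x|Mn n. flow n (real j * \<tau>) g x * inner_cutoff R x)"
  using Suc.IH[OF e2] by blast
 \<comment> \<open>After \<open>j\<close> steps at most \<open>e / 2\<close> of the mass is missing
   inside \<open>W Q\<close>, for every \<open>n \<ge> Q\<close>. So the radius \<open>k'\<close>
   for the next step, and with it \<open>R1\<close>, does not depend on \<open>n\<close>.\<close>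
 define Q where "Q = max R0 1"
 obtain k1 where k1: "1 \<le> k1" "K \<subseteq> sublevel \<rho> k1" using K_bounded by blast
 define k' where "k' = max k1 (4 * real Q)"
 have k': "1 \<le> k'" "K \<subseteq> sublevel \<rho> k'" using k1 by (auto simp: k'_def sublevel_def max_def)
 obtain R1 where R1: "\<And>R n g s. R1 \<le> R \<Longrightarrow> R \<le> n \<Longrightarrow> g \<in> borel_measurable \<mu> \<Longrightarrow> AE x in \<mu>. \<bar>g x\<bar> \<le> C \<Longrightarrow> \<forall>x. k' \<le> \<rho> x \<longrightarrow> g x = 0 \<Longrightarrow>
   0 \<le> s \<Longrightarrow> s \<le> step_time \<Longrightarrow>
   \<bar>(LINT x|Mn n. flow n s g x * inner_cutoff R x) - (LINT x|Mn n. g x * inner_cutoff R x)\<bar> \<le> e / 2"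
  using mass_loss_uniform[OF k' C e2] by blast
 show ?case
 proof (intro exI[of _ "max R1 (2 * Q)"] allI impI)
  fix R n :: nat and g :: "'a \<Rightarrow> real" assume Rn0: "max R1 (2 * Q) \<le> R" "R \<le> n"
   and g: "g \<in> borel_measurable \<mu>" "AE x in \<mu>. 0 \<le> g x \<and> g x \<le> C" "\<forall>x. k \<le> \<rho> x \<longrightarrow> g x = 0"
  have Q: "1 \<le> Q" "R0 \<le> Q" by (auto simp: Q_def)
  have Rn: "R1 \<le> R" "2 * Q \<le> R" "1 \<le> R" "1 \<le> n" "Q \<le> n" using Rn0 Q by auto
  interpret sg: contraction_semigroup "Mn n" p "S n" by (rule semigroup[OF Rn(4)])
  have gM: "g \<in> borel_measurable (Mn n)" by (rule measurable_restrict_space1[OF g(1)])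
  have gb: "AE x in Mn n. 0 \<le> g x \<and> g x \<le> C" unfolding AE_Mn using g(2) by eventually_elim simp
  have gLp: "g \<in> sg.Lp" by (rule sg.Lp_bounded[OF gM, of C]) (use gb in \<open>eventually_elim, simp\<close>)
  have j0: "0 \<le> real j * \<tau>" using \<tau> by simp
  define v where "v = flow n (real j * \<tau>) g"
  have vLp: "v \<in> sg.Lp" unfolding v_def by (rule sg.Sx_Lp[OF j0 gLp])
  have vM: "v \<in> borel_measurable (Mn n)" by (rule sg.Lp_meas[OF vLp])
  have vb: "AE x in Mn n. 0 \<le> v x \<and> v x \<le> C" unfolding v_def by (rule sg.Sx_between[OF gLp gb C j0])
  have vcut: "(\<lambda>x. indicator (W n) x *\<^sub>R v x) \<in> borel_measurable \<mu>"
   using vM W_sets[of n] by (subst (asm) borel_measurable_restrict_space_iff) (auto simp: form.space_M)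
  \<comment> \<open>The factor for \<open>W n\<close> makes \<open>g'\<close> measurable on the
    whole space, \<open>v\<close> being controlled on \<open>W n\<close> only. Discarding
    \<open>v\<close> outside \<open>W Q\<close> can only lower the flow, by monotonicity, which is
    harmless for a lower bound.\<close>
  define g' where "g' = (\<lambda>x. indicator (W Q) x * (indicator (W n) x *\<^sub>R v x))"
  have g'm: "g' \<in> borel_measurable \<mu>" unfolding g'_def using vcut W_sets[of Q] by simp
  have g'b: "AE x in \<mu>. 0 \<le> g' x \<and> g' x \<le> C"
   using vb[unfolded AE_Mn] by eventually_elim (use C in \<open>auto simp: g'_def indicator_def\<close>)
  have g'0: "\<forall>x. k' \<le> \<rho> x \<longrightarrow> g' x = 0" by (auto simp: g'_def k'_def indicator_def W_iff)
  have g'v: "AE x in Mn n. g' x \<le> v x" "AE x in Mn n. v x * inner_cutoff Q x \<le> g' x * inner_cutoff R x"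
  proof -
   have inW: "AE x in Mn n. x \<in> W n" by (simp add: AE_Mn)
   show "AE x in Mn n. g' x \<le> v x"
    using vb inW by eventually_elim (auto simp: g'_def indicator_def)
   show "AE x in Mn n. v x * inner_cutoff Q x \<le> g' x * inner_cutoff R x"
    using vb inW
   proof eventually_elim
    case (elim x)
    show ?case
    proof (cases "x \<in> W Q")
     case True
     then have "\<rho> x \<le> 2 * real R" using Rn(2) by (simp add: W_iff)
     then have "inner_cutoff R x = 1" using Rn by (intro inner_cutoff(3))
     moreover have "v x * inner_cutoff Q x \<le> v x * 1" using inner_cutoff(2)[OF Q(1)] elim by (intro mult_left_mono) auto
     ultimately show ?thesis using True elim by (simp add: g'_def)
    next
     case False
     then have "inner_cutoff Q x = 0" by (rule inner_cutoff(4)[OF Q(1)])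
     moreover have "g' x = 0" using False by (simp add: g'_def)
     ultimately show ?thesis by simp
    qed
   qed
  qed
  have g'M: "g' \<in> borel_measurable (Mn n)" by (rule measurable_restrict_space1[OF g'm])
  have g'bM: "AE x in Mn n. \<bar>g' x\<bar> \<le> C" unfolding AE_Mn using g'b by eventually_elim simp
  have vbM: "AE x in Mn n. \<bar>v x\<bar> \<le> C" using vb by eventually_elim simp
  have cM: "(\<lambda>x. inner_cutoff q x) \<in> borel_measurable (Mn n)" "AE x in Mn n. \<bar>inner_cutoff q x\<bar> \<le> 1" if "1 \<le> q" for q
   by (rule measurable_restrict_space1[OF inner_cutoff_meas[OF that]]) (use inner_cutoff(1,2)[OF that] in \<open>intro AE_I2, simp\<close>)
  have int: "integrable (Mn n) (\<lambda>x. h x * inner_cutoff q x)" if "h \<in> sg.Lp" "1 \<le> q" for h q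
   by (rule sg.integral_mult_le(1)[OF sg.L1_le_nrm(1)[OF that(1)] cM[OF that(2)]])
  have g'Lp: "g' \<in> sg.Lp" by (rule sg.Lp_bounded[OF g'M g'bM])
  have \<tau>0: "0 \<le> \<tau>" using \<tau> by simp
  have 1: "(LINT x|Mn n. g x) - e / 2 \<le> (LINT x|Mn n. v x * inner_cutoff Q x)"
   unfolding v_def by (rule R0[OF Q(2) Rn(5) g])
  have 2: "(LINT x|Mn n. v x * inner_cutoff Q x) \<le> (LINT x|Mn n. g' x * inner_cutoff R x)"
   by (rule integral_mono_AE[OF int[OF vLp Q(1)] int[OF g'Lp Rn(3)] g'v(2)])
  have g'abs: "AE x in \<mu>. \<bar>g' x\<bar> \<le> C" using g'b by eventually_elim simp
  have 3: "\<bar>(LINT x|Mn n. flow n \<tau> g' x * inner_cutoff R x) - (LINT x|Mn n. g' x * inner_cutoff R x)\<bar> \<le> e / 2"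
   by (rule R1[OF Rn(1) Rn0(2) g'm g'abs g'0 \<tau>0 \<tau>(2)])
  have SucLp: "flow n (real (Suc j) * \<tau>) g \<in> sg.Lp" using \<tau>0 by (intro sg.Sx_Lp gLp) simp
  have 4: "(LINT x|Mn n. flow n \<tau> g' x * inner_cutoff R x) \<le> (LINT x|Mn n. flow n (real (Suc j) * \<tau>) g x * inner_cutoff R x)"
  proof (rule integral_mono_AE[OF int[OF sg.Sx_Lp[OF \<tau>0 g'Lp] Rn(3)] int[OF SucLp Rn(3)]])
   have eq: "real (Suc j) * \<tau> = \<tau> + real j * \<tau>" by (simp add: algebra_simps)
   show "AE x in Mn n. flow n \<tau> g' x * inner_cutoff R x \<le> flow n (real (Suc j) * \<tau>) g x * inner_cutoff R x"
    using sg.Sx_mono[OF g'M g'bM vM vbM g'v(1) C \<tau>0] sg.Sx_add[OF \<tau>0 j0 gLp]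
   proof eventually_elim
    case (elim x)
    show ?case unfolding eq elim(2) using elim(1) inner_cutoff(1)[OF Rn(3), of x]
     unfolding v_def by (rule mult_right_mono)
   qed
  qed
  show "(LINT x|Mn n. g x) - e \<le> (LINT x|Mn n. flow n (real (Suc j) * \<tau>) g x * inner_cutoff R x)"
   using 1 2 3 4 by linarith
 qed
qed

text \<open>Time \<open>t\<close> is divided into steps no longer than \<open>step_time\<close>. The
  approximating operators increase to \<open>T' t\<close>, so the lower mass bound for one of them,
  on \<open>Mn R\<close> with the cut-off at the same \<open>R\<close>, passes to the
  adjoint.\<close>

lemma adjoint_mass:
 assumes e: "e > 0"
 shows "\<exists>R\<ge>1. measure \<mu> (W m) - e \<le> (LINT x|\<mu>. T' t (indicator (W m)) x * inner_cutoff R x)"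
proof -
 obtain j :: nat where j: "t / step_time < real j" using reals_Archimedean2 by blast
 have jpos: "0 < real j" using j t_pos step_time_pos by (meson divide_pos_pos order.strict_trans)
 define \<tau> where "\<tau> = t / real j"
 have \<tau>: "0 < \<tau>" "\<tau> \<le> step_time" "real j * \<tau> = t"
  using j jpos t_pos step_time_pos by (auto simp: \<tau>_def field_simps)
 let ?g = "indicator (W m) :: 'a \<Rightarrow> real"
 obtain R1 where R1: "\<forall>R\<ge>R1. \<forall>n\<ge>R. \<forall>g. g \<in> borel_measurable \<mu> \<longrightarrow> (AE x in \<mu>. 0 \<le> g x \<and> g x \<le> 1) \<longrightarrow> (\<forall>x. 4 * real m \<le> \<rho> x \<longrightarrow> g x = 0) \<longrightarrow>
   (LINT x|Mn n. g x) - e \<le> (LINT x|Mn n. flow n (real j * \<tau>) g x * inner_cutoff R x)"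
  using mass_iterated[OF \<tau>(1,2) zero_less_one e] by blast
 define R where "R = max R1 (max m 1)"
 have R: "R1 \<le> R" "m \<le> R" "1 \<le> R" by (auto simp: R_def)
 have gm: "?g \<in> borel_measurable \<mu>" using W_sets[of m] by simp
 have gb: "AE x in \<mu>. 0 \<le> ?g x \<and> ?g x \<le> 1" by (intro AE_I2) (simp add: indicator_def)
 have g0: "\<forall>x. 4 * real m \<le> \<rho> x \<longrightarrow> ?g x = 0" by (simp add: indicator_def W_iff)
 have main: "(LINT x|Mn R. ?g x) - e \<le> (LINT x|Mn R. flow R t ?g x * inner_cutoff R x)"
  using R1[rule_format, OF R(1) order_refl gm gb] g0 unfolding \<tau>(3) by blast
 interpret sg: contraction_semigroup "Mn R" p "S R" by (rule semigroup[OF R(3)])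
 have Wm: "W m \<subseteq> W R" by (rule W_mono[OF R(2)])
 have "(LINT x|Mn R. ?g x) = (LINT x|\<mu>. indicator (W R) x *\<^sub>R ?g x)"
  unfolding integral_Mn[symmetric] set_lebesgue_integral_def ..
 also have "\<dots> = (LINT x|\<mu>. ?g x)"
  by (rule Bochner_Integration.integral_cong) (use Wm in \<open>auto simp: indicator_def\<close>)
 finally have i1: "(LINT x|Mn R. ?g x) = measure \<mu> (W m)" using W_sets[of m] by (simp add: form.space_M)
 have cut: "cut (W R) ?g = ?g" using Wm by (auto simp: cut_def indicator_def fun_eq_iff)
 have t0: "t \<noteq> 0" using t_pos by simp
 have ap: "approx_op W S R t ?g x = indicator (W R) x * flow R t ?g x" for x
  unfolding approx_op_def cut if_not_P[OF t0] sg.Sx_def by (simp add: cut_def)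
 have gL: "?g \<in> Lspace 2 \<mu>" "?g \<in> Lspace 1 \<mu>" "?g \<in> Linf \<mu>"
 proof -
  have sq: "(\<lambda>x. (?g x)\<^sup>2) = ?g" by (auto simp: indicator_def fun_eq_iff)
  show "?g \<in> Lspace 2 \<mu>" "?g \<in> Lspace 1 \<mu>"
   unfolding Lspace2_iff Lspace1_iff sq using W_sets[of m] W_finite[of m] by simp_all
  show "?g \<in> Linf \<mu>" unfolding Linf_def ae_bounded_def using gm gb by (intro CollectI conjI exI[of _ 1]) auto
 qed
 have "AE x in \<mu>. 0 \<le> ?g x" by (intro AE_I2) simp
 then have up: "AE x in \<mu>. (\<forall>n\<ge>1. approx_op W S n t ?g x \<le> approx_op W S (Suc n) t ?g x)
       \<and> (\<lambda>n. approx_op W S n t ?g x) \<longlonglongrightarrow> T' t ?g x"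
  using H1 gL unfolding cond_H1_def by blast
 have le: "AE x in \<mu>. approx_op W S R t ?g x \<le> T' t ?g x"
  using up
 proof eventually_elim
  case (elim x)
  have inc: "incseq (\<lambda>n. approx_op W S (n + R) t ?g x)"
   by (rule incseq_SucI) (use elim R(3) in simp)
  have "(\<lambda>n. approx_op W S (n + R) t ?g x) \<longlonglongrightarrow> T' t ?g x" using elim LIMSEQ_ignore_initial_segment by blast
  from incseq_le[OF inc this, of 0] show ?case by simp
 qed
 have C0T': "C0_contraction_semigroup 2 \<mu> T'" "sub_Markovian 2 \<mu> T'" using setting unfolding gen_Dirichlet_setting_def by blast+
 have T'L: "T' t ?g \<in> Lspace 2 \<mu>" using C0T'(1) t_pos gL(1) unfolding C0_contraction_semigroup_def by blast
 have T'pos: "AE x in \<mu>. 0 \<le> T' t ?g x \<and> T' t ?g x \<le> 1" using C0T'(2) t_pos gL(1) gb unfolding sub_Markovian_def by blast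
 have wL: "(\<lambda>x. inner_cutoff R x) \<in> Lspace 2 \<mu>"
  unfolding Lspace2_iff
 proof
  show "integrable \<mu> (\<lambda>x. (inner_cutoff R x)\<^sup>2)"
  proof (rule Bochner_Integration.integrable_bound[where f = "indicator (W R) :: 'a \<Rightarrow> real"])
   show "integrable \<mu> (indicator (W R) :: 'a \<Rightarrow> real)" using W_sets[of R] W_finite[of R] by simp
   show "(\<lambda>x. (inner_cutoff R x)\<^sup>2) \<in> borel_measurable \<mu>" using inner_cutoff_meas[OF R(3)] by simp
   show "AE x in \<mu>. norm ((inner_cutoff R x)\<^sup>2) \<le> norm (indicator (W R) x :: real)"
   proof (rule AE_I2)
    fix x
    have "(inner_cutoff R x)\<^sup>2 \<le> 1" using inner_cutoff(1,2)[OF R(3), of x] by (simp add: power_le_one)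
    then show "norm ((inner_cutoff R x)\<^sup>2) \<le> norm (indicator (W R) x :: real)"
     using inner_cutoff(4)[OF R(3), of x] by (cases "x \<in> W R") auto
   qed
  qed
 qed (rule inner_cutoff_meas[OF R(3)])
 have "(LINT x|Mn R. flow R t ?g x * inner_cutoff R x) = (LINT x|\<mu>. indicator (W R) x *\<^sub>R (flow R t ?g x * inner_cutoff R x))"
  unfolding integral_Mn[symmetric] set_lebesgue_integral_def ..
 also have "\<dots> \<le> (LINT x|\<mu>. T' t ?g x * inner_cutoff R x)"
 proof (rule integral_mono_AE'[OF Lspace2_mult_integrable[OF T'L wL]])
  show "AE x in \<mu>. indicator (W R) x *\<^sub>R (flow R t ?g x * inner_cutoff R x) \<le> T' t ?g x * inner_cutoff R x"
   using le
  proof eventually_elim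
   case (elim x)
   have "(indicator (W R) x * flow R t ?g x) * inner_cutoff R x \<le> T' t ?g x * inner_cutoff R x"
    using elim unfolding ap by (rule mult_right_mono[OF _ inner_cutoff(1)[OF R(3)]])
   then show ?case by (simp add: mult.assoc)
  qed
  show "AE x in \<mu>. 0 \<le> T' t ?g x * inner_cutoff R x"
   using T'pos by eventually_elim (use inner_cutoff(1)[OF R(3)] in simp)
 qed
 finally show ?thesis using main i1 R(3) by (intro exI[of _ R] conjI) linarith+
qed

end

section \<open>Conservativeness\<close>

context growth_criterion
begin

lemma T_C0: "C0_contraction_semigroup 2 \<mu> T" and T_markov: "sub_Markovian 2 \<mu> T"
 and T_adjoint: "s > 0 \<Longrightarrow> f \<in> Lspace 2 \<mu> \<Longrightarrow> g \<in> Lspace 2 \<mu> \<Longrightarrow> inner2 \<mu> (T s f) g = inner2 \<mu> f (T' s g)"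
 and T'_C0: "C0_contraction_semigroup 2 \<mu> T'" and T'_markov: "sub_Markovian 2 \<mu> T'"
 using setting unfolding gen_Dirichlet_setting_def by blast+

lemma T_L2: "s > 0 \<Longrightarrow> f \<in> Lspace 2 \<mu> \<Longrightarrow> T s f \<in> Lspace 2 \<mu>"
 and T_contraction: "s > 0 \<Longrightarrow> f \<in> Lspace 2 \<mu> \<Longrightarrow> Lnorm 2 \<mu> (T s f) \<le> Lnorm 2 \<mu> f"
 and T_linear: "s > 0 \<Longrightarrow> ae_linear_on \<mu> (Lspace 2 \<mu>) (T s)"
 and T_semigroup: "r > 0 \<Longrightarrow> s > 0 \<Longrightarrow> f \<in> Lspace 2 \<mu> \<Longrightarrow> AE x in \<mu>. T (r + s) f x = T r (T s f) x"
 using T_C0 unfolding C0_contraction_semigroup_def by blast+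

lemma T_between: "s > 0 \<Longrightarrow> f \<in> Lspace 2 \<mu> \<Longrightarrow> AE x in \<mu>. 0 \<le> f x \<and> f x \<le> 1 \<Longrightarrow> AE x in \<mu>. 0 \<le> T s f x \<and> T s f x \<le> 1"
 using T_markov unfolding sub_Markovian_def by blast

lemma T_diff:
 assumes "s > 0" "f \<in> Lspace 2 \<mu>" "g \<in> Lspace 2 \<mu>"
 shows "AE x in \<mu>. T s (\<lambda>y. f y - g y) x = T s f x - T s g x"
proof -
 have "AE x in \<mu>. T s (\<lambda>y. 1 * f y + (-1) * g y) x = 1 * T s f x + (-1) * T s g x"
  using T_linear[OF assms(1)] assms(2,3) unfolding ae_linear_on_def by blast
 then show ?thesis by simp
qed

lemma T_mono:
 assumes "s > 0" "f \<in> Lspace 2 \<mu>" "g \<in> Lspace 2 \<mu>" "AE x in \<mu>. 0 \<le> f x \<and> f x \<le> g x \<and> g x \<le> 1"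
 shows "AE x in \<mu>. T s f x \<le> T s g x"
proof -
 have "AE x in \<mu>. 0 \<le> g x - f x \<and> g x - f x \<le> 1" using assms(4) by eventually_elim auto
 from T_between[OF assms(1) Lspace2_diff[OF assms(3,2)] this] T_diff[OF assms(1,3,2)] show ?thesis
  by eventually_elim simp
qed

definition approximates_one :: "(nat \<Rightarrow> 'a \<Rightarrow> real) \<Rightarrow> bool" where
 "approximates_one g \<longleftrightarrow> (\<forall>k. g k \<in> Lspace 2 \<mu> \<inter> Linf \<mu>)
   \<and> (AE x in \<mu>. (\<forall>k. 0 \<le> g k x) \<and> incseq (\<lambda>k. g k x) \<and> (\<lambda>k. g k x) \<longlonglongrightarrow> 1)"

text \<open>The extension to bounded functions is a choice made through all monotone approximations,
  so \<open>T\<^sub>s 1 = 1\<close> is expressed by every sequence increasing to 1.\<close>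

definition preserves_one :: "real \<Rightarrow> bool" where
 "preserves_one s \<longleftrightarrow> s > 0 \<and> (\<forall>g. approximates_one g \<longrightarrow> (AE x in \<mu>. (\<lambda>k. T s (g k) x) \<longlonglongrightarrow> 1))"

lemma approximates_oneD:
 assumes "approximates_one g"
 shows "g k \<in> Lspace 2 \<mu>" "AE x in \<mu>. (\<forall>k. 0 \<le> g k x \<and> g k x \<le> 1) \<and> incseq (\<lambda>k. g k x) \<and> (\<lambda>k. g k x) \<longlonglongrightarrow> 1"
proof -
 show "g k \<in> Lspace 2 \<mu>" using assms unfolding approximates_one_def by blast
 have "AE x in \<mu>. (\<forall>k. 0 \<le> g k x) \<and> incseq (\<lambda>k. g k x) \<and> (\<lambda>k. g k x) \<longlonglongrightarrow> 1"
  using assms unfolding approximates_one_def by blast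
 then show "AE x in \<mu>. (\<forall>k. 0 \<le> g k x \<and> g k x \<le> 1) \<and> incseq (\<lambda>k. g k x) \<and> (\<lambda>k. g k x) \<longlonglongrightarrow> 1"
  by eventually_elim (auto intro: incseq_le)
qed

lemma T_sequence:
 assumes g: "approximates_one g" and s: "s > 0"
 shows "AE x in \<mu>. (\<forall>k. 0 \<le> T s (g k) x \<and> T s (g k) x \<le> 1) \<and> incseq (\<lambda>k. T s (g k) x)"
proof -
 note G = approximates_oneD[OF g]
 have b: "AE x in \<mu>. \<forall>k. 0 \<le> T s (g k) x \<and> T s (g k) x \<le> 1"
  unfolding AE_all_countable
 proof
  fix k
  have "AE x in \<mu>. 0 \<le> g k x \<and> g k x \<le> 1" using G(2) by eventually_elim simp
  then show "AE x in \<mu>. 0 \<le> T s (g k) x \<and> T s (g k) x \<le> 1" by (rule T_between[OF s G(1)])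
 qed
 have "AE x in \<mu>. \<forall>k. T s (g k) x \<le> T s (g (Suc k)) x"
  unfolding AE_all_countable
 proof
  fix k
  have "AE x in \<mu>. 0 \<le> g k x \<and> g k x \<le> g (Suc k) x \<and> g (Suc k) x \<le> 1"
   using G(2) by eventually_elim (simp add: incseq_def)
  then show "AE x in \<mu>. T s (g k) x \<le> T s (g (Suc k)) x" by (rule T_mono[OF s G(1) G(1)])
 qed
 with b show ?thesis by eventually_elim (simp add: incseq_SucI)
qed

lemma indicator_W_L2: "(indicator (W m) :: 'a \<Rightarrow> real) \<in> Lspace 2 \<mu>"
proof -
 have "(\<lambda>x. (indicator (W m) x :: real)\<^sup>2) = indicator (W m)" by (auto simp: indicator_def fun_eq_iff)
 then show ?thesis unfolding Lspace2_iff using W_sets[of m] W_finite[of m] by simp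
qed

lemma W_exhaust: "\<exists>m. x \<in> W m"
proof -
 obtain m :: nat where "\<rho> x < real m" using reals_Archimedean2 by blast
 then have "x \<in> W m" by (simp add: W_iff)
 then show ?thesis ..
qed

lemma approximates_one_exists: "approximates_one (\<lambda>k. indicator (W k))"
 unfolding approximates_one_def
proof (intro conjI allI AE_I2)
 fix k :: nat and x :: 'a
 have "(indicator (W k) :: 'a \<Rightarrow> real) \<in> Linf \<mu>"
  unfolding Linf_def ae_bounded_def using W_sets[of k] by (intro CollectI conjI exI[of _ 1] AE_I2) (auto simp: indicator_def)
 then show "indicator (W k) \<in> Lspace 2 \<mu> \<inter> Linf \<mu>" using indicator_W_L2 by blast
 show "0 \<le> (indicator (W k) x :: real)" by simp
 show "incseq (\<lambda>k. indicator (W k) x :: real)" using W_mono by (auto simp: incseq_def indicator_def)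
 obtain m where m: "x \<in> W m" using W_exhaust by blast
 show "(\<lambda>k. indicator (W k) x :: real) \<longlonglongrightarrow> 1"
  by (rule tendsto_eventually[OF eventually_mono[OF eventually_ge_at_top[of m]]]) (use W_mono m in \<open>auto simp: indicator_def\<close>)
qed

text \<open>By duality the integral of \<open>1 - T t (g k)\<close> over \<open>W m\<close> is the
  measure of \<open>W m\<close> minus the pairing of \<open>g k\<close> with \<open>T' t\<close> of
  its indicator. An inner cut-off in the pairing permits dominated convergence, and by
  \<open>adjoint_mass\<close> the limit of the pairing falls short of the measure by at most
  \<open>e\<close>. So \<open>h\<close>, which is at most 1, equals 1 on every
  \<open>W m\<close>.\<close>

lemma preserves_one_t: "preserves_one t"
 unfolding preserves_one_def
proof (intro conjI allI impI t_pos)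
 fix g assume g: "approximates_one g"
 note G = approximates_oneD[OF g]
 note TG = T_sequence[OF g t_pos]
 define h where "h x = lim (\<lambda>k. T t (g k) x)" for x
 have TL: "T t (g k) \<in> Lspace 2 \<mu>" for k by (rule T_L2[OF t_pos G(1)])
 have hm: "h \<in> borel_measurable \<mu>" unfolding h_def
  using TL by (intro borel_measurable_lim_metric) (auto simp: Lspace2_iff)
 have conv: "AE x in \<mu>. (\<lambda>k. T t (g k) x) \<longlonglongrightarrow> h x \<and> (\<forall>k. T t (g k) x \<le> h x) \<and> h x \<le> 1"
  using TG
 proof eventually_elim
  case (elim x)
  then obtain l where l: "(\<lambda>k. T t (g k) x) \<longlonglongrightarrow> l" "\<forall>k. T t (g k) x \<le> l" using incseq_convergent[of "\<lambda>k. T t (g k) x" 1] by blast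
  have "h x = l" unfolding h_def using l(1) by (rule limI)
  then show ?case using l elim LIMSEQ_le_const2[OF l(1), of 1] by auto
 qed
 have one: "AE x in \<mu>. x \<in> W m \<longrightarrow> h x = 1" for m
 proof -
  let ?f = "indicator (W m) :: 'a \<Rightarrow> real"
  let ?L = "\<lambda>x. ?f x * (1 - h x)"
  have fi: "integrable \<mu> ?f" using W_sets[of m] W_finite[of m] by simp
  have f01: "AE x in \<mu>. 0 \<le> ?f x \<and> ?f x \<le> 1" by (intro AE_I2) (simp add: indicator_def)
  have T'L: "T' t ?f \<in> Lspace 2 \<mu>" using T'_C0 t_pos indicator_W_L2 unfolding C0_contraction_semigroup_def by blast
  have T'pos: "AE x in \<mu>. 0 \<le> T' t ?f x \<and> T' t ?f x \<le> 1" using T'_markov t_pos indicator_W_L2 f01 unfolding sub_Markovian_def by blast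
  have T'm: "T' t ?f \<in> borel_measurable \<mu>" using T'L by (simp add: Lspace2_iff)
  have Lpos: "AE x in \<mu>. 0 \<le> ?L x" using conv by eventually_elim simp
  have Lb: "AE x in \<mu>. ?L x \<le> ?f x * (1 - T t (g k) x) \<and> ?L x \<le> ?f x" for k
   using conv TG
  proof eventually_elim
   case (elim x)
   then have "1 - h x \<le> 1 - T t (g k) x" "0 \<le> T t (g k) x" by auto
   then have "1 - h x \<le> 1" by linarith
   then show ?case using \<open>1 - h x \<le> 1 - T t (g k) x\<close> by (auto simp: indicator_def)
  qed
  have Li: "integrable \<mu> ?L"
  proof (rule Bochner_Integration.integrable_bound[OF fi])
   show "?L \<in> borel_measurable \<mu>" using hm W_sets[of m] by simp
   show "AE x in \<mu>. norm (?L x) \<le> norm (?f x)" using Lpos Lb[of 0] by eventually_elim simp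
  qed
  have le_e: "(LINT x|\<mu>. ?L x) \<le> e" if e: "e > 0" for e
  proof -
   obtain R where R: "1 \<le> R" "measure \<mu> (W m) - e \<le> (LINT x|\<mu>. T' t ?f x * inner_cutoff R x)"
    using adjoint_mass[OF e, of m] by blast
   have wm: "(\<lambda>x. inner_cutoff R x) \<in> borel_measurable \<mu>" by (rule inner_cutoff_meas[OF R(1)])
   have gm: "g k \<in> borel_measurable \<mu>" for k using G(1)[of k] by (simp add: Lspace2_iff)
   have Wi: "integrable \<mu> (indicator (W R) :: 'a \<Rightarrow> real)" using W_sets[of R] W_finite[of R] by simp
   have lim: "(\<lambda>k. LINT x|\<mu>. g k x * (T' t ?f x * inner_cutoff R x)) \<longlonglongrightarrow> (LINT x|\<mu>. T' t ?f x * inner_cutoff R x)"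
   proof (rule integral_dominated_convergence[where w = "indicator (W R)"])
    show "(\<lambda>x. T' t ?f x * inner_cutoff R x) \<in> borel_measurable \<mu>" by (rule borel_measurable_times[OF T'm wm])
    show "(\<lambda>x. g k x * (T' t ?f x * inner_cutoff R x)) \<in> borel_measurable \<mu>" for k
     by (intro borel_measurable_times gm T'm wm)
    show "integrable \<mu> (indicator (W R) :: 'a \<Rightarrow> real)" by (rule Wi)
    show "AE x in \<mu>. (\<lambda>k. g k x * (T' t ?f x * inner_cutoff R x)) \<longlonglongrightarrow> T' t ?f x * inner_cutoff R x"
     using G(2)
    proof eventually_elim
     case (elim x)
     then have "(\<lambda>k. g k x * (T' t ?f x * inner_cutoff R x)) \<longlonglongrightarrow> 1 * (T' t ?f x * inner_cutoff R x)"
      by (intro tendsto_mult tendsto_const) blast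
     then show ?case by (simp only: mult_1)
    qed
    show "AE x in \<mu>. norm (g k x * (T' t ?f x * inner_cutoff R x)) \<le> indicator (W R) x" for k
     using G(2) T'pos
    proof eventually_elim
     case (elim x)
     show ?case
     proof (cases "x \<in> W R")
      case True
      have "\<bar>g k x\<bar> * (\<bar>T' t ?f x\<bar> * \<bar>inner_cutoff R x\<bar>) \<le> 1 * (1 * 1)"
       using elim inner_cutoff(1,2)[OF R(1), of x] by (intro mult_mono) auto
      then show ?thesis using True by (simp add: abs_mult)
     next
      case False
      then show ?thesis using inner_cutoff(4)[OF R(1) False] by simp
     qed
    qed
   qed
   have step: "(LINT x|\<mu>. ?L x) \<le> measure \<mu> (W m) - (LINT x|\<mu>. g k x * (T' t ?f x * inner_cutoff R x))" for k
   proof -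
    have i1: "integrable \<mu> (\<lambda>x. T t (g k) x * ?f x)" by (rule Lspace2_mult_integrable[OF TL indicator_W_L2])
    have i2: "integrable \<mu> (\<lambda>x. g k x * T' t ?f x)" by (rule Lspace2_mult_integrable[OF G(1) T'L])
    have eq: "?f x * (1 - T t (g k) x) = ?f x - T t (g k) x * ?f x" for x by (simp add: algebra_simps)
    have "(LINT x|\<mu>. ?L x) \<le> (LINT x|\<mu>. ?f x - T t (g k) x * ?f x)"
    proof (rule integral_mono_AE[OF Li Bochner_Integration.integrable_diff[OF fi i1]])
     show "AE x in \<mu>. ?L x \<le> ?f x - T t (g k) x * ?f x" using Lb[of k] unfolding eq by eventually_elim (rule conjunct1)
    qed
    also have "\<dots> = measure \<mu> (W m) - inner2 \<mu> (T t (g k)) ?f"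
     using Bochner_Integration.integral_diff[OF fi i1] W_sets[of m] by (simp add: inner2_def form.space_M)
    also have "inner2 \<mu> (T t (g k)) ?f = (LINT x|\<mu>. g k x * T' t ?f x)"
     using T_adjoint[OF t_pos G(1) indicator_W_L2] by (simp add: inner2_def)
    also have "measure \<mu> (W m) - (LINT x|\<mu>. g k x * T' t ?f x) \<le> measure \<mu> (W m) - (LINT x|\<mu>. g k x * (T' t ?f x * inner_cutoff R x))"
    proof (rule diff_left_mono, rule integral_mono_AE'[OF i2])
     show "AE x in \<mu>. g k x * (T' t ?f x * inner_cutoff R x) \<le> g k x * T' t ?f x"
      using G(2) T'pos
     proof eventually_elim
      case (elim x)
      have "T' t ?f x * inner_cutoff R x \<le> T' t ?f x * 1" using elim inner_cutoff(2)[OF R(1), of x] by (intro mult_left_mono) auto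
      then show ?case using elim by (intro mult_left_mono) auto
     qed
     show "AE x in \<mu>. 0 \<le> g k x * T' t ?f x" using G(2) T'pos by eventually_elim simp
    qed
    finally show ?thesis .
   qed
   have "(LINT x|\<mu>. ?L x) \<le> measure \<mu> (W m) - (LINT x|\<mu>. T' t ?f x * inner_cutoff R x)"
    by (rule LIMSEQ_le_const[OF tendsto_diff[OF tendsto_const lim]]) (use step in blast)
   then show ?thesis using R(2) by linarith
  qed
  have "(LINT x|\<mu>. ?L x) = 0"
   using field_le_epsilon[of "LINT x|\<mu>. ?L x" 0] le_e integral_nonneg_AE[OF Lpos] by auto
  then have "AE x in \<mu>. ?L x = 0" using integral_nonneg_eq_0_iff_AE[OF Li Lpos] by blast
  then show ?thesis by eventually_elim (auto simp: indicator_def)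
 qed
 have "AE x in \<mu>. \<forall>m. x \<in> W m \<longrightarrow> h x = 1" unfolding AE_all_countable using one by blast
 then show "AE x in \<mu>. (\<lambda>k. T t (g k) x) \<longlonglongrightarrow> 1"
  using conv
 proof eventually_elim
  case (elim x)
  obtain m where "x \<in> W m" using W_exhaust by blast
  then have "h x = 1" using elim(1) by blast
  then show ?case using elim(2) by simp
 qed
qed

lemma T_approximates_one:
 assumes "preserves_one s" "approximates_one g"
 shows "approximates_one (\<lambda>k. T s (g k))"
proof -
 have s: "s > 0" using assms(1) by (simp add: preserves_one_def)
 have 1: "AE x in \<mu>. (\<lambda>k. T s (g k) x) \<longlonglongrightarrow> 1" using assms unfolding preserves_one_def by blast
 note TG = T_sequence[OF assms(2) s]
 have "AE x in \<mu>. \<bar>T s (g k) x\<bar> \<le> 1" for k using TG by eventually_elim simp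
 then have "T s (g k) \<in> Lspace 2 \<mu> \<inter> Linf \<mu>" for k
  using T_L2[OF s approximates_oneD(1)[OF assms(2)], of k] unfolding Linf_def ae_bounded_def by (auto simp: Lspace2_iff)
 moreover have "AE x in \<mu>. (\<forall>k. 0 \<le> T s (g k) x) \<and> incseq (\<lambda>k. T s (g k) x) \<and> (\<lambda>k. T s (g k) x) \<longlonglongrightarrow> 1"
  using 1 TG by eventually_elim blast
 ultimately show ?thesis unfolding approximates_one_def by blast
qed

lemma T_semigroup_sequence:
 assumes "r > 0" "s > 0" "approximates_one g"
 shows "AE x in \<mu>. \<forall>k. T (r + s) (g k) x = T r (T s (g k)) x"
 unfolding AE_all_countable using T_semigroup[OF assms(1,2) approximates_oneD(1)[OF assms(3)]] by blast

lemma preserves_one_add: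
 assumes "preserves_one r" "preserves_one s"
 shows "preserves_one (r + s)"
 unfolding preserves_one_def
proof (intro conjI allI impI)
 have rs: "r > 0" "s > 0" using assms by (auto simp: preserves_one_def)
 then show "r + s > 0" by simp
 fix g assume g: "approximates_one g"
 have "AE x in \<mu>. (\<lambda>k. T r (T s (g k)) x) \<longlonglongrightarrow> 1"
  using assms(1) T_approximates_one[OF assms(2) g] unfolding preserves_one_def by blast
 then show "AE x in \<mu>. (\<lambda>k. T (r + s) (g k) x) \<longlonglongrightarrow> 1"
  using T_semigroup_sequence[OF rs g] by eventually_elim simp
qed

text \<open>\<open>u\<close> need not lie below any \<open>g j\<close>. The minima of
  \<open>g j\<close> and \<open>u\<close> do, and they converge to \<open>u\<close> in L2 because
  \<open>0 \<le> u \<le> 1\<close>; contractivity transfers the convergence to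
  \<open>T r\<close>.\<close>

lemma T_le_limit:
 assumes r: "r > 0" and g: "approximates_one g" and u: "u \<in> Lspace 2 \<mu>" "AE x in \<mu>. 0 \<le> u x \<and> u x \<le> 1"
  and l: "AE x in \<mu>. \<forall>j. T r (g j) x \<le> l x"
 shows "AE x in \<mu>. T r u x \<le> l x"
proof -
 note G = approximates_oneD[OF g]
 define w where "w j = (\<lambda>x. min (g j x) (u x))" for j
 have um: "u \<in> borel_measurable \<mu>" and gm: "g j \<in> borel_measurable \<mu>" for j using u(1) G(1)[of j] by (simp_all add: Lspace2_iff)
 have wm: "w j \<in> borel_measurable \<mu>" for j unfolding w_def using um gm by simp
 have wb: "AE x in \<mu>. 0 \<le> w j x \<and> w j x \<le> u x \<and> w j x \<le> g j x \<and> g j x \<le> 1" for j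
  using G(2) u(2) by eventually_elim (simp add: w_def)
 have u2: "integrable \<mu> (\<lambda>x. (u x)\<^sup>2)" using u(1) by (simp add: Lspace2_iff)
 have wL: "w j \<in> Lspace 2 \<mu>" for j
  unfolding Lspace2_iff
 proof (intro conjI wm Bochner_Integration.integrable_bound[OF u2])
  show "(\<lambda>x. (w j x)\<^sup>2) \<in> borel_measurable \<mu>" using wm by simp
  show "AE x in \<mu>. norm ((w j x)\<^sup>2) \<le> norm ((u x)\<^sup>2)" using wb[of j] by eventually_elim (simp add: power_mono)
 qed
 have "(\<lambda>j. LINT x|\<mu>. (w j x - u x)\<^sup>2) \<longlonglongrightarrow> (LINT x|\<mu>. 0)"
 proof (rule integral_dominated_convergence[where w = "\<lambda>x. (u x)\<^sup>2"])
  show "(\<lambda>x. (w j x - u x)\<^sup>2) \<in> borel_measurable \<mu>" for j using wm um by simp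
  show "AE x in \<mu>. (\<lambda>j. (w j x - u x)\<^sup>2) \<longlonglongrightarrow> 0"
   using G(2) u(2)
  proof eventually_elim
   case (elim x)
   have "(\<lambda>j. (w j x - u x)\<^sup>2) \<longlonglongrightarrow> (min 1 (u x) - u x)\<^sup>2"
    unfolding w_def using elim by (intro tendsto_intros) auto
   then show ?case using elim by (simp add: min_absorb2)
  qed
  show "AE x in \<mu>. norm ((w j x - u x)\<^sup>2) \<le> (u x)\<^sup>2" for j
   using wb[of j]
  proof eventually_elim
   case (elim x)
   then have "(u x - w j x)\<^sup>2 \<le> (u x)\<^sup>2" by (intro power_mono) auto
   then show ?case by (simp add: power2_commute)
  qed
 qed (use u2 in auto)
 then have lim: "(\<lambda>j. LINT x|\<mu>. (w j x - u x)\<^sup>2) \<longlonglongrightarrow> 0" by simp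
 have TwL: "T r (w j) \<in> Lspace 2 \<mu>" for j by (rule T_L2[OF r wL])
 have TuL: "T r u \<in> Lspace 2 \<mu>" by (rule T_L2[OF r u(1)])
 have le: "(LINT x|\<mu>. (T r (w j) x - T r u x)\<^sup>2) \<le> (LINT x|\<mu>. (w j x - u x)\<^sup>2)" for j
 proof -
  have d: "(\<lambda>x. w j x - u x) \<in> Lspace 2 \<mu>" by (rule Lspace2_diff[OF wL u(1)])
  have ae: "AE x in \<mu>. (T r (\<lambda>x. w j x - u x) x)\<^sup>2 = (T r (w j) x - T r u x)\<^sup>2"
   using T_diff[OF r wL u(1), of j] by eventually_elim (simp only:)
  have m1: "(\<lambda>x. (T r (\<lambda>x. w j x - u x) x)\<^sup>2) \<in> borel_measurable \<mu>" using T_L2[OF r d] by (simp add: Lspace2_iff borel_measurable_integrable)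
  have m2: "(\<lambda>x. (T r (w j) x - T r u x)\<^sup>2) \<in> borel_measurable \<mu>"
   using Lspace2_diff[OF TwL[of j] TuL] by (simp add: Lspace2_iff borel_measurable_integrable)
  show ?thesis using T_contraction[OF r d] integral_cong_AE[OF m1 m2 ae] by (simp add: Lnorm2_eq)
 qed
 have Tlim: "(\<lambda>j. LINT x|\<mu>. (T r (w j) x - T r u x)\<^sup>2) \<longlonglongrightarrow> 0"
 proof (rule tendsto_sandwich[OF _ _ tendsto_const lim]; intro always_eventually allI)
  show "0 \<le> (LINT x|\<mu>. (T r (w j) x - T r u x)\<^sup>2)" for j by (intro integral_nonneg_AE AE_I2) simp
 qed (rule le)
 obtain q where q: "strict_mono q" "AE x in \<mu>. (\<lambda>j. T r (w (q j)) x) \<longlonglongrightarrow> T r u x"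
  by (rule L2_tendsto_AE_subseq[OF TwL TuL Tlim]) blast
 have "AE x in \<mu>. \<forall>j. T r (w j) x \<le> T r (g j) x"
  unfolding AE_all_countable
 proof
  fix j
  have "AE x in \<mu>. 0 \<le> w j x \<and> w j x \<le> g j x \<and> g j x \<le> 1" using wb[of j] by eventually_elim blast
  then show "AE x in \<mu>. T r (w j) x \<le> T r (g j) x" by (rule T_mono[OF r wL G(1)])
 qed
 then show ?thesis using q(2) l
 proof eventually_elim
  case (elim x)
  have "T r (w (q j)) x \<le> l x" for j using elim(1,3) order_trans by blast
  then show ?case by (intro LIMSEQ_le_const2[OF elim(2)]) blast
 qed
qed

text \<open>As \<open>T s (g k)\<close> is at most 1,
  \<open>T (r + s) (g k) = T r (T s (g k))\<close> is at most \<open>l\<close>, the limit of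
  \<open>T r (g j)\<close>. The left side tends to 1 and \<open>l\<close> is at most 1.\<close>

lemma preserves_one_left:
 assumes rs: "r > 0" "s > 0" and p: "preserves_one (r + s)"
 shows "preserves_one r"
 unfolding preserves_one_def
proof (intro conjI allI impI rs(1))
 fix g assume g: "approximates_one g"
 note G = approximates_oneD[OF g]
 define l where "l x = lim (\<lambda>k. T r (g k) x)" for x
 have conv: "AE x in \<mu>. (\<lambda>k. T r (g k) x) \<longlonglongrightarrow> l x \<and> (\<forall>k. T r (g k) x \<le> l x) \<and> l x \<le> 1"
  using T_sequence[OF g rs(1)]
 proof eventually_elim
  case (elim x)
  then obtain y where y: "(\<lambda>k. T r (g k) x) \<longlonglongrightarrow> y" "\<forall>k. T r (g k) x \<le> y" using incseq_convergent[of "\<lambda>k. T r (g k) x" 1] by blast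
  have "l x = y" unfolding l_def using y(1) by (rule limI)
  then show ?case using y elim LIMSEQ_le_const2[OF y(1), of 1] by auto
 qed
 have le: "AE x in \<mu>. \<forall>k. T r (T s (g k)) x \<le> l x"
  unfolding AE_all_countable
 proof
  fix k
  have "AE x in \<mu>. 0 \<le> T s (g k) x \<and> T s (g k) x \<le> 1" using T_sequence[OF g rs(2)] by eventually_elim simp
  moreover have "AE x in \<mu>. \<forall>j. T r (g j) x \<le> l x" using conv by eventually_elim blast
  ultimately show "AE x in \<mu>. T r (T s (g k)) x \<le> l x" by (rule T_le_limit[OF rs(1) g T_L2[OF rs(2) G(1)]])
 qed
 have one: "AE x in \<mu>. (\<lambda>k. T (r + s) (g k) x) \<longlonglongrightarrow> 1" using p g unfolding preserves_one_def by blast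
 show "AE x in \<mu>. (\<lambda>k. T r (g k) x) \<longlonglongrightarrow> 1"
  using conv le one T_semigroup_sequence[OF rs g]
 proof eventually_elim
  case (elim x)
  have "1 \<le> l x" by (rule LIMSEQ_le_const2[OF elim(3)]) (use elim(2,4) in simp)
  then have "l x = 1" using elim(1) by linarith
  then show ?case using elim(1) by simp
 qed
qed

text \<open>The mass argument is tied to the given \<open>t\<close>, whereas conservativeness
  concerns all times: \<open>preserves_one_add\<close> reaches the multiples of \<open>t\<close>,
  and \<open>preserves_one_left\<close> descends to every smaller time.\<close>

lemma preserves_one_all:
 assumes "s > 0"
 shows "preserves_one s"
proof -
 have mult: "preserves_one (real (Suc j) * t)" for j
 proof (induction j)
  case (Suc j)
  have "real (Suc (Suc j)) * t = real (Suc j) * t + t" by (simp add: algebra_simps)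
  then show ?case using preserves_one_add[OF Suc preserves_one_t] by simp
 qed (simp add: preserves_one_t)
 obtain j :: nat where j: "s / t < real j" using reals_Archimedean2 by blast
 then have "s < real j * t" using t_pos by (simp add: field_simps)
 also have "\<dots> \<le> real (Suc j) * t" using t_pos by (intro mult_right_mono) auto
 finally have "s < real (Suc j) * t" .
 then show ?thesis using preserves_one_left[OF assms, of "real (Suc j) * t - s"] mult[of j] by simp
qed

text \<open>\<open>mono_ext\<close> is chosen by a property that the constant 1 has, so the chosen
  function has it as well. Both are limits along the indicators of the sets \<open>W k\<close>,
  hence equal.\<close>

theorem conservative: "conservative \<mu> T"
 unfolding conservative_def
proof (intro allI impI)
 fix s :: real assume s: "s > 0"
 define P where "P h \<longleftrightarrow> h \<in> borel_measurable \<mu> \<and>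
   (\<forall>g. (\<forall>k. g k \<in> Lspace 2 \<mu> \<inter> Linf \<mu>)
    \<and> (AE x in \<mu>. (\<forall>k. 0 \<le> g k x) \<and> incseq (\<lambda>k. g k x) \<and> (\<lambda>k. g k x) \<longlonglongrightarrow> 1)
    \<longrightarrow> (AE x in \<mu>. (\<lambda>k. T s (g k) x) \<longlonglongrightarrow> h x))" for h
 have one: "AE x in \<mu>. (\<lambda>k. T s (g k) x) \<longlonglongrightarrow> 1" if "approximates_one g" for g
  using preserves_one_all[OF s] that unfolding preserves_one_def by blast
 have P1: "P (\<lambda>_. 1)" unfolding P_def approximates_one_def[symmetric] by (intro conjI borel_measurable_const allI impI one)
 have "P (Eps P)" by (rule someI[of P "\<lambda>_. 1", OF P1])
 moreover have "Eps P = mono_ext \<mu> (T s) (\<lambda>_. 1)" unfolding mono_ext_def P_def [abs_def] ..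
 ultimately have "P (mono_ext \<mu> (T s) (\<lambda>_. 1))" by simp
 then have "AE x in \<mu>. (\<lambda>k. T s (indicator (W k)) x) \<longlonglongrightarrow> mono_ext \<mu> (T s) (\<lambda>_. 1) x"
  unfolding P_def approximates_one_def[symmetric] using approximates_one_exists by simp
 then show "AE x in \<mu>. mono_ext \<mu> (T s) (\<lambda>_. 1) x = 1"
  using one[OF approximates_one_exists] by eventually_elim (rule LIMSEQ_unique)
qed

end

section \<open>The three growth functions\<close>

lemma filterlim_at_bot_linear_bound:
 fixes X Y :: "nat \<Rightarrow> real"
 assumes Y: "filterlim Y at_top sequentially" and d: "d > 0"
  and le: "\<forall>\<^sub>F R in sequentially. X R \<le> a - d * Y R"
 shows "filterlim X at_bot sequentially"
 unfolding filterlim_at_bot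
proof
 fix Z :: real
 have "\<forall>\<^sub>F R in sequentially. (a - Z) / d \<le> Y R" using Y unfolding filterlim_at_top by blast
 with le show "\<forall>\<^sub>F R in sequentially. X R \<le> Z"
 proof eventually_elim
  case (elim R)
  then have "a - Z \<le> d * Y R" using d by (simp add: field_simps)
  then show ?case using elim(1) by linarith
 qed
qed

lemma filterlim_ln_affine: "filterlim (\<lambda>R. ln (2 * real R + 1)) at_top sequentially"
proof -
 have "filterlim (\<lambda>R. 2 * real R + 1) at_top sequentially"
  by (rule filterlim_at_top_mono[OF filterlim_real_sequentially]) (auto intro!: always_eventually)
 then show ?thesis by (rule filterlim_compose[OF ln_at_top])
qed

lemma filterlim_powr_at_top:
 assumes "(g :: real) > 0"
 shows "filterlim (\<lambda>x. x powr g) at_top at_top"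
proof -
 have "filterlim (\<lambda>x. exp (g * ln x)) at_top at_top"
  by (rule filterlim_compose[OF exp_at_top filterlim_tendsto_pos_mult_at_top[OF tendsto_const assms ln_at_top]])
 moreover have "\<forall>\<^sub>F x in at_top. exp (g * ln x) = x powr g"
  using eventually_gt_at_top[of 0] by eventually_elim (simp add: powr_def)
 ultimately show ?thesis by (rule filterlim_mono_eventually[OF _ order_refl order_refl])
qed

lemma filterlim_shift_at_top: "filterlim (\<lambda>r. r + 1) at_top (at_top :: real filter)"
 by (rule filterlim_at_top_mono[OF filterlim_ident]) (auto intro!: always_eventually)

text \<open>Compares \<phi> at \<open>4 R\<close> and \<open>2 R\<close> in the logarithmic cases:
  \<open>4 R + 1\<close> is at most the square of \<open>2 R + 1\<close>.\<close>

lemma ln_4_le: "ln (4 * real R + 1) \<le> 2 * ln (2 * real R + 1)"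
proof -
 have "4 * real R + 1 \<le> (2 * real R + 1)\<^sup>2" by (simp add: power2_eq_square algebra_simps)
 then have "ln (4 * real R + 1) \<le> ln ((2 * real R + 1)\<^sup>2)" by (rule ln_mono[rotated 2]) simp_all
 then show ?thesis by (simp add: ln_realpow)
qed

context conservativeness_setting
begin

lemma Gam_rho_nonneg: "AE x\<in>W n in \<mu>. 0 \<le> \<Gamma>\<rho> x"
proof -
 obtain r where "rho_trunc n r" using rho_trunc_exists by blast
 then show ?thesis by (rule Gam_rho_eq(2))
qed

text \<open>The coefficient of \<open>N(\<rho>)\<close> in the hypothesis is
  \<open>1 / \<phi>'(\<rho>)\<close>, so multiplication by \<open>\<phi>'(\<rho>)\<^sup>2\<close>
  yields the criterion. With \<open>g = 2 - \<beta>\<close> the exponents of the logarithm add up to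
  \<open>2 (g - 1) + \<beta> = g\<close>, whence the constant \<open>M C g\<^sup>2\<close>. For
  \<open>\<rho> \<ge> 1\<close> the logarithm is positive and \<open>rpow\<close> agrees with
  \<open>powr\<close>.\<close>

lemma conservative_powr_ln:
 assumes M: "M > 0" and C: "C > 0" and \<alpha>: "0 < \<alpha>" "\<alpha> < 1" and \<beta>: "\<beta> < 2"
  and bound: "\<And>n. n \<ge> 1 \<Longrightarrow> AE x\<in>W n - K in \<mu>.
   \<bar>\<Gamma>\<rho> x + (\<rho> x + 1) * N_rho N \<rho> n x / (C * (2 - \<beta>) * rpow (ln (\<rho> x + 1)) (1 - \<beta>))\<bar>
    \<le> M * (\<rho> x + 1)\<^sup>2 * rpow (ln (\<rho> x + 1)) \<beta>"
  and growth: "\<forall>\<^sub>F n in sequentially. growth \<mu> \<rho> \<Gamma>\<rho> (N_rho N \<rho>) (\<lambda>r. C * ln (r + 1) powr (2 - \<beta>)) n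
    \<le> real n * exp (\<alpha> * C * ln (real n + 1) powr (2 - \<beta>))"
 shows "conservative \<mu> T"
proof -
 define g where "g = 2 - \<beta>"
 have g: "g > 0" "1 - \<beta> = g - 1" using \<beta> by (auto simp: g_def)
 define \<phi> where "\<phi> r = C * ln (r + 1) powr g" for r
 define \<phi>' where "\<phi>' r = C * g * ln (r + 1) powr (g - 1) / (r + 1)" for r
 \<comment> \<open>As \<open>\<phi> (4 R)\<close> is at most \<open>2 powr g\<close> times
   \<open>\<phi> (2 R)\<close>, this spends half of the margin \<open>1 - \<alpha>\<close> left by
   the growth bound.\<close>
 define \<kappa> where "\<kappa> = (1 - \<alpha>) / (2 * 2 powr g)"
 have \<kappa>: "\<kappa> > 0" using \<alpha> by (simp add: \<kappa>_def)
 have "growth_criterion \<mu> V DE DN A E0 U T T' S \<Gamma> N \<rho> K0 K p t \<phi> \<phi>' (M * C * g\<^sup>2) \<kappa> (\<lambda>R. \<alpha> * C * ln (real R + 1) powr g)"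
 proof unfold_locales
  fix r :: real assume r: "r > 0"
  then have L: "ln (r + 1) > 0" by simp
  have "((\<lambda>r. ln (r + 1)) has_real_derivative 1 / (r + 1)) (at r)"
   using r by (auto intro!: derivative_eq_intros)
  from DERIV_cmult[OF DERIV_chain2[OF has_real_derivative_powr[OF L] this], of C g]
  show "(\<phi> has_real_derivative \<phi>' r) (at r)" unfolding \<phi>_def [abs_def] \<phi>'_def by (simp add: mult.assoc)
  show "0 \<le> \<phi>' r" "0 \<le> \<phi> r" using C g r by (simp_all add: \<phi>'_def \<phi>_def)
 next
  show "continuous_on {0<..} \<phi>'" unfolding \<phi>'_def [abs_def] by (auto intro!: continuous_intros)
  show "filterlim \<phi> at_top at_top"
   unfolding \<phi>_def [abs_def]
   by (intro filterlim_tendsto_pos_mult_at_top[OF tendsto_const C] filterlim_compose[OF filterlim_powr_at_top[OF g(1)]]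
     filterlim_compose[OF ln_at_top filterlim_shift_at_top])
  show "0 < M * C * g\<^sup>2" "0 < \<kappa>" using M C g \<kappa> by simp_all
  show "\<forall>\<^sub>F R in sequentially. growth \<mu> \<rho> \<Gamma>\<rho> (N_rho N \<rho>) \<phi> R \<le> real R * exp (\<alpha> * C * ln (real R + 1) powr g)"
   using growth unfolding \<phi>_def [abs_def] g_def .
  show "filterlim (\<lambda>R. \<alpha> * C * ln (real R + 1) powr g + \<kappa> * \<phi> (4 * real R) - \<phi> (2 * real R)) at_bot sequentially"
  proof (rule filterlim_at_bot_linear_bound[OF filterlim_compose[OF filterlim_powr_at_top[OF g(1)] filterlim_ln_affine]])
   show "0 < C * (1 - \<alpha>) / 2" using C \<alpha> by simp
   show "\<forall>\<^sub>F R in sequentially. \<alpha> * C * ln (real R + 1) powr g + \<kappa> * \<phi> (4 * real R) - \<phi> (2 * real R)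
     \<le> 0 - C * (1 - \<alpha>) / 2 * ln (2 * real R + 1) powr g"
   proof (rule always_eventually, rule allI)
    fix R :: nat
    let ?Y = "ln (2 * real R + 1) powr g"
    have "\<alpha> * C * ln (real R + 1) powr g \<le> \<alpha> * C * ?Y"
     using C \<alpha> g by (intro mult_left_mono powr_mono2) auto
    moreover have "\<kappa> * \<phi> (4 * real R) \<le> C * (1 - \<alpha>) / 2 * ?Y"
    proof -
     have "ln (4 * real R + 1) powr g \<le> (2 * ln (2 * real R + 1)) powr g"
      using g ln_4_le[of R] by (intro powr_mono2) auto
     also have "\<dots> = 2 powr g * ?Y" by (simp add: powr_mult)
     finally have "\<kappa> * (C * ln (4 * real R + 1) powr g) \<le> \<kappa> * (C * (2 powr g * ?Y))"
      using \<kappa> C by (intro mult_left_mono) auto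
     also have "\<dots> = C * (1 - \<alpha>) / 2 * ?Y" by (simp add: \<kappa>_def)
     finally show ?thesis unfolding \<phi>_def .
    qed
    ultimately show "\<alpha> * C * ln (real R + 1) powr g + \<kappa> * \<phi> (4 * real R) - \<phi> (2 * real R)
      \<le> 0 - C * (1 - \<alpha>) / 2 * ?Y" by (simp add: \<phi>_def field_simps)
   qed
  qed
 next
  fix n :: nat assume n: "n \<ge> 1"
  show "AE x\<in>W n - K in \<mu>. 1 \<le> \<rho> x \<longrightarrow> (\<phi>' (\<rho> x))\<^sup>2 * \<Gamma>\<rho> x + \<phi>' (\<rho> x) * N_rho N \<rho> n x \<le> M * C * g\<^sup>2 * (\<phi> (\<rho> x) + 1)"
   using bound[OF n]
  proof eventually_elim
   case (elim x)
   show ?case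
   proof (intro impI)
    assume x: "x \<in> W n - K" and r: "1 \<le> \<rho> x"
    let ?L = "ln (\<rho> x + 1)" and ?r = "\<rho> x + 1"
    have L: "?L > 0" using r by simp
    have rp: "rpow ?L a = ?L powr a" for a using L by (simp add: rpow_def)
    have p0: "\<phi>' (\<rho> x) > 0" using C g L r by (simp add: \<phi>'_def)
    have b: "\<Gamma>\<rho> x + N_rho N \<rho> n x / \<phi>' (\<rho> x) \<le> M * ?r\<^sup>2 * ?L powr \<beta>"
    proof -
     have "?r * N_rho N \<rho> n x / (C * (2 - \<beta>) * rpow ?L (1 - \<beta>)) = N_rho N \<rho> n x / \<phi>' (\<rho> x)"
      unfolding rp \<phi>'_def g(2) g_def by simp
     then show ?thesis using elim x unfolding rp by (auto simp: abs_le_iff)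
    qed
    have "(\<phi>' (\<rho> x))\<^sup>2 * \<Gamma>\<rho> x + \<phi>' (\<rho> x) * N_rho N \<rho> n x = (\<phi>' (\<rho> x))\<^sup>2 * (\<Gamma>\<rho> x + N_rho N \<rho> n x / \<phi>' (\<rho> x))"
     using p0 by (simp add: power2_eq_square field_simps)
    also have "\<dots> \<le> (\<phi>' (\<rho> x))\<^sup>2 * (M * ?r\<^sup>2 * ?L powr \<beta>)" by (rule mult_left_mono[OF b]) simp
    also have "\<dots> = M * C * g\<^sup>2 * \<phi> (\<rho> x)"
    proof -
     have "(?L powr (g - 1))\<^sup>2 * ?L powr \<beta> = ?L powr g"
      by (simp add: power2_eq_square g_def flip: powr_add)
     moreover have "(\<phi>' (\<rho> x))\<^sup>2 * (M * ?r\<^sup>2 * ?L powr \<beta>) = M * C\<^sup>2 * g\<^sup>2 * ((?L powr (g - 1))\<^sup>2 * ?L powr \<beta>)"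
      unfolding \<phi>'_def using r by (simp add: power_divide power_mult_distrib)
     ultimately have "(\<phi>' (\<rho> x))\<^sup>2 * (M * ?r\<^sup>2 * ?L powr \<beta>) = M * C\<^sup>2 * g\<^sup>2 * ?L powr g" by (simp only:)
     also have "\<dots> = M * C * g\<^sup>2 * \<phi> (\<rho> x)" by (simp add: \<phi>_def power2_eq_square)
     finally show ?thesis .
    qed
    also have "\<dots> \<le> M * C * g\<^sup>2 * (\<phi> (\<rho> x) + 1)" using M C by (intro mult_left_mono) auto
    finally show "(\<phi>' (\<rho> x))\<^sup>2 * \<Gamma>\<rho> x + \<phi>' (\<rho> x) * N_rho N \<rho> n x \<le> M * C * g\<^sup>2 * (\<phi> (\<rho> x) + 1)" .
   qed
  qed
 qed
 then show ?thesis by (rule growth_criterion.conservative)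
qed

text \<open>The coefficient of \<open>N(\<rho>)\<close> contains \<open>ln (\<rho> + 1)\<close>
  where \<open>1 / \<phi>'\<close> has \<open>ln (\<rho> + 1) + 1\<close>. So the hypothesis is
  multiplied by a factor \<open>f\<close> that turns this coefficient exactly into
  \<open>\<phi>'\<close> and dominates \<open>\<phi>'\<^sup>2\<close>; the excess is harmless
  because \<Gamma> is nonnegative.\<close>

lemma conservative_ln_ln:
 assumes M: "M > 0" and C: "C > 0" and \<alpha>: "0 < \<alpha>" "\<alpha> < 1"
  and bound: "\<And>n. n \<ge> 1 \<Longrightarrow> AE x\<in>W n - K in \<mu>.
   \<bar>\<Gamma>\<rho> x + 1 / C * (\<rho> x + 1) * ln (\<rho> x + 1) * N_rho N \<rho> n x\<bar> \<le> M * (\<rho> x + 1)\<^sup>2 * (ln (\<rho> x + 1))\<^sup>2"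
  and growth: "\<forall>\<^sub>F n in sequentially. growth \<mu> \<rho> \<Gamma>\<rho> (N_rho N \<rho>) (\<lambda>r. C * ln (ln (r + 1) + 1)) n
    \<le> real n * ln (real n + 1) powr (C * \<alpha>)"
 shows "conservative \<mu> T"
proof -
 define \<phi> where "\<phi> r = C * ln (ln (r + 1) + 1)" for r
 define \<phi>' where "\<phi>' r = C / ((ln (r + 1) + 1) * (r + 1))" for r
 \<comment> \<open>From \<open>2 R\<close> to \<open>4 R\<close> the function \<phi> grows by at
   most the constant \<open>C * ln 2\<close>, so half of the margin \<open>1 - \<alpha>\<close> may
   be spent.\<close>
 define \<kappa> where "\<kappa> = (1 - \<alpha>) / 2"
 have \<kappa>: "\<kappa> > 0" using \<alpha> by (simp add: \<kappa>_def)
 have "growth_criterion \<mu> V DE DN A E0 U T T' S \<Gamma> N \<rho> K0 K p t \<phi> \<phi>' (M * C\<^sup>2) \<kappa> (\<lambda>R. C * \<alpha> * ln (ln (real R + 1)))"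
 proof unfold_locales
  fix r :: real assume r: "r > 0"
  then have L: "ln (r + 1) > 0" by simp
  have "((\<lambda>r. ln (r + 1) + 1) has_real_derivative 1 / (r + 1)) (at r)"
   using r by (auto intro!: derivative_eq_intros)
  moreover have "ln (r + 1) + 1 > 0" using L by simp
  ultimately show "(\<phi> has_real_derivative \<phi>' r) (at r)"
   using DERIV_cmult[OF DERIV_chain2[OF DERIV_ln_divide], of "\<lambda>r. ln (r + 1) + 1" r "1 / (r + 1)" UNIV C]
   unfolding \<phi>_def [abs_def] \<phi>'_def by (simp add: divide_simps)
  show "0 \<le> \<phi>' r" "0 \<le> \<phi> r" using C L r by (simp_all add: \<phi>'_def \<phi>_def)
 next
  have pos: "ln (x + 1) + 1 \<noteq> 0" if "0 < x" for x :: real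
   using ln_gt_zero[of "x + 1"] that by linarith
  show "continuous_on {0<..} \<phi>'" unfolding \<phi>'_def [abs_def] by (auto intro!: continuous_intros simp: pos)
  show "filterlim \<phi> at_top at_top"
   unfolding \<phi>_def [abs_def]
   by (intro filterlim_tendsto_pos_mult_at_top[OF tendsto_const C]
     filterlim_compose[OF ln_at_top filterlim_compose[OF filterlim_shift_at_top filterlim_compose[OF ln_at_top filterlim_shift_at_top]]])
  show "0 < M * C\<^sup>2" "0 < \<kappa>" using M C \<kappa> by simp_all
  show "\<forall>\<^sub>F R in sequentially. growth \<mu> \<rho> \<Gamma>\<rho> (N_rho N \<rho>) \<phi> R \<le> real R * exp (C * \<alpha> * ln (ln (real R + 1)))"
   using growth eventually_gt_at_top[of 0]
  proof eventually_elim
   case (elim R)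
   \<comment> \<open>\<open>0 powr x\<close> is 0 by convention, so \<open>R = 0\<close> has to be
     excluded before \<open>powr\<close> is written as an exponential.\<close>
   have "ln (real R + 1) \<noteq> 0" using elim(2) by simp
   then have "ln (real R + 1) powr (C * \<alpha>) = exp (C * \<alpha> * ln (ln (real R + 1)))" by (simp add: powr_def)
   then show ?case using elim(1) unfolding \<phi>_def [abs_def] by simp
  qed
  have lim: "filterlim (\<lambda>R. ln (ln (2 * real R + 1) + 1)) at_top sequentially"
   by (rule filterlim_compose[OF ln_at_top filterlim_compose[OF filterlim_shift_at_top filterlim_ln_affine]])
  show "filterlim (\<lambda>R. C * \<alpha> * ln (ln (real R + 1)) + \<kappa> * \<phi> (4 * real R) - \<phi> (2 * real R)) at_bot sequentially"
  proof (rule filterlim_at_bot_linear_bound[OF lim])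
   show "0 < C * (1 - \<alpha>) / 2" using C \<alpha> by simp
   show "\<forall>\<^sub>F R in sequentially. C * \<alpha> * ln (ln (real R + 1)) + \<kappa> * \<phi> (4 * real R) - \<phi> (2 * real R)
     \<le> \<kappa> * C * ln 2 - C * (1 - \<alpha>) / 2 * ln (ln (2 * real R + 1) + 1)"
    using eventually_gt_at_top[of 0]
   proof eventually_elim
    case (elim R)
    let ?Z = "ln (ln (2 * real R + 1) + 1)"
    have L0: "0 < ln (real R + 1)" using elim by simp
    have L1: "ln (real R + 1) \<le> ln (2 * real R + 1)" by simp
    have a: "ln (ln (real R + 1)) \<le> ?Z" by (subst ln_le_cancel_iff) (use L0 L1 in linarith)+
    have "ln (ln (4 * real R + 1) + 1) \<le> ln (2 * (ln (2 * real R + 1) + 1))"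
     using ln_4_le[of R] L0 L1 by (intro ln_mono) (auto intro: add_nonneg_pos)
    also have "\<dots> = ln 2 + ?Z"
    proof -
     have "ln (2 * z) = ln 2 + ln z" if "z > 0" for z :: real using that by (simp add: ln_mult)
     moreover have "ln (2 * real R + 1) + 1 > 0" using L0 L1 by linarith
     ultimately show ?thesis by blast
    qed
    finally have b: "ln (ln (4 * real R + 1) + 1) \<le> ln 2 + ?Z" .
    have "C * \<alpha> * ln (ln (real R + 1)) \<le> C * \<alpha> * ?Z" using C \<alpha> a by (intro mult_left_mono) auto
    moreover have "\<kappa> * \<phi> (4 * real R) \<le> \<kappa> * (C * (ln 2 + ?Z))"
     unfolding \<phi>_def using \<kappa> C b by (intro mult_left_mono) auto
    ultimately show ?case by (simp add: \<phi>_def \<kappa>_def field_simps)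
   qed
  qed
 next
  fix n :: nat assume n: "n \<ge> 1"
  show "AE x\<in>W n - K in \<mu>. 1 \<le> \<rho> x \<longrightarrow> (\<phi>' (\<rho> x))\<^sup>2 * \<Gamma>\<rho> x + \<phi>' (\<rho> x) * N_rho N \<rho> n x \<le> M * C\<^sup>2 * (\<phi> (\<rho> x) + 1)"
   using bound[OF n] Gam_rho_nonneg[of n]
  proof eventually_elim
   case (elim x)
   show ?case
   proof (intro impI)
    assume x: "x \<in> W n - K" and r: "1 \<le> \<rho> x"
    let ?L = "ln (\<rho> x + 1)" and ?r = "\<rho> x + 1" and ?N = "N_rho N \<rho> n x"
    have L: "?L > 0" using r by simp
    have r0: "?r > 0" using r by simp
    have b: "\<Gamma>\<rho> x + 1 / C * ?r * ?L * ?N \<le> M * ?r\<^sup>2 * ?L\<^sup>2" using elim(1) x by (auto simp: abs_le_iff)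
    have G0: "0 \<le> \<Gamma>\<rho> x" using elim(2) x by blast
    define f where "f = C\<^sup>2 / ((?L + 1) * ?L * ?r\<^sup>2)"
    have f0: "0 \<le> f" using L by (simp add: f_def)
    have s1: "(\<phi>' (\<rho> x))\<^sup>2 \<le> f"
    proof -
     have "C\<^sup>2 / ((l + 1)\<^sup>2 * y\<^sup>2) \<le> C\<^sup>2 / ((l + 1) * l * y\<^sup>2)" if "l > 0" "y > 0" for l y :: real
     proof (rule divide_left_mono)
      show "(l + 1) * l * y\<^sup>2 \<le> (l + 1)\<^sup>2 * y\<^sup>2"
       using that by (intro mult_right_mono) (simp_all add: power2_eq_square)
      show "0 < (l + 1)\<^sup>2 * y\<^sup>2 * ((l + 1) * l * y\<^sup>2)" using that by (intro mult_pos_pos) simp_all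
     qed simp
     from this[OF L r0] show ?thesis unfolding \<phi>'_def f_def power_divide power_mult_distrib .
    qed
    have s2: "\<phi>' (\<rho> x) * ?N = f * (1 / C * ?r * ?L * ?N)"
    proof -
     have "C / ((l + 1) * y) = C\<^sup>2 / ((l + 1) * l * y\<^sup>2) * (1 / C * y * l)" if "l > 0" "y > 0" for l y :: real
      using that C by (simp add: power2_eq_square)
     from this[OF L r0] show ?thesis unfolding \<phi>'_def f_def by simp
    qed
    have "(\<phi>' (\<rho> x))\<^sup>2 * \<Gamma>\<rho> x + \<phi>' (\<rho> x) * ?N \<le> f * \<Gamma>\<rho> x + f * (1 / C * ?r * ?L * ?N)"
     unfolding s2 using s1 G0 by (intro add_right_mono mult_right_mono)
    also have "\<dots> = f * (\<Gamma>\<rho> x + 1 / C * ?r * ?L * ?N)" by (simp only: distrib_left)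
    also have "\<dots> \<le> f * (M * ?r\<^sup>2 * ?L\<^sup>2)" by (rule mult_left_mono[OF b f0])
    also have "\<dots> = M * C\<^sup>2 * (?L / (?L + 1))"
    proof -
     have "C\<^sup>2 / ((l + 1) * l * y\<^sup>2) * (M * y\<^sup>2 * l\<^sup>2) = M * C\<^sup>2 * (l / (l + 1))" if "l > 0" "y > 0" for l y :: real
      using that by (simp add: power2_eq_square)
     from this[OF L r0] show ?thesis unfolding f_def .
    qed
    also have "\<dots> \<le> M * C\<^sup>2 * (\<phi> (\<rho> x) + 1)"
    proof (rule mult_left_mono)
     have "?L / (?L + 1) \<le> 1" using L by simp
     moreover have "0 \<le> \<phi> (\<rho> x)" using C L by (simp add: \<phi>_def)
     ultimately show "?L / (?L + 1) \<le> \<phi> (\<rho> x) + 1" by linarith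
    qed (use M in simp)
    finally show "(\<phi>' (\<rho> x))\<^sup>2 * \<Gamma>\<rho> x + \<phi>' (\<rho> x) * ?N \<le> M * C\<^sup>2 * (\<phi> (\<rho> x) + 1)" .
   qed
  qed
 qed
 then show ?thesis by (rule growth_criterion.conservative)
qed

text \<open>\<open>\<phi>'(\<rho>) = C \<rho>\<close> is the denominator in the hypothesis, and
  \<open>(C \<rho>)\<^sup>2 M = 2 C M \<phi>(\<rho>)\<close>. The range \<open>\<alpha> < 2\<close>
  reflects \<open>\<phi> (2 R) = 2 C R\<^sup>2\<close>.\<close>

lemma conservative_square:
 assumes M: "M > 0" and C: "C > 0" and \<alpha>: "\<alpha> < 2"
  and bound: "\<And>n. n \<ge> 1 \<Longrightarrow> AE x\<in>W n - K in \<mu>. \<bar>\<Gamma>\<rho> x + N_rho N \<rho> n x / (C * \<rho> x)\<bar> \<le> M"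
  and growth: "\<forall>\<^sub>F n in sequentially. growth \<mu> \<rho> \<Gamma>\<rho> (N_rho N \<rho>) (\<lambda>r. C * r\<^sup>2 / 2) n \<le> real n * exp (\<alpha> * C * (real n)\<^sup>2)"
 shows "conservative \<mu> T"
proof -
 define \<phi> where "\<phi> r = C * r\<^sup>2 / 2" for r :: real
 define \<phi>' where "\<phi>' r = C * r" for r :: real
 \<comment> \<open>Since \<open>\<phi> (4 R) = 8 C R\<^sup>2\<close>, this spends half of the margin
   \<open>2 - \<alpha>\<close>.\<close>
 define \<kappa> where "\<kappa> = (2 - \<alpha>) / 16"
 have "growth_criterion \<mu> V DE DN A E0 U T T' S \<Gamma> N \<rho> K0 K p t \<phi> \<phi>' (2 * C * M) \<kappa> (\<lambda>R. \<alpha> * C * (real R)\<^sup>2)"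
 proof unfold_locales
  fix r :: real assume r: "r > 0"
  show "(\<phi> has_real_derivative \<phi>' r) (at r)" unfolding \<phi>_def [abs_def] \<phi>'_def by (auto intro!: derivative_eq_intros)
  show "0 \<le> \<phi>' r" "0 \<le> \<phi> r" using C r by (simp_all add: \<phi>'_def \<phi>_def)
 next
  show "continuous_on {0<..} \<phi>'" unfolding \<phi>'_def [abs_def] by (intro continuous_intros)
  have "filterlim (\<lambda>r. (C / 2) * r\<^sup>2) at_top (at_top :: real filter)"
   using C by (intro filterlim_tendsto_pos_mult_at_top[OF tendsto_const] filterlim_pow_at_top filterlim_ident) auto
  then show "filterlim \<phi> at_top at_top" unfolding \<phi>_def [abs_def] by simp
  show "0 < 2 * C * M" "0 < \<kappa>" using M C \<alpha> by (simp_all add: \<kappa>_def)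
  show "\<forall>\<^sub>F R in sequentially. growth \<mu> \<rho> \<Gamma>\<rho> (N_rho N \<rho>) \<phi> R \<le> real R * exp (\<alpha> * C * (real R)\<^sup>2)"
   using growth unfolding \<phi>_def [abs_def] .
  have lim: "filterlim (\<lambda>R. (real R)\<^sup>2) at_top sequentially"
   by (rule filterlim_pow_at_top[OF _ filterlim_real_sequentially]) simp
  show "filterlim (\<lambda>R. \<alpha> * C * (real R)\<^sup>2 + \<kappa> * \<phi> (4 * real R) - \<phi> (2 * real R)) at_bot sequentially"
  proof (rule filterlim_at_bot_linear_bound[OF lim])
   show "0 < C * (2 - \<alpha>) / 2" using C \<alpha> by simp
   show "\<forall>\<^sub>F R in sequentially. \<alpha> * C * (real R)\<^sup>2 + \<kappa> * \<phi> (4 * real R) - \<phi> (2 * real R)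
     \<le> 0 - C * (2 - \<alpha>) / 2 * (real R)\<^sup>2"
    by (rule always_eventually) (simp add: \<phi>_def \<kappa>_def power_mult_distrib field_simps)
  qed
 next
  fix n :: nat assume n: "n \<ge> 1"
  show "AE x\<in>W n - K in \<mu>. 1 \<le> \<rho> x \<longrightarrow> (\<phi>' (\<rho> x))\<^sup>2 * \<Gamma>\<rho> x + \<phi>' (\<rho> x) * N_rho N \<rho> n x \<le> 2 * C * M * (\<phi> (\<rho> x) + 1)"
   using bound[OF n]
  proof eventually_elim
   case (elim x)
   show ?case
   proof (intro impI)
    assume x: "x \<in> W n - K" and r: "1 \<le> \<rho> x"
    have b: "\<Gamma>\<rho> x + N_rho N \<rho> n x / (C * \<rho> x) \<le> M" using elim x by (auto simp: abs_le_iff)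
    have "(\<phi>' (\<rho> x))\<^sup>2 * \<Gamma>\<rho> x + \<phi>' (\<rho> x) * N_rho N \<rho> n x = (C * \<rho> x)\<^sup>2 * (\<Gamma>\<rho> x + N_rho N \<rho> n x / (C * \<rho> x))"
     using r C by (simp add: \<phi>'_def power2_eq_square field_simps)
    also have "\<dots> \<le> (C * \<rho> x)\<^sup>2 * M" by (rule mult_left_mono[OF b]) simp
    also have "\<dots> = 2 * C * M * \<phi> (\<rho> x)" by (simp add: \<phi>_def power2_eq_square)
    also have "\<dots> \<le> 2 * C * M * (\<phi> (\<rho> x) + 1)" using M C by (intro mult_left_mono) auto
    finally show "(\<phi>' (\<rho> x))\<^sup>2 * \<Gamma>\<rho> x + \<phi>' (\<rho> x) * N_rho N \<rho> n x \<le> 2 * C * M * (\<phi> (\<rho> x) + 1)" .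
   qed
  qed
 qed
 then show ?thesis by (rule growth_criterion.conservative)
qed

end

theorem corollary10:
  fixes \<mu> :: "'a::{metric_space, second_countable_topology} measure"
    and V DE DN :: "('a \<Rightarrow> real) set"
    and A E0 :: "('a \<Rightarrow> real) \<Rightarrow> ('a \<Rightarrow> real) \<Rightarrow> real"
    and U T T' :: "real \<Rightarrow> ('a \<Rightarrow> real) \<Rightarrow> 'a \<Rightarrow> real"
    and S :: "nat \<Rightarrow> real \<Rightarrow> ('a \<Rightarrow> real) \<Rightarrow> 'a \<Rightarrow> real"
    and \<Gamma> :: "('a \<Rightarrow> real) \<Rightarrow> ('a \<Rightarrow> real) \<Rightarrow> 'a \<Rightarrow> real"
    and N :: "('a \<Rightarrow> real) \<Rightarrow> 'a \<Rightarrow> real"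
    and \<rho> :: "'a \<Rightarrow> real" and K0 K :: "'a set" and p :: nat and t :: real
  defines "\<Gamma>\<rho> \<equiv> carre_loc \<mu> DE \<Gamma> \<rho> \<rho>"
    and "N\<rho> \<equiv> N_rho N \<rho>"
  assumes "state_space \<mu>"
    and "gen_Dirichlet_setting \<mu> V A U T T'"
    and "t > 0"
    and "cond_H1 \<mu> T' t (exhaustion \<rho>) p S"
    and "cond_H2 \<mu> (exhaustion \<rho>) p S DE E0 \<Gamma> DN N"
    and "cond_H3 \<mu> DE \<Gamma> N \<rho> K0"
    and "compact K" and "K0 \<subseteq> K"
    and "cond_H4 \<mu> t \<rho> K p S"
  shows
    "(\<forall>M C \<alpha> \<beta>. M > 0 \<and> C > 0 \<and> 0 < \<alpha> \<and> \<alpha> < 1 \<and> 0 \<le> \<beta> \<and> \<beta> < 2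
        \<and> (\<forall>n\<ge>1. AE x\<in>exhaustion \<rho> n - K in \<mu>.
             \<bar>\<Gamma>\<rho> x + (\<rho> x + 1) * N\<rho> n x / (C * (2 - \<beta>) * rpow (ln (\<rho> x + 1)) (1 - \<beta>))\<bar>
               \<le> M * (\<rho> x + 1)\<^sup>2 * rpow (ln (\<rho> x + 1)) \<beta>)
        \<and> (\<forall>\<^sub>F n in sequentially.
             growth \<mu> \<rho> \<Gamma>\<rho> N\<rho> (\<lambda>r. C * ln (r + 1) powr (2 - \<beta>)) n
               \<le> real n * exp (\<alpha> * C * ln (real n + 1) powr (2 - \<beta>)))
        \<longrightarrow> conservative \<mu> T)
     \<and>
     (\<forall>M C \<alpha>. M > 0 \<and> C > 0 \<and> 0 < \<alpha> \<and> \<alpha> < 1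
        \<and> (\<forall>n\<ge>1. AE x\<in>exhaustion \<rho> n - K in \<mu>.
             \<bar>\<Gamma>\<rho> x + 1 / C * (\<rho> x + 1) * ln (\<rho> x + 1) * N\<rho> n x\<bar>
               \<le> M * (\<rho> x + 1)\<^sup>2 * (ln (\<rho> x + 1))\<^sup>2)
        \<and> (\<forall>\<^sub>F n in sequentially.
             growth \<mu> \<rho> \<Gamma>\<rho> N\<rho> (\<lambda>r. C * ln (ln (r + 1) + 1)) n
               \<le> real n * ln (real n + 1) powr (C * \<alpha>))
        \<longrightarrow> conservative \<mu> T)
     \<and>
     (\<forall>M C \<alpha>. M > 0 \<and> C > 0 \<and> 0 < \<alpha> \<and> \<alpha> < 2
        \<and> (\<forall>n\<ge>1. AE x\<in>exhaustion \<rho> n - K in \<mu>.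
             \<bar>\<Gamma>\<rho> x + N\<rho> n x / (C * \<rho> x)\<bar> \<le> M)
        \<and> (\<forall>\<^sub>F n in sequentially.
             growth \<mu> \<rho> \<Gamma>\<rho> N\<rho> (\<lambda>r. C * r\<^sup>2 / 2) n
               \<le> real n * exp (\<alpha> * C * (real n)\<^sup>2))
        \<longrightarrow> conservative \<mu> T)"
proof -
 interpret conservativeness_setting \<mu> V DE DN A E0 U T T' S \<Gamma> N \<rho> K0 K p t
  by unfold_locales (rule assms)+
 show ?thesis
  unfolding \<Gamma>\<rho>_def N\<rho>_def
 proof ((intro conjI allI impI; elim conjE), goal_cases)
  case (1 M C \<alpha> \<beta>)
  show ?case by (rule conservative_powr_ln[OF 1(1-4,6) 1(7)[THEN spec, THEN mp] 1(8)])
 next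
  case (2 M C \<alpha>)
  show ?case by (rule conservative_ln_ln[OF 2(1-4) 2(5)[THEN spec, THEN mp] 2(6)])
 next
  case (3 M C \<alpha>)
  show ?case by (rule conservative_square[OF 3(1,2,4) 3(5)[THEN spec, THEN mp] 3(6)])
 qed
qed

end
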